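(* The $\mathbb C$-graded vector space $W$ together with the twisted vertex operator map $Y_W$ described in the context is a canonically twisted module, i.e. a lower-bounded $\theta$-twisted $V$-module, for the $\frac{\mathbb Z}{2}$-graded meromorphic open-string vertex algebra $V$ described in the context, where $\theta$ is the parity involution of $V$.
   Context: **The algebra $V$.** $\mathbb N=\{0,1,\dots\}$, $\mathbb Z_+=\{1,2,\dots\}$. Let $\mathfrak h$ be a finite-dimensional complex vector space with a nondegenerate symmetric bilinear form $(\cdot,\cdot)$; let $\mathfrak h^{\mathcal B},\mathfrak h^{\mathcal F}$ be two copies of $\mathfrak h$, mutually orthogonal in $\mathfrak h^{\mathcal B}\oplus\mathfrak h^{\mathcal F}$; $|a|=0$ for $a\in\mathfrak h^{\mathcal B}$, $|a|=1$ for $a\in\mathfrak h^{\mathcal F}$. Let $\widehat{\mathfrak h}_{\mathbb Z/2}=(\mathfrak h^{\mathcal B}\otimes\mathbb C[t,t^{-1}])\oplus(\mathfrak h^{\mathcal F}\otimes t^{1/2}\mathbb C[t,t^{-1}])\oplus\mathbb C\mathbf k_{\mathcal B}\oplus\mathbb C\mathbf k_{\mathcal F}$. Its tensor algebra is $\mathbb Z_2$-graded with $a\otimes t^{k+|a|/2}$ of parity $|a|$ and $\mathbf k_{\mathcal B},\mathbf k_{\mathcal F}$ even; $[u,v]=uv-(-1)^{|u||v|}vu$. Let $N$ be its quotient by the two-sided ideal generated by: $[\mathbf k_{\mathcal B},\mathbf k_{\mathcal F}]$; $[a\otimes t^{k+|a|/2},\mathbf k_{\mathcal B}]$, $[a\otimes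 t^{k+|a|/2},\mathbf k_{\mathcal F}]$ ($a\in\mathfrak h^{\mathcal B}\cup\mathfrak h^{\mathcal F}$, $k\in\mathbb Z$); $[a\otimes t^k,b\otimes t^0]$ ($a,b\in\mathfrak h^{\mathcal B}$, $k\ne0$); $[a\otimes t^{k+1/2},b\otimes t^0]$ ($a\in\mathfrak h^{\mathcal F},b\in\mathfrak h^{\mathcal B},k\in\mathbb Z$); $[a\otimes t^m,b\otimes t^n]-m(a,b)\delta_{m+n,0}\mathbf k_{\mathcal B}$ ($a,b\in\mathfrak h^{\mathcal B}$, $m\in\mathbb Z_+,n\in-\mathbb Z_+$); $[a\otimes t^{m+1/2},b\otimes t^{n+1/2}]-(a,b)\delta_{m+n+1,0}\mathbf k_{\mathcal F}$ ($a,b\in\mathfrak h^{\mathcal F}$, $m\in\mathbb N,n\in-\mathbb Z_+$); $[a\otimes t^m,b\otimes t^{n+1/2}]$ ($a\in\mathfrak h^{\mathcal B},b\in\mathfrak h^{\mathcal F}$, with $m\in\mathbb Z_+,n\in-\mathbb Z_+$ or $m\in-\mathbb Z_+,n\in\mathbb N$). Fix $\ell_{\mathcal B},\ell_{\mathcal F}\in\mathbb C^\times$. Let $V=N\otimes_{N_{\ge0}}\mathbb C\mathbf 1$, where $N_{\ge0}$ is the subalgebra generated by all $a\otimes t^{n+|a|/2}$ with $n\ge0$ (acting as $0$ on $\mathbb C\mathbf 1$) and $\mathbf k_{\mathcal B},\mathbf k_{\mathcal F}$ (acting as $\ell_{\mathcal B},\ell_{\mathcal F}$). Write $a(m+|a|/2)$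 for the action of $a\otimes t^{m+|a|/2}$ on $V$. $V$ is spanned by $a_1(-m_1+|a_1|/2)\cdots a_r(-m_r+|a_r|/2)\mathbf 1$ ($r\in\mathbb N$, $m_i\in\mathbb Z_+$), of weight $\sum_i(m_i-|a_i|/2)$, and as a vector space is the tensor algebra of the span of the negative modes. On $V$ put $a(x)_V=\sum_{n\in\mathbb Z}a(n+|a|/2)x^{-n-1}$, $a^{(m)}(x)_V=\frac1{m!}\frac{d^m}{dx^m}a(x)_V$; $:\cdots:$ rearranges modes as negative modes, then positive modes, then zero modes, keeping the relative order in each group, times the sign of the induced permutation of the fermionic factors (extended coefficientwise to series); and $Y(a_1(-m_1+|a_1|/2)\cdots a_r(-m_r+|a_r|/2)\mathbf 1,x)=\,:a_1^{(m_1-1)}(x)_V\cdots a_r^{(m_r-1)}(x)_V:$, $Y(\mathbf 1,x)=1_V$. Let $V^0=\coprod_{n\in\mathbb Z}V_{(n)}$, $V^1=\coprod_{n\in\mathbb Z+1/2}V_{(n)}$, $\theta=(-1)^i$ on $V^i$, and $\mathbf d_Vv=nv$ for $v\in V_{(n)}$. **The space $W$.** Let $\widehat{\mathfrak h}^{\mathcal B,\mathcal F}_{\mathbb Z}=(\mathfrak h^{\mathcal B}\oplus\mathfrak h^{\mathcal F})\otimes\mathbb C[t,t^{-1}]\oplus\mathbb C\mathbf k_{\mathcal B}\oplus\mathbb C\mathbf k_{\mathcal F}$, with $a\otimes t^n$ of parity $|a|$ and $\mathbf k_{\mathcal B},\mathbf k_{\mathcal F}$ even. Let $N^{tw}$ be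 the quotient of its tensor algebra by the two-sided ideal generated by: $[\mathbf k_{\mathcal B},\mathbf k_{\mathcal F}]$; $[a\otimes t^m,\mathbf k_{\mathcal B}]$, $[a\otimes t^m,\mathbf k_{\mathcal F}]$ ($a\in\mathfrak h^{\mathcal B}\cup\mathfrak h^{\mathcal F}$, $m\in\mathbb Z$); $[a\otimes t^m,b\otimes t^0]$ ($a,b\in\mathfrak h^{\mathcal B}\cup\mathfrak h^{\mathcal F}$, $m\neq0$); $[a\otimes t^m,b\otimes t^n]$ ($a\in\mathfrak h^{\mathcal B},b\in\mathfrak h^{\mathcal F}$, $m,n$ nonzero of opposite signs); $[a\otimes t^m,b\otimes t^n]-m(a,b)\delta_{m+n,0}\mathbf k_{\mathcal B}$ ($a,b\in\mathfrak h^{\mathcal B}$, $m\in\mathbb Z_+,n\in-\mathbb Z_+$); $[a\otimes t^m,b\otimes t^n]-(a,b)\delta_{m+n,0}\mathbf k_{\mathcal F}$ ($a,b\in\mathfrak h^{\mathcal F}$, $m\in\mathbb Z_+,n\in-\mathbb Z_+$). Let $M$ be a module for the tensor algebra $T(\mathfrak h^{\mathcal B}\oplus\mathfrak h^{\mathcal F})$, with a $\mathbb C$-grading by weights $M=\coprod_{n\in\mathbb C}M_{[n]}$ preserved by the action and lower bounded. Let $a\otimes t^0$ act on $M$ as $a$, $a\otimes t^n$ ($n>0$) as $0$, $\mathbf k_{\mathcal B},\mathbf k_{\mathcal F}$ as $\ell_{\mathcal B},\ell_{\mathcal F}$; let $W=N^{tw}\otimes_{N^{tw}_{\ge0}}M$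 be the induced module, $N^{tw}_{\ge0}$ being the subalgebra generated by all $a\otimes t^n$ ($n\ge0$) and $\mathbf k_{\mathcal B},\mathbf k_{\mathcal F}$. Write $a(n)$ for the action of $a\otimes t^n$ on $W$. $W$ is spanned by $a_1(-m_1)\cdots a_r(-m_r)w$ ($m_i\in\mathbb Z_+$, $w\in M$ homogeneous), of weight $\sum m_i+\mathrm{wt}\,w$; $\mathbf d_W$ is the weight operator. **The map $Y_W$.** On $W$ let $a(x)=\sum_{n\in\mathbb Z}a(n)x^{-n-1+|a|/2}$, $a^{(m)}(x)=\frac1{m!}\frac{d^m}{dx^m}a(x)$. The normal ordering ${\circ\atop\circ}\cdots{\circ\atop\circ}$ of a product of modes on $W$ is obtained by placing the negative modes first, then the positive modes, each group in its original relative order, followed by ${\circ\atop\circ}\cdots{\circ\atop\circ}$ of the zero modes in their original relative order, times the sign of the induced permutation of the fermionic factors; for zero modes it is defined recursively (empty product $=1$): ${\circ\atop\circ}a_1(0)\cdots a_r(0){\circ\atop\circ}=a_1(0){\circ\atop\circ}a_2(0)\cdots a_r(0){\circ\atop\circ}$ if $a_1\in\mathfrak h^{\mathcal B}$, and if $a_1\in\mathfrak h^{\mathcal F}$, $${\circ\atop\circ}a_1(0)\cdots a_r(0){\circ\atop\circ}=a_1(0){\circ\atop\circ}a_2(0)\cdots a_r(0){\circ\atop\circ}+\sum_{i\ge2,\,a_i\in\mathfrak h^{\mathcal F}}\frac{(-1)^{r^{\mathcal F}(i)-1}}2(a_1,a_i){\circ\atop\circ}a_2(0)\cdots\widehat{a_i(0)}\cdots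 a_r(0){\circ\atop\circ},$$ $r^{\mathcal F}(i)=\#\{j\le i:a_j\in\mathfrak h^{\mathcal F}\}$. It is extended coefficientwise to series. Let $\bar Y_W(\mathbf 1,x)=1_W$ and $\bar Y_W(a_1(-m_1+|a_1|/2)\cdots a_r(-m_r+|a_r|/2)\mathbf 1,x)={\circ\atop\circ}a_1^{(m_1-1)}(x)\cdots a_r^{(m_r-1)}(x){\circ\atop\circ}$, extended linearly. For an orthonormal basis $e_1,\dots,e_d$ of $\mathfrak h^{\mathcal F}$ put, as operators on $V$, $$\Delta(x)=\sum_{i=1}^d\sum_{m,n\ge1}\tfrac12C_{mn}\,e_i(m-\tfrac12)e_i(n-\tfrac12)x^{-m-n+1},\quad C_{mn}=\tfrac12\tfrac{m-n}{m+n-1}\tbinom{-1/2}{m-1}\tbinom{-1/2}{n-1},$$ $\exp(\Delta(x))=\sum_{t\ge0}\Delta(x)^t/t!$, and $Y_W(u,x)=\bar Y_W(\exp(\Delta(x))u,x)$, a map $V\otimes W\to W((x^{1/2}))$. **Definition (lower-bounded $\theta$-twisted module).** For $z\in\mathbb C^\times$, $p\in\mathbb Z$, let $l_p(z)=\log|z|+i(\arg z+2\pi p)$, $\arg z\in[0,2\pi)$. Write $Y_W(v,x)=\sum_{n\in\frac12\mathbb Z}(Y_W)_n(v)x^{-n-1}$ and $Y_W^p(v,z)=\sum_n(Y_W)_n(v)e^{(-n-1)l_p(z)}$. A lower-bounded $\theta$-twisted $V$-module is a vector space $W=\coprod_{n\in\mathbb C,\,\alpha\in\mathbb C/2\mathbb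 Z}W_{(n)}^{[\alpha]}$ (graded by weights $n$ and $\theta$-weights $\alpha$) with $Y_W:V\otimes W\to W[[x^{1/2},x^{-1/2}]]$ and an operator $\mathbf d_W$ on $W$ satisfying, with $W'$ the graded dual: (1) $W_{(m)}^{[\alpha]}=0$ for every $\alpha$ when $\mathrm{Re}(m)$ is sufficiently negative; for $w\in W_{(m)}^{[\alpha]}$, $\mathbf d_Ww=mw$ and $\theta w=e^{2\pi i\alpha/2}w$; $\theta Y_W(v,x)w=Y_W(\theta v,x)\theta w$ for $v\in V,w\in W$; $[\mathbf d_W,Y_W(u,x)]=Y_W(\mathbf d_Vu,x)+x\frac d{dx}Y_W(u,x)$ for $u\in V$. (2) $Y_W(\mathbf 1,x)=1_W$. (3) Generalized rationality: for $v_i\in V^{k_i}$, $k_i\in\{0,1\}$ ($1\le i\le n$), $w\in W$, $w'\in W'$ there are a polynomial $g$ and $q_i,q_{ij}\in\mathbb N$ such that for every $p$, $\langle w',Y_W^p(v_1,z_1)\cdots Y_W^p(v_n,z_n)w\rangle$ converges absolutely in $|z_1|>\cdots>|z_n|>0$ to $g(z_1,\dots,z_n)\prod_ie^{\frac{k_i}2l_p(z_i)}z_i^{-q_i}\prod_{i<j}(z_i-z_j)^{-q_{ij}}$; and for $v_1\in V^{k_1},v_2\in V^{k_2}$, $w\in W$, $w'\in W'$, there are a polynomial $g$ and $q_1,q_2,t\in\mathbb N$ such that for every $p$, $\langle w',Y_W^p(Y(v_1,z_1-z_2)v_2,z_2)w\rangle$ converges absolutely when $|z_2|>|z_1-z_2|>0$,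 with sum equal to $g(z_1,z_2)e^{\frac{k_1}2l_p(z_1)}z_1^{-q_1}e^{\frac{k_2}2l_p(z_2)}z_2^{-q_2}(z_1-z_2)^{-t}$ when moreover $|\arg z_1-\arg z_2|<\frac\pi2$. (4) Associativity: for all $p\in\mathbb Z$, $v_1,v_2\in V$, $w\in W$, $w'\in W'$, $\langle w',Y_W^p(v_1,z_1)Y_W^p(v_2,z_2)w\rangle=\langle w',Y_W^p(Y(v_1,z_1-z_2)v_2,z_2)w\rangle$ when $|z_1|>|z_2|>|z_1-z_2|>0$ and $|\arg z_1-\arg z_2|<\frac\pi2$.
   Formalization: For ℓ_F≠1 the literal claim fails; here the zero-mode contraction is ℓ_F(a_1,a_i)/2 and Δ(x) carries 1/ℓ_F (no change if ℓ_F=1). M also gets a θ-weight grading by C/2Z, preserved by h^B and shifted by 1 by h^F, since otherwise θ need not exist on W. *)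

theory Defs
  imports "HOL-Analysis.Analysis" "HOL-Library.Poly_Mapping"
begin

section \<open>Linear algebra over the complex numbers\<close>

text \<open>
  Complex vector spaces are given by a scalar multiplication \<open>sc\<close> on an abelian group type, subject to
  \<^const>\<open>vector_space\<close>.
\<close>

text \<open>The subspaces \<open>A i\<close> form a direct sum decomposition of the whole space.\<close>

definition graded :: "(complex \<Rightarrow> 'v::ab_group_add \<Rightarrow> 'v) \<Rightarrow> ('i \<Rightarrow> 'v set) \<Rightarrow> bool" where
  "graded sc A \<longleftrightarrow> (\<forall>i. module.subspace sc (A i)) \<and>
     (\<forall>v. \<exists>!f. finite {i. f i \<noteq> 0} \<and> (\<forall>i. f i \<in> A i) \<and> v = Sum_any f)"

text \<open>The linear operator acting as the scalar \<open>c i\<close> on \<open>A i\<close>.\<close>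

definition diag_op :: "(complex \<Rightarrow> 'v::ab_group_add \<Rightarrow> 'v) \<Rightarrow> ('i \<Rightarrow> 'v set) \<Rightarrow> ('i \<Rightarrow> complex) \<Rightarrow> 'v \<Rightarrow> 'v" where
  "diag_op sc A c = (THE D. Vector_Spaces.linear sc sc D \<and> (\<forall>i. \<forall>v\<in>A i. D v = sc (c i) v))"

definition graded_dual :: "(complex \<Rightarrow> 'v::ab_group_add \<Rightarrow> 'v) \<Rightarrow> ('i \<Rightarrow> 'v set) \<Rightarrow> ('v \<Rightarrow> complex) set" where
  "graded_dual sc A = {f. Vector_Spaces.linear sc (*) f \<and> finite {i. \<exists>v\<in>A i. f v \<noteq> 0}}"

text \<open>
  The linear map sending the spanning vector \<open>b x\<close> to \<open>f x\<close> for \<open>x \<in> X\<close>.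
\<close>

definition lin_extend ::
  "(complex \<Rightarrow> 'v::ab_group_add \<Rightarrow> 'v) \<Rightarrow> (complex \<Rightarrow> 'w::ab_group_add \<Rightarrow> 'w) \<Rightarrow>
   'x set \<Rightarrow> ('x \<Rightarrow> 'v) \<Rightarrow> ('x \<Rightarrow> 'w) \<Rightarrow> 'v \<Rightarrow> 'w" where
  "lin_extend s1 s2 X b f = (THE L. Vector_Spaces.linear s1 s2 L \<and> (\<forall>x\<in>X. L (b x) = f x))"

definition nondegenerate_symmetric_form ::
  "(complex \<Rightarrow> 'h::ab_group_add \<Rightarrow> 'h) \<Rightarrow> ('h \<Rightarrow> 'h \<Rightarrow> complex) \<Rightarrow> bool" where
  "nondegenerate_symmetric_form sc frm \<longleftrightarrow>
     (\<forall>a. Vector_Spaces.linear sc (*) (frm a)) \<and> (\<forall>a b. frm a b = frm b a) \<and>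
     (\<forall>a. (\<forall>b. frm a b = 0) \<longrightarrow> a = 0)"

definition orthonormal_basis ::
  "(complex \<Rightarrow> 'h::ab_group_add \<Rightarrow> 'h) \<Rightarrow> ('h \<Rightarrow> 'h \<Rightarrow> complex) \<Rightarrow> 'h list \<Rightarrow> bool" where
  "orthonormal_basis sc frm es \<longleftrightarrow> module.span sc (set es) = UNIV \<and>
     (\<forall>i<length es. \<forall>j<length es. frm (es ! i) (es ! j) = (if i = j then 1 else 0))"

section \<open>Algebras given by generators and relations, and induced modules\<close>

text \<open>
  With concatenation as addition of words, \<open>'g list \<Rightarrow>\<^sub>0 complex\<close> is the free associative algebra
  on \<open>'g\<close>.
\<close>

instantiation list :: (type) monoid_add
begin

definition "0 = ([] :: 'a list)"
definition "xs + ys = (xs @ ys :: 'a list)"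

instance
  by standard (simp_all add: zero_list_def plus_list_def)

end

text \<open>
  The two copies of the space \<open>'h\<close> are distinguished by a tag: the element \<open>a\<close> of the bosonic
  (fermionic) copy is the pair \<open>Bos, a\<close> (\<open>Fer, a\<close>).
\<close>

datatype stat = Bos | Fer

primrec par :: "stat \<Rightarrow> nat" where
  "par Bos = 0"
| "par Fer = 1"

text \<open>
  For the untwisted algebra \<open>Mode s a k\<close> stands for the tensor of \<open>a\<close> with the power
  \<open>k + par s / 2\<close> of \<open>t\<close>; for the twisted algebra it stands for the tensor of \<open>a\<close> with the \<open>k\<close>-th
  power of \<open>t\<close>.
\<close>

datatype 'h gen = Mode stat 'h int | KB | KF

primrec gpar :: "'h gen \<Rightarrow> nat" where
  "gpar (Mode s a k) = par s"
| "gpar KB = 0"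
| "gpar KF = 0"

type_synonym 'h free_alg = "'h gen list \<Rightarrow>\<^sub>0 complex"

definition G :: "'h gen \<Rightarrow> 'h free_alg" where
  "G g = Poly_Mapping.single [g] 1"

definition Const :: "complex \<Rightarrow> 'h free_alg" where
  "Const c = Poly_Mapping.single [] c"

definition scomm :: "'h gen \<Rightarrow> 'h gen \<Rightarrow> 'h free_alg" where
  "scomm g h = G g * G h - (- 1) ^ (gpar g * gpar h) * (G h * G g)"

text \<open>
  The relations \<open>lin_add\<close> and \<open>lin_scale\<close> turn the free algebra on the set of all modes into the
  tensor algebra of the vector space which the modes span.
\<close>

inductive_set untwisted_relators ::
  "(complex \<Rightarrow> 'h::ab_group_add \<Rightarrow> 'h) \<Rightarrow> ('h \<Rightarrow> 'h \<Rightarrow> complex) \<Rightarrow> 'h free_alg set"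
  for sc :: "complex \<Rightarrow> 'h::ab_group_add \<Rightarrow> 'h" and frm :: "'h \<Rightarrow> 'h \<Rightarrow> complex"
where
  lin_add: "G (Mode s (a + b) k) - G (Mode s a k) - G (Mode s b k) \<in> untwisted_relators sc frm"
| lin_scale: "G (Mode s (sc c a) k) - Const c * G (Mode s a k) \<in> untwisted_relators sc frm"
| central: "scomm KB KF \<in> untwisted_relators sc frm"
| central_B: "scomm (Mode s a k) KB \<in> untwisted_relators sc frm"
| central_F: "scomm (Mode s a k) KF \<in> untwisted_relators sc frm"
| zero_B: "k \<noteq> 0 \<Longrightarrow> scomm (Mode Bos a k) (Mode Bos b 0) \<in> untwisted_relators sc frm"
| zero_F: "scomm (Mode Fer a k) (Mode Bos b 0) \<in> untwisted_relators sc frm"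
| comm_BB: "m > 0 \<Longrightarrow> n < 0 \<Longrightarrow>
    scomm (Mode Bos a m) (Mode Bos b n)
      - (if m + n = 0 then Const (of_int m * frm a b) * G KB else 0) \<in> untwisted_relators sc frm"
| comm_FF: "m \<ge> 0 \<Longrightarrow> n < 0 \<Longrightarrow>
    scomm (Mode Fer a m) (Mode Fer b n)
      - (if m + n + 1 = 0 then Const (frm a b) * G KF else 0) \<in> untwisted_relators sc frm"
| comm_BF: "m > 0 \<and> n < 0 \<or> m < 0 \<and> n \<ge> 0 \<Longrightarrow>
    scomm (Mode Bos a m) (Mode Fer b n) \<in> untwisted_relators sc frm"

inductive_set twisted_relators ::
  "(complex \<Rightarrow> 'h::ab_group_add \<Rightarrow> 'h) \<Rightarrow> ('h \<Rightarrow> 'h \<Rightarrow> complex) \<Rightarrow> 'h free_alg set"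
  for sc :: "complex \<Rightarrow> 'h::ab_group_add \<Rightarrow> 'h" and frm :: "'h \<Rightarrow> 'h \<Rightarrow> complex"
where
  tw_lin_add: "G (Mode s (a + b) k) - G (Mode s a k) - G (Mode s b k) \<in> twisted_relators sc frm"
| tw_lin_scale: "G (Mode s (sc c a) k) - Const c * G (Mode s a k) \<in> twisted_relators sc frm"
| tw_central: "scomm KB KF \<in> twisted_relators sc frm"
| tw_central_B: "scomm (Mode s a m) KB \<in> twisted_relators sc frm"
| tw_central_F: "scomm (Mode s a m) KF \<in> twisted_relators sc frm"
| tw_zero: "m \<noteq> 0 \<Longrightarrow> scomm (Mode s a m) (Mode s' b 0) \<in> twisted_relators sc frm"
| tw_comm_BF: "m > 0 \<and> n < 0 \<or> m < 0 \<and> n > 0 \<Longrightarrow>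
    scomm (Mode Bos a m) (Mode Fer b n) \<in> twisted_relators sc frm"
| tw_comm_BB: "m > 0 \<Longrightarrow> n < 0 \<Longrightarrow>
    scomm (Mode Bos a m) (Mode Bos b n)
      - (if m + n = 0 then Const (of_int m * frm a b) * G KB else 0) \<in> twisted_relators sc frm"
| tw_comm_FF: "m > 0 \<Longrightarrow> n < 0 \<Longrightarrow>
    scomm (Mode Fer a m) (Mode Fer b n)
      - (if m + n = 0 then Const (frm a b) * G KF else 0) \<in> twisted_relators sc frm"

inductive_set two_sided_ideal :: "'r::ring_1 set \<Rightarrow> 'r set" for R :: "'r::ring_1 set" where
  ideal_zero: "0 \<in> two_sided_ideal R"
| ideal_gen: "r \<in> R \<Longrightarrow> u * r * v \<in> two_sided_ideal R"
| ideal_add: "x \<in> two_sided_ideal R \<Longrightarrow> y \<in> two_sided_ideal R \<Longrightarrow> x + y \<in> two_sided_ideal R"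

text \<open>
  For a complex vector space \<open>'m\<close>, the type \<open>'h gen list \<Rightarrow>\<^sub>0 'm\<close> is the tensor product over the
  complex numbers of the free algebra with \<open>'m\<close>.
\<close>

definition pm_scale :: "(complex \<Rightarrow> 'm::ab_group_add \<Rightarrow> 'm) \<Rightarrow> complex \<Rightarrow> ('k \<Rightarrow>\<^sub>0 'm) \<Rightarrow> ('k \<Rightarrow>\<^sub>0 'm)" where
  "pm_scale sc c x = Poly_Mapping.map (sc c) x"

definition tens :: "(complex \<Rightarrow> 'm::ab_group_add \<Rightarrow> 'm) \<Rightarrow> 'h free_alg \<Rightarrow> 'm \<Rightarrow> ('h gen list \<Rightarrow>\<^sub>0 'm)" where
  "tens sc r m = (\<Sum>u\<in>Poly_Mapping.keys r. Poly_Mapping.single u (sc (Poly_Mapping.lookup r u) m))"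

definition prepend :: "'h gen \<Rightarrow> ('h gen list \<Rightarrow>\<^sub>0 'm) \<Rightarrow> ('h gen list \<Rightarrow>\<^sub>0 'm::ab_group_add)" where
  "prepend g x = (\<Sum>u\<in>Poly_Mapping.keys x. Poly_Mapping.single (g # u) (Poly_Mapping.lookup x u))"

text \<open>
  Let \<open>N\<close> be the free algebra modulo the two-sided ideal \<open>I\<close>, and let the subalgebra generated by the
  set \<open>gens\<close> of generators act on \<open>'m\<close>, each generator \<open>g\<close> by \<open>act g\<close>. A linear surjection \<open>\<pi>\<close> with
  the kernel below realizes \<open>'w\<close> as the induced module, the tensor product of \<open>N\<close> and \<open>'m\<close> over that
  subalgebra; \<open>\<pi> (tens scM r m)\<close> is the class of the tensor of \<open>r\<close> and \<open>m\<close>. The subalgebra is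
  spanned by the words in \<open>gens\<close>, so it suffices to balance over these.
\<close>

definition induced_module ::
  "(complex \<Rightarrow> 'm::ab_group_add \<Rightarrow> 'm) \<Rightarrow> 'h free_alg set \<Rightarrow> 'h gen set \<Rightarrow> ('h gen \<Rightarrow> 'm \<Rightarrow> 'm) \<Rightarrow>
   (complex \<Rightarrow> 'w::ab_group_add \<Rightarrow> 'w) \<Rightarrow> (('h gen list \<Rightarrow>\<^sub>0 'm) \<Rightarrow> 'w) \<Rightarrow> bool" where
  "induced_module scM I gens act scW \<pi> \<longleftrightarrow>
     Vector_Spaces.linear (pm_scale scM) scW \<pi> \<and> surj \<pi> \<and>
     {x. \<pi> x = 0} = module.span (pm_scale scM)
        ({tens scM r m | r m. r \<in> I} \<union>
         {tens scM (t * Poly_Mapping.single u 1) m - tens scM t (foldr act u m) | t u m. u \<in> lists gens})"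

text \<open>The action of the generator \<open>g\<close> on the induced module.\<close>

definition gen_op :: "(('h gen list \<Rightarrow>\<^sub>0 'm::ab_group_add) \<Rightarrow> 'w) \<Rightarrow> 'h gen \<Rightarrow> 'w \<Rightarrow> 'w" where
  "gen_op \<pi> g w = \<pi> (prepend g (inv \<pi> w))"

definition mode_op :: "(('h gen list \<Rightarrow>\<^sub>0 'm::ab_group_add) \<Rightarrow> 'w) \<Rightarrow> stat \<Rightarrow> 'h \<Rightarrow> int \<Rightarrow> 'w \<Rightarrow> 'w" where
  "mode_op \<pi> s a k = gen_op \<pi> (Mode s a k)"

definition nonneg_gens :: "'h gen set" where
  "nonneg_gens = {Mode s a n | s a n. n \<ge> 0} \<union> {KB, KF}"

primrec vacuum_act :: "complex \<Rightarrow> complex \<Rightarrow> 'h gen \<Rightarrow> complex \<Rightarrow> complex" where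
  "vacuum_act lB lF (Mode s a n) = (\<lambda>c. 0)"
| "vacuum_act lB lF KB = (\<lambda>c. lB * c)"
| "vacuum_act lB lF KF = (\<lambda>c. lF * c)"

text \<open>Negative modes do not belong to \<^const>\<open>nonneg_gens\<close>; their value here is irrelevant.\<close>

primrec M_act ::
  "(complex \<Rightarrow> 'm::ab_group_add \<Rightarrow> 'm) \<Rightarrow> (stat \<Rightarrow> 'h \<Rightarrow> 'm \<Rightarrow> 'm) \<Rightarrow> complex \<Rightarrow> complex \<Rightarrow> 'h gen \<Rightarrow> 'm \<Rightarrow> 'm" where
  "M_act sc act lB lF (Mode s a n) = (if n = 0 then act s a else (\<lambda>m. 0))"
| "M_act sc act lB lF KB = sc lB"
| "M_act sc act lB lF KF = sc lF"

definition is_V ::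
  "(complex \<Rightarrow> 'h::ab_group_add \<Rightarrow> 'h) \<Rightarrow> ('h \<Rightarrow> 'h \<Rightarrow> complex) \<Rightarrow> complex \<Rightarrow> complex \<Rightarrow>
   (complex \<Rightarrow> 'v::ab_group_add \<Rightarrow> 'v) \<Rightarrow> (('h gen list \<Rightarrow>\<^sub>0 complex) \<Rightarrow> 'v) \<Rightarrow> bool" where
  "is_V scH frm lB lF scV \<pi>V \<longleftrightarrow>
     induced_module (*) (two_sided_ideal (untwisted_relators scH frm)) nonneg_gens (vacuum_act lB lF) scV \<pi>V"

definition is_W ::
  "(complex \<Rightarrow> 'h::ab_group_add \<Rightarrow> 'h) \<Rightarrow> ('h \<Rightarrow> 'h \<Rightarrow> complex) \<Rightarrow> complex \<Rightarrow> complex \<Rightarrow>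
   (complex \<Rightarrow> 'm::ab_group_add \<Rightarrow> 'm) \<Rightarrow> (stat \<Rightarrow> 'h \<Rightarrow> 'm \<Rightarrow> 'm) \<Rightarrow>
   (complex \<Rightarrow> 'w::ab_group_add \<Rightarrow> 'w) \<Rightarrow> (('h gen list \<Rightarrow>\<^sub>0 'm) \<Rightarrow> 'w) \<Rightarrow> bool" where
  "is_W scH frm lB lF scM act scW \<pi>W \<longleftrightarrow>
     induced_module scM (two_sided_ideal (twisted_relators scH frm)) nonneg_gens (M_act scM act lB lF) scW \<pi>W"

section \<open>Creation words and gradings\<close>

text \<open>The group of complex numbers modulo the even integers, which indexes the \<open>\<theta>\<close>-weights.\<close>

quotient_type cmod2 = complex / "\<lambda>x y. \<exists>k::int. x - y = 2 * of_int k"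
proof (rule equivpI)
  show "reflp (\<lambda>x y::complex. \<exists>k::int. x - y = 2 * of_int k)"
    by (rule reflpI) (rule exI[of _ 0], simp)
  show "symp (\<lambda>x y::complex. \<exists>k::int. x - y = 2 * of_int k)"
  proof (rule sympI)
    fix x y :: complex assume "\<exists>k::int. x - y = 2 * of_int k"
    then obtain k :: int where "x - y = 2 * of_int k" ..
    then have "y - x = 2 * of_int (- k)" by (simp add: algebra_simps)
    then show "\<exists>k::int. y - x = 2 * of_int k" ..
  qed
  show "transp (\<lambda>x y::complex. \<exists>k::int. x - y = 2 * of_int k)"
  proof (rule transpI)
    fix x y z :: complex
    assume "\<exists>k::int. x - y = 2 * of_int k" and "\<exists>k::int. y - z = 2 * of_int k"
    then obtain k l :: int where "x - y = 2 * of_int k" and "y - z = 2 * of_int l" by auto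
    then have "x - z = 2 * of_int (k + l)" by (simp add: algebra_simps)
    then show "\<exists>k::int. x - z = 2 * of_int k" ..
  qed
qed

lift_definition theta_eigenvalue :: "cmod2 \<Rightarrow> complex" is "\<lambda>\<alpha>. exp (2 * of_real pi * \<i> * \<alpha> / 2)"
proof -
  fix x y :: complex assume "\<exists>k::int. x - y = 2 * of_int k"
  then obtain k :: int where "x - y = 2 * of_int k" ..
  then have "2 * of_real pi * \<i> * x / 2 = 2 * of_real pi * \<i> * y / 2 + of_int (2 * k) * (of_real pi * \<i>)"
    by (simp add: algebra_simps)
  then show "exp (2 * of_real pi * \<i> * x / 2) = exp (2 * of_real pi * \<i> * y / 2)"
    unfolding exp_eq by (intro exI[of _ k]) (simp add: algebra_simps)
qed

definition apply_modes :: "(stat \<Rightarrow> 'h \<Rightarrow> int \<Rightarrow> 'w \<Rightarrow> 'w) \<Rightarrow> (stat \<times> 'h \<times> int) list \<Rightarrow> 'w \<Rightarrow> 'w" where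
  "apply_modes A ms w = foldr (\<lambda>(s, a, k). A s a k) ms w"

text \<open>
  A list of triples \<open>(s, a, m)\<close> with all \<open>m \<ge> 1\<close> encodes the product of the modes \<open>a(-m + |a|/2)\<close>
  on \<open>V\<close>, and the product of the modes \<open>a(-m)\<close> on \<open>W\<close>.
\<close>

definition creation_words :: "(stat \<times> 'h \<times> nat) list set" where
  "creation_words = {xs. \<forall>(s, a, m)\<in>set xs. m \<ge> 1}"

definition create :: "(stat \<Rightarrow> 'h \<Rightarrow> int \<Rightarrow> 'w \<Rightarrow> 'w) \<Rightarrow> (stat \<times> 'h \<times> nat) list \<Rightarrow> 'w \<Rightarrow> 'w" where
  "create A xs w = apply_modes A (map (\<lambda>(s, a, m). (s, a, - int m)) xs) w"

definition vac :: "(('h gen list \<Rightarrow>\<^sub>0 complex) \<Rightarrow> 'v) \<Rightarrow> 'v" where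
  "vac \<pi>V = \<pi>V (Poly_Mapping.single [] 1)"

definition V_vec :: "(('h gen list \<Rightarrow>\<^sub>0 complex) \<Rightarrow> 'v) \<Rightarrow> (stat \<times> 'h \<times> nat) list \<Rightarrow> 'v" where
  "V_vec \<pi>V xs = create (mode_op \<pi>V) xs (vac \<pi>V)"

definition V_grading ::
  "(complex \<Rightarrow> 'v::ab_group_add \<Rightarrow> 'v) \<Rightarrow> (('h gen list \<Rightarrow>\<^sub>0 complex) \<Rightarrow> 'v) \<Rightarrow> complex \<Rightarrow> 'v set" where
  "V_grading scV \<pi>V n = module.span scV {V_vec \<pi>V xs | xs. xs \<in> creation_words \<and>
     (\<Sum>(s, a, m)\<leftarrow>xs. of_nat m - of_nat (par s) / 2) = n}"

definition W_grading ::
  "(complex \<Rightarrow> 'w::ab_group_add \<Rightarrow> 'w) \<Rightarrow> (complex \<times> cmod2 \<Rightarrow> 'm set) \<Rightarrow>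
   (('h gen list \<Rightarrow>\<^sub>0 'm::ab_group_add) \<Rightarrow> 'w) \<Rightarrow> complex \<times> cmod2 \<Rightarrow> 'w set" where
  "W_grading scW Mgr \<pi>W = (\<lambda>(n, \<alpha>). module.span scW
     {create (mode_op \<pi>W) xs (\<pi>W (Poly_Mapping.single [] w)) | xs w. xs \<in> creation_words \<and>
        (\<exists>n' \<beta>. w \<in> Mgr (n', abs_cmod2 \<beta>) \<and> n = (\<Sum>(s, a, m)\<leftarrow>xs. of_nat m) + n' \<and>
           \<alpha> = abs_cmod2 (\<beta> + (\<Sum>(s, a, m)\<leftarrow>xs. of_nat (par s))))})"

definition W_weight_op ::
  "(complex \<Rightarrow> 'w::ab_group_add \<Rightarrow> 'w) \<Rightarrow> (complex \<times> cmod2 \<Rightarrow> 'm set) \<Rightarrow>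
   (('h gen list \<Rightarrow>\<^sub>0 'm::ab_group_add) \<Rightarrow> 'w) \<Rightarrow> 'w \<Rightarrow> 'w" where
  "W_weight_op scW Mgr \<pi>W = diag_op scW (W_grading scW Mgr \<pi>W) (\<lambda>(n, \<alpha>). n)"

text \<open>
  The coefficient space: a module for the tensor algebra of the two copies of \<open>'h\<close> in the
  \<open>\<int>\<^sub>2\<close>-graded sense, lower bounded. Besides the weight \<open>n\<close>, the index of \<open>Mgr\<close> records the \<open>\<theta>\<close>-weight,
  which is preserved by the bosonic elements and shifted by \<open>1\<close> by the fermionic ones
  (a \<open>\<int>\<^sub>2\<close>-grading is the case where only the \<open>\<theta>\<close>-weights \<open>0\<close> and \<open>1\<close> occur). An involution of
  this kind, needed to define \<open>\<theta>\<close> on the induced module, cannot be dispensed with: if \<open>'m\<close> is one-dimensional and a fermionic element acts by a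
  nonzero scalar, no compatible action of \<open>\<theta>\<close> on the induced module exists.
\<close>

definition graded_T_module ::
  "(complex \<Rightarrow> 'h::ab_group_add \<Rightarrow> 'h) \<Rightarrow> (complex \<Rightarrow> 'm::ab_group_add \<Rightarrow> 'm) \<Rightarrow>
   (stat \<Rightarrow> 'h \<Rightarrow> 'm \<Rightarrow> 'm) \<Rightarrow> (complex \<times> cmod2 \<Rightarrow> 'm set) \<Rightarrow> bool" where
  "graded_T_module scH scM act Mgr \<longleftrightarrow>
     vector_space scM \<and>
     (\<forall>s a. Vector_Spaces.linear scM scM (act s a)) \<and>
     (\<forall>s m. Vector_Spaces.linear scH scM (\<lambda>a. act s a m)) \<and>
     graded scM Mgr \<and>
     (\<exists>R::real. \<forall>n \<alpha>. Re n < R \<longrightarrow> Mgr (n, \<alpha>) = {0}) \<and>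
     (\<forall>s a n \<alpha>. act s a ` Mgr (n, abs_cmod2 \<alpha>) \<subseteq> Mgr (n, abs_cmod2 (\<alpha> + of_nat (par s))))"

section \<open>Normal ordered products and vertex operators\<close>

text \<open>
  The parameter \<open>dg\<close> gives the degree of a mode; negative, positive and zero modes are put into
  groups 0, 1, 2.
\<close>

definition mode_group :: "(stat \<Rightarrow> int \<Rightarrow> real) \<Rightarrow> stat \<times> 'h \<times> int \<Rightarrow> nat" where
  "mode_group dg = (\<lambda>(s, a, k). if dg s k < 0 then 0 else if dg s k > 0 then 1 else 2)"

definition modes_in :: "(stat \<Rightarrow> int \<Rightarrow> real) \<Rightarrow> nat \<Rightarrow> (stat \<times> 'h \<times> int) list \<Rightarrow> (stat \<times> 'h \<times> int) list" where
  "modes_in dg c ms = filter (\<lambda>x. mode_group dg x = c) ms"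

text \<open>
  The sign of the permutation of the fermionic factors, computed from its inversions: since the
  order within each group is kept, these are the pairs whose groups appear in the wrong order.
\<close>

definition fermion_sign :: "(stat \<Rightarrow> int \<Rightarrow> real) \<Rightarrow> (stat \<times> 'h \<times> int) list \<Rightarrow> complex" where
  "fermion_sign dg ms = (- 1) ^ card {(i, j). i < j \<and> j < length ms \<and>
     fst (ms ! i) = Fer \<and> fst (ms ! j) = Fer \<and> mode_group dg (ms ! j) < mode_group dg (ms ! i)}"

definition V_degree :: "stat \<Rightarrow> int \<Rightarrow> real" where
  "V_degree s k = of_int k + of_nat (par s) / 2"

definition W_degree :: "stat \<Rightarrow> int \<Rightarrow> real" where
  "W_degree s k = of_int k"

definition V_normal_order ::
  "(complex \<Rightarrow> 'v \<Rightarrow> 'v) \<Rightarrow> (stat \<Rightarrow> 'h \<Rightarrow> int \<Rightarrow> 'v \<Rightarrow> 'v) \<Rightarrow> (stat \<times> 'h \<times> int) list \<Rightarrow> 'v \<Rightarrow> 'v" where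
  "V_normal_order sc A ms v = sc (fermion_sign V_degree ms)
     (apply_modes A (modes_in V_degree 0 ms @ modes_in V_degree 1 ms @ modes_in V_degree 2 ms) v)"

text \<open>
  Normal ordering of a product of zero modes. The element \<open>gs ! i\<close> is the factor with number
  \<open>i + 2\<close> of the product. The contraction of two fermionic zero modes is half of \<open>lF * frm a b\<close>,
  which is the value taken by the supercommutators of the nonzero fermionic modes. The source has
  \<open>frm a b / 2\<close>, and no factor \<open>1 / lF\<close> in \<open>Delta_coeff\<close> below; both agree with the present formulas
  for \<open>lF = 1\<close>. For \<open>lF \<noteq> 1\<close> the formulas without these factors violate associativity on every
  nonzero \<open>W\<close>, already for \<open>a(-1/2)1\<close> and \<open>b(-1/2)1\<close> with \<open>frm a b \<noteq> 0\<close>.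
\<close>

fun zero_normal_order ::
  "('h \<Rightarrow> 'h \<Rightarrow> complex) \<Rightarrow> complex \<Rightarrow> (complex \<Rightarrow> 'w::ab_group_add \<Rightarrow> 'w) \<Rightarrow>
   (stat \<Rightarrow> 'h \<Rightarrow> int \<Rightarrow> 'w \<Rightarrow> 'w) \<Rightarrow> (stat \<times> 'h) list \<Rightarrow> 'w \<Rightarrow> 'w" where
  "zero_normal_order frm lF sc A [] w = w"
| "zero_normal_order frm lF sc A ((s, a) # gs) w =
     A s a 0 (zero_normal_order frm lF sc A gs w) +
     (if s = Fer then
        (\<Sum>i\<leftarrow>[0..<length gs]. if fst (gs ! i) = Fer then
            sc ((- 1) ^ length (filter (\<lambda>(s', b). s' = Fer) (take (Suc i) gs)) / 2 * (lF * frm a (snd (gs ! i))))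
               (zero_normal_order frm lF sc A (take i gs @ drop (Suc i) gs) w)
          else 0)
      else 0)"

definition W_normal_order ::
  "('h \<Rightarrow> 'h \<Rightarrow> complex) \<Rightarrow> complex \<Rightarrow> (complex \<Rightarrow> 'w::ab_group_add \<Rightarrow> 'w) \<Rightarrow>
   (stat \<Rightarrow> 'h \<Rightarrow> int \<Rightarrow> 'w \<Rightarrow> 'w) \<Rightarrow> (stat \<times> 'h \<times> int) list \<Rightarrow> 'w \<Rightarrow> 'w" where
  "W_normal_order frm lF sc A ms w = sc (fermion_sign W_degree ms)
     (apply_modes A (modes_in W_degree 0 ms @ modes_in W_degree 1 ms)
       (zero_normal_order frm lF sc A (map (\<lambda>(s, a, k). (s, a)) (modes_in W_degree 2 ms)) w))"

text \<open>
  For a field \<open>a(x)\<close> in which the \<open>n\<close>-th mode is the coefficient of the power \<open>ex s n\<close> of \<open>x\<close>, the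
  coefficient of that mode in the divided derivative \<open>a\<^sup>(\<^sup>m\<^sup>-\<^sup>1\<^sup>)(x)\<close> is \<open>ex s n gchoose (m - 1)\<close>
  times the power \<open>ex s n - (m - 1)\<close>. The following is the coefficient of \<open>x\<close> to the power \<open>e\<close> in
  the normal ordered product (with respect to \<open>nord\<close>) of the divided derivatives encoded by \<open>xs\<close>,
  applied to \<open>w\<close>.
\<close>

definition normal_product_coeff ::
  "(complex \<Rightarrow> 'w::ab_group_add \<Rightarrow> 'w) \<Rightarrow> ((stat \<times> 'h \<times> int) list \<Rightarrow> 'w \<Rightarrow> 'w) \<Rightarrow>
   (stat \<Rightarrow> int \<Rightarrow> complex) \<Rightarrow> (stat \<times> 'h \<times> nat) list \<Rightarrow> complex \<Rightarrow> 'w \<Rightarrow> 'w" where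
  "normal_product_coeff sc nord ex xs e w = Sum_any (\<lambda>ns :: int list.
     if length ns = length xs \<and>
        (\<Sum>((s, a, m), n)\<leftarrow>zip xs ns. ex s n - of_nat (m - 1)) = e
     then sc (\<Prod>((s, a, m), n)\<leftarrow>zip xs ns. ex s n gchoose (m - 1))
            (nord (map (\<lambda>((s, a, m), n). (s, a, n)) (zip xs ns)) w)
     else 0)"

text \<open>\<open>Y_V scV \<pi>V n u v\<close> is the coefficient of the power \<open>- n - 1\<close> of \<open>x\<close> in \<open>Y(u, x)v\<close>.\<close>

definition Y_V ::
  "(complex \<Rightarrow> 'v::ab_group_add \<Rightarrow> 'v) \<Rightarrow> (('h gen list \<Rightarrow>\<^sub>0 complex) \<Rightarrow> 'v) \<Rightarrow> int \<Rightarrow> 'v \<Rightarrow> 'v \<Rightarrow> 'v" where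
  "Y_V scV \<pi>V n u v = lin_extend scV scV creation_words (V_vec \<pi>V)
     (\<lambda>xs. normal_product_coeff scV (V_normal_order scV (mode_op \<pi>V)) (\<lambda>s k. - of_int k - 1)
        xs (- of_int n - 1) v) u"

text \<open>
  Series in powers of the square root of \<open>x\<close> are indexed by an integer \<open>k\<close> standing for the
  half-integer \<open>n = k/2\<close>, that is, for the coefficient of the power \<open>- k/2 - 1\<close> of \<open>x\<close>.
\<close>

definition Y_W_bar ::
  "('h \<Rightarrow> 'h \<Rightarrow> complex) \<Rightarrow> complex \<Rightarrow> (complex \<Rightarrow> 'v::ab_group_add \<Rightarrow> 'v) \<Rightarrow> (('h gen list \<Rightarrow>\<^sub>0 complex) \<Rightarrow> 'v) \<Rightarrow>
   (complex \<Rightarrow> 'w::ab_group_add \<Rightarrow> 'w) \<Rightarrow> (('h gen list \<Rightarrow>\<^sub>0 'm::ab_group_add) \<Rightarrow> 'w) \<Rightarrow> int \<Rightarrow> 'v \<Rightarrow> 'w \<Rightarrow> 'w" where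
  "Y_W_bar frm lF scV \<pi>V scW \<pi>W k u w = lin_extend scV scW creation_words (V_vec \<pi>V)
     (\<lambda>xs. normal_product_coeff scW (W_normal_order frm lF scW (mode_op \<pi>W))
        (\<lambda>s n. - of_int n - 1 + of_nat (par s) / 2) xs (- of_int k / 2 - 1) w) u"

definition C_coeff :: "nat \<Rightarrow> nat \<Rightarrow> complex" where
  "C_coeff m n = 1/2 * ((of_nat m - of_nat n) / (of_nat m + of_nat n - 1)) *
     ((- 1/2) gchoose (m - 1)) * ((- 1/2) gchoose (n - 1))"

text \<open>
  The coefficient of the power \<open>- p\<close> of \<open>x\<close> in \<open>\<Delta>(x)\<close>; the mode \<open>e(m - 1/2)\<close> on \<open>V\<close> has index
  \<open>m - 1\<close>.
\<close>

definition Delta_coeff ::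
  "complex \<Rightarrow> 'h list \<Rightarrow> (complex \<Rightarrow> 'v::ab_group_add \<Rightarrow> 'v) \<Rightarrow> (('h gen list \<Rightarrow>\<^sub>0 complex) \<Rightarrow> 'v) \<Rightarrow> nat \<Rightarrow> 'v \<Rightarrow> 'v" where
  "Delta_coeff lF es scV \<pi>V p u =
     (\<Sum>e\<leftarrow>es. \<Sum>(m, n)\<in>{(m, n). m \<ge> 1 \<and> n \<ge> 1 \<and> m + n = p + 1}.
        scV (1/2 * C_coeff m n / lF)
          (mode_op \<pi>V Fer e (int m - 1) (mode_op \<pi>V Fer e (int n - 1) u)))"

text \<open>The coefficients of the power \<open>- q\<close> of \<open>x\<close> in \<open>\<Delta>(x)\<^sup>t\<close> and in \<open>exp(\<Delta>(x))\<close>.\<close>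

primrec Delta_power_coeff ::
  "complex \<Rightarrow> 'h list \<Rightarrow> (complex \<Rightarrow> 'v::ab_group_add \<Rightarrow> 'v) \<Rightarrow> (('h gen list \<Rightarrow>\<^sub>0 complex) \<Rightarrow> 'v) \<Rightarrow>
   nat \<Rightarrow> nat \<Rightarrow> 'v \<Rightarrow> 'v" where
  "Delta_power_coeff lF es scV \<pi>V 0 = (\<lambda>q u. if q = 0 then u else 0)"
| "Delta_power_coeff lF es scV \<pi>V (Suc t) =
     (\<lambda>q u. \<Sum>p\<le>q. Delta_coeff lF es scV \<pi>V p (Delta_power_coeff lF es scV \<pi>V t (q - p) u))"

definition exp_Delta_coeff ::
  "complex \<Rightarrow> 'h list \<Rightarrow> (complex \<Rightarrow> 'v::ab_group_add \<Rightarrow> 'v) \<Rightarrow> (('h gen list \<Rightarrow>\<^sub>0 complex) \<Rightarrow> 'v) \<Rightarrow> nat \<Rightarrow> 'v \<Rightarrow> 'v" where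
  "exp_Delta_coeff lF es scV \<pi>V q u =
     Sum_any (\<lambda>t. scV (1 / fact t) (Delta_power_coeff lF es scV \<pi>V t q u))"

definition Y_W ::
  "('h \<Rightarrow> 'h \<Rightarrow> complex) \<Rightarrow> complex \<Rightarrow> 'h list \<Rightarrow>
   (complex \<Rightarrow> 'v::ab_group_add \<Rightarrow> 'v) \<Rightarrow> (('h gen list \<Rightarrow>\<^sub>0 complex) \<Rightarrow> 'v) \<Rightarrow>
   (complex \<Rightarrow> 'w::ab_group_add \<Rightarrow> 'w) \<Rightarrow> (('h gen list \<Rightarrow>\<^sub>0 'm::ab_group_add) \<Rightarrow> 'w) \<Rightarrow> int \<Rightarrow> 'v \<Rightarrow> 'w \<Rightarrow> 'w" where
  "Y_W frm lF es scV \<pi>V scW \<pi>W k u w =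
     Sum_any (\<lambda>q::nat. Y_W_bar frm lF scV \<pi>V scW \<pi>W (k - 2 * int q) (exp_Delta_coeff lF es scV \<pi>V q u) w)"

section \<open>Lower-bounded twisted modules\<close>

text \<open>
  Polynomials in the variables numbered \<open>0, \<dots>, n - 1\<close>, as finitely supported families of
  coefficients indexed by exponent vectors.
\<close>

type_synonym cpoly = "(nat \<Rightarrow>\<^sub>0 nat) \<Rightarrow>\<^sub>0 complex"

definition cpoly_in :: "nat \<Rightarrow> cpoly \<Rightarrow> bool" where
  "cpoly_in n g \<longleftrightarrow> (\<forall>\<mu>\<in>Poly_Mapping.keys g. Poly_Mapping.keys \<mu> \<subseteq> {..<n})"

definition cpoly_eval :: "cpoly \<Rightarrow> (nat \<Rightarrow> complex) \<Rightarrow> complex" where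
  "cpoly_eval g z = (\<Sum>\<mu>\<in>Poly_Mapping.keys g. Poly_Mapping.lookup g \<mu> *
     (\<Prod>i\<in>Poly_Mapping.keys \<mu>. z i ^ Poly_Mapping.lookup \<mu> i))"

definition log_branch :: "int \<Rightarrow> complex \<Rightarrow> complex" where
  "log_branch p z = of_real (ln (norm z)) + \<i> * of_real (Arg2pi z + 2 * pi * of_int p)"

definition abs_sums_to :: "('i \<Rightarrow> complex) \<Rightarrow> 'i set \<Rightarrow> complex \<Rightarrow> bool" where
  "abs_sums_to f A S \<longleftrightarrow> (\<lambda>x. norm (f x)) summable_on A \<and> (f has_sum S) A"

text \<open>
  The terms of the multiple series for \<open>\<langle>w', Y_W\<^sup>p(v\<^sub>0, z\<^sub>0) \<cdots> Y_W\<^sup>p(v\<^sub>n\<^sub>-\<^sub>1, z\<^sub>n\<^sub>-\<^sub>1)w\<rangle>\<close>, indexed by lists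
  \<open>ks\<close> of length \<open>n\<close>, and of the double series for \<open>\<langle>w', Y_W\<^sup>p(Y(v\<^sub>1, z\<^sub>1 - z\<^sub>2)v\<^sub>2, z\<^sub>2)w\<rangle>\<close>.
\<close>

definition product_term ::
  "(int \<Rightarrow> 'v \<Rightarrow> 'w \<Rightarrow> 'w) \<Rightarrow> int \<Rightarrow> nat \<Rightarrow> (nat \<Rightarrow> 'v) \<Rightarrow> (nat \<Rightarrow> complex) \<Rightarrow> 'w \<Rightarrow> ('w \<Rightarrow> complex) \<Rightarrow> int list \<Rightarrow> complex" where
  "product_term YW p n v z w w' ks =
     w' (foldr (\<lambda>i. YW (ks ! i) (v i)) [0..<n] w) *
     (\<Prod>i<n. exp ((- of_int (ks ! i) / 2 - 1) * log_branch p (z i)))"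

definition iterate_term ::
  "(int \<Rightarrow> 'v \<Rightarrow> 'v \<Rightarrow> 'v) \<Rightarrow> (int \<Rightarrow> 'v \<Rightarrow> 'w \<Rightarrow> 'w) \<Rightarrow> int \<Rightarrow> 'v \<Rightarrow> 'v \<Rightarrow> complex \<Rightarrow> complex \<Rightarrow>
   'w \<Rightarrow> ('w \<Rightarrow> complex) \<Rightarrow> int \<times> int \<Rightarrow> complex" where
  "iterate_term YV YW p v1 v2 z1 z2 w w' = (\<lambda>(n, k).
     w' (YW k (YV n v1 v2) w) * (z1 - z2) powi (- n - 1) * exp ((- of_int k / 2 - 1) * log_branch p z2))"

text \<open>
  \<open>parity_space scV Vgr i\<close> is the sum of the weight spaces with weight in \<open>i/2 + \<int>\<close>; it depends
  only on the parity of \<open>i\<close>.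
\<close>

definition parity_space :: "(complex \<Rightarrow> 'v::ab_group_add \<Rightarrow> 'v) \<Rightarrow> (complex \<Rightarrow> 'v set) \<Rightarrow> nat \<Rightarrow> 'v set" where
  "parity_space scV Vgr i = module.span scV (\<Union>n\<in>{n. n - of_nat i / 2 \<in> \<int>}. Vgr n)"

definition parity_involution :: "(complex \<Rightarrow> 'v::ab_group_add \<Rightarrow> 'v) \<Rightarrow> (complex \<Rightarrow> 'v set) \<Rightarrow> 'v \<Rightarrow> 'v" where
  "parity_involution scV Vgr = diag_op scV (parity_space scV Vgr) (\<lambda>i. (- 1) ^ i)"

locale lower_bounded_theta_twisted_module =
  fixes scV :: "complex \<Rightarrow> 'v::ab_group_add \<Rightarrow> 'v"
    and vacV :: 'v
    and Vgr :: "complex \<Rightarrow> 'v set"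
    and YV :: "int \<Rightarrow> 'v \<Rightarrow> 'v \<Rightarrow> 'v"
    and scW :: "complex \<Rightarrow> 'w::ab_group_add \<Rightarrow> 'w"
    and Wgr :: "complex \<times> cmod2 \<Rightarrow> 'w set"
    and dW :: "'w \<Rightarrow> 'w"
    and YW :: "int \<Rightarrow> 'v \<Rightarrow> 'w \<Rightarrow> 'w"
  assumes W_vector_space: "vector_space scW"
    and W_graded: "graded scW Wgr"
    and YW_linear_left: "\<And>k w. Vector_Spaces.linear scV scW (\<lambda>u. YW k u w)"
    and YW_linear_right: "\<And>k u. Vector_Spaces.linear scW scW (YW k u)"
    and dW_linear: "Vector_Spaces.linear scW scW dW"
    and lower_bounded: "\<exists>R::real. \<forall>m \<alpha>. Re m < R \<longrightarrow> Wgr (m, \<alpha>) = {0}"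
    and dW_grading: "\<And>m \<alpha> w. w \<in> Wgr (m, \<alpha>) \<Longrightarrow> dW w = scW m w"
    and theta_covariance:
      "\<And>k v w. diag_op scW Wgr (\<lambda>(m, \<alpha>). theta_eigenvalue \<alpha>) (YW k v w) =
         YW k (parity_involution scV Vgr v) (diag_op scW Wgr (\<lambda>(m, \<alpha>). theta_eigenvalue \<alpha>) w)"
    and dW_commutator:
      "\<And>k u w. dW (YW k u w) - YW k u (dW w) =
         YW k (diag_op scV Vgr (\<lambda>n. n) u) w + scW (- of_int k / 2 - 1) (YW k u w)"
    and identity: "\<And>k w. YW k vacV w = (if k = - 2 then w else 0)"
    and product_rationality:
      "\<And>n (v :: nat \<Rightarrow> 'v) (i :: nat \<Rightarrow> nat) w w'.
         \<lbrakk> \<forall>j<n. i j \<in> {0, 1} \<and> v j \<in> parity_space scV Vgr (i j); w' \<in> graded_dual scW Wgr \<rbrakk> \<Longrightarrow>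
         \<exists>(g :: cpoly) (q :: nat \<Rightarrow> nat) (qq :: nat \<Rightarrow> nat \<Rightarrow> nat). cpoly_in n g \<and>
           (\<forall>p z. (\<forall>j<n. z j \<noteq> 0) \<and> (\<forall>j l. j < l \<and> l < n \<longrightarrow> norm (z l) < norm (z j)) \<longrightarrow>
              abs_sums_to (product_term YW p n v z w w') {ks. length ks = n}
                (cpoly_eval g z *
                 (\<Prod>j<n. exp (of_nat (i j) / 2 * log_branch p (z j)) * inverse (z j ^ q j)) *
                 (\<Prod>l<n. \<Prod>j<l. inverse ((z j - z l) ^ qq j l))))"
    and iterate_rationality:
      "\<And>v1 v2 (i1 :: nat) (i2 :: nat) w w'.
         \<lbrakk> i1 \<in> {0, 1}; i2 \<in> {0, 1}; v1 \<in> parity_space scV Vgr i1; v2 \<in> parity_space scV Vgr i2;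
           w' \<in> graded_dual scW Wgr \<rbrakk> \<Longrightarrow>
         \<exists>(g :: cpoly) (q1 :: nat) (q2 :: nat) (t :: nat). cpoly_in 2 g \<and>
           (\<forall>p z1 z2. norm z2 > norm (z1 - z2) \<and> norm (z1 - z2) > 0 \<longrightarrow>
              (\<lambda>nk. norm (iterate_term YV YW p v1 v2 z1 z2 w w' nk)) summable_on UNIV \<and>
              (\<bar>Arg2pi z1 - Arg2pi z2\<bar> < pi / 2 \<longrightarrow>
                 (iterate_term YV YW p v1 v2 z1 z2 w w' has_sum
                    cpoly_eval g (\<lambda>j. if j = 0 then z1 else z2) *
                    exp (of_nat i1 / 2 * log_branch p z1) * inverse (z1 ^ q1) *
                    exp (of_nat i2 / 2 * log_branch p z2) * inverse (z2 ^ q2) *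
                    inverse ((z1 - z2) ^ t)) UNIV))"
    and associativity:
      "\<And>p v1 v2 w w' z1 z2.
         \<lbrakk> w' \<in> graded_dual scW Wgr; norm z1 > norm z2; norm z2 > norm (z1 - z2); norm (z1 - z2) > 0;
           \<bar>Arg2pi z1 - Arg2pi z2\<bar> < pi / 2 \<rbrakk> \<Longrightarrow>
         \<exists>S. abs_sums_to
               (product_term YW p 2 (\<lambda>j. if j = 0 then v1 else v2) (\<lambda>j. if j = 0 then z1 else z2) w w')
               {ks. length ks = 2} S \<and>
             abs_sums_to (iterate_term YV YW p v1 v2 z1 z2 w w') UNIV S"

end

theory Submission
  imports Defs
begin

text \<open>
 Normal ordered products multiply by Wick's theorem: a product of vertex operators is the exponential
 of the pair contractions of the fields, applied to one big normal ordered product. The contractions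
 are explicit: for bosons \<open>1 / (x - y)\<^sup>2\<close>, and for fermions \<open>(x + y) / (2(x - y)(xy)\<^sup>1\<^sup>/\<^sup>2)\<close>, with
 their derivatives. On \<open>V\<close> the fermionic contraction is \<open>1 / (x - y)\<close>, and the regular difference of
 the two is the generating function of the \<open>C\<^sub>m\<^sub>n\<close>; so \<open>exp(\<Delta>(x))\<close>, again a Wick exponential,
 supplies what an iterate lacks. Products and iterates therefore are expansions of the same finite sum
 of contractions times matrix elements of normal ordered products. This sum is a rational function of
 the roots of the variables, whose dependence on the sign of each root is governed by the number of
 fermionic letters; the gradings leave only finitely many modes to a matrix element.
\<close>

text \<open>The algebras have no relation between two negative, two positive or two zero modes, so
  fields cannot be reordered freely; all that can be done is to move nonnegative modes to the right
  through negative ones. This is why the calculus lives on words, that is, on a tensor algebra. It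
  is transposed to functionals of words because linear maps, infinite summations over mode indices
  and weight arguments then pass through it, and because composing two exponentials just adds their
  contraction functions. The obstacle is that the fermionic contraction on W is not a function of
  \<open>x - y\<close>, so its higher derivatives have no convenient closed form. They are never
  computed: Euler's identity and the value of \<open>d/dx + d/dy\<close> determine them recursively,
  and a mode series is recognized by checking these two first order equations, which come from
  telescoping and homogeneity. The contraction of zero modes is halved because this turns the
  geometric series \<open>t / (u(t^2 - u^2))\<close> of the modes at \<open>x = t^2\<close>,
  \<open>y = u^2\<close> into an expression antisymmetric in \<open>t\<close> and \<open>u\<close>,
  whose regular part the antisymmetric \<open>C_coeff\<close> can supply.\<close>

type_synonym 'h letter = "stat \<times> 'h \<times> nat"
type_synonym 'h mode = "stat \<times> 'h \<times> int"
type_synonym 'h labelled = "stat \<times> 'h \<times> nat \<times> nat"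
type_synonym 'h word = "'h letter list"

abbreviation (input) "CW \<equiv> creation_words"
abbreviation (input) "sgl \<equiv> Poly_Mapping.single"

section \<open>Contractions of words\<close>

definition sg :: "stat => stat => complex" where
 "sg s t = (if s = Fer & t = Fer then - 1 else 1)"

lemma sg_Bos [simp]: "sg Bos t = 1" "sg t Bos = 1" by (simp_all add: sg_def)

lemma sg_FF [simp]: "sg Fer Fer = - 1" by (simp add: sg_def)

lemma sg_sym: "sg s t = sg t s" by (auto simp: sg_def)

lemma sg_sg [simp]: "sg s t * sg s t = 1" "sg s t * (sg s t * c) = c" by (auto simp: sg_def)

lemma power_par_eq_sg: "(- 1) ^ (par s * par t) = sg s t" by (cases s; cases t) simp_all

text \<open>A superderivation of parity \<open>t\<close> with scalar values can be nonzero only on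
  letters of parity \<open>t\<close>; this makes the signs of two contractions compatible.\<close>

definition homog :: "stat => (stat \<times> 'r => complex) => bool" where
 "homog t ph \<longleftrightarrow> (\<forall>x. fst x ~= t --> ph x = 0)"

definition del :: "nat => 'a list => 'a list" where
 "del p xs = take p xs @ drop (Suc p) xs"

locale complex_space = vector_space sc
 for sc :: "complex => 'w::ab_group_add => 'w"
begin

text \<open>
 A word functional \<open>Ps\<close> stands for a linear functional on the tensor algebra of the letters.
 \<open>contract t ph\<close> is the transpose of the superderivation of parity \<open>t\<close> that sends the letter \<open>x\<close>
 to \<open>ph x\<close>, and \<open>wick c\<close> is the transpose of the exponential of the pair contraction \<open>c\<close>, a sum over
 all partial matchings of the letters.
\<close>

primrec contract ::
 "stat => (stat \<times> 'r => complex) => (stat \<times> 'r) list => ((stat \<times> 'r) list => 'w) => 'w" where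
 "contract t ph [] Ps = 0"
| "contract t ph (x # w) Ps = sc (ph x) (Ps w) + sc (sg t (fst x)) (contract t ph w (%v. Ps (x # v)))"

primrec wick ::
 "(stat \<times> 'r => stat \<times> 'r => complex) => (stat \<times> 'r) list => ((stat \<times> 'r) list => 'w) => 'w" where
 "wick c [] Ph = Ph []"
| "wick c (x # w) Ph = wick c w (%v. Ph (x # v) + contract (fst x) (c x) v Ph)"

lemma contract_add: "contract t ph w (%v. Ps v + Ps' v) = contract t ph w Ps + contract t ph w Ps'"
 by (induction w arbitrary: Ps Ps') (simp_all add: algebra_simps)

lemma contract_scale: "contract t ph w (%v. sc k (Ps v)) = sc k (contract t ph w Ps)" by (induction w arbitrary: Ps) (simp_all add: algebra_simps)

lemma contract_zero [simp]: "contract t ph w (%v. 0) = 0" by (induction w) simp_all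

lemma contract_add_left: "contract t (%x. ph x + ph' x) w Ps = contract t ph w Ps + contract t ph' w Ps"
 by (induction w arbitrary: Ps) (simp_all add: algebra_simps)

lemma contract_scale_left: "contract t (%x. k * ph x) w Ps = sc k (contract t ph w Ps)" by (induction w arbitrary: Ps) (simp_all add: algebra_simps)

lemma contract_minus_left: "contract t (%x. - ph x) w Ps = - contract t ph w Ps" using contract_scale_left[of t "-1" ph] by simp

lemma contract_zero_left [simp]: "contract t (%x. 0) w Ps = 0" by (induction w arbitrary: Ps) simp_all

text \<open>The shortened words have to be compared only where the removed letter has a nonzero
  value. Invariants that survive only genuine contractions, such as a parity or a total index, can
  therefore be used.\<close>

lemma contract_cong:
 assumes "!!u y v. w = u @ y # v ==> ph y = ph' y & (ph y ~= 0 --> Ps (u @ v) = Ps' (u @ v))" shows "contract t ph w Ps = contract t ph' w Ps'"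
 using assms
proof (induction w arbitrary: Ps Ps')
 case (Cons x w)
 have "contract t ph w (%v. Ps (x # v)) = contract t ph' w (%v. Ps' (x # v))" by (rule Cons.IH) (use Cons.prems[of "x # _"] in auto)
 moreover have "sc (ph x) (Ps w) = sc (ph' x) (Ps' w)" using Cons.prems[of "[]" x w] by (cases "ph x = 0") auto
 ultimately show ?case by simp
qed simp

lemma contract_append:
 "contract t ph (u @ v) Ps = contract t ph u (%w. Ps (w @ v))
   + sc (PROD x<-u. sg t (fst x)) (contract t ph v (%w. Ps (u @ w)))" by (induction u arbitrary: Ps) (simp_all add: algebra_simps)

lemma contract_eq_0: "(!!x. x \<in> set w ==> ph x = 0) ==> contract t ph w Ps = 0" by (induction w arbitrary: Ps) simp_all

lemma contract_map:
 assumes "!!x. x \<in> set w ==> fst (g x) = fst x" shows "contract t ph (map g w) Ps = contract t (%x. ph (g x)) w (%v. Ps (map g v))"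
 using assms by (induction w arbitrary: Ps) simp_all

text \<open>The supercommutator of two superderivations is again one, and it kills every letter
  because the values on letters are scalars.\<close>

lemma contract_contract:
 assumes "homog s ph" "homog t \<psi>"
 shows "contract s ph w (%v. contract t \<psi> v Ps) = sc (sg s t) (contract t \<psi> w (%v. contract s ph v Ps))"
proof (induction w arbitrary: Ps)
 case (Cons x w)
 have 1: "ph x = 0 | sg s t * sg t (fst x) = 1"
 proof -
  have "fst x = s | ph x = 0" using assms(1) unfolding homog_def by blast
  thus ?thesis by (auto simp: sg_sym[of s t])
 qed
 have 2: "\<psi> x = 0 | sg s (fst x) = sg s t"
 proof -
  have "fst x = t | \<psi> x = 0" using assms(2) unfolding homog_def by blast
  thus ?thesis by auto
 qed
 show ?case using 1 2 by (auto simp: contract_add contract_scale Cons.IH algebra_simps)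
qed simp

lemma wick_add: "wick c w (%v. Ph v + Ph' v) = wick c w Ph + wick c w Ph'"
proof (induction w arbitrary: Ph Ph')
 case (Cons x w)
 have "wick c (x # w) (%v. Ph v + Ph' v) =
   wick c w (%v. (Ph (x # v) + contract (fst x) (c x) v Ph) + (Ph' (x # v) + contract (fst x) (c x) v Ph'))" by (simp add: contract_add algebra_simps)
 thus ?case by (simp only: Cons.IH wick.simps)
qed simp

lemma wick_scale: "wick c w (%v. sc k (Ph v)) = sc k (wick c w Ph)"
proof (induction w arbitrary: Ph)
 case (Cons x w)
 have "wick c (x # w) (%v. sc k (Ph v)) = wick c w (%v. sc k (Ph (x # v) + contract (fst x) (c x) v Ph))" by (simp add: contract_scale algebra_simps)
 thus ?case by (simp only: Cons.IH wick.simps)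
qed simp

lemma wick_0 [simp]: "wick c w (%v. 0) = 0" using wick_scale[of c w 0 "%_. 0"] by simp

text \<open>Pair contractions are even: by \<open>homog\<close> the two removed letters have the
  same parity, so the signs met by \<open>contract\<close> in passing them cancel.\<close>

lemma contract_wick:
 assumes "homog t ph" and c: "!!x. homog (fst x) (c x)" shows "contract t ph w (%v. wick c v Ps) = wick c w (%v. contract t ph v Ps)"
proof (induction w arbitrary: Ps)
 case (Cons x w)
 have "contract t ph (x # w) (%v. wick c v Ps) = sc (ph x) (wick c w Ps) +
   sc (sg t (fst x)) (wick c w (%v. contract t ph v (%u. Ps (x # u) + contract (fst x) (c x) u Ps)))" by (simp add: Cons.IH)
 also have "... = wick c w (%v. sc (ph x) (Ps v) + sc (sg t (fst x))
   (contract t ph v (%u. Ps (x # u)) + contract t ph v (%u. contract (fst x) (c x) u Ps)))" by (simp add: wick_add wick_scale contract_add)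
 also have "... = wick c (x # w) (%v. contract t ph v Ps)" by (simp add: contract_contract[OF assms(1) c] algebra_simps)
 finally show ?case .
qed simp

text \<open>The definition matches the first letter against the survivors of the rest. Here it is
  matched before the rest is treated, so that the remaining word is shorter; this form drives the
  inductions on the length.\<close>

lemma wick_Cons:
 assumes c: "!!x. homog (fst x) (c x)" shows "wick c (x # w) Ph = wick c w (%v. Ph (x # v)) + contract (fst x) (c x) w (%v. wick c v Ph)"
 by (simp add: wick_add contract_wick[OF c c])

text \<open>The pair contractions commute, so the product of their exponentials is the exponential
  of their sum. In particular \<open>c\<close> and its negative give inverse operations.\<close>

lemma wick_wick:
 assumes c: "!!x. homog (fst x) (c x)" and c': "!!x. homog (fst x) (c' x)" shows "wick c w (%v. wick c' v Ph) = wick (%x y. c x y + c' x y) w Ph"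
proof (induction w arbitrary: Ph)
 case (Cons x w)
 have "wick c (x # w) (%v. wick c' v Ph) =
   wick c w (%v. wick c' v (%u. Ph (x # u) + contract (fst x) (c' x) u Ph + contract (fst x) (c x) u Ph))"
  by (simp add: contract_wick[OF c c'] wick_add add.assoc)
 also have "... = wick (%x y. c x y + c' x y) (x # w) Ph" by (simp add: Cons.IH contract_add_left algebra_simps)
 finally show ?case .
qed simp

lemma wick_zero_left [simp]: "wick (%x y. 0) w Ph = Ph w" by (induction w arbitrary: Ph) simp_all

text \<open>\<open>P\<close> is an invariant of the removal of nonzero pairs. The contraction
  functions need to agree only on pairs that occur in the given order inside a word with
  \<open>P\<close>, so sortedness of labels or conservation of an index may decide which
  contractions are present at all.\<close>

lemma wick_cong:
 assumes c: "!!x. homog (fst x) (c x)" and c': "!!x. homog (fst x) (c' x)"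
  and "P w"
  and "!!u x v y t. P (u @ x # v @ y # t) ==> c x y = c' x y & (c x y ~= 0 --> P (u @ v @ t))"
  and "!!v. P v ==> Ph v = Ph' v" shows "wick c w Ph = wick c' w Ph'" using assms(3-)
proof (induction "length w" arbitrary: w P Ph Ph' rule: less_induct)
 case less
 show ?case
 proof (cases w)
  case (Cons x w')
  have "wick c w' (%v. Ph (x # v)) = wick c' w' (%v. Ph' (x # v))"
   by (rule less.hyps[of w' "%v. P (x # v)"]) (use less.prems Cons less.prems(2)[of "x # _"] in auto)
  moreover have "contract (fst x) (c x) w' (%v. wick c v Ph) = contract (fst x) (c' x) w' (%v. wick c' v Ph')"
  proof (rule contract_cong, intro conjI impI)
   fix u y v assume w': "w' = u @ y # v"
   show "c x y = c' x y" using less.prems(2)[of "[]" x u y v] less.prems(1) Cons w' by simp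
   assume "c x y ~= 0"
   hence "P (u @ v)" using less.prems(2)[of "[]" x u y v] less.prems(1) Cons w' by simp
   thus "wick c (u @ v) Ph = wick c' (u @ v) Ph'" using less.prems w' Cons by (intro less.hyps[of "u @ v" P]) auto
  qed
  ultimately show ?thesis unfolding Cons by (simp add: wick_Cons[OF c] wick_Cons[OF c'] del: wick.simps(2))
 qed (use less.prems in simp)
qed

lemma wick_cong_simple:
 assumes c: "!!x. homog (fst x) (c x)" and c': "!!x. homog (fst x) (c' x)"
  and "!!x y. x \<in> set w ==> y \<in> set w ==> c x y = c' x y"
  and "!!v. set v \<subseteq> set w ==> Ph v = Ph' v" shows "wick c w Ph = wick c' w Ph'"
 by (rule wick_cong[where P = "%v. set v \<subseteq> set w"]) (use assms in auto)

lemma wick_map: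
 assumes "!!x. fst (g x) = fst x" shows "wick c (map g w) Ph = wick (%x y. c (g x) (g y)) w (%v. Ph (map g v))"
 by (induction w arbitrary: Ph) (simp_all add: assms contract_map)

lemma contract_interchange:
 "contract t ph u (%u'. wick c v (%v'. Ph u' v')) = wick c v (%v'. contract t ph u (%u'. Ph u' v'))"
 by (induction u arbitrary: Ph) (simp_all add: wick_add wick_scale)

text \<open>Contractions run from earlier to later letters, so only pairs from \<open>u\<close> to
  \<open>v\<close> could mix the two words.\<close>

lemma wick_append:
 assumes "!!x y. x \<in> set u ==> y \<in> set v ==> c x y = 0"
  and c: "!!x. homog (fst x) (c x)" shows "wick c (u @ v) Ph = wick c u (%u'. wick c v (%v'. Ph (u' @ v')))" using assms(1)
proof (induction u arbitrary: Ph)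
 case (Cons x u)
 have "wick c (x # u @ v) Ph =
   wick c u (%u'. wick c v (%v'. Ph (x # u' @ v') + contract (fst x) (c x) (u' @ v') Ph))" using Cons by simp
 also have "... = wick c u (%u'. wick c v (%v'. Ph (x # u' @ v') + contract (fst x) (c x) u' (%w. Ph (w @ v'))))"
 proof (intro wick_cong_simple[OF c c])
  fix u' v' assume "set v' \<subseteq> set v"
  hence "contract (fst x) (c x) v' Ps = 0" for Ps by (intro contract_eq_0) (use Cons.prems[of x] in auto)
  thus "Ph (x # u' @ v') + contract (fst x) (c x) (u' @ v') Ph =
    Ph (x # u' @ v') + contract (fst x) (c x) u' (%w. Ph (w @ v'))" by (simp add: contract_append)
 qed simp_all
 also have "... = wick c (x # u) (%u'. wick c v (%v'. Ph (u' @ v')))" by (simp add: wick_add contract_interchange)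
 finally show ?case by simp
qed simp

text \<open>A removed letter pays its own factor through \<open>ph\<close>, so that the total is the
  weight of the full word. With signs as weights this moves a parity sign through a contraction;
  with weights 0 and 1 the analogue for \<open>wick\<close> restricts to words of selected
  letters.\<close>

lemma contract_weight:
 assumes "!!y. ph y = k * t y * ph' y" shows "contract s ph w (%v. sc (PROD x<-v. t x) (Ps v)) = sc (k * (PROD x<-w. t x)) (contract s ph' w Ps)"
proof (induction w arbitrary: Ps)
 case (Cons y w)
 show ?case using Cons.IH[of "%v. sc (t y) (Ps (y # v))"] by (simp add: assms contract_scale algebra_simps)
qed simp

lemma wick_weight:
 assumes "!!x y. c x y = t x * t y * c' x y" shows "wick c w (%v. sc (PROD x<-v. t x) (Ph v)) = sc (PROD x<-w. t x) (wick c' w Ph)"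
proof (induction w arbitrary: Ph)
 case (Cons x w)
 have "wick c (x # w) (%v. sc (PROD x<-v. t x) (Ph v)) =
   wick c w (%v. sc (PROD x<-v. t x) (sc (t x) (Ph (x # v) + contract (fst x) (c' x) v Ph)))" by (simp add: contract_weight[OF assms] algebra_simps)
 thus ?case by (simp only: Cons.IH wick_scale) (simp add: algebra_simps)
qed simp

lemma contract_eq_sum:
 "contract t ph w Ps = (SUM p<length w. sc ((PROD x<-take p w. sg t (fst x)) * ph (w ! p)) (Ps (del p w)))"
proof (induction w arbitrary: Ps)
 case (Cons x w)
 have "(SUM p<length (x # w). sc ((PROD x<-take p (x # w). sg t (fst x)) * ph ((x # w) ! p)) (Ps (del p (x # w)))) =
   sc (ph x) (Ps w) + (SUM p<length w. sc (sg t (fst x)) (sc ((PROD x<-take p w. sg t (fst x)) * ph (w ! p)) (Ps (x # del p w))))"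
  by (simp only: length_Cons sum.lessThan_Suc_shift) (simp add: del_def algebra_simps)
 thus ?case by (simp add: Cons.IH scale_sum_right)
qed simp

end

lemma linear_contract:
 assumes "Vector_Spaces.linear s1 s2 L" shows "L (complex_space.contract s1 t ph w Ps) = complex_space.contract s2 t ph w (%v. L (Ps v))"
proof -
 interpret Vector_Spaces.linear s1 s2 L by fact
 interpret c1: complex_space s1 by unfold_locales
 interpret c2: complex_space s2 by unfold_locales
 show ?thesis by (induction w arbitrary: Ps) (simp_all add: add scale zero)
qed

lemma linear_wick:
 assumes "Vector_Spaces.linear s1 s2 L" shows "L (complex_space.wick s1 c w Ph) = complex_space.wick s2 c w (%v. L (Ph v))"
proof -
 interpret Vector_Spaces.linear s1 s2 L by fact
 interpret c1: complex_space s1 by unfold_locales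
 interpret c2: complex_space s2 by unfold_locales
 show ?thesis by (induction w arbitrary: Ph) (simp_all add: add linear_contract[OF assms])
qed

section \<open>Summation over the indices of the letters\<close>

interpretation cx: complex_space "(*) :: complex => complex => complex" by unfold_locales (simp_all add: algebra_simps)

lemma has_sum_product_complex:
 fixes f g :: "_ => complex"
 assumes f: "(f has_sum a) A" and g: "(g has_sum b) B" shows "((%(x, y). f x * g y) has_sum a * b) (A \<times> B)"
proof (rule has_sum_SigmaI)
 show "((%y. case (x, y) of (x, y) => f x * g y) has_sum f x * b) B" if "x \<in> A" for x using has_sum_cmult_right[OF g, of "f x"] by simp
 show "((%x. f x * b) has_sum a * b) A" using has_sum_cmult_left[OF f, of b] by simp
 have f': "(%x. norm (f x)) summable_on A" and g': "(%y. norm (g y)) summable_on B" using has_sum_imp_summable[OF f] has_sum_imp_summable[OF g]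
  by (simp_all only: summable_on_iff_abs_summable_on_complex)
 have "(%(x, y). norm (f x) * norm (g y)) summable_on A \<times> B"
 proof (rule summable_on_SigmaI)
  show "((%y. case (x, y) of (x, y) => norm (f x) * norm (g y)) has_sum norm (f x) * (\<Sum>\<^sub>\<infinity>y\<in>B. norm (g y))) B" for x
   using has_sum_cmult_right[OF has_sum_infsum[OF g']] by simp
  show "(%x. norm (f x) * (\<Sum>\<^sub>\<infinity>y\<in>B. norm (g y))) summable_on A" using f' by (rule summable_on_cmult_left)
 qed auto
 thus "(%(x, y). f x * g y) summable_on A \<times> B" by (subst summable_on_iff_abs_summable_on_complex) (simp add: case_prod_unfold norm_mult)
qed

lemma has_sum_sum:
 fixes f :: "_ => _ => complex"
 assumes "!!i. i \<in> I ==> (f i has_sum S i) A" shows "((%a. SUM i:I. f i a) has_sum (SUM i:I. S i)) A"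
 using assms by (induction I rule: infinite_finite_induct) (simp_all add: has_sum_add)

text \<open>Only the parity of a letter is kept in first position when an index is attached.\<close>

definition ix :: "stat \<times> 'r => 'i => stat \<times> 'r \<times> 'i" where
 "ix x i = (fst x, snd x, i)"

definition indexed :: "(stat \<times> 'r) list => 'i list => (stat \<times> 'r \<times> 'i) list" where
 "indexed w is = map2 ix w is"

definition iprod :: "(stat \<times> 'r => 'i => complex) => (stat \<times> 'r) list => 'i list => complex" where
 "iprod f w is = (\<Prod>(x, i)\<leftarrow>zip w is. f x i)"

definition lists_of :: "nat => 'i list set" where
 "lists_of n = {is. length is = n}"

lemma fst_ix [simp]: "fst (ix x i) = fst x" by (simp add: ix_def)

lemma indexed_simps [simp]:
 "indexed [] is = []" "indexed (x # w) (i # is) = ix x i # indexed w is" "indexed w [] = []" by (simp_all add: indexed_def)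

lemma iprod_simps [simp]:
 "iprod f [] is = 1" "iprod f (x # w) (i # is) = f x i * iprod f w is" by (simp_all add: iprod_def)

lemma length_indexed [simp]: "length (indexed w is) = min (length w) (length is)" by (simp add: indexed_def)

lemma indexed_append:
 "length is = length u ==> indexed (u @ v) (is @ js) = indexed u is @ indexed v js" by (simp add: indexed_def)

lemma iprod_append:
 "length is = length u ==> iprod f (u @ v) (is @ js) = iprod f u is * iprod f v js" by (simp add: iprod_def)

lemma del_indexed: "length is = length w ==> del p (indexed w is) = indexed (del p w) (del p is)"
 by (simp add: del_def indexed_def take_map drop_map take_zip drop_zip)

lemma iprod_del:
 assumes "length is = length w" "p < length w" shows "iprod f w is = f (w ! p) (is ! p) * iprod f (del p w) (del p is)"
proof -
 have "zip w is = zip (take p w @ w ! p # drop (Suc p) w) (take p is @ is ! p # drop (Suc p) is)" using assms by (simp flip: id_take_nth_drop)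
 thus ?thesis using assms by (simp add: iprod_def del_def)
qed

lemma indexed_nth:
 "length is = length w ==> p < length w ==> indexed w is ! p = ix (w ! p) (is ! p)" by (simp add: indexed_def)

lemma length_del: "p < length xs ==> length (del p xs) = length xs - 1" by (simp add: del_def)

lemma set_del: "set (del p xs) \<subseteq> set xs" by (auto simp: del_def dest: in_set_takeD in_set_dropD)

lemma map_fst_indexed: "length is = length w ==> map (%x. h (fst x)) (indexed w is) = map (%x. h (fst x)) w"
 by (induction w "is" rule: list_induct2') simp_all

text \<open>Induction on the number of undecided letters. \<open>K\<close> collects the letters
  already known to stay unmatched: their indices cannot be summed yet, since \<open>Ph\<close>
  couples the indices of all survivors. The two indices of a matched pair occur in one contraction
  only and split off as a factor.\<close>

lemma wick_has_sum_aux: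
 fixes c :: "stat \<times> 'r \<times> 'i => stat \<times> 'r \<times> 'i => complex"
 assumes c: "!!x. homog (fst x) (c x)" and cb: "!!x. homog (fst x) (cb x)"
  and pair: "!!x y. x \<in> X ==> y \<in> X ==>
    ((%(i, j). f x i * f y j * c (ix x i) (ix y j)) has_sum cb x y) UNIV"
  and Ph: "!!w. set w \<subseteq> X ==>
    ((%is. iprod f w is * Ph (indexed w is)) has_sum Phb w) (lists_of (length w))"
  and "set (K @ w) \<subseteq> X" shows "((%(ks, is). iprod f K ks * iprod f w is *
    cx.wick c (indexed w is) (%v. Ph (indexed K ks @ v))) has_sum cx.wick cb w (%v. Phb (K @ v)))
    (lists_of (length K) \<times> lists_of (length w))" using assms(5)
proof (induction "length w" arbitrary: w K rule: less_induct)
 case less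
 show ?case
 proof (cases w)
  case Nil
  have "((%is. iprod f K is * Ph (indexed K is)) has_sum Phb K) (lists_of (length K))" using Ph less.prems by simp
  thus ?thesis unfolding Nil by (subst has_sum_reindex_bij_witness[where j = fst and i = "%ks. (ks, [])" and
      T = "lists_of (length K)" and h = "%is. iprod f K is * Ph (indexed K is)"])
    (auto simp: lists_of_def)
 next
  case (Cons x w')
  let ?D = "(lists_of (length K) :: 'i list set) \<times> (lists_of (length w) :: 'i list set)"
  let ?Ph = "%ks v. Ph (indexed K ks @ v)"
  \<comment> \<open>The letter \<open>x\<close> stays unmatched and moves, with its index, to the
    end of \<open>K\<close>.\<close>
  have 1: "((%(ks, is). iprod f K ks * iprod f w is *
    cx.wick c (indexed w' (tl is)) (%v. ?Ph ks (ix x (hd is) # v))) has_sum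
    cx.wick cb w' (%v. Phb (K @ x # v))) ?D"
  proof -
   have "((%(ks, is). iprod f (K @ [x]) ks * iprod f w' is *
     cx.wick c (indexed w' is) (%v. Ph (indexed (K @ [x]) ks @ v))) has_sum
     cx.wick cb w' (%v. Phb ((K @ [x]) @ v))) (lists_of (length (K @ [x])) \<times> lists_of (length w'))"
    by (rule less.hyps) (use less.prems Cons in auto)
   thus ?thesis
   proof (subst has_sum_reindex_bij_witness[where j = "%(ks, is). (ks @ [hd is], tl is)"
      and i = "%(ks, is). (butlast ks, last ks # is)"])
    fix a assume "a \<in> ?D"
    then obtain ks i "is" where a: "a = (ks, i # is)" "length ks = length K" "length is = length w'"
     by (cases a; cases "snd a") (auto simp: lists_of_def Cons)
    thus "(case case a of (ks, is) => (ks @ [hd is], tl is) of (ks, is) =>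
       iprod f (K @ [x]) ks * iprod f w' is *
       cx.wick c (indexed w' is) (%v. Ph (indexed (K @ [x]) ks @ v))) =
      (case a of (ks, is) => iprod f K ks * iprod f w is *
       cx.wick c (indexed w' (tl is)) (%v. ?Ph ks (ix x (hd is) # v)))" by (simp add: Cons indexed_append iprod_append)
   next
    fix b assume "b \<in> (lists_of (length (K @ [x])) :: 'i list set) \<times> (lists_of (length w') :: 'i list set)"
    then obtain ks k "is" where "b = (ks @ [k], is)" "length ks = length K" "length is = length w'"
     by (cases b; cases "fst b" rule: rev_cases) (auto simp: lists_of_def)
    thus "(case (case b of (ks, is) => (butlast ks, last ks # is)) of (ks, is) => (ks @ [hd is], tl is)) = b" by simp
   qed (auto simp: lists_of_def Cons intro!: list.collapse)
  qed
  \<comment> \<open>The letter \<open>x\<close> is matched with the letter at position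
    \<open>p\<close>: the index set is the product of the two indices of the pair with the indices
    of everything else.\<close>
  have 2: "((%(ks, is). iprod f K ks * iprod f w is *
    ((PROD x'<-take p w'. sg (fst x) (fst x')) * c (ix x (hd is)) (ix (w' ! p) (tl is ! p))) *
     cx.wick c (indexed (del p w') (del p (tl is))) (?Ph ks)) has_sum
    ((PROD x'<-take p w'. sg (fst x) (fst x')) * cb x (w' ! p)) * cx.wick cb (del p w') (%v. Phb (K @ v))) ?D"
   if p: "p < length w'" for p
  proof -
   let ?s = "PROD x'<-take p w'. sg (fst x) (fst x')"
   let ?f = "%(i, j). f x i * f (w' ! p) j * c (ix x i) (ix (w' ! p) j)"
   let ?g = "%(ks, is). iprod f K ks * iprod f (del p w') is *
     cx.wick c (indexed (del p w') is) (?Ph ks)"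
   have "((%(a, b). ?f a * ?g b) has_sum cb x (w' ! p) * cx.wick cb (del p w') (%v. Phb (K @ v)))
     (UNIV \<times> (lists_of (length K) \<times> lists_of (length (del p w'))))"
   proof (intro has_sum_product_complex)
    show "(?f has_sum cb x (w' ! p)) UNIV" by (rule pair) (use less.prems Cons p nth_mem[OF p] in auto)
    show "(?g has_sum cx.wick cb (del p w') (%v. Phb (K @ v)))
      (lists_of (length K) \<times> lists_of (length (del p w')))"
     by (rule less.hyps) (use less.prems Cons p set_del[of p w'] in "auto simp: length_del")
   qed
   from has_sum_cmult_right[OF this, of ?s]
   show ?thesis
   proof (subst has_sum_reindex_bij_witness[where j = "%(ks, is). ((hd is, tl is ! p), (ks, del p (tl is)))"
      and i = "%((i, j), (ks, is)). (ks, i # take p is @ j # drop p is)"])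
    fix a assume "a \<in> ?D"
    then obtain ks i "is" where a: "a = (ks, i # is)" "length ks = length K" "length is = length w'"
     by (cases a; cases "snd a") (auto simp: lists_of_def Cons)
    have "take p is @ is ! p # drop (Suc p) is = is" using p a by (simp flip: id_take_nth_drop)
    thus "(%((i, j), (ks, is)). (ks, i # take p is @ j # drop p is))
      (case a of (ks, is) => ((hd is, tl is ! p), (ks, del p (tl is)))) = a" using a p by (simp add: del_def)
    show "?s * (case case a of (ks, is) => ((hd is, tl is ! p), ks, del p (tl is)) of
      (a, b) => ?f a * ?g b) = (case a of (ks, is) => iprod f K ks * iprod f w is *
    (?s * c (ix x (hd is)) (ix (w' ! p) (tl is ! p))) *
     cx.wick c (indexed (del p w') (del p (tl is))) (?Ph ks))" using a p by (simp add: Cons iprod_del[of "is" w' p])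
   next
    fix b assume "b \<in> (UNIV :: ('i \<times> 'i) set) \<times> ((lists_of (length K) :: 'i list set) \<times> (lists_of (length (del p w')) :: 'i list set))"
    thus "(case (%((i, j), (ks, is)). (ks, i # take p is @ j # drop p is)) b of
      (ks, is) => ((hd is, tl is ! p), (ks, del p (tl is)))) = b" using p by (auto simp: lists_of_def length_del del_def nth_append min_def)
    show "(%((i, j), (ks, is)). (ks, i # take p is @ j # drop p is)) b \<in> ?D"
     using p \<open>b \<in> _\<close> by (auto simp: lists_of_def length_del Cons)
   qed (use p in "auto simp: lists_of_def Cons length_del")
  qed
  have 3: "((%(ks, is). iprod f K ks * iprod f w is *
    cx.contract (fst x) (c (ix x (hd is))) (indexed w' (tl is)) (%v. cx.wick c v (?Ph ks))) has_sum
    cx.contract (fst x) (cb x) w' (%v. cx.wick cb v (%v. Phb (K @ v)))) ?D"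
  proof -
   have "((%a. SUM p<length w'. case a of (ks, is) => iprod f K ks * iprod f w is *
    ((PROD x'<-take p w'. sg (fst x) (fst x')) * c (ix x (hd is)) (ix (w' ! p) (tl is ! p))) *
     cx.wick c (indexed (del p w') (del p (tl is))) (?Ph ks)) has_sum
    cx.contract (fst x) (cb x) w' (%v. cx.wick cb v (%v. Phb (K @ v)))) ?D" unfolding cx.contract_eq_sum by (intro has_sum_sum 2) auto
   thus ?thesis
   proof (rule has_sum_cong[THEN iffD1, rotated], goal_cases)
    case (1 a)
    then obtain ks i "is" where a: "a = (ks, i # is)" "length ks = length K" "length is = length w'"
     by (cases a; cases "snd a") (auto simp: lists_of_def Cons)
    have "(PROD x'<-take p (indexed w' is). sg (fst x) (fst x')) = (PROD x'<-take p w'. sg (fst x) (fst x'))" for p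
     using map_fst_indexed[OF a(3), of "sg (fst x)"] by (simp flip: take_map)
    thus ?case using a by (simp add: cx.contract_eq_sum sum_distrib_left indexed_nth del_indexed mult_ac)
   qed
  qed
  have "?thesis \<longleftrightarrow> ((%a. (case a of (ks, is) => iprod f K ks * iprod f w is *
    cx.wick c (indexed w' (tl is)) (%v. ?Ph ks (ix x (hd is) # v))) +
    (case a of (ks, is) => iprod f K ks * iprod f w is *
    cx.contract (fst x) (c (ix x (hd is))) (indexed w' (tl is)) (%v. cx.wick c v (?Ph ks)))) has_sum
    cx.wick cb w (%v. Phb (K @ v))) ?D"
  proof (rule has_sum_cong, goal_cases)
   case (1 a)
   then obtain ks i "is" where a: "a = (ks, i # is)" "length ks = length K" "length is = length w'"
    by (cases a; cases "snd a") (auto simp: lists_of_def Cons)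
   thus ?case using cx.wick_Cons[OF c, of "ix x i" "indexed w' is"] by (simp add: Cons distrib_left del: cx.wick.simps(2))
  qed
  with has_sum_add[OF 1 3] show ?thesis by (simp add: Cons cx.wick_Cons[OF cb] del: cx.wick.simps(2))
 qed
qed

text \<open>Mode sums may be carried out inside a Wick expansion, pair by pair, once each pair
  series and each series of survivors converges.\<close>

lemma wick_has_sum:
 fixes c :: "stat \<times> 'r \<times> 'i => stat \<times> 'r \<times> 'i => complex"
 assumes "!!x. homog (fst x) (c x)" and "!!x. homog (fst x) (cb x)"
  and "!!x y. x \<in> set w ==> y \<in> set w ==>
    ((%(i, j). f x i * f y j * c (ix x i) (ix y j)) has_sum cb x y) UNIV"
  and "!!v. set v \<subseteq> set w ==>
    ((%is. iprod f v is * Ph (indexed v is)) has_sum Phb v) (lists_of (length v))"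
 shows "((%is. iprod f w is * cx.wick c (indexed w is) Ph) has_sum cx.wick cb w Phb) (lists_of (length w))"
proof -
 have "((%(ks, is). iprod f [] ks * iprod f w is *
    cx.wick c (indexed w is) (%v. Ph (indexed [] ks @ v))) has_sum cx.wick cb w (%v. Phb ([] @ v)))
    (lists_of (length ([] :: (stat \<times> 'r) list)) \<times> lists_of (length w))"
  by (rule wick_has_sum_aux[where X = "set w"]) (use assms in auto)
 thus ?thesis by (subst has_sum_reindex_bij_witness[where j = "%is. ([], is)" and i = snd]) (auto simp: lists_of_def)
qed

section \<open>The contraction functions\<close>

abbreviation hb :: "nat => complex" where
 "hb i == - (1 / 2) gchoose i"

text \<open>The \<open>i\<close>-th divided derivative of \<open>x^(-1/2)\<close> at
  \<open>x = t^2\<close>, expressed by the root \<open>t\<close>.\<close>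

definition hbeta :: "nat => complex => complex" where
 "hbeta i t = hb i * inverse t ^ (2 * i + 1)"

lemma gchoose_Suc: "of_nat (Suc k) * (a gchoose Suc k) = (a - of_nat k) * (a gchoose k)" for a :: complex
 using gbinomial_mult_1[of a k] by (simp add: algebra_simps)

lemma hb_Suc: "of_nat (Suc i) * hb (Suc i) = - (of_nat i + 1 / 2) * hb i"
proof -
 have "- (1 / 2) - of_nat i = - (of_nat i + 1 / 2 :: complex)" by simp
 thus ?thesis using gchoose_Suc[of i "- (1/2)"] by metis
qed

text \<open>
 The divided derivatives \<open>\<partial>\<^sub>x\<^sup>(\<^sup>i\<^sup>)\<partial>\<^sub>y\<^sup>(\<^sup>j\<^sup>)\<close> of a homogeneous function \<open>S\<close> of degree \<open>- w\<close> are determined by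
 the function itself and by the divided derivatives \<open>T\<close> of \<open>(\<partial>\<^sub>x + \<partial>\<^sub>y)S\<close>, since Euler's identity
 provides a second linear equation for the two derivatives of the next order.
\<close>

definition euler_solution ::
 "complex => (nat => nat => complex) => complex => complex => (nat => nat => complex) => bool" where
 "euler_solution w T x y S \<longleftrightarrow>
   (\<forall>i j. (x - y) * (of_nat (Suc i) * S (Suc i) j) = - (of_nat (i + j) + w) * S i j - y * T i j &
      (y - x) * (of_nat (Suc j) * S i (Suc j)) = - (of_nat (i + j) + w) * S i j - x * T i j)"

lemma euler_solutionI:
 assumes "!!i j. of_nat (Suc i) * S (Suc i) j + of_nat (Suc j) * S i (Suc j) = T i j"
  and "!!i j. x * (of_nat (Suc i) * S (Suc i) j) + y * (of_nat (Suc j) * S i (Suc j)) = - (of_nat (i + j) + w) * S i j"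
 shows "euler_solution w T x y S" unfolding euler_solution_def
proof (intro allI conjI)
 fix i j
 show "(x - y) * (of_nat (Suc i) * S (Suc i) j) = - (of_nat (i + j) + w) * S i j - y * T i j"
  unfolding assms(1)[symmetric] assms(2)[symmetric] by (simp only: algebra_simps)
 show "(y - x) * (of_nat (Suc j) * S i (Suc j)) = - (of_nat (i + j) + w) * S i j - x * T i j"
  unfolding assms(1)[symmetric] assms(2)[symmetric] by (simp only: algebra_simps)
qed

text \<open>Off the diagonal the two equations can be solved for the next order in \<open>j\<close>
  and in \<open>i\<close>.\<close>

lemma euler_solution_unique:
 assumes "euler_solution w T x y S" "euler_solution w T x y S'" "x ~= y" "S 0 0 = S' 0 0" shows "S i j = S' i j"
proof -
 have 0: "S 0 j = S' 0 j" for j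
 proof (induction j)
  case (Suc j)
  have "(y - x) * (of_nat (Suc j) * S 0 (Suc j)) = (y - x) * (of_nat (Suc j) * S' 0 (Suc j))"
   using assms(1,2) Suc unfolding euler_solution_def by metis
  thus ?case using assms(3) by (simp del: of_nat_Suc)
 qed (use assms in simp)
 show ?thesis
 proof (induction i)
  case (Suc i)
  have "(x - y) * (of_nat (Suc i) * S (Suc i) j) = (x - y) * (of_nat (Suc i) * S' (Suc i) j)"
   using assms(1,2) Suc unfolding euler_solution_def by metis
  thus ?case using assms(3) by (simp del: of_nat_Suc)
 qed (rule 0)
qed

text \<open>The divided derivatives of \<open>d/dx + d/dy\<close> applied to the fermionic
  contraction on W. They do not vanish because this contraction, unlike \<open>1 / (x - y)\<close>,
  is not translation invariant.\<close>

definition defect :: "complex => complex => nat => nat => complex" where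
 "defect t u i j = 1/2 * (hbeta i t * (of_nat (Suc j) * hbeta (Suc j) u) - of_nat (Suc i) * hbeta (Suc i) t * hbeta j u)"

text \<open>
 The contraction of two fermionic fields at \<open>x = t\<^sup>2\<close> and \<open>y = u\<^sup>2\<close> is \<open>(x + y) / (2(x - y)tu)\<close>; here
 are its divided derivatives.
\<close>

primrec fermion_fn0 :: "nat => complex => complex => complex" where
 "fermion_fn0 0 t u = (t^2 + u^2) / (2 * (t^2 - u^2) * t * u)"
| "fermion_fn0 (Suc j) t u =
   (- (of_nat j + 1) * fermion_fn0 j t u - t^2 * defect t u 0 j) / ((u^2 - t^2) * of_nat (Suc j))"

primrec fermion_fn :: "nat => nat => complex => complex => complex" where
 "fermion_fn 0 j t u = fermion_fn0 j t u"
| "fermion_fn (Suc i) j t u =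
   (- (of_nat (i + j) + 1) * fermion_fn i j t u - u^2 * defect t u i j) / ((t^2 - u^2) * of_nat (Suc i))"

text \<open>The recursions of \<open>fermion_fn\<close> are the equations of
  \<open>euler_solution\<close> solved for the next order. Product series and iterate series are
  both identified with the contraction through this criterion.\<close>

lemma fermion_fn_eq:
 assumes S: "euler_solution 1 (defect t u) (t^2) (u^2) S" and "t^2 ~= u^2"
  and S0: "S 0 0 = (t^2 + u^2) / (2 * (t^2 - u^2) * t * u)" shows "S i j = fermion_fn i j t u"
proof -
 have 0: "S 0 j = fermion_fn0 j t u" for j
 proof (induction j)
  case (Suc j)
  have "(u^2 - t^2) * (of_nat (Suc j) * S 0 (Suc j)) = - (of_nat (0 + j) + 1) * S 0 j - t^2 * defect t u 0 j"
   using S unfolding euler_solution_def by blast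
  thus ?case using Suc assms(2) by (simp add: eq_divide_eq mult_ac del: of_nat_Suc)
 qed (simp add: S0)
 show ?thesis
 proof (induction i)
  case (Suc i)
  have "(t^2 - u^2) * (of_nat (Suc i) * S (Suc i) j) = - (of_nat (i + j) + 1) * S i j - u^2 * defect t u i j"
   using S unfolding euler_solution_def by blast
  thus ?case using Suc assms(2) by (simp add: eq_divide_eq mult_ac del: of_nat_Suc)
 qed (simp add: 0)
qed

text \<open>The divided derivatives, of order \<open>i\<close> in \<open>x\<close> and
  \<open>j\<close> in \<open>y\<close>, of \<open>1 / (x - y)^2\<close>.\<close>

definition boson_fn :: "nat => nat => complex => complex => complex" where
 "boson_fn i j x y = of_nat (Suc j) * ((- of_nat j - 2) gchoose i) * inverse (x - y) ^ (i + j + 2)"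

lemma boson_fn_solution:
 assumes "x ~= y" shows "euler_solution 2 (%i j. 0) x y (%i j. boson_fn i j x y)"
proof (rule euler_solutionI)
 fix i j
 let ?g = "(- of_nat j - 2 :: complex) gchoose i" and ?d = "inverse (x - y)"
 have 1: "of_nat (Suc i) * ((- of_nat j - 2 :: complex) gchoose Suc i) = (- of_nat j - 2 - of_nat i) * ?g" by (rule gchoose_Suc)
 have 2: "(- of_nat j - 2) * ((- of_nat j - 2 - 1 :: complex) gchoose i) = (- of_nat j - 2 - of_nat i) * ?g"
  by (rule gbinomial_absorb_comp[symmetric])
 have 3: "of_nat (Suc i) * boson_fn (Suc i) j x y = of_nat (Suc j) * ((- of_nat j - 2 - of_nat i) * ?g) * ?d ^ (i + j + 3)"
  unfolding boson_fn_def 1[symmetric] by (simp add: mult_ac eval_nat_numeral del: of_nat_Suc)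
 have "of_nat (Suc j) * boson_fn i (Suc j) x y =
   - of_nat (Suc j) * ((- of_nat j - 2) * ((- of_nat j - 2 - 1) gchoose i)) * ?d ^ (i + j + 3)"
  by (simp add: boson_fn_def algebra_simps eval_nat_numeral)
 hence 4: "of_nat (Suc j) * boson_fn i (Suc j) x y =
   - of_nat (Suc j) * ((- of_nat j - 2 - of_nat i) * ?g) * ?d ^ (i + j + 3)" unfolding 2 .
 show "of_nat (Suc i) * boson_fn (Suc i) j x y + of_nat (Suc j) * boson_fn i (Suc j) x y = 0"
  unfolding 3 4 by (simp only: mult_minus_left add.right_inverse)
 have d: "(x - y) * ?d = 1" using assms by simp
 have "x * (of_nat (Suc i) * boson_fn (Suc i) j x y) + y * (of_nat (Suc j) * boson_fn i (Suc j) x y) =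
   of_nat (Suc j) * ((- of_nat j - 2 - of_nat i) * ?g) * ((x - y) * ?d) * ?d ^ (i + j + 2)"
  unfolding 3 4 power_add[of _ "i + j"] eval_nat_numeral power_Suc power_0 by algebra
 also have "... = - (of_nat (i + j) + 2) * boson_fn i j x y" unfolding d by (simp add: boson_fn_def algebra_simps)
 finally show "x * (of_nat (Suc i) * boson_fn (Suc i) j x y) + y * (of_nat (Suc j) * boson_fn i (Suc j) x y) =
   - (of_nat (i + j) + 2) * boson_fn i j x y" .
qed

subsection \<open>The series of a product of two fields\<close>

lemma norm_quotient: "norm (u / t) < 1" if "norm u < norm t" for u t :: complex
proof -
 have "norm t > 0" using that norm_ge_zero[of u] by linarith
 thus ?thesis using that by (simp add: norm_divide)
qed

lemma norm_quotient_square: "norm ((u / t)^2) < 1" if "norm u < norm t" for u t :: complex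
 using norm_quotient[OF that] by (simp add: norm_power power_less_one_iff abs_square_less_1)

text \<open>Coefficients of power series with radius of convergence at least 1. The class is closed
  under multiplication by polynomials in \<open>n\<close>, and the derivatives of the fields
  multiply the geometric mode series by binomials of this kind.\<close>

definition slow :: "(nat => complex) => bool" where
 "slow f \<longleftrightarrow> (\<forall>z. norm z < 1 --> summable (%n. norm (f n * z ^ n)))"

lemma slow_1: "slow (%n. 1)" by (simp add: slow_def norm_power summable_geometric)

text \<open>A radius \<open>r\<close> between \<open>norm z\<close> and 1 leaves room: the factor
  \<open>n\<close> is absorbed by \<open>(z / r)^n\<close>.\<close>

lemma slow_mult_linear:
 assumes "slow f" shows "slow (%n. (a * of_nat n + b) * f n)" unfolding slow_def
proof (intro allI impI)
 fix z :: complex assume z: "norm z < 1"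
 obtain r where r: "norm z < r" "r < 1" using dense[OF z] by blast
 hence r0: "r > 0" using norm_ge_zero[of z] by linarith
 have s: "summable (%n. norm (f n * of_real r ^ n))" and s': "summable (%n. norm (f n * z ^ n))"
  using assms r r0 z unfolding slow_def by (metis abs_of_pos norm_of_real)+
 have "norm (z / of_real r) < 1" using r r0 by (simp add: norm_divide)
 from powser_times_n_limit_0[OF this] have "Bseq (%n. of_nat n * (z / of_real r) ^ n)" by (rule convergent_imp_Bseq[OF convergentI])
 then obtain K where K: "!!n. norm (of_nat n * (z / of_real r) ^ n) <= K" by (auto simp: Bseq_def)
 have le: "norm (of_nat n * f n * z ^ n) <= K * norm (f n * of_real r ^ n)" for n
 proof -
  have "of_nat n * f n * z ^ n = (of_nat n * (z / of_real r) ^ n) * (f n * of_real r ^ n)" using r0 by (simp add: power_divide)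
  hence "norm (of_nat n * f n * z ^ n) = norm (of_nat n * (z / of_real r) ^ n) * norm (f n * of_real r ^ n)" by (simp only: norm_mult)
  thus ?thesis using mult_right_mono[OF K[of n], of "norm (f n * of_real r ^ n)"] by simp
 qed
 have "summable (%n. norm (of_nat n * f n * z ^ n))" by (rule summable_comparison_test[OF _ summable_mult[OF s, of K]]) (use le in auto)
 hence "summable (%n. norm a * norm (of_nat n * f n * z ^ n) + norm b * norm (f n * z ^ n))" by (intro summable_add summable_mult s')
 thus "summable (%n. norm ((a * of_nat n + b) * f n * z ^ n))"
 proof (rule summable_comparison_test[rotated], intro exI[of _ 0] allI impI)
  fix n
  have "(a * of_nat n + b) * f n * z ^ n = a * (of_nat n * f n * z ^ n) + b * (f n * z ^ n)" by (simp add: algebra_simps)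
  thus "norm (norm ((a * of_nat n + b) * f n * z ^ n)) <=
    norm a * norm (of_nat n * f n * z ^ n) + norm b * norm (f n * z ^ n)" by (metis norm_mult abs_norm_cancel real_norm_def norm_triangle_ineq)
 qed
qed

lemma slow_gchoose:
 assumes "slow f" shows "slow (%n. ((a * of_nat n + b) gchoose i) * f n)"
proof (induction i)
 case (Suc i)
 have "((a * of_nat n + b) gchoose Suc i) * f n =
   (a / of_nat (Suc i) * of_nat n + (b - of_nat i) / of_nat (Suc i)) * (((a * of_nat n + b) gchoose i) * f n)" for n
 proof -
  have "of_nat (Suc i) * ((a * of_nat n + b) gchoose Suc i) = (a * of_nat n + b - of_nat i) * ((a * of_nat n + b) gchoose i)" by (rule gchoose_Suc)
  hence "((a * of_nat n + b) gchoose Suc i) = (a * of_nat n + b - of_nat i) * ((a * of_nat n + b) gchoose i) / of_nat (Suc i)"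
   by (simp add: eq_divide_eq mult.commute del: of_nat_Suc)
  moreover have "a / of_nat (Suc i) * of_nat n + (b - of_nat i) / of_nat (Suc i) = (a * of_nat n + b - of_nat i) / of_nat (Suc i)"
   by (simp add: add_divide_distrib[symmetric] del: of_nat_Suc)
  ultimately show ?thesis by (simp only: times_divide_eq_left mult.assoc)
 qed
 thus ?case using slow_mult_linear[OF Suc] by presburger
qed (simp add: assms)

text \<open>The contribution of the mode \<open>n\<close> at \<open>x = t^2\<close> and the mode
  \<open>-n\<close> at \<open>y = u^2\<close>: the fields contain \<open>x^(-n - 1/2)\<close> and
  \<open>y^(n - 1/2)\<close>, taken here with their divided derivatives.\<close>

definition fterm :: "complex => complex => nat => nat => nat => complex" where
 "fterm t u i j n = ((- of_nat n - 1/2) gchoose i) * ((of_nat n - 1/2) gchoose j) *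
   (inverse t ^ (2 * n + 2 * i + 1) * (u ^ (2 * n) * inverse u ^ (2 * j + 1)))"

lemma fterm_summable:
 assumes "norm u < norm t" shows "summable (%n. norm (fterm t u i j n))"
proof -
 have "slow (%n. ((- 1 * of_nat n + - 1/2) gchoose i) * (((1 * of_nat n + - 1/2) gchoose j) * 1))" by (intro slow_gchoose slow_1)
 moreover have "norm ((u / t)^2) < 1" using assms by (rule norm_quotient_square)
 ultimately have "summable (%n. norm (((- of_nat n - 1/2) gchoose i) * ((of_nat n - 1/2) gchoose j) * ((u / t)^2) ^ n))" by (simp add: slow_def)
 from summable_mult[OF this, of "norm (inverse t ^ (2 * i + 1) * inverse u ^ (2 * j + 1))"]
 have "summable (%n. norm ((inverse t ^ (2 * i + 1) * inverse u ^ (2 * j + 1)) *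
   (((- of_nat n - 1/2) gchoose i) * ((of_nat n - 1/2) gchoose j) * ((u / t)^2) ^ n)))" by (simp only: norm_mult)
 moreover have "fterm t u i j n = (inverse t ^ (2 * i + 1) * inverse u ^ (2 * j + 1)) *
   (((- of_nat n - 1/2) gchoose i) * ((of_nat n - 1/2) gchoose j) * ((u / t)^2) ^ n)" for n
 proof -
  have 1: "((u / t)^2) ^ n = u ^ (2 * n) * inverse t ^ (2 * n)" by (simp only: power_mult[symmetric] divide_inverse power_mult_distrib)
  have 2: "inverse t ^ (2 * n + 2 * i + 1) = inverse t ^ (2 * n) * inverse t ^ (2 * i + 1)" by (simp only: power_add[symmetric] add.assoc)
  show ?thesis unfolding fterm_def 1 2 by (simp only: mult_ac)
 qed
 ultimately show ?thesis by simp
qed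

text \<open>By the first identity the \<open>x\<close>-derivative of a term cancels the
  \<open>y\<close>-derivative of the next one, so \<open>d/dx + d/dy\<close> of the series
  telescopes. The second is Euler's identity, valid termwise as each term comes from a homogeneous
  function of degree -1.\<close>

lemma fterm_step:
 assumes "u ~= 0" "t ~= 0" shows "of_nat (Suc i) * fterm t u (Suc i) j n = - (of_nat (Suc j) * fterm t u i (Suc j) (Suc n))"
  and "t^2 * (of_nat (Suc i) * fterm t u (Suc i) j n) + u^2 * (of_nat (Suc j) * fterm t u i (Suc j) n) =
    - (of_nat (i + j) + 1) * fterm t u i j n"
proof -
 let ?A = "%n i. (- of_nat n - 1/2 :: complex) gchoose i" and ?B = "%n j. (of_nat n - 1/2 :: complex) gchoose j"
 have 1: "of_nat (Suc i) * ?A n (Suc i) = (- of_nat n - 1/2) * ?A (Suc n) i"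
  using gbinomial_absorption[of i "- of_nat n - 1/2 :: complex"] by (simp add: algebra_simps)
 have 2: "of_nat (Suc j) * ?B (Suc n) (Suc j) = (of_nat n + 1/2) * ?B n j"
  using gbinomial_absorption[of j "of_nat (Suc n) - 1/2 :: complex"] by (simp add: algebra_simps)
 have 3: "of_nat (Suc i) * ?A n (Suc i) = (- of_nat n - 1/2 - of_nat i) * ?A n i" by (rule gchoose_Suc)
 have 4: "of_nat (Suc j) * ?B n (Suc j) = (of_nat n - 1/2 - of_nat j) * ?B n j" by (rule gchoose_Suc)
 have "of_nat (Suc i) * fterm t u (Suc i) j n = (of_nat (Suc i) * ?A n (Suc i)) * ?B n j *
   (inverse t ^ (2 * n + 2 * Suc i + 1) * (u ^ (2 * n) * inverse u ^ (2 * j + 1)))" by (simp only: fterm_def mult_ac)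
 also have "... = - (?A (Suc n) i * ((of_nat n + 1/2) * ?B n j) *
   (inverse t ^ (2 * n + 2 * Suc i + 1) * (u ^ (2 * n) * inverse u ^ (2 * j + 1))))" unfolding 1 by (simp add: algebra_simps)
 also have "inverse t ^ (2 * n + 2 * Suc i + 1) * (u ^ (2 * n) * inverse u ^ (2 * j + 1)) =
   inverse t ^ (2 * Suc n + 2 * i + 1) * (u ^ (2 * Suc n) * inverse u ^ (2 * Suc j + 1))" using assms by (simp add: field_simps)
 finally show "of_nat (Suc i) * fterm t u (Suc i) j n = - (of_nat (Suc j) * fterm t u i (Suc j) (Suc n))"
  unfolding 2[symmetric] by (simp only: fterm_def mult_ac)
 have 5: "t^2 * (of_nat (Suc i) * fterm t u (Suc i) j n) = (- of_nat n - 1/2 - of_nat i) * fterm t u i j n"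
 proof -
  have "t^2 * (of_nat (Suc i) * fterm t u (Suc i) j n) = (of_nat (Suc i) * ?A n (Suc i)) * ?B n j *
   ((t^2 * inverse t ^ (2 * n + 2 * Suc i + 1)) * (u ^ (2 * n) * inverse u ^ (2 * j + 1)))" by (simp only: fterm_def mult_ac)
  also have "t^2 * inverse t ^ (2 * n + 2 * Suc i + 1) = inverse t ^ (2 * n + 2 * i + 1)" using assms by (simp add: field_simps power2_eq_square)
  finally show ?thesis unfolding 3 by (simp only: fterm_def mult_ac)
 qed
 have 6: "u^2 * (of_nat (Suc j) * fterm t u i (Suc j) n) = (of_nat n - 1/2 - of_nat j) * fterm t u i j n"
 proof -
  have "u^2 * (of_nat (Suc j) * fterm t u i (Suc j) n) = ?A n i * (of_nat (Suc j) * ?B n (Suc j)) *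
   (inverse t ^ (2 * n + 2 * i + 1) * (u ^ (2 * n) * (u^2 * inverse u ^ (2 * Suc j + 1))))" by (simp only: fterm_def mult_ac)
  also have "u^2 * inverse u ^ (2 * Suc j + 1) = inverse u ^ (2 * j + 1)" using assms by (simp add: field_simps power2_eq_square)
  finally show ?thesis unfolding 4 by (simp only: fterm_def mult_ac)
 qed
 show "t^2 * (of_nat (Suc i) * fterm t u (Suc i) j n) + u^2 * (of_nat (Suc j) * fterm t u i (Suc j) n) =
    - (of_nat (i + j) + 1) * fterm t u i j n" unfolding 5 6 by (simp add: algebra_simps)
qed

lemma fterm_0: "fterm t u i j 0 = hbeta i t * hbeta j u" by (simp add: fterm_def hbeta_def)

text \<open>Half of the zero mode term is due to the normal ordering of the zero modes.\<close>

lemma fterm_sums: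
 assumes ut: "norm u < norm t" and u: "u ~= 0" shows "(%n. fterm t u i j n) sums (fermion_fn i j t u + hbeta i t * hbeta j u / 2)"
proof -
 have t: "t ~= 0" using ut by auto
 have ne: "t^2 ~= u^2" using ut by (metis norm_power power2_eq_iff_nonneg norm_ge_zero order_less_irrefl)
 note step = fterm_step[OF u t]
 have sums: "fterm t u i j sums suminf (fterm t u i j)" for i j using summable_norm_cancel[OF fterm_summable[OF ut]] by (rule summable_sums)
 define S where "S i j = suminf (fterm t u i j) - fterm t u i j 0 / 2" for i j
 have "euler_solution 1 (defect t u) (t^2) (u^2) S"
 proof (rule euler_solutionI)
  fix i j
  let ?f = "%n. of_nat (Suc j) * fterm t u i (Suc j) n"
  have f: "?f \<longlonglongrightarrow> 0" using summable_LIMSEQ_zero[OF summable_norm_cancel[OF fterm_summable[OF ut]], of i "Suc j"]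
   by (rule tendsto_mult_right_zero)
  \<comment> \<open>Telescoping leaves the \<open>y\<close>-derivative of the zeroth term;
    subtracting half of both derivatives of that term turns it into the antisymmetric expression
    \<open>defect\<close>.\<close>
  have "(%n. of_nat (Suc i) * fterm t u (Suc i) j n + ?f n) sums ?f 0" using telescope_sums'[OF f] unfolding step(1) by simp
  moreover have "(%n. of_nat (Suc i) * fterm t u (Suc i) j n + ?f n) sums
    (of_nat (Suc i) * suminf (fterm t u (Suc i) j) + of_nat (Suc j) * suminf (fterm t u i (Suc j)))" by (intro sums_add sums_mult sums)
  ultimately have "of_nat (Suc i) * suminf (fterm t u (Suc i) j) + of_nat (Suc j) * suminf (fterm t u i (Suc j)) = ?f 0"
   by (rule sums_unique2[rotated])
  thus "of_nat (Suc i) * S (Suc i) j + of_nat (Suc j) * S i (Suc j) = defect t u i j"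
   by (simp add: S_def defect_def fterm_0 algebra_simps del: of_nat_Suc)
 next
  fix i j
  have "(%n. t^2 * (of_nat (Suc i) * fterm t u (Suc i) j n) + u^2 * (of_nat (Suc j) * fterm t u i (Suc j) n)) sums
   (t^2 * (of_nat (Suc i) * suminf (fterm t u (Suc i) j)) + u^2 * (of_nat (Suc j) * suminf (fterm t u i (Suc j))))" by (intro sums_add sums_mult sums)
  moreover have "(%n. t^2 * (of_nat (Suc i) * fterm t u (Suc i) j n) + u^2 * (of_nat (Suc j) * fterm t u i (Suc j) n)) sums
   (- (of_nat (i + j) + 1) * suminf (fterm t u i j))" unfolding step(2) by (intro sums_mult sums)
  ultimately have e: "t^2 * (of_nat (Suc i) * suminf (fterm t u (Suc i) j)) + u^2 * (of_nat (Suc j) * suminf (fterm t u i (Suc j))) =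
    - (of_nat (i + j) + 1) * suminf (fterm t u i j)" by (rule sums_unique2)
  have "t^2 * (of_nat (Suc i) * S (Suc i) j) + u^2 * (of_nat (Suc j) * S i (Suc j)) =
    (t^2 * (of_nat (Suc i) * suminf (fterm t u (Suc i) j)) + u^2 * (of_nat (Suc j) * suminf (fterm t u i (Suc j))))
    - (t^2 * (of_nat (Suc i) * fterm t u (Suc i) j 0) + u^2 * (of_nat (Suc j) * fterm t u i (Suc j) 0)) / 2"
   by (simp add: S_def algebra_simps add_divide_distrib del: of_nat_Suc)
  also have "... = - (of_nat (i + j) + 1) * S i j" unfolding e step(2) by (simp add: S_def algebra_simps diff_divide_distrib add_divide_distrib)
  finally show "t^2 * (of_nat (Suc i) * S (Suc i) j) + u^2 * (of_nat (Suc j) * S i (Suc j)) =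
    - (of_nat (i + j) + 1) * S i j" .
 qed
 \<comment> \<open>A geometric series in \<open>(u / t)^2\<close>; removing half of its first term
   makes the value antisymmetric in \<open>t\<close> and \<open>u\<close>.\<close>
 moreover have "S 0 0 = (t^2 + u^2) / (2 * (t^2 - u^2) * t * u)"
 proof -
  have "norm ((u / t)^2) < 1" using ut by (rule norm_quotient_square)
  hence "(%n. inverse (t * u) * ((u / t)^2) ^ n) sums (inverse (t * u) * (1 / (1 - (u / t)^2)))" by (intro sums_mult geometric_sums)
  moreover have "inverse (t * u) * ((u / t)^2) ^ n = fterm t u 0 0 n" for n
  proof -
   have "((u / t)^2) ^ n = u ^ (2 * n) * inverse t ^ (2 * n)" by (simp only: power_mult[symmetric] divide_inverse power_mult_distrib)
   thus ?thesis by (simp add: fterm_def)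
  qed
  ultimately have "suminf (fterm t u 0 0) = inverse (t * u) * (1 / (1 - (u / t)^2))" unfolding sums_iff by (simp only:)
  also have "... = t / (u * (t^2 - u^2))" using t u ne by (simp add: field_simps power2_eq_square)
  finally have e: "suminf (fterm t u 0 0) = t / (u * (t^2 - u^2))" .
  show ?thesis unfolding S_def e fterm_0 hbeta_def using t u ne by (simp add: field_simps) (simp add: field_simps power2_eq_square eval_nat_numeral)
 qed
 ultimately have "S i j = fermion_fn i j t u" by (intro fermion_fn_eq ne)
 hence "suminf (fterm t u i j) = fermion_fn i j t u + hbeta i t * hbeta j u / 2" by (simp add: S_def fterm_0 algebra_simps)
 thus ?thesis using sums[of i j] by simp
qed

text \<open>The contribution of the modes \<open>n + 1\<close> and \<open>-(n + 1)\<close>, whose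
  commutator supplies the factor \<open>n + 1\<close>; there is no zero mode term.\<close>

definition bterm :: "complex => complex => nat => nat => nat => complex" where
 "bterm x y i j n = of_nat (Suc n) * ((- of_nat n - 2) gchoose i) * (of_nat n gchoose j) *
   (inverse x ^ (n + i + 2) * (y ^ n * inverse y ^ j))"

lemma bterm_summable:
 assumes "norm y < norm x" shows "summable (%n. norm (bterm x y i j n))"
proof -
 have "slow (%n. (1 * of_nat n + 1) * (((- 1 * of_nat n + - 2) gchoose i) * (((1 * of_nat n + 0) gchoose j) * 1)))"
  by (intro slow_mult_linear slow_gchoose slow_1)
 moreover have "norm (y / x) < 1" using assms by (rule norm_quotient)
 ultimately have "summable (%n. norm (of_nat (Suc n) * ((- of_nat n - 2) gchoose i) * (of_nat n gchoose j) * (y / x) ^ n))"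
  unfolding slow_def by (simp add: mult.assoc add.commute)
 from summable_mult[OF this, of "norm (inverse x ^ (i + 2) * inverse y ^ j)"]
 have "summable (%n. norm ((inverse x ^ (i + 2) * inverse y ^ j) *
   (of_nat (Suc n) * ((- of_nat n - 2) gchoose i) * (of_nat n gchoose j) * (y / x) ^ n)))" by (simp only: norm_mult)
 moreover have "bterm x y i j n = (inverse x ^ (i + 2) * inverse y ^ j) *
   (of_nat (Suc n) * ((- of_nat n - 2) gchoose i) * (of_nat n gchoose j) * (y / x) ^ n)" for n
 proof -
  have 1: "(y / x) ^ n = y ^ n * inverse x ^ n" by (simp only: divide_inverse power_mult_distrib)
  have 2: "inverse x ^ (n + i + 2) = inverse x ^ n * inverse x ^ (i + 2)" by (simp only: power_add[symmetric] add.assoc)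
  show ?thesis unfolding bterm_def 1 2 by (simp only: mult_ac)
 qed
 ultimately show ?thesis by simp
qed

lemma bterm_step:
 assumes "y ~= 0" "x ~= 0" shows "of_nat (Suc i) * bterm x y (Suc i) j n = - (of_nat (Suc j) * bterm x y i (Suc j) (Suc n))"
  and "x * (of_nat (Suc i) * bterm x y (Suc i) j n) + y * (of_nat (Suc j) * bterm x y i (Suc j) n) =
    - (of_nat (i + j) + 2) * bterm x y i j n"
proof -
 let ?A = "%n i. (- of_nat n - 2 :: complex) gchoose i" and ?B = "%n j. (of_nat n :: complex) gchoose j"
 have 1: "of_nat (Suc i) * ?A n (Suc i) = (- of_nat n - 2) * ?A (Suc n) i"
  using gbinomial_absorption[of i "- of_nat n - 2 :: complex"] by (simp add: algebra_simps)
 have 2: "of_nat (Suc j) * ?B (Suc n) (Suc j) = of_nat (Suc n) * ?B n j"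
  using gbinomial_absorption[of j "of_nat (Suc n) :: complex"] by (simp add: algebra_simps)
 have 3: "of_nat (Suc i) * ?A n (Suc i) = (- of_nat n - 2 - of_nat i) * ?A n i" by (rule gchoose_Suc)
 have 4: "of_nat (Suc j) * ?B n (Suc j) = (of_nat n - of_nat j) * ?B n j" by (rule gchoose_Suc)
 have "of_nat (Suc i) * bterm x y (Suc i) j n = of_nat (Suc n) * (of_nat (Suc i) * ?A n (Suc i)) * ?B n j *
   (inverse x ^ (n + Suc i + 2) * (y ^ n * inverse y ^ j))" by (simp only: bterm_def mult_ac)
 also have "... = - (of_nat (Suc (Suc n)) * ?A (Suc n) i * (of_nat (Suc n) * ?B n j) *
   (inverse x ^ (n + Suc i + 2) * (y ^ n * inverse y ^ j)))" unfolding 1 by (simp add: algebra_simps)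
 also have "inverse x ^ (n + Suc i + 2) * (y ^ n * inverse y ^ j) =
   inverse x ^ (Suc n + i + 2) * (y ^ Suc n * inverse y ^ Suc j)" using assms by (simp add: field_simps)
 finally show "of_nat (Suc i) * bterm x y (Suc i) j n = - (of_nat (Suc j) * bterm x y i (Suc j) (Suc n))"
  unfolding 2[symmetric] by (simp only: bterm_def mult_ac)
 have 5: "x * (of_nat (Suc i) * bterm x y (Suc i) j n) = (- of_nat n - 2 - of_nat i) * bterm x y i j n"
 proof -
  have "x * (of_nat (Suc i) * bterm x y (Suc i) j n) = of_nat (Suc n) * (of_nat (Suc i) * ?A n (Suc i)) * ?B n j *
   ((x * inverse x ^ (n + Suc i + 2)) * (y ^ n * inverse y ^ j))" by (simp only: bterm_def mult_ac)
  also have "x * inverse x ^ (n + Suc i + 2) = inverse x ^ (n + i + 2)" using assms by (simp add: field_simps)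
  finally show ?thesis unfolding 3 by (simp only: bterm_def mult_ac)
 qed
 have 6: "y * (of_nat (Suc j) * bterm x y i (Suc j) n) = (of_nat n - of_nat j) * bterm x y i j n"
 proof -
  have "y * (of_nat (Suc j) * bterm x y i (Suc j) n) = of_nat (Suc n) * ?A n i * (of_nat (Suc j) * ?B n (Suc j)) *
   (inverse x ^ (n + i + 2) * (y ^ n * (y * inverse y ^ Suc j)))" by (simp only: bterm_def mult_ac)
  also have "y * inverse y ^ Suc j = inverse y ^ j" using assms by (simp add: field_simps)
  finally show ?thesis unfolding 4 by (simp only: bterm_def mult_ac)
 qed
 show "x * (of_nat (Suc i) * bterm x y (Suc i) j n) + y * (of_nat (Suc j) * bterm x y i (Suc j) n) =
    - (of_nat (i + j) + 2) * bterm x y i j n" unfolding 5 6 by (simp add: algebra_simps)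
qed

lemma bterm_sums:
 assumes yx: "norm y < norm x" and y: "y ~= 0" shows "(%n. bterm x y i j n) sums boson_fn i j x y"
proof -
 have x: "x ~= 0" and ne: "x ~= y" using yx by auto
 note step = bterm_step[OF y x]
 have sums: "bterm x y i j sums suminf (bterm x y i j)" for i j using summable_norm_cancel[OF bterm_summable[OF yx]] by (rule summable_sums)
 let ?S = "%i j. suminf (bterm x y i j)"
 have "euler_solution 2 (%i j. 0) x y ?S"
 proof (rule euler_solutionI)
  fix i j
  let ?f = "%n. of_nat (Suc j) * bterm x y i (Suc j) n"
  have f: "?f \<longlonglongrightarrow> 0" using summable_LIMSEQ_zero[OF summable_norm_cancel[OF bterm_summable[OF yx]], of i "Suc j"]
   by (rule tendsto_mult_right_zero)
  \<comment> \<open>The boundary term of the telescoping sum vanishes, in accordance with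
    translation invariance.\<close>
  have "?f 0 = 0" by (simp add: bterm_def gbinomial_0_left)
  hence "(%n. of_nat (Suc i) * bterm x y (Suc i) j n + ?f n) sums 0" using telescope_sums'[OF f] unfolding step(1) \<open>?f 0 = 0\<close> by simp
  moreover have "(%n. of_nat (Suc i) * bterm x y (Suc i) j n + ?f n) sums
    (of_nat (Suc i) * ?S (Suc i) j + of_nat (Suc j) * ?S i (Suc j))" by (intro sums_add sums_mult sums)
  ultimately show "of_nat (Suc i) * ?S (Suc i) j + of_nat (Suc j) * ?S i (Suc j) = 0" by (rule sums_unique2[rotated])
 next
  fix i j
  have "(%n. x * (of_nat (Suc i) * bterm x y (Suc i) j n) + y * (of_nat (Suc j) * bterm x y i (Suc j) n)) sums
   (x * (of_nat (Suc i) * ?S (Suc i) j) + y * (of_nat (Suc j) * ?S i (Suc j)))" by (intro sums_add sums_mult sums)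
  moreover have "(%n. x * (of_nat (Suc i) * bterm x y (Suc i) j n) + y * (of_nat (Suc j) * bterm x y i (Suc j) n)) sums
   (- (of_nat (i + j) + 2) * ?S i j)" unfolding step(2) by (intro sums_mult sums)
  ultimately show "x * (of_nat (Suc i) * ?S (Suc i) j) + y * (of_nat (Suc j) * ?S i (Suc j)) = - (of_nat (i + j) + 2) * ?S i j" by (rule sums_unique2)
 qed
 moreover have "?S 0 0 = boson_fn 0 0 x y"
 proof -
  have "norm (y / x) < 1" using yx by (rule norm_quotient)
  from geometric_deriv_sums[OF this]
  have "(%n. inverse (x^2) * (of_nat (Suc n) * (y / x) ^ n)) sums (inverse (x^2) * (1 / (1 - y / x)^2))" by (rule sums_mult)
  moreover have "inverse (x^2) * (of_nat (Suc n) * (y / x) ^ n) = bterm x y 0 0 n" for n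
  proof -
   have "(y / x) ^ n = y ^ n * inverse x ^ n" by (simp only: divide_inverse power_mult_distrib)
   thus ?thesis by (simp add: bterm_def power2_eq_square)
  qed
  ultimately have "?S 0 0 = inverse (x^2) * (1 / (1 - y / x)^2)" unfolding sums_iff by (simp only:)
  also have "... = inverse (x - y) ^ 2" using x ne by (simp add: field_simps power2_eq_square)
  finally show ?thesis by (simp add: boson_fn_def power2_eq_square)
 qed
 ultimately have "?S i j = boson_fn i j x y" by (rule euler_solution_unique[OF _ boson_fn_solution[OF ne] ne])
 thus ?thesis using sums[of i j] by simp
qed

subsection \<open>The series of an iterate of two fields\<close>

text \<open>The Taylor coefficients of a shift: the \<open>i\<close>-th divided derivative at
  \<open>y + z\<close> is the sum over \<open>k\<close> of \<open>shcoeff z i k\<close> times the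
  \<open>k\<close>-th divided derivative at \<open>y\<close>.\<close>

definition shcoeff :: "complex => nat => nat => complex" where
 "shcoeff z i k = (of_nat k gchoose i) * z powi (int k - int i)"

lemma shcoeff_eq_0: "k < i ==> shcoeff z i k = 0" by (simp add: shcoeff_def binomial_gbinomial[symmetric])

lemma shcoeff_Suc_Suc: "of_nat (Suc i) * shcoeff z (Suc i) (Suc k) = of_nat (Suc k) * shcoeff z i k"
proof -
 have "of_nat (Suc i) * (of_nat (Suc k) gchoose Suc i) = of_nat (Suc k) * (of_nat k gchoose i :: complex)"
  using gbinomial_absorption[of i "of_nat (Suc k) :: complex"] by simp
 moreover have "int (Suc k) - int (Suc i) = int k - int i" by simp
 ultimately show ?thesis unfolding shcoeff_def by (simp only: mult.assoc[symmetric])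
qed

lemma shcoeff_Suc_Suc_mult:
 "of_nat (Suc i) * (shcoeff z (Suc i) (Suc k) * c) = shcoeff z i k * (of_nat (Suc k) * c)"
 unfolding mult.assoc[symmetric] shcoeff_Suc_Suc by (simp only: mult_ac)

lemma shcoeff_Suc:
 assumes "z ~= 0" shows "z * (of_nat (Suc i) * shcoeff z (Suc i) k) = (of_nat k - of_nat i) * shcoeff z i k"
proof -
 have "z * z powi (int k - int (Suc i)) = z powi (int k - int i)" using assms power_int_add_1'[of z "int k - int (Suc i)"] by simp
 moreover have "z * (of_nat (Suc i) * shcoeff z (Suc i) k) =
   (of_nat (Suc i) * (of_nat k gchoose Suc i)) * (z * z powi (int k - int (Suc i)))" unfolding shcoeff_def by (simp only: mult_ac)
 ultimately show ?thesis unfolding gchoose_Suc shcoeff_def by (simp only: mult.assoc)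
qed

text \<open>Equals minus \<open>C_coeff (k + 1) (l + 1)\<close>. These are the divided derivatives
  at \<open>x = y = 1\<close> of the regular part
  \<open>(x + y) / (2(x - y)(xy)^(1/2)) - 1 / (x - y)\<close>.\<close>

definition delta_fn :: "nat => nat => complex" where
 "delta_fn k l = - (1/2) * ((of_nat k - of_nat l) / (of_nat (k + l) + 1)) * hb k * hb l"

text \<open>With the powers of \<open>y\<close> removed, these are the two equations of the regular
  part on the diagonal: Euler's identity, and \<open>d/dx + d/dy\<close> producing the defect, to
  which \<open>1 / (x - y)\<close> contributes nothing.\<close>

lemma delta_fn_step: shows "of_nat (Suc k) * delta_fn (Suc k) l + of_nat (Suc l) * delta_fn k (Suc l) = - (of_nat (k + l) + 1) * delta_fn k l"
  and "of_nat (Suc k) * delta_fn (Suc k) l + of_nat (Suc l) * delta_fn k (Suc l) =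
   1/2 * (hb k * (of_nat (Suc l) * hb (Suc l)) - of_nat (Suc k) * hb (Suc k) * hb l)"
proof -
 have nz: "of_nat (k + l) + 1 ~= (0 :: complex)" "of_nat (k + l) + 2 ~= (0 :: complex)"
  using of_nat_neq_0[of "k + l", where ?'a = complex] of_nat_neq_0[of "Suc (k + l)", where ?'a = complex] by (simp_all add: algebra_simps)
 have 1: "of_nat (Suc k) * delta_fn (Suc k) l =
   - (1/2) * ((of_nat k + 1 - of_nat l) / (of_nat (k + l) + 2)) * (of_nat (Suc k) * hb (Suc k)) * hb l"
 proof -
  have "of_nat (Suc k) - of_nat l = (of_nat k + 1 - of_nat l :: complex)" "of_nat (Suc k + l) + 1 = (of_nat (k + l) + 2 :: complex)" by simp_all
  thus ?thesis unfolding delta_fn_def by (simp only: mult_ac)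
 qed
 have 2: "of_nat (Suc l) * delta_fn k (Suc l) =
   - (1/2) * ((of_nat k - of_nat l - 1) / (of_nat (k + l) + 2)) * hb k * (of_nat (Suc l) * hb (Suc l))"
 proof -
  have "of_nat k - of_nat (Suc l) = (of_nat k - of_nat l - 1 :: complex)" "of_nat (k + Suc l) + 1 = (of_nat (k + l) + 2 :: complex)" by simp_all
  thus ?thesis unfolding delta_fn_def by (simp only: mult_ac)
 qed
 have "of_nat (Suc k) * delta_fn (Suc k) l + of_nat (Suc l) * delta_fn k (Suc l) =
   1/2 * hb k * hb l * (((of_nat k + 1 - of_nat l) * (of_nat k + 1/2) + (of_nat k - of_nat l - 1) * (of_nat l + 1/2)) / (of_nat (k + l) + 2))"
 proof -
  have "- (1/2) * (A / N) * (- P * h) * g + - (1/2) * (B / N) * h * (- Q * g) = 1/2 * h * g * ((A * P + B * Q) / N)"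
   for A B P Q h g N :: complex by (simp add: add_divide_distrib algebra_simps)
  thus ?thesis unfolding 1 2 hb_Suc .
 qed
 also have "(of_nat k + 1 - of_nat l) * (of_nat k + 1/2) + (of_nat k - of_nat l - 1) * (of_nat l + 1/2 :: complex) =
   (of_nat k - of_nat l) * (of_nat (k + l) + 2)" by (simp add: field_simps)
 finally have 3: "of_nat (Suc k) * delta_fn (Suc k) l + of_nat (Suc l) * delta_fn k (Suc l) =
   1/2 * hb k * hb l * (of_nat k - of_nat l)" using nz by simp
 show "of_nat (Suc k) * delta_fn (Suc k) l + of_nat (Suc l) * delta_fn k (Suc l) = - (of_nat (k + l) + 1) * delta_fn k l"
 proof -
  have "1/2 * h * g * A = - N * (- (1/2) * (A / N) * h * g)" if "N ~= 0" for h g A N :: complex using that by simp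
  from this[OF nz(1)] show ?thesis unfolding 3 unfolding delta_fn_def .
 qed
 show "of_nat (Suc k) * delta_fn (Suc k) l + of_nat (Suc l) * delta_fn k (Suc l) =
   1/2 * (hb k * (of_nat (Suc l) * hb (Suc l)) - of_nat (Suc k) * hb (Suc k) * hb l)" unfolding 3 hb_Suc by (simp add: field_simps)
qed

text \<open>Dominates the coefficients by a product, so that double series converge because the
  binomial series in each variable does.\<close>

lemma norm_delta_fn_le: "norm (delta_fn k l) <= norm (hb k) * norm (hb l)"
proof -
 have "norm (of_nat (k + l) + 1 :: complex) = real (k + l) + 1" by (metis norm_of_nat of_nat_Suc add.commute)
 moreover have "norm (of_nat k - of_nat l :: complex) <= real k + real l" by (metis norm_triangle_ineq4 norm_of_nat)
 ultimately have "norm ((of_nat k - of_nat l) / (of_nat (k + l) + 1) :: complex) <= 1" by (simp add: norm_divide divide_le_eq)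
 hence "norm (- (1/2) * ((of_nat k - of_nat l) / (of_nat (k + l) + 1)) :: complex) <= 1" unfolding norm_mult norm_minus_cancel by simp
 from mult_right_mono[OF this norm_ge_zero[of "hb k * hb l"]] show ?thesis by (simp only: delta_fn_def norm_mult mult.assoc mult_1_left)
qed

text \<open>
 Here \<open>u\<close> is a root of \<open>y\<close>, and \<open>t\<close> is the root of \<open>x = y + z\<close> near \<open>u\<close>.
\<close>

locale shifted_root =
 fixes u z t :: complex
 assumes u: "u ~= 0" and z: "z ~= 0" and zu: "norm z < norm (u^2)"
  and t_def: "t = u * (1 + z / u^2) powr (1/2)"
begin

lemma nonzero: "1 + z / u^2 ~= 0"
proof
 assume "1 + z / u^2 = 0"
 hence "z = - (u^2)" using u by (simp add: add_eq_0_iff divide_eq_eq)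
 thus False using zu by simp
qed

lemma t: "t ~= 0" using u nonzero by (simp add: t_def)

lemma quotient_powi: "(1 + z / u^2) powr (of_int n / 2) = (t / u) powi n" using nonzero u by (simp add: t_def powr_def exp_power_int)

lemma t_square: "t^2 = u^2 + z"
proof -
 have "(t / u)^2 = 1 + z / u^2" using quotient_powi[of 2] nonzero by simp
 thus ?thesis using u by (simp add: power_divide field_simps)
qed

lemma t_square_neq: "t^2 ~= u^2" using z by (simp add: t_square)

text \<open>The binomial series of \<open>x^(E/2)\<close> at \<open>x = y + z\<close>,
  differentiated \<open>i\<close> times and written in the roots \<open>t\<close> and
  \<open>u\<close>.\<close>

lemma shift_sums:
 fixes E :: int
 defines "f == %i k. shcoeff z i k * ((of_int E / 2) gchoose k) * u powi (E - 2 * int k)"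
 shows "f i sums (((of_int E / 2) gchoose i) * t powi (E - 2 * int i))" (is ?A)
  and "summable (%k. norm (f i k))" (is ?B)
proof -
 define a :: complex where "a = of_int E / 2"
 define C where "C = (a gchoose i) * u powi (E - 2 * int i)"
 let ?g = "%k. ((a - of_nat i) gchoose k) * (z / u^2) ^ k"
 have f: "f i (k + i) = C * ?g k" for k
 proof -
  have 1: "(a gchoose (k + i)) * (of_nat (k + i) gchoose i) = (a gchoose i) * ((a - of_nat i) gchoose k)"
   using gbinomial_trinomial_revision[of i "k + i" a] by simp
  have "u powi (E - 2 * int (k + i)) = u powi (E - 2 * int i) / u powi (2 * int k)" using u by (simp add: power_int_diff[symmetric] algebra_simps)
  also have "u powi (2 * int k) = (u^2) ^ k" using power_int_of_nat[of u "2 * k"] by (simp add: power_mult)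
  finally have 2: "u powi (E - 2 * int (k + i)) = u powi (E - 2 * int i) / (u^2) ^ k" .
  have "f i (k + i) = ((a gchoose (k + i)) * (of_nat (k + i) gchoose i)) * (z ^ k * (u powi (E - 2 * int i) / (u^2) ^ k))"
   unfolding f_def 2 shcoeff_def a_def by (simp add: mult_ac)
  thus ?thesis unfolding 1 C_def by (simp add: power_divide mult_ac)
 qed
 have w: "norm (z / u^2) < 1" using zu u by (simp add: norm_divide)
 have s: "?g sums (1 + z / u^2) powr (a - of_nat i)" by (rule gen_binomial_complex[OF w])
 have sn: "summable (%k. norm (?g k))"
 proof -
  obtain r where r: "norm (z / u^2) < r" "r < 1" using dense[OF w] by blast
  hence "r > 0" using norm_ge_zero[of "z / u^2"] by linarith
  hence "norm (of_real r :: complex) < 1" "norm (z / u^2) < norm (of_real r :: complex)" using r by simp_all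
  thus ?thesis using powser_insidea sums_summable[OF gen_binomial_complex] by blast
 qed
 have "(%k. f i (k + i)) sums (C * (1 + z / u^2) powr (a - of_nat i))" unfolding f by (rule sums_mult[OF s])
 hence "f i sums (C * (1 + z / u^2) powr (a - of_nat i) + (SUM k<i. f i k))" by (rule sums_iff_shift[THEN iffD1])
 moreover have "(SUM k<i. f i k) = 0" by (intro sum.neutral) (simp add: f_def shcoeff_eq_0)
 moreover have "C * (1 + z / u^2) powr (a - of_nat i) = (a gchoose i) * t powi (E - 2 * int i)"
 proof -
  have "a - of_nat i = of_int (E - 2 * int i) / 2" by (simp add: a_def field_simps)
  hence "(1 + z / u^2) powr (a - of_nat i) = (t / u) powi (E - 2 * int i)" by (simp only: quotient_powi)
  thus ?thesis using u by (simp add: C_def power_int_divide_distrib)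
 qed
 ultimately show ?A by (simp add: a_def)
 have "summable (%k. norm (f i (k + i)))" unfolding f norm_mult[of C] by (rule summable_mult[OF sn])
 thus ?B by (rule summable_iff_shift[THEN iffD1])
qed

lemma shift_has_sum:
 "((%k. shcoeff z i k * ((of_int E / 2) gchoose k) * u powi (E - 2 * int k)) has_sum
   (((of_int E / 2) gchoose i) * t powi (E - 2 * int i))) UNIV" by (rule norm_summable_imp_has_sum[OF shift_sums(2,1)])

lemma powi_odd: "w powi (- 1 - 2 * int k) = inverse w ^ (2 * k + 1)" for w :: complex
proof -
 have "- 1 - 2 * int k = - int (2 * k + 1)" by simp
 thus ?thesis by (simp only: power_int_minus power_int_of_nat power_inverse)
qed

lemma hb_sums: shows "(%k. shcoeff z i k * (hb k * inverse u ^ (2 * k + 1))) sums hbeta i t"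
  and "summable (%k. norm (shcoeff z i k * (hb k * inverse u ^ (2 * k + 1))))"
proof -
 have e: "(of_int (- 1) / 2 :: complex) = - (1 / 2)" by simp
 show "(%k. shcoeff z i k * (hb k * inverse u ^ (2 * k + 1))) sums hbeta i t"
  using shift_sums(1)[of i "- 1"] unfolding e powi_odd hbeta_def mult.assoc .
 show "summable (%k. norm (shcoeff z i k * (hb k * inverse u ^ (2 * k + 1))))" using shift_sums(2)[of i "- 1"] unfolding e powi_odd mult.assoc .
qed

lemma hb_Suc_sums:
 "(%k. shcoeff z i k * (of_nat (Suc k) * hb (Suc k) * inverse u ^ (2 * Suc k + 1))) sums
   (of_nat (Suc i) * hbeta (Suc i) t)"
proof -
 have "(%k. of_nat (Suc i) * (shcoeff z (Suc i) k * (hb k * inverse u ^ (2 * k + 1)))) sums (of_nat (Suc i) * hbeta (Suc i) t)"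
  by (intro sums_mult hb_sums)
 hence "(%k. of_nat (Suc i) * (shcoeff z (Suc i) (Suc k) * (hb (Suc k) * inverse u ^ (2 * Suc k + 1)))) sums
   (of_nat (Suc i) * hbeta (Suc i) t)" by (subst sums_Suc_iff) (simp add: shcoeff_eq_0)
 moreover have "of_nat (Suc i) * (shcoeff z (Suc i) (Suc k) * (hb (Suc k) * inverse u ^ (2 * Suc k + 1))) =
   shcoeff z i k * (of_nat (Suc k) * hb (Suc k) * inverse u ^ (2 * Suc k + 1))" for k unfolding shcoeff_Suc_Suc_mult by (simp only: mult.assoc)
 ultimately show ?thesis by (simp only:)
qed

definition iterate_term' :: "nat => nat => nat => complex" where
 "iterate_term' i l k = shcoeff z i k * (delta_fn k l * inverse u ^ (2 * (k + l + 1)))"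

lemma inverse_u_power: "inverse u ^ (2 * (k + l + 1)) = inverse u ^ (2 * k + 1) * inverse u ^ (2 * l + 1)" by (simp add: power_add[symmetric])

lemma norm_iterate_term:
 "norm (iterate_term' i l k) <= norm (shcoeff z i k * (hb k * inverse u ^ (2 * k + 1))) * norm (hb l * inverse u ^ (2 * l + 1))"
proof -
 have "norm (iterate_term' i l k) = norm (delta_fn k l) * norm (shcoeff z i k * inverse u ^ (2 * (k + l + 1)))"
  by (simp only: iterate_term'_def norm_mult mult_ac)
 also have "... <= (norm (hb k) * norm (hb l)) * norm (shcoeff z i k * inverse u ^ (2 * (k + l + 1)))"
  by (intro mult_right_mono norm_delta_fn_le norm_ge_zero)
 finally show ?thesis unfolding inverse_u_power by (simp only: norm_mult mult_ac)
qed

lemma iterate_term_summable: "summable (%k. norm (iterate_term' i l k))"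
 by (rule summable_comparison_test[OF _ summable_mult2[OF hb_sums(2)[of i], of "norm (hb l * inverse u ^ (2 * l + 1))"]])
  (use norm_iterate_term in auto)

text \<open>The regular part of the contraction, Taylor expanded from the diagonal point
  \<open>(y, y)\<close> to \<open>(y + z, y)\<close>.\<close>

definition isum :: "nat => nat => complex" where
 "isum i l = suminf (iterate_term' i l)"

lemma isums: "iterate_term' i l sums isum i l" unfolding isum_def using summable_norm_cancel[OF iterate_term_summable] by (rule summable_sums)

text \<open>As \<open>x = u^2 + z\<close>, the combination in the second equation is Euler's
  operator, grouped as \<open>y(d/dx + d/dy) + z d/dx\<close>.\<close>

lemma isum_step: shows "of_nat (Suc i) * isum (Suc i) l + of_nat (Suc l) * isum i (Suc l) = defect t u i l"
  and "u^2 * (of_nat (Suc i) * isum (Suc i) l + of_nat (Suc l) * isum i (Suc l)) +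
   z * (of_nat (Suc i) * isum (Suc i) l) = - (of_nat (i + l) + 1) * isum i l"
proof -
 \<comment> \<open>The series of \<open>d/dx + d/dy\<close>, its \<open>x\<close>-part shifted by
   one index because the zeroth term there is zero. The two evaluations of the coefficients in
   \<open>delta_fn_step\<close> give the two equations.\<close>
 define X where "X k = shcoeff z i k *
  ((of_nat (Suc k) * delta_fn (Suc k) l + of_nat (Suc l) * delta_fn k (Suc l)) * inverse u ^ (2 * (k + l + 2)))" for k
 have "(%k. of_nat (Suc i) * iterate_term' (Suc i) l k) sums (of_nat (Suc i) * isum (Suc i) l)" by (intro sums_mult isums)
 hence "(%k. of_nat (Suc i) * iterate_term' (Suc i) l (Suc k)) sums (of_nat (Suc i) * isum (Suc i) l)"
  by (subst sums_Suc_iff) (simp add: iterate_term'_def shcoeff_eq_0)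
 moreover have "of_nat (Suc i) * iterate_term' (Suc i) l (Suc k) =
   shcoeff z i k * (of_nat (Suc k) * delta_fn (Suc k) l * inverse u ^ (2 * (k + l + 2)))" for k
 proof -
  have "Suc k + l + 1 = k + l + 2" by simp
  hence "of_nat (Suc i) * iterate_term' (Suc i) l (Suc k) =
   (of_nat (Suc i) * shcoeff z (Suc i) (Suc k)) * (delta_fn (Suc k) l * inverse u ^ (2 * (k + l + 2)))"
   unfolding iterate_term'_def by (simp only: mult.assoc)
  thus ?thesis unfolding shcoeff_Suc_Suc by (simp only: mult_ac)
 qed
 ultimately have "(%k. shcoeff z i k * (of_nat (Suc k) * delta_fn (Suc k) l * inverse u ^ (2 * (k + l + 2)))) sums
   (of_nat (Suc i) * isum (Suc i) l)" by (simp only:)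
 moreover have "(%k. of_nat (Suc l) * iterate_term' i (Suc l) k) sums (of_nat (Suc l) * isum i (Suc l))" by (intro sums_mult isums)
 ultimately have "(%k. shcoeff z i k * (of_nat (Suc k) * delta_fn (Suc k) l * inverse u ^ (2 * (k + l + 2))) +
   of_nat (Suc l) * iterate_term' i (Suc l) k) sums
   (of_nat (Suc i) * isum (Suc i) l + of_nat (Suc l) * isum i (Suc l))" by (rule sums_add)
 moreover have "shcoeff z i k * (of_nat (Suc k) * delta_fn (Suc k) l * inverse u ^ (2 * (k + l + 2))) +
   of_nat (Suc l) * iterate_term' i (Suc l) k = X k" for k
 proof -
  have "k + Suc l + 1 = k + l + 2" by simp
  thus ?thesis unfolding iterate_term'_def X_def by (simp only: distrib_left distrib_right mult_ac)
 qed
 ultimately have X1: "X sums (of_nat (Suc i) * isum (Suc i) l + of_nat (Suc l) * isum i (Suc l))" (is "_ sums ?L") by (simp only:)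
 have "(%k. 1/2 * (shcoeff z i k * (hb k * inverse u ^ (2 * k + 1)) * (of_nat (Suc l) * hbeta (Suc l) u) -
   shcoeff z i k * (of_nat (Suc k) * hb (Suc k) * inverse u ^ (2 * Suc k + 1)) * hbeta l u)) sums defect t u i l"
  unfolding defect_def by (intro sums_mult sums_diff sums_mult2 hb_sums hb_Suc_sums)
 moreover have "1/2 * (shcoeff z i k * (hb k * inverse u ^ (2 * k + 1)) * (of_nat (Suc l) * hbeta (Suc l) u) -
   shcoeff z i k * (of_nat (Suc k) * hb (Suc k) * inverse u ^ (2 * Suc k + 1)) * hbeta l u) = X k" for k
 proof -
  have 1: "inverse u ^ (2 * (k + l + 2)) = inverse u ^ (2 * k + 1) * inverse u ^ (2 * Suc l + 1)"
   and 2: "inverse u ^ (2 * (k + l + 2)) = inverse u ^ (2 * Suc k + 1) * inverse u ^ (2 * l + 1)" by (simp_all only: power_add[symmetric]) simp_all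
  have "X k = 1/2 * (shcoeff z i k * hb k * (of_nat (Suc l) * hb (Suc l)) * inverse u ^ (2 * (k + l + 2)) -
    shcoeff z i k * (of_nat (Suc k) * hb (Suc k) * hb l) * inverse u ^ (2 * (k + l + 2)))"
   unfolding X_def delta_fn_step(2) by (simp only: left_diff_distrib right_diff_distrib mult_ac)
  also have "... = 1/2 * (shcoeff z i k * hb k * (of_nat (Suc l) * hb (Suc l)) * (inverse u ^ (2 * k + 1) * inverse u ^ (2 * Suc l + 1)) -
    shcoeff z i k * (of_nat (Suc k) * hb (Suc k) * hb l) * (inverse u ^ (2 * Suc k + 1) * inverse u ^ (2 * l + 1)))" using 1 2 by presburger
  finally show ?thesis unfolding hbeta_def by (simp only: mult_ac)
 qed
 ultimately have "X sums defect t u i l" by (simp only:)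
 thus "?L = defect t u i l" by (rule sums_unique2[OF X1])
 have "(%k. u^2 * X k + z * (of_nat (Suc i) * iterate_term' (Suc i) l k)) sums
   (u^2 * ?L + z * (of_nat (Suc i) * isum (Suc i) l))" by (intro sums_add sums_mult X1 isums)
 moreover have "u^2 * X k + z * (of_nat (Suc i) * iterate_term' (Suc i) l k) = - (of_nat (i + l) + 1) * iterate_term' i l k" for k
 proof -
  have "inverse u ^ (2 * (k + l + 2)) = inverse u ^ (2 * (k + l + 1)) * (inverse u)^2" by (simp only: power_add[symmetric]) simp
  hence "u^2 * inverse u ^ (2 * (k + l + 2)) = inverse u ^ (2 * (k + l + 1))" using u by (simp add: field_simps)
  moreover have "u^2 * X k = shcoeff z i k * ((- (of_nat (k + l) + 1) * delta_fn k l) * (u^2 * inverse u ^ (2 * (k + l + 2))))"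
   unfolding X_def delta_fn_step(1) by (simp only: mult_ac)
  ultimately have 1: "u^2 * X k = - (of_nat (k + l) + 1) * iterate_term' i l k" by (simp only: iterate_term'_def mult_ac)
  have 2: "z * (of_nat (Suc i) * iterate_term' (Suc i) l k) = (of_nat k - of_nat i) * iterate_term' i l k"
   using shcoeff_Suc[OF z, of i k] unfolding iterate_term'_def mult.assoc[symmetric] by (simp only:)
  show ?thesis unfolding 1 2 by (simp add: algebra_simps)
 qed
 ultimately have "(%k. - (of_nat (i + l) + 1) * iterate_term' i l k) sums
   (u^2 * ?L + z * (of_nat (Suc i) * isum (Suc i) l))" by (simp only:)
 thus "u^2 * ?L + z * (of_nat (Suc i) * isum (Suc i) l) = - (of_nat (i + l) + 1) * isum i l" by (rule sums_unique2[OF _ sums_mult[OF isums]])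
qed

text \<open>Writing \<open>k / (k + 1)\<close> as \<open>1 - 1 / (k + 1)\<close> splits the series
  into the binomial series of \<open>1 / t\<close> and that of \<open>t\<close>.\<close>

lemma isum_0: "isum 0 0 = - (1/2) * (1 / (t * u) - 2 * (t / u - 1) / z)"
proof -
 let ?w = "z / u^2"
 have w: "norm ?w < 1" using zu u by (simp add: norm_divide)
 have "(%k. ((1/2) gchoose k) * ?w ^ k) sums (t / u)" using gen_binomial_complex[OF w, of "1/2"] quotient_powi[of 1] by simp
 hence "(%k. ((1/2) gchoose Suc k) * ?w ^ Suc k) sums (t / u - 1)" by (subst sums_Suc_iff) simp
 from sums_mult[OF this, of "2 / z"]
 have 1: "(%k. 2 / z * (((1/2) gchoose Suc k) * ?w ^ Suc k)) sums (2 / z * (t / u - 1))" .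
 have 2: "(%k. shcoeff z 0 k * (hb k * inverse u ^ (2 * k + 1)) * inverse u) sums (hbeta 0 t * inverse u)" by (intro sums_mult2 hb_sums)
 have "(%k. - (1/2) * (shcoeff z 0 k * (hb k * inverse u ^ (2 * k + 1)) * inverse u - 2 / z * (((1/2) gchoose Suc k) * ?w ^ Suc k)))
   sums (- (1/2) * (hbeta 0 t * inverse u - 2 / z * (t / u - 1)))" by (intro sums_mult sums_diff 1 2)
 moreover have "- (1/2) * (shcoeff z 0 k * (hb k * inverse u ^ (2 * k + 1)) * inverse u - 2 / z * (((1/2) gchoose Suc k) * ?w ^ Suc k))
   = iterate_term' 0 0 k" for k
 proof -
  have nz: "of_nat (Suc k) ~= (0::complex)" by (rule of_nat_neq_0)
  have 3: "((1/2) gchoose Suc k) = 1/2 * hb k / of_nat (Suc k)"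
  proof -
   have "of_nat (Suc k) * ((1/2) gchoose Suc k) = 1/2 * hb k" using gbinomial_absorption[of k "1/2 :: complex"] by (simp del: of_nat_Suc)
   thus ?thesis using nz by (simp only: nonzero_eq_divide_eq mult.commute not_False_eq_True)
  qed
  have 4: "?w ^ Suc k = z * (z ^ k * inverse u ^ (2 * k + 2))"
  proof -
   have "inverse (u^2) ^ Suc k = inverse u ^ (2 * k + 2)" by (simp only: power_inverse[symmetric] power_mult[symmetric]) simp
   thus ?thesis unfolding divide_inverse power_mult_distrib by (simp only: power_Suc mult.assoc)
  qed
  have 5: "inverse u ^ (2 * k + 1) * inverse u = inverse u ^ (2 * k + 2)" by simp
  have 6: "2 / z * (((1/2) gchoose Suc k) * ?w ^ Suc k) = hb k / of_nat (Suc k) * (z ^ k * inverse u ^ (2 * k + 2))"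
   unfolding 3 4 using z by (simp add: mult_ac del: of_nat_Suc)
  have 7: "shcoeff z 0 k * (hb k * inverse u ^ (2 * k + 1)) * inverse u = hb k * (z ^ k * inverse u ^ (2 * k + 2))"
   unfolding 5[symmetric] by (simp add: shcoeff_def mult_ac)
  have 8: "iterate_term' 0 0 k = - (1/2) * (of_nat k / of_nat (Suc k)) * (hb k * (z ^ k * inverse u ^ (2 * k + 2)))"
   by (simp add: iterate_term'_def shcoeff_def delta_fn_def mult_ac add.commute)
  have 9: "of_nat k / of_nat (Suc k) = 1 - 1 / (of_nat (Suc k) :: complex)" using nz by (simp add: field_simps)
  show ?thesis unfolding 6 7 8 9 by (simp add: algebra_simps del: of_nat_Suc)
 qed
 ultimately have "iterate_term' 0 0 sums (- (1/2) * (hbeta 0 t * inverse u - 2 / z * (t / u - 1)))" by (simp only:)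
 hence "isum 0 0 = - (1/2) * (hbeta 0 t * inverse u - 2 / z * (t / u - 1))" by (rule sums_unique2[OF isums])
 moreover have "hbeta 0 t * inverse u = 1 / (t * u)" using t u by (simp add: hbeta_def field_simps)
 moreover have "2 / z * (t / u - 1) = 2 * (t / u - 1) / z" by (rule times_divide_eq_left)
 ultimately show ?thesis by (simp only:)
qed

text \<open>The divided derivatives of \<open>1 / (x - y)\<close>, the fermionic contraction on V,
  at \<open>x - y = z\<close>.\<close>

definition V_contr_fn :: "nat => nat => complex" where
 "V_contr_fn i j = ((- of_nat j - 1) gchoose i) * inverse z ^ (i + j + 1)"

lemma V_contr_fn_step: shows "of_nat (Suc i) * V_contr_fn (Suc i) j + of_nat (Suc j) * V_contr_fn i (Suc j) = 0"
  and "z * (of_nat (Suc i) * V_contr_fn (Suc i) j) = - (of_nat (i + j) + 1) * V_contr_fn i j"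
proof -
 let ?g = "(- of_nat j - 1 :: complex) gchoose i"
 have 1: "of_nat (Suc i) * V_contr_fn (Suc i) j = ((- of_nat j - 1 - of_nat i) * ?g) * inverse z ^ (i + j + 2)"
  unfolding V_contr_fn_def gchoose_Suc[symmetric] by (simp add: mult_ac)
 have "- of_nat (Suc j) * ((- of_nat (Suc j) - 1) gchoose i) = (- of_nat j - 1 - of_nat i :: complex) * ?g"
  using gbinomial_absorb_comp[of "- of_nat j - 1 :: complex" i] by (simp add: algebra_simps)
 hence 2: "of_nat (Suc j) * V_contr_fn i (Suc j) = - (((- of_nat j - 1 - of_nat i) * ?g) * inverse z ^ (i + j + 2))"
 proof -
  have "of_nat (Suc j) * V_contr_fn i (Suc j) =
    - ((- of_nat (Suc j) * ((- of_nat (Suc j) - 1) gchoose i)) * inverse z ^ (i + j + 2))" by (simp add: V_contr_fn_def del: of_nat_Suc)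
  thus ?thesis unfolding \<open>- of_nat (Suc j) * _ = _\<close> .
 qed
 show "of_nat (Suc i) * V_contr_fn (Suc i) j + of_nat (Suc j) * V_contr_fn i (Suc j) = 0" unfolding 1 2 by (simp only: add.right_inverse)
 have "z * inverse z ^ (i + j + 2) = inverse z ^ (i + j + 1)" using z by simp
 thus "z * (of_nat (Suc i) * V_contr_fn (Suc i) j) = - (of_nat (i + j) + 1) * V_contr_fn i j"
 proof -
  assume e: "z * inverse z ^ (i + j + 2) = inverse z ^ (i + j + 1)"
  have "- of_nat j - 1 - of_nat i = - (of_nat (i + j) + 1 :: complex)" by simp
  thus ?thesis unfolding 1 unfolding V_contr_fn_def mult.left_commute[of z] e by (simp only: mult.assoc)
 qed
qed

text \<open>The sum of both parts satisfies the first order equations that characterize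
  \<open>fermion_fn\<close>, so that only the values of order zero remain to be compared.\<close>

lemma cross_sum: "V_contr_fn i j + isum i j = fermion_fn i j t u"
proof (rule fermion_fn_eq[where S = "%i j. V_contr_fn i j + isum i j"])
 show "euler_solution 1 (defect t u) (t^2) (u^2) (%i j. V_contr_fn i j + isum i j)"
 proof (rule euler_solutionI)
  fix i j
  note s = isum_step[of i j] V_contr_fn_step[of i j]
  show "of_nat (Suc i) * (V_contr_fn (Suc i) j + isum (Suc i) j) +
    of_nat (Suc j) * (V_contr_fn i (Suc j) + isum i (Suc j)) = defect t u i j"
  proof -
   have "a * (p + q) + b * (p' + q') = r" if "a * q + b * q' = r" "a * p + b * p' = 0" for a b p q p' q' r :: complex
   proof -
    have "a * (p + q) + b * (p' + q') = (a * q + b * q') + (a * p + b * p')" by (simp only: distrib_left add_ac)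
    thus ?thesis unfolding that by simp
   qed
   from this[OF s(1,3)] show ?thesis .
  qed
  show "t^2 * (of_nat (Suc i) * (V_contr_fn (Suc i) j + isum (Suc i) j)) +
    u^2 * (of_nat (Suc j) * (V_contr_fn i (Suc j) + isum i (Suc j))) =
    - (of_nat (i + j) + 1) * (V_contr_fn i j + isum i j)"
  proof -
   have "(U + Z) * (a * (p + q)) + U * (b * (p' + q')) = - N * (r' + r)"
    if "U * (a * q + b * q') + Z * (a * q) = - N * r" "a * p + b * p' = 0" "Z * (a * p) = - N * r'"
    for U Z N a b p q p' q' r r' :: complex
   proof -
    have "(U + Z) * (a * (p + q)) + U * (b * (p' + q')) =
      (U * (a * q + b * q') + Z * (a * q)) + (U * (a * p + b * p') + Z * (a * p))" by (simp only: distrib_left distrib_right add_ac)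
    thus ?thesis unfolding that by (simp add: distrib_left)
   qed
   from this[OF s(2-4)] show ?thesis unfolding t_square .
  qed
 qed
 show "t^2 ~= u^2" by (rule t_square_neq)
 \<comment> \<open>In terms of \<open>s\<close> and \<open>u\<close> the identity of order zero
   becomes rational.\<close>
 define s where "s = t / u"
 have s: "t = s * u" "s ~= 0" using u t by (simp_all add: s_def)
 have "z = (s^2 - 1) * u^2" using t_square s by (simp add: algebra_simps)
 moreover from this have "s^2 - 1 ~= 0" using z by auto
 ultimately show "V_contr_fn 0 0 + isum 0 0 = (t^2 + u^2) / (2 * (t^2 - u^2) * t * u)"
  unfolding isum_0 V_contr_fn_def using s u by (simp add: divide_simps) (simp add: algebra_simps power2_eq_square)
qed

lemma cross_has_sum: "(iterate_term' i j has_sum (fermion_fn i j t u - V_contr_fn i j)) UNIV"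
 using norm_summable_imp_has_sum[OF iterate_term_summable isums[of i j]] unfolding cross_sum[symmetric] by simp

text \<open>Serves two letters of the first vector: both variables are moved from \<open>y\<close>
  to \<open>y + z\<close>, which turns a \<Delta>-contraction at \<open>u^2\<close> into the one at
  \<open>t^2\<close>.\<close>

lemma diagonal_has_sum:
 "((%(l, k). shcoeff z j l * iterate_term' i l k) has_sum (delta_fn i j * inverse t ^ (2 * (i + j + 1)))) (UNIV \<times> UNIV)"
proof -
 let ?f = "%i j (l, k). shcoeff z j l * iterate_term' i l k"
 \<comment> \<open>Majorized by the product of two differentiated binomial series for
   \<open>1 / t\<close>.\<close>
 have "(%x. norm (?f i j x)) summable_on UNIV \<times> UNIV" for i j
 proof (rule Infinite_Sum.abs_summable_on_comparison_test)
  have "((%(l, k). (shcoeff z j l * (hb l * inverse u ^ (2 * l + 1))) * (shcoeff z i k * (hb k * inverse u ^ (2 * k + 1))))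
    has_sum (hbeta j t * hbeta i t)) (UNIV \<times> UNIV)" by (intro has_sum_product_complex norm_summable_imp_has_sum hb_sums)
  thus "(%x. norm ((%(l, k). (shcoeff z j l * (hb l * inverse u ^ (2 * l + 1))) * (shcoeff z i k * (hb k * inverse u ^ (2 * k + 1)))) x))
    summable_on UNIV \<times> UNIV" using has_sum_imp_summable summable_on_iff_abs_summable_on_complex by blast
  fix x :: "nat \<times> nat"
  obtain l k where x: "x = (l, k)" by (cases x)
  have "norm (shcoeff z j l) * norm (iterate_term' i l k) <= norm (shcoeff z j l) *
    (norm (shcoeff z i k * (hb k * inverse u ^ (2 * k + 1))) * norm (hb l * inverse u ^ (2 * l + 1)))"
   by (intro mult_left_mono norm_iterate_term norm_ge_zero)
  thus "norm (?f i j x) <= norm (case x of (l, k) =>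
    (shcoeff z j l * (hb l * inverse u ^ (2 * l + 1))) * (shcoeff z i k * (hb k * inverse u ^ (2 * k + 1))))"
   unfolding x by (simp add: norm_mult mult_ac)
 qed
 hence S: "(?f i j has_sum infsum (?f i j) (UNIV \<times> UNIV)) (UNIV \<times> UNIV)" for i j by (rule has_sum_infsum[OF abs_summable_summable])
 define D where "D i j = infsum (?f i j) (UNIV \<times> UNIV)" for i j
 have D: "(%l. shcoeff z j l * isum i l) sums D i j" for i j
 proof -
  have "((%l. shcoeff z j l * isum i l) has_sum D i j) UNIV"
  proof (rule has_sum_SigmaD)
   show "(?f i j has_sum D i j) (Sigma UNIV (%_. UNIV))" unfolding D_def by (rule S)
   fix l
   show "((%k. ?f i j (l, k)) has_sum shcoeff z j l * isum i l) UNIV"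
    using has_sum_cmult_right[OF norm_summable_imp_has_sum[OF iterate_term_summable isums]] by simp
  qed
  thus ?thesis by (rule has_sum_imp_sums)
 qed
 have D_Suc: "(%l. shcoeff z j l * (of_nat (Suc l) * isum i (Suc l))) sums (of_nat (Suc j) * D i (Suc j))" for i j
 proof -
  have "(%l. of_nat (Suc j) * (shcoeff z (Suc j) l * isum i l)) sums (of_nat (Suc j) * D i (Suc j))" by (intro sums_mult D)
  hence "(%l. of_nat (Suc j) * (shcoeff z (Suc j) (Suc l) * isum i (Suc l))) sums (of_nat (Suc j) * D i (Suc j))"
   by (subst sums_Suc_iff) (simp add: shcoeff_eq_0)
  moreover have "of_nat (Suc j) * (shcoeff z (Suc j) (Suc l) * isum i (Suc l)) =
   shcoeff z j l * (of_nat (Suc l) * isum i (Suc l))" for l by (rule shcoeff_Suc_Suc_mult)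
  ultimately show ?thesis by (simp only:)
 qed
 let ?A = "of_nat (Suc i) * D (Suc i) j + of_nat (Suc j) * D i (Suc j)"
 have A: "(%l. of_nat (Suc i) * (shcoeff z j l * isum (Suc i) l) + shcoeff z j l * (of_nat (Suc l) * isum i (Suc l))) sums ?A"
  by (intro sums_add sums_mult D D_Suc)
 have eA: "of_nat (Suc i) * (shcoeff z j l * isum (Suc i) l) + shcoeff z j l * (of_nat (Suc l) * isum i (Suc l)) =
   shcoeff z j l * defect t u i l" for l unfolding isum_step(1)[symmetric] by (simp only: distrib_left mult_ac)
 have "(%l. 1/2 * (hbeta i t * (shcoeff z j l * (of_nat (Suc l) * hb (Suc l) * inverse u ^ (2 * Suc l + 1))) -
    of_nat (Suc i) * hbeta (Suc i) t * (shcoeff z j l * (hb l * inverse u ^ (2 * l + 1))))) sums defect t t i j"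
  unfolding defect_def by (intro sums_mult sums_diff hb_sums hb_Suc_sums)
 moreover have "1/2 * (hbeta i t * (shcoeff z j l * (of_nat (Suc l) * hb (Suc l) * inverse u ^ (2 * Suc l + 1))) -
    of_nat (Suc i) * hbeta (Suc i) t * (shcoeff z j l * (hb l * inverse u ^ (2 * l + 1)))) = shcoeff z j l * defect t u i l" for l
  unfolding defect_def hbeta_def[of _ u] by (simp only: right_diff_distrib mult_ac)
 ultimately have dA: "?A = defect t t i j" using sums_unique2[OF A] unfolding eA by (simp only:)
 have "(%l. u^2 * (of_nat (Suc i) * (shcoeff z j l * isum (Suc i) l) + shcoeff z j l * (of_nat (Suc l) * isum i (Suc l))) +
   z * (of_nat (Suc i) * (shcoeff z j l * isum (Suc i) l)) + z * (of_nat (Suc j) * (shcoeff z (Suc j) l * isum i l))) sums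
   (u^2 * ?A + z * (of_nat (Suc i) * D (Suc i) j) + z * (of_nat (Suc j) * D i (Suc j)))" by (intro sums_add[OF sums_add] sums_mult D A)
 moreover have "u^2 * (of_nat (Suc i) * (shcoeff z j l * isum (Suc i) l) + shcoeff z j l * (of_nat (Suc l) * isum i (Suc l))) +
   z * (of_nat (Suc i) * (shcoeff z j l * isum (Suc i) l)) + z * (of_nat (Suc j) * (shcoeff z (Suc j) l * isum i l)) =
   - (of_nat (i + j) + 1) * (shcoeff z j l * isum i l)" for l
 proof -
  have "z * (of_nat (Suc j) * (shcoeff z (Suc j) l * isum i l)) = (of_nat l - of_nat j) * shcoeff z j l * isum i l"
   using shcoeff_Suc[OF z, of j l] unfolding mult.assoc[symmetric] by (simp only:)
  thus ?thesis using isum_step(2)[of i l] unfolding of_nat_add by algebra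
 qed
 ultimately have "(%l. - (of_nat (i + j) + 1) * (shcoeff z j l * isum i l)) sums
   (u^2 * ?A + z * (of_nat (Suc i) * D (Suc i) j) + z * (of_nat (Suc j) * D i (Suc j)))" by (simp only:)
 hence "u^2 * ?A + z * (of_nat (Suc i) * D (Suc i) j) + z * (of_nat (Suc j) * D i (Suc j)) = - (of_nat (i + j) + 1) * D i j"
  by (rule sums_unique2[OF _ sums_mult[OF D]])
 hence "t^2 * ?A = - (of_nat (i + j) + 1) * D i j" unfolding t_square by (simp only: distrib_left distrib_right add_ac)
 \<comment> \<open>Both variables sit at the same point, so Euler's identity and the defect equation
   involve the same combination \<open>?A\<close>. Together they determine \<open>D i j\<close>
   outright, without recursion or initial value.\<close>
 hence e: "t^2 * defect t t i j = - (of_nat (i + j) + 1) * D i j" unfolding dA .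
 have 1: "inverse t ^ (2 * (i + j + 2)) = inverse t ^ (2 * i + 1) * inverse t ^ (2 * Suc j + 1)"
  and 2: "inverse t ^ (2 * (i + j + 2)) = inverse t ^ (2 * Suc i + 1) * inverse t ^ (2 * j + 1)" by (simp_all only: power_add[symmetric]) simp_all
 have "defect t t i j = 1/2 * ((hb i * (of_nat (Suc j) * hb (Suc j)) * inverse t ^ (2 * (i + j + 2))) -
   of_nat (Suc i) * hb (Suc i) * hb j * inverse t ^ (2 * (i + j + 2)))" unfolding defect_def hbeta_def by (subst 1, subst 2) (simp only: mult_ac)
 also have "... = - (of_nat (i + j) + 1) * delta_fn i j * inverse t ^ (2 * (i + j + 2))"
  unfolding delta_fn_step(1)[symmetric] delta_fn_step(2) by (simp only: left_diff_distrib mult.assoc)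
 also have "t^2 * ... = - (of_nat (i + j) + 1) * (delta_fn i j * inverse t ^ (2 * (i + j + 1)))"
 proof -
  have "inverse t ^ (2 * (i + j + 2)) = inverse t ^ (2 * (i + j + 1)) * (inverse t)^2" by (simp only: power_add[symmetric]) simp
  hence "t^2 * inverse t ^ (2 * (i + j + 2)) = inverse t ^ (2 * (i + j + 1))" using t by (simp add: field_simps)
  thus ?thesis by (simp only: mult.left_commute[of "t^2"] mult.assoc)
 qed
 finally have "- (of_nat (i + j) + 1) * D i j = - (of_nat (i + j) + 1) * (delta_fn i j * inverse t ^ (2 * (i + j + 1)))" using e by simp
 moreover have "- (of_nat (i + j) + 1) ~= (0::complex)"
  using of_nat_neq_0[of "i + j", where ?'a = complex] by (simp only: of_nat_Suc add.commute neg_equal_0_iff_equal not_False_eq_True)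
 ultimately have "D i j = delta_fn i j * inverse t ^ (2 * (i + j + 1))" by (simp only: mult_cancel_left simp_thms)
 thus ?thesis using S[of j i] unfolding D_def by (simp only:)
qed

end

section \<open>Induced modules\<close>

abbreviation (input) "lin == Vector_Spaces.linear"

lemma pm_eq_sum_single:
 fixes x :: "'k \<Rightarrow>\<^sub>0 'a::comm_monoid_add" shows "x = (SUM u:Poly_Mapping.keys x. sgl u (Poly_Mapping.lookup x u))"
 by (rule poly_mapping_eqI)
  (auto simp: lookup_sum lookup_single when_def sum.delta' in_keys_iff)

lemma pm_induct [case_names single add]:
 fixes x :: "'k \<Rightarrow>\<^sub>0 'a::comm_monoid_add"
 assumes "!!u m. P (sgl u m)" and "!!x y. P x ==> P y ==> P (x + y)" shows "P x"
proof -
 have "P 0" using assms(1)[of undefined 0] by simp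
 hence "P (SUM u:A. sgl u (Poly_Mapping.lookup x u))" for A using assms by (induction A rule: infinite_finite_induct) auto
 thus ?thesis using pm_eq_sum_single[of x] by metis
qed

definition pm_sum :: "('k => 'a::ab_group_add => 'b::ab_group_add) => ('k \<Rightarrow>\<^sub>0 'a) => 'b" where
 "pm_sum F x = (SUM u:Poly_Mapping.keys x. F u (Poly_Mapping.lookup x u))"

lemma pm_sum_single: "F u 0 = 0 ==> pm_sum F (sgl u m) = F u m" by (simp add: pm_sum_def)

lemma pm_sum_add:
 assumes "!!u a b. F u (a + b) = F u a + F u b" shows "pm_sum F (x + y) = pm_sum F x + pm_sum F y"
proof -
 have 0: "F u 0 = 0" for u using assms[of u 0 0] by simp
 have *: "pm_sum F z = (SUM u:A. F u (Poly_Mapping.lookup z u))"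
  if "finite A" "Poly_Mapping.keys z \<subseteq> A" for A z
  unfolding pm_sum_def by (rule sum.mono_neutral_left) (use that in "auto simp: 0 in_keys_iff")
 let ?A = "Poly_Mapping.keys x \<union> Poly_Mapping.keys y"
 have "Poly_Mapping.keys (x + y) \<subseteq> ?A" by (rule Poly_Mapping.keys_add)
 thus ?thesis by (simp add: *[of ?A] lookup_add assms sum.distrib)
qed

lemma pm_sum_add_diff:
 assumes "!!u a b. F u (a + b) = F u a + F u b" shows "pm_sum F (x - y) = pm_sum F x - pm_sum F y"
 using pm_sum_add[where F = F, OF assms, of "x - y" y] by (simp add: algebra_simps)

lemma tens_eq: "tens sc r m = pm_sum (%u c. sgl u (sc c m)) r" by (simp add: tens_def pm_sum_def)

lemma prepend_eq: "prepend g x = pm_sum (%u m. sgl (g # u) m) x" by (simp add: prepend_def pm_sum_def)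

lemma prepend_add: "prepend g (x + y) = prepend g x + prepend g y" unfolding prepend_eq by (rule pm_sum_add) (simp add: single_add)

lemma prepend_single [simp]: "prepend g (sgl u m) = sgl (g # u) m" unfolding prepend_eq by (simp add: pm_sum_single)

lemma single_mult_single:
 "(sgl u c :: 'h free_alg) * sgl v c' = sgl (u @ v) (c * c')" by (simp add: mult_single plus_list_def)

lemma single_Nil_1: "sgl [] 1 = (1 :: 'h free_alg)" using single_one[where 'a = "'h gen list" and 'b = complex] by (simp add: zero_list_def)

lemma minus_one_power_eq: "(- 1 :: 'h free_alg) ^ n = sgl [] ((- 1) ^ n)" by (induction n)
  (simp_all add: single_mult_single single_Nil_1 flip: single_Nil_1 single_uminus)

lemma scomm_eq:
 "scomm g h = sgl [g, h] 1 - sgl [h, g] ((- 1) ^ (gpar g * gpar h))" unfolding scomm_def G_def minus_one_power_eq single_mult_single by simp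

lemma ideal_mult_left: "x \<in> two_sided_ideal R ==> t * x \<in> two_sided_ideal R"
proof (induction rule: two_sided_ideal.induct)
 case (ideal_gen r u v)
 thus ?case using two_sided_ideal.ideal_gen[of r R "t * u" v] by (simp add: mult.assoc)
qed (auto intro: two_sided_ideal.intros simp: distrib_left)

locale induced =
 fixes scM :: "complex => 'm::ab_group_add => 'm"
  and R :: "'h free_alg set" and gens :: "'h gen set" and actM :: "'h gen => 'm => 'm"
  and scW :: "complex => 'w::ab_group_add => 'w" and \<pi> :: "('h gen list \<Rightarrow>\<^sub>0 'm) => 'w"
 assumes scM: "vector_space scM"
  and actM: "!!g. lin scM scM (actM g)"
  and induced: "induced_module scM (two_sided_ideal R) gens actM scW \<pi>"
begin

sublocale M: complex_space scM using scM by (simp add: complex_space_def)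

lemma pi_linear: "lin (pm_scale scM) scW \<pi>" and pi_surj: "surj \<pi>"
 and pi_kernel: "{x. \<pi> x = 0} = module.span (pm_scale scM)
    ({tens scM r m | r m. r \<in> two_sided_ideal R} \<union>
     {tens scM (t * sgl u 1) m - tens scM t (foldr actM u m) | t u m. u \<in> lists gens})" using induced by (auto simp: induced_module_def)

sublocale W: complex_space scW using pi_linear by (simp add: complex_space_def Vector_Spaces.linear_def)

sublocale P: vector_space "pm_scale scM :: complex => ('h gen list \<Rightarrow>\<^sub>0 'm) => _"
 using pi_linear by (simp add: Vector_Spaces.linear_def)

sublocale pi: Vector_Spaces.linear "pm_scale scM" scW \<pi> by (rule pi_linear)

lemma pm_scale_single [simp]: "pm_scale scM c (sgl u m) = sgl u (scM c m)" by (simp add: pm_scale_def)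

lemma tens_add: "tens scM (r + r') m = tens scM r m + tens scM r' m"
 unfolding tens_eq by (rule pm_sum_add) (simp add: M.scale_left_distrib single_add)

lemma tens_single [simp]: "tens scM (sgl u c) m = sgl u (scM c m)" unfolding tens_eq by (simp add: pm_sum_single)

lemma prepend_tens: "prepend g (tens scM r m) = tens scM (G g * r) m"
proof (induction r rule: pm_induct)
 case (single u c)
 thus ?case by (simp add: G_def single_mult_single)
qed (simp add: tens_add prepend_add distrib_left)

lemma prepend_scale:
 fixes g :: "'h gen" shows "prepend g (pm_scale scM c x) = pm_scale scM c (prepend g x)"
 by (induction x rule: pm_induct) (simp_all add: prepend_add P.scale_right_distrib)

text \<open>Left multiplication by a generator maps the ideal to itself and only changes the left
  factor \<open>t\<close> of a balancing relation. Hence \<open>gen_op\<close> does not depend on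
  the preimage chosen by \<open>inv \<pi>\<close>.\<close>

lemma prepend_kernel: "\<pi> x = 0 ==> \<pi> (prepend g x) = 0"
proof -
 let ?S = "{tens scM r m | r m. r \<in> two_sided_ideal R} \<union>
     {tens scM (t * sgl u 1) m - tens scM t (foldr actM u m) | t u m. u \<in> lists gens}"
 have S: "\<pi> y = 0" if "y \<in> ?S" for y using P.span_base[OF that] pi_kernel by blast
 have prepend_diff: "prepend g (y - z) = prepend g y - prepend g z" for y z :: "'h gen list \<Rightarrow>\<^sub>0 'm"
  using prepend_add[of g "y - z" z] by (simp add: algebra_simps)
 have "prepend g y \<in> ?S" if y: "y \<in> ?S" for y using y
 proof
  assume "y \<in> {tens scM r m | r m. r \<in> two_sided_ideal R}"
  thus ?thesis using prepend_tens[of g] ideal_mult_left[of _ R "G g"] by blast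
 next
  assume "y \<in> {tens scM (t * sgl u 1) m - tens scM t (foldr actM u m) | t u m. u \<in> lists gens}"
  then obtain t u m where "y = tens scM (t * sgl u 1) m - tens scM t (foldr actM u m)"
   and u: "u \<in> lists gens" by blast
  hence "prepend g y = tens scM ((G g * t) * sgl u 1) m - tens scM (G g * t) (foldr actM u m)" by (simp add: prepend_diff prepend_tens mult.assoc)
  thus ?thesis using u by blast
 qed
 hence gen: "\<pi> (prepend g y) = 0" if "y \<in> ?S" for y using S that by blast
 assume "\<pi> x = 0"
 hence "x \<in> P.span ?S" using pi_kernel by blast
 thus "\<pi> (prepend g x) = 0"
 proof (induction rule: P.span_induct_alt)
  case base
  show ?case using prepend_scale[of g 0 0] by (simp add: pi.zero)
 next
  case (step c y z)
  thus ?case by (simp add: prepend_add prepend_scale pi.add pi.scale gen)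
 qed
qed

lemma gen_op_pi: "gen_op \<pi> g (\<pi> x) = \<pi> (prepend g x)"
proof -
 have "\<pi> (inv \<pi> (\<pi> x) - x) = 0" by (simp add: pi.diff surj_f_inv_f pi_surj)
 hence "\<pi> (prepend g (inv \<pi> (\<pi> x) - x)) = 0" by (rule prepend_kernel)
 moreover have "prepend g (inv \<pi> (\<pi> x)) = prepend g (inv \<pi> (\<pi> x) - x) + prepend g x" by (simp flip: prepend_add)
 ultimately show ?thesis by (simp add: gen_op_def pi.add)
qed

lemma gen_op_linear: "lin scW scW (gen_op \<pi> g)"
proof unfold_locales
 fix w w' c
 obtain x y where "w = \<pi> x" "w' = \<pi> y" using pi_surj by (metis surjD)
 thus "gen_op \<pi> g (w + w') = gen_op \<pi> g w + gen_op \<pi> g w'"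
  and "gen_op \<pi> g (scW c w) = scW c (gen_op \<pi> g w)" by (simp_all add: gen_op_pi prepend_add prepend_scale flip: pi.add pi.scale)
qed

definition wv :: "'h gen list => 'm => 'w" where
 "wv u m = \<pi> (sgl u m)"

lemma gen_op_wv [simp]: "gen_op \<pi> g (wv u m) = wv (g # u) m" by (simp add: wv_def gen_op_pi)

lemma wv_linear: "lin scM scW (wv u)" by unfold_locales (simp_all add: wv_def single_add pi.add flip: pi.scale)

lemma foldr_gen_op_wv: "foldr (gen_op \<pi>) v (wv u m) = wv (v @ u) m" by (induction v) simp_all

lemma wv_induct [case_names wv add]:
 assumes "!!u m. P (wv u m)" and "!!x y. P x ==> P y ==> P (x + y)" shows "P w"
proof -
 have "P (\<pi> x)" for x using assms by (induction x rule: pm_induct) (simp_all add: pi.add flip: wv_def)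
 thus ?thesis using pi_surj by (metis surjD)
qed

lemma wv_act:
 assumes "g \<in> gens" shows "wv (u @ [g]) m = wv u (actM g m)"
proof -
 have "tens scM (sgl u 1 * sgl [g] 1) m
   - tens scM (sgl u 1) (foldr actM [g] m) \<in> {x. \<pi> x = 0}" unfolding pi_kernel
  by (intro P.span_base UnI2 CollectI exI[of _ "sgl u 1"] exI[of _ "[g]"] exI[of _ m] conjI)
   (use assms in auto)
 thus ?thesis by (simp add: single_mult_single pi.diff wv_def)
qed

definition rel_op :: "'h free_alg => 'w => 'w" where
 "rel_op r w = pm_sum (%v c. scW c (foldr (gen_op \<pi>) v w)) r"

lemma rel_op_add: "rel_op (r + r') w = rel_op r w + rel_op r' w"
 and rel_op_diff: "rel_op (r - r') w = rel_op r w - rel_op r' w"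
 and rel_op_single: "rel_op (sgl v c) w = scW c (foldr (gen_op \<pi>) v w)" unfolding rel_op_def
 by (rule pm_sum_add pm_sum_add_diff, simp add: W.scale_left_distrib)+ (simp add: pm_sum_single)

lemma rel_op_0 [simp]: "rel_op 0 w = 0" using rel_op_diff[of 0 0 w] by simp

text \<open>Applied to the class of \<open>u\<close> tensor \<open>m\<close>, a relator gives the
  class of an element of the ideal, since the ideal absorbs \<open>u\<close> on the right.\<close>

lemma rel_op_relator:
 assumes "r \<in> R" shows "rel_op r w = 0"
proof (induction w rule: wv_induct)
 case (wv u m)
 have "rel_op r' (wv u m) = \<pi> (tens scM (r' * sgl u 1) m)" for r'
 proof (induction r' rule: pm_induct)
  case (single v c)
  interpret wv: Vector_Spaces.linear scM scW "wv (v @ u)" by (rule wv_linear)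
  show ?case by (simp add: rel_op_single single_mult_single foldr_gen_op_wv wv.scale flip: wv_def)
 qed (simp add: rel_op_add distrib_right tens_add pi.add)
 moreover have "1 * r * sgl u 1 \<in> two_sided_ideal R" using assms by (rule ideal_gen)
 hence "tens scM (r * sgl u 1) m \<in> {x. \<pi> x = 0}" unfolding pi_kernel by (intro P.span_base UnI1) auto
 ultimately show ?case by simp
next
 case (add x y)
 have "foldr (gen_op \<pi>) v (x + y) = foldr (gen_op \<pi>) v x + foldr (gen_op \<pi>) v y" for v
 proof (induction v)
  case (Cons g v)
  interpret g: Vector_Spaces.linear scW scW "gen_op \<pi> g" by (rule gen_op_linear)
  show ?case by (simp add: Cons g.add)
 qed simp
 hence "rel_op r' (x + y) = rel_op r' x + rel_op r' y" for r' by (simp add: rel_op_def pm_sum_def W.scale_right_distrib sum.distrib)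
 thus ?case using add by simp
qed

lemma rel_op_scomm: "rel_op (scomm g h) w =
  gen_op \<pi> g (gen_op \<pi> h w) - scW ((- 1) ^ (gpar g * gpar h)) (gen_op \<pi> h (gen_op \<pi> g w))"
 by (simp add: scomm_eq rel_op_diff rel_op_single)

text \<open>
 The universal property: \<open>T g\<close> is a transposed action of the generator \<open>g\<close> on a space \<open>L\<close> of word
 functionals with values in the maps on \<open>'m\<close>; the functional \<open>f\<close> induces a linear map on the module.
\<close>

lemma induced_extend:
 fixes T :: "'h gen => ('x list => 'm => 'y::ab_group_add) => 'x list => 'm => 'y"
 assumes scY: "vector_space scY"
  and T_add: "!!g F F'. T g (%w m. F w m + F' w m) = (%w m. T g F w m + T g F' w m)"
  and T_scale: "!!g F c. T g (%w m. scY c (F w m)) = (%w m. scY c (T g F w m))"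
  and T_L: "!!g F. F \<in> L ==> T g F \<in> L"
  and lin_L: "!!F w. F \<in> L ==> lin scM scY (F w)"
  and T_R: "!!F r w m. F \<in> L ==> r \<in> R ==> pm_sum (%u c. scY c (fold T u F w m)) r = 0"
  and T_gens: "!!F g m. F \<in> L ==> g \<in> gens ==> T g F [] m = F [] (actM g m)"
  and f: "f \<in> L" shows "\<exists>l. lin scW scY l & (\<forall>u m. l (wv u m) = fold T u f [] m)"
proof -
 interpret Y: complex_space scY using scY by (simp add: complex_space_def)
 define l0 where "l0 = pm_sum (%u m. fold T u f [] m)"
 have fold_L: "fold T u F \<in> L" if "F \<in> L" for u F using that by (induction u arbitrary: F) (simp_all add: T_L)
 have l0_add: "l0 (x + y) = l0 x + l0 y" for x y
 proof -
  have "fold T u f [] (a + b) = fold T u f [] a + fold T u f [] b" for u a b using lin_L[OF fold_L[OF f]] by (simp add: Vector_Spaces.linear_iff)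
  thus ?thesis unfolding l0_def by (rule pm_sum_add)
 qed
 have scale: "fold T u f [] (scM c a) = scY c (fold T u f [] a)" for u c a using lin_L[OF fold_L[OF f]] by (simp add: Vector_Spaces.linear_iff)
 have l0_single: "l0 (sgl u m) = fold T u f [] m" for u m unfolding l0_def using scale[of u 0 0] by (simp add: pm_sum_single)
 have l0_diff: "l0 (x - y) = l0 x - l0 y" for x y using l0_add[of "x - y" y] by (simp add: algebra_simps)
 have l0_scale: "l0 (pm_scale scM c x) = scY c (l0 x)" for c x by (induction x rule: pm_induct)
   (simp_all add: l0_single scale P.scale_right_distrib Y.scale_right_distrib l0_add)
 \<comment> \<open>Needed for relators inside a word: in \<open>u * r * v\<close> the letters of
   \<open>v\<close> act after the linear combination given by \<open>r\<close>, and
   \<open>fold\<close> has to be exchanged with it.\<close>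
 have fold_sum: "fold T v (%w m. SUM i:A. scY (a i) (F i w m)) = (%w m. SUM i:A. scY (a i) (fold T v (F i) w m))"
  for v A a and F :: "'h gen list => 'x list => 'm => 'y"
 proof (induction v arbitrary: F)
  case (Cons g v)
  have T0: "T g (%w m. 0) = (%w m. 0)" using T_scale[of g 0 "%w m. 0"] by simp
  have "T g (%w m. SUM i:A. scY (a i) (F i w m)) = (%w m. SUM i:A. scY (a i) (T g (F i) w m))"
   by (induction A rule: infinite_finite_induct) (simp_all add: T0 T_add T_scale)
  thus ?case by (simp add: Cons)
 qed simp
 have ideal: "l0 (tens scM r m) = 0" if "r \<in> two_sided_ideal R" for r m using that
 proof (induction rule: two_sided_ideal.induct)
  case ideal_zero
  thus ?case using l0_diff[of 0 0] by (simp add: tens_def)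
 next
  case (ideal_gen r u v)
  show ?case
  proof (induction u rule: pm_induct)
   case (single u c)
   show ?case
   proof (induction v rule: pm_induct)
    case (single v d)
    \<comment> \<open>Transposition reverses the nesting: the letters of \<open>u\<close> act on
      \<open>f\<close> before all others, so the relator is tested on \<open>fold T u f\<close>,
      which lies in \<open>L\<close>.\<close>
    have "l0 (tens scM (sgl u c * r' * sgl v d) m) =
      scY (c * d) (pm_sum (%w e. scY e (fold T v (fold T w (fold T u f)) [] m)) r')" for r'
    proof (induction r' rule: pm_induct)
     case (single w e)
     thus ?case using scale[of "u @ w @ v"] by (simp add: single_mult_single l0_single pm_sum_single mult_ac)
    next
     case (add x y)
     have "pm_sum (%w e. scY e (fold T v (fold T w (fold T u f)) [] m)) (x + y) =
      pm_sum (%w e. scY e (fold T v (fold T w (fold T u f)) [] m)) x +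
      pm_sum (%w e. scY e (fold T v (fold T w (fold T u f)) [] m)) y" by (rule pm_sum_add) (simp add: Y.scale_left_distrib)
     thus ?case using add by (simp add: distrib_left distrib_right tens_add l0_add Y.scale_right_distrib)
    qed
    also have "pm_sum (%w e. scY e (fold T v (fold T w (fold T u f)) [] m)) r =
      fold T v (%w' m'. pm_sum (%w e. scY e (fold T w (fold T u f) w' m')) r) [] m" by (simp only: pm_sum_def fold_sum)
    also have "... = 0"
    proof -
     have "fold T v (%w m. 0) = (%w m. 0)" using fold_sum[of v _ _ "{}"] by simp
     thus ?thesis using T_R[OF fold_L[OF f] ideal_gen] by simp
    qed
    finally show ?case by simp
   qed (simp add: distrib_left tens_add l0_add)
  qed (simp add: distrib_right tens_add l0_add)
 qed (simp add: tens_add l0_add)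
 have gens_fold: "fold T u F [] m = F [] (foldr actM u m)" if "F \<in> L" "u \<in> lists gens" for u F m
  using that(2,1) by (induction arbitrary: F rule: lists.induct) (simp_all add: T_L T_gens)
 have balanced: "l0 (tens scM (t * sgl u 1) m) = l0 (tens scM t (foldr actM u m))"
  if u: "u \<in> lists gens" for t u m
 proof (induction t rule: pm_induct)
  case (single v c)
  have "fold T (v @ u) f [] m = fold T v f [] (foldr actM u m)" by (simp add: gens_fold[OF fold_L[OF f] u])
  thus ?case using scale[of "v @ u" c m] scale[of v c] by (simp add: single_mult_single l0_single)
 qed (simp add: distrib_right tens_add l0_add)
 have kernel: "l0 x = 0" if "\<pi> x = 0" for x
 proof -
  have "x \<in> P.span ({tens scM r m | r m. r \<in> two_sided_ideal R} \<union>
     {tens scM (t * sgl u 1) m - tens scM t (foldr actM u m) | t u m. u \<in> lists gens})" using that pi_kernel by blast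
  thus ?thesis
  proof (induction rule: P.span_induct_alt)
   case base
   show ?case using l0_diff[of 0 0] by simp
  next
   case (step c y z)
   have "l0 y = 0" using step(1) ideal balanced l0_diff by (force simp del: in_lists_conv_set)
   thus ?case using step by (simp add: l0_add l0_scale)
  qed
 qed
 define l where "l w = l0 (inv \<pi> w)" for w
 have l_pi: "l (\<pi> x) = l0 x" for x using kernel[of "inv \<pi> (\<pi> x) - x"] by (simp add: l_def l0_diff pi.diff surj_f_inv_f pi_surj)
 have "lin scW scY l"
 proof (unfold_locales)
  fix w w' c
  obtain x y where "w = \<pi> x" "w' = \<pi> y" using pi_surj by (metis surjD)
  thus "l (w + w') = l w + l w'" and "l (scW c w) = scY c (l w)" by (simp_all add: l_pi l0_add l0_scale flip: pi.add pi.scale)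
 qed
 thus ?thesis by (intro exI[of _ l]) (simp add: wv_def l_pi l0_single)
qed

end

section \<open>Mode algebras\<close>

text \<open>
 The doubled degree of a mode: the untwisted algebra is the case \<open>d Fer = 1\<close>, the twisted one the
 case \<open>d Fer = 0\<close>.
\<close>

definition dg :: "(stat => int) => stat => int => int" where
 "dg d s k = 2 * k + d s"

text \<open>The supercommutator of a positive and a negative mode as a scalar;
  \<open>k + j + d s\<close> is half the sum of their doubled degrees. Setting both levels to 1
  gives the coefficient of the central generator in the relations.\<close>

definition contr_coeff ::
 "('h => 'h => complex) => (stat => int) => complex => complex => 'h mode => 'h mode => complex"
where
 "contr_coeff frm d lB lF = (%(s, a, k) (s', b, j).
   if s = s' & dg d s k > 0 & k + j + d s = 0
   then (case s of Bos => lB * (of_int k * frm a b) | Fer => lF * frm a b) else 0)"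

primrec center :: "stat => 'h gen" where
 "center Bos = KB"
| "center Fer = KF"

text \<open>One presentation for both algebras, so that V and W share all results on modes. No
  relation connects two modes of the same sign or two zero modes.\<close>

inductive_set mode_relators ::
 "(complex => 'h::ab_group_add => 'h) => ('h => 'h => complex) => (stat => int) => 'h free_alg set"
 for sc :: "complex => 'h::ab_group_add => 'h" and frm :: "'h => 'h => complex" and d :: "stat => int"
where
 m_add: "G (Mode s (a + b) k) - G (Mode s a k) - G (Mode s b k) \<in> mode_relators sc frm d"
| m_scale: "G (Mode s (sc c a) k) - Const c * G (Mode s a k) \<in> mode_relators sc frm d"
| m_central: "scomm KB KF \<in> mode_relators sc frm d"
| m_central_s: "scomm (Mode s a k) (center s') \<in> mode_relators sc frm d"
| m_zero: "dg d s k ~= 0 ==> dg d s' j = 0 ==> scomm (Mode s a k) (Mode s' b j) \<in> mode_relators sc frm d"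
| m_comm: "dg d s k > 0 ==> j < 0 ==> scomm (Mode s a k) (Mode s b j)
  - sgl [center s] (contr_coeff frm d 1 1 (s, a, k) (s, b, j)) \<in> mode_relators sc frm d"
| m_comm_BF: "dg d Bos m > 0 & n < 0 | m < 0 & dg d Fer n > 0 ==>
  scomm (Mode Bos a m) (Mode Fer b n) \<in> mode_relators sc frm d"

lemma Const_mult_G: "Const c * G g = sgl [g] c" by (simp add: Const_def G_def single_mult_single)

text \<open>Fermionic modes have odd doubled degree here, so the zero mode in \<open>m_zero\<close>
  can only be bosonic.\<close>

lemma untwisted_relators_eq:
 fixes frm :: "'h::ab_group_add => 'h => complex" shows "untwisted_relators sc frm = mode_relators sc frm (%s. int (par s))"
proof (intro equalityI subsetI)
 fix r assume "r \<in> untwisted_relators sc frm"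
 thus "r \<in> mode_relators sc frm (%s. int (par s))"
 proof cases
  case (central_B s a k)
  thus ?thesis using m_central_s[of s a k Bos] by simp
 next
  case (central_F s a k)
  thus ?thesis using m_central_s[of s a k Fer] by simp
 next
  case (comm_BB m n a b)
  thus ?thesis using m_comm[of "%s. int (par s)" Bos m n a b frm sc] by (simp add: Const_mult_G contr_coeff_def dg_def split: if_splits)
 next
  case (comm_FF m n a b)
  thus ?thesis using m_comm[of "%s. int (par s)" Fer m n a b frm sc] by (simp add: Const_mult_G contr_coeff_def dg_def split: if_splits)
 next
  case (zero_F a k b)
  have "2 * k + 1 ~= 0" by presburger
  thus ?thesis using zero_F by (simp add: m_zero dg_def)
 qed (auto simp: dg_def intro: mode_relators.intros)
next
 fix r :: "'h free_alg" assume "r \<in> mode_relators sc frm (%s. int (par s))"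
 thus "r \<in> untwisted_relators sc frm"
 proof cases
  case (m_central_s s a k s')
  thus ?thesis by (cases s') (simp_all add: untwisted_relators.intros)
 next
  case (m_zero s k s' j a b)
  hence [simp]: "s' = Bos" "j = 0" by (cases s'; simp add: dg_def; presburger)+
  show ?thesis using m_zero by (cases s) (simp_all add: dg_def untwisted_relators.intros)
 next
  case (m_comm s k j a b)
  show ?thesis
  proof (cases s)
   case Bos
   thus ?thesis using m_comm untwisted_relators.comm_BB[of k j a b frm sc] by (simp add: Const_mult_G contr_coeff_def dg_def split: if_splits)
  next
   case Fer
   thus ?thesis using m_comm untwisted_relators.comm_FF[of k j a b frm sc] by (simp add: Const_mult_G contr_coeff_def dg_def split: if_splits)
  qed
 next
  case (m_comm_BF m n a b)
  thus ?thesis by (auto simp: dg_def intro!: untwisted_relators.comm_BF)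
 qed (auto intro: untwisted_relators.intros)
qed

lemma twisted_relators_eq:
 fixes frm :: "'h::ab_group_add => 'h => complex" shows "twisted_relators sc frm = mode_relators sc frm (%s. 0)"
proof (intro equalityI subsetI)
 fix r assume "r \<in> twisted_relators sc frm"
 thus "r \<in> mode_relators sc frm (%s. 0)"
 proof cases
  case (tw_central_B s a k)
  thus ?thesis using m_central_s[of s a k Bos] by simp
 next
  case (tw_central_F s a k)
  thus ?thesis using m_central_s[of s a k Fer] by simp
 next
  case (tw_comm_BB m n a b)
  thus ?thesis using m_comm[of "%s. 0" Bos m n a b frm sc] by (simp add: Const_mult_G contr_coeff_def dg_def split: if_splits)
 next
  case (tw_comm_FF m n a b)
  thus ?thesis using m_comm[of "%s. 0" Fer m n a b frm sc] by (simp add: Const_mult_G contr_coeff_def dg_def split: if_splits)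
 qed (auto simp: dg_def intro: mode_relators.intros)
next
 fix r :: "'h free_alg" assume "r \<in> mode_relators sc frm (%s. 0)"
 thus "r \<in> twisted_relators sc frm"
 proof cases
  case (m_central_s s a k s')
  thus ?thesis by (cases s') (simp_all add: twisted_relators.intros)
 next
  case (m_zero s k s' j a b)
  thus ?thesis by (simp add: dg_def twisted_relators.intros)
 next
  case (m_comm s k j a b)
  show ?thesis
  proof (cases s)
   case Bos
   thus ?thesis using m_comm twisted_relators.tw_comm_BB[of k j a b frm sc] by (simp add: Const_mult_G contr_coeff_def dg_def split: if_splits)
  next
   case Fer
   thus ?thesis using m_comm twisted_relators.tw_comm_FF[of k j a b frm sc] by (simp add: Const_mult_G contr_coeff_def dg_def split: if_splits)
  qed
 next
  case (m_comm_BF m n a b)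
  thus ?thesis by (auto simp: dg_def intro!: twisted_relators.tw_comm_BF)
 qed (auto intro: twisted_relators.intros)
qed

text \<open>The word functionals that descend to the tensor algebra of the letters.\<close>

definition multilinear ::
 "(complex => 'h::ab_group_add => 'h) => (complex => 'y::ab_group_add => 'y) =>
  ((stat \<times> 'h \<times> 'j) list => 'y) => bool" where
 "multilinear scH scY f \<longleftrightarrow>
   (\<forall>u s a b j v. f (u @ (s, a + b, j) # v) = f (u @ (s, a, j) # v) + f (u @ (s, b, j) # v)) &
   (\<forall>u s c a j v. f (u @ (s, scH c a, j) # v) = scY c (f (u @ (s, a, j) # v)))"

lemma multilinear_Cons: "multilinear scH scY f ==> multilinear scH scY (%w. f (x # w))" unfolding multilinear_def by (metis append_Cons)

definition neg :: "'h letter => 'h mode" where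
 "neg x = (fst x, fst (snd x), - int (snd (snd x)))"

lemma neg_simps [simp]: "neg (s, a, m) = (s, a, - int m)" "fst (neg x) = fst x" by (simp_all add: neg_def)

text \<open>Instantiated for V with the scalars as coefficient space and for W with the given
  module; the two cases differ in \<open>d Fer\<close> and in the action of the zero modes.\<close>

locale mode_module = induced scM "mode_relators scH frm d" nonneg_gens actM scW \<pi>
 for scM :: "complex => 'm::ab_group_add => 'm"
  and scH :: "complex => 'h::ab_group_add => 'h" and frm d
  and actM :: "'h gen => 'm => 'm"
  and scW :: "complex => 'w::ab_group_add => 'w" and \<pi> +
 fixes lB lF :: complex
 assumes frm_linear: "!!a. lin scH (*) (frm a)" and frm_sym: "!!a b. frm a b = frm b a"
  and d_Bos: "d Bos = 0" and d_Fer: "d Fer = 0 | d Fer = 1"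
  and act_KB: "actM KB = scM lB" and act_KF: "actM KF = scM lF"
  and act_pos: "!!s a k m. dg d s k > 0 ==> actM (Mode s a k) m = 0"
  and act_add: "!!s a b k m. actM (Mode s (a + b) k) m = actM (Mode s a k) m + actM (Mode s b k) m"
  and act_scale: "!!s c a k m. actM (Mode s (scH c a) k) m = scM c (actM (Mode s a k) m)"
begin

abbreviation "kap == contr_coeff frm d lB lF"

lemma frm_add: "frm a (b + c) = frm a b + frm a c" "frm (b + c) a = frm b a + frm c a"
 and frm_scale: "frm a (scH k b) = k * frm a b" "frm (scH k b) a = k * frm b a"
 using frm_linear[of a] frm_sym by (simp_all add: Vector_Spaces.linear_iff)

lemma kap_add: "kap (s, a + b, k) y = kap (s, a, k) y + kap (s, b, k) y"
  "kap y (s, a + b, k) = kap y (s, a, k) + kap y (s, b, k)"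
 and kap_scale: "kap (s, scH c a, k) y = c * kap (s, a, k) y" "kap y (s, scH c a, k) = c * kap y (s, a, k)"
 by (auto simp: contr_coeff_def frm_add frm_scale algebra_simps split: prod.splits stat.splits)

lemma kap_homog: "homog (fst x) (%y. kap x (f y))" if "!!y. fst (f y) = fst y"
 using that by (auto simp: homog_def contr_coeff_def split: prod.splits) (metis fst_conv)

lemma d_cases: "d s = 0 | d s = 1" using d_Bos d_Fer by (cases s) auto

lemma dg_neg_iff: "dg d s k < 0 \<longleftrightarrow> k < 0" using d_cases[of s] by (auto simp: dg_def)

lemma kap_nonpos: "dg d s k <= 0 ==> kap (s, a, k) y = 0" by (auto simp: contr_coeff_def split: prod.splits)

abbreviation A :: "stat => 'h => int => 'w => 'w" where
 "A == mode_op \<pi>"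

lemma A_linear: "lin scW scW (A s a k)" unfolding mode_op_def by (rule gen_op_linear)

lemma A_add: "A s a k (v + w) = A s a k v + A s a k w"
 and A_scale: "A s a k (scW c v) = scW c (A s a k v)"
 and A_0 [simp]: "A s a k 0 = 0"
 and A_minus: "A s a k (- v) = - A s a k v"
 and A_diff: "A s a k (v - w) = A s a k v - A s a k w"
proof -
 interpret a: Vector_Spaces.linear scW scW "A s a k" by (rule A_linear)
 show "A s a k (v + w) = A s a k v + A s a k w" "A s a k (scW c v) = scW c (A s a k v)" "A s a k 0 = 0"
  "A s a k (- v) = - A s a k v" "A s a k (v - w) = A s a k v - A s a k w" by (fact a.add a.scale a.zero a.neg a.diff)+
qed

lemma A_add_left: "A s (a + b) k w = A s a k w + A s b k w"
proof -
 have "rel_op (G (Mode s (a + b) k) - G (Mode s a k) - G (Mode s b k)) w = 0" by (intro rel_op_relator mode_relators.intros)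
 thus ?thesis by (simp add: rel_op_diff rel_op_add rel_op_single G_def mode_op_def algebra_simps)
qed

lemma A_scale_left: "A s (scH c a) k w = scW c (A s a k w)"
proof -
 have "rel_op (G (Mode s (scH c a) k) - Const c * G (Mode s a k)) w = 0" by (intro rel_op_relator mode_relators.intros)
 thus ?thesis by (simp add: rel_op_diff rel_op_single Const_mult_G) (simp add: rel_op_single G_def mode_op_def)
qed

lemma A_super_zero:
 assumes "dg d s k ~= 0" "dg d s' j = 0" shows "A s a k (A s' b j w) = scW (sg s s') (A s' b j (A s a k w))"
proof -
 have "rel_op (scomm (Mode s a k) (Mode s' b j)) w = 0" using assms by (intro rel_op_relator mode_relators.intros)
 thus ?thesis by (simp add: rel_op_scomm mode_op_def power_par_eq_sg)
qed

lemma center_scalar: "gen_op \<pi> (center s) w = scW (case s of Bos => lB | Fer => lF) w"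
proof -
 let ?l = "case s of Bos => lB | Fer => lF"
 have *: "actM (center s) = scM ?l" "center s \<in> nonneg_gens" by (cases s; simp add: act_KB act_KF nonneg_gens_def)+
 have comm: "gen_op \<pi> (center s) (gen_op \<pi> g x) = gen_op \<pi> g (gen_op \<pi> (center s) x)" for g x
 proof (cases g)
  case (Mode s' a k)
  have "rel_op (scomm (Mode s' a k) (center s)) x = 0" by (intro rel_op_relator mode_relators.intros)
  moreover have "gpar (center s :: 'h gen) = 0" by (cases s) simp_all
  ultimately show ?thesis by (simp add: rel_op_scomm Mode)
 next
  case KB
  have "rel_op (scomm KB KF) x = 0" by (intro rel_op_relator mode_relators.intros)
  thus ?thesis by (cases s) (simp_all add: rel_op_scomm KB)
 next
  case KF
  have "rel_op (scomm KB KF) x = 0" by (intro rel_op_relator mode_relators.intros)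
  thus ?thesis by (cases s) (simp_all add: rel_op_scomm KF)
 qed
 interpret c: Vector_Spaces.linear scW scW "gen_op \<pi> (center s)" by (rule gen_op_linear)
 show ?thesis
 proof (induction w rule: wv_induct)
  case (wv u m)
  show ?case
  proof (induction u)
   case Nil
   interpret wv: Vector_Spaces.linear scM scW "wv []" by (rule wv_linear)
   show ?case using wv_act[OF *(2), of "[]" m] by (simp add: *(1) wv.scale)
  next
   case (Cons g u)
   interpret g: Vector_Spaces.linear scW scW "gen_op \<pi> g" by (rule gen_op_linear)
   have "gen_op \<pi> (center s) (gen_op \<pi> g (wv u m)) = gen_op \<pi> g (scW ?l (wv u m))" using Cons by (simp only: comm)
   thus ?case by (simp add: g.scale)
  qed
 qed (simp add: c.add W.scale_right_distrib)
qed

text \<open>The relations distinguish signs and statistics; here they take one form, because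
  \<open>kap\<close> vanishes for a zero mode and for different statistics.\<close>

lemma A_super_neg:
 assumes k: "dg d s k >= 0" and j: "j < 0" shows "A s a k (A s' b j w) = scW (sg s s') (A s' b j (A s a k w)) + scW (kap (s, a, k) (s', b, j)) w"
proof -
 consider "dg d s k = 0" | "dg d s k > 0" "s = s'" | "dg d s k > 0" "s ~= s'" using k by linarith
 thus ?thesis
 proof cases
  case 1
  have "dg d s' j ~= 0" using j dg_neg_iff[of s' j] by simp
  from A_super_zero[OF this 1, of b a w] 1 show ?thesis by (simp add: kap_nonpos sg_sym)
 next
  case 2
  have "rel_op (scomm (Mode s a k) (Mode s b j)
    - sgl [center s] (contr_coeff frm d 1 1 (s, a, k) (s, b, j))) w = 0" using 2 j by (intro rel_op_relator mode_relators.intros)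
  hence "A s a k (A s b j w) = scW (sg s s) (A s b j (A s a k w)) +
    scW (contr_coeff frm d 1 1 (s, a, k) (s, b, j)) (scW (case s of Bos => lB | Fer => lF) w)"
   by (simp add: rel_op_diff rel_op_scomm rel_op_single mode_op_def power_par_eq_sg center_scalar algebra_simps)
  moreover have "contr_coeff frm d 1 1 (s, a, k) (s, b, j) * (case s of Bos => lB | Fer => lF) =
    kap (s, a, k) (s, b, j)" by (cases s) (simp_all add: contr_coeff_def)
  ultimately show ?thesis using 2 by simp
 next
  case 3
  have "kap (s, a, k) (s', b, j) = 0" using 3 by (simp add: contr_coeff_def)
  moreover have "A s a k (A s' b j w) = A s' b j (A s a k w)"
  proof (cases s)
   case Bos
   hence "s' = Fer" using 3 by (cases s') auto
   have "rel_op (scomm (Mode Bos a k) (Mode Fer b j)) w = 0" using 3 j Bos by (intro rel_op_relator mode_relators.intros) simp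
   thus ?thesis using Bos \<open>s' = Fer\<close> by (simp add: rel_op_scomm mode_op_def)
  next
   case Fer
   hence "s' = Bos" using 3 by (cases s') auto
   have "rel_op (scomm (Mode Bos b j) (Mode Fer a k)) w = 0" using 3 j Fer by (intro rel_op_relator mode_relators.intros) simp
   thus ?thesis using Fer \<open>s' = Bos\<close> by (simp add: rel_op_scomm mode_op_def)
  qed
  moreover have "sg s s' = 1" using 3 by (cases s; cases s') auto
  ultimately show ?thesis by simp
 qed
qed

definition io :: "'m => 'w" where
 "io m = wv [] m"

lemma io_linear: "lin scM scW io" using wv_linear[of "[]"] by (simp add: io_def[abs_def])

lemma A_io: "dg d s k >= 0 ==> A s a k (io m) = io (actM (Mode s a k) m)" using wv_act[of "Mode s a k" "[]" m] dg_neg_iff[of s k]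
 by (auto simp: io_def mode_op_def nonneg_gens_def)

lemma A_io_pos: "dg d s k > 0 ==> A s a k (io m) = 0"
proof -
 interpret io: Vector_Spaces.linear scM scW io by (rule io_linear)
 assume "dg d s k > 0"
 thus ?thesis by (simp add: A_io act_pos)
qed

lemma create_Nil [simp]: "create A [] w = w"
 and create_Cons [simp]: "create A ((s, a, m) # xs) w = A s a (- int m) (create A xs w)" by (simp_all add: create_def apply_modes_def)

lemma creation_words_simps [simp]:
 "[] \<in> CW" "(s, a, m) # xs \<in> CW \<longleftrightarrow> m >= 1 & xs \<in> CW" by (auto simp: creation_words_def)

text \<open>A nonnegative mode moves right through the creation operators, leaving a scalar multiple
  of a shorter word at each one, until it acts on the coefficient space.\<close>

lemma create_span: "W.span {create A xs (io m) | xs m. xs \<in> CW} = UNIV"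
proof -
 let ?S = "{create A xs (io m) | xs m. xs \<in> CW}"
 have in_span: "create A xs (io m) \<in> W.span ?S" if "xs \<in> CW" for xs m by (rule W.span_base) (use that in blast)
 have A_closed: "A s a k w \<in> W.span ?S" if "w \<in> W.span ?S" for s a k w
 proof -
  have *: "A s a k (create A xs (io m)) \<in> W.span ?S" if "xs \<in> CW" for xs m s a k
  proof (cases "k < 0")
   case True
   thus ?thesis using in_span[of "(s, a, nat (- k)) # xs" m] that by simp
  next
   case False
   hence k: "dg d s k >= 0" using dg_neg_iff by (meson linorder_not_less)
   show ?thesis using that
   proof (induction xs)
    case Nil
    show ?case using in_span[of "[]"] by (simp add: A_io[OF k])
   next
    case (Cons x xs)
    obtain s' b j where x: "x = (s', b, j)" by (cases x)
    have j: "- int j < 0" "xs \<in> CW" using Cons.prems x by simp_all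
    have "A s' b (- int j) w \<in> W.span ?S" if "w \<in> W.span ?S" for w using that
    proof (induction rule: W.span_induct_alt)
     case base
     show ?case by (simp add: W.span_zero)
    next
     case (step c y z)
     then obtain ys m' where y: "y = create A ys (io m')" "ys \<in> CW" by blast
     have "create A ((s', b, j) # ys) (io m') \<in> W.span ?S" by (rule in_span) (use y j in simp)
     thus ?case using step y by (simp add: A_add A_scale W.span_add W.span_scale)
    qed
    moreover have "create A xs (io m) \<in> W.span ?S" using j by (intro in_span)
    ultimately show ?case using Cons.IH j by (simp add: x A_super_neg[OF k j(1)] W.span_add W.span_scale)
   qed
  qed
  show ?thesis using that
  proof (induction rule: W.span_induct_alt)
   case (step c y z)
   hence "A s a k y \<in> W.span ?S" using * by blast
   thus ?case using step by (simp add: A_add A_scale W.span_add W.span_scale)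
  qed (simp add: W.span_zero)
 qed
 have "wv u m \<in> W.span ?S" for u m
 proof (induction u)
  case Nil
  show ?case using in_span[of "[]" m] by (simp add: io_def)
 next
  case (Cons g u)
  have "gen_op \<pi> g (wv u m) \<in> W.span ?S"
  proof (cases g)
   case (Mode s a k)
   thus ?thesis using A_closed[OF Cons, of s a k] by (simp add: mode_op_def)
  next
   case KB
   thus ?thesis using center_scalar[of Bos] Cons by (simp add: W.span_scale del: gen_op_wv)
  next
   case KF
   thus ?thesis using center_scalar[of Fer] Cons by (simp add: W.span_scale del: gen_op_wv)
  qed
  thus ?case by simp
 qed
 hence "w \<in> W.span ?S" for w by (induction w rule: wv_induct) (auto intro: W.span_add)
 thus ?thesis by auto
qed

end

abbreviation sign_prod :: "stat => (stat \<times> 'r) list => complex" where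
 "sign_prod s w == (PROD x<-w. sg s (fst x))"

context complex_space
begin

lemma contract_multilinear:
 assumes Ps: "multilinear scH sc Ps"
  and "!!s a b j. ph (s, a + b, j) = ph (s, a, j) + ph (s, b, j)"
  and "!!s c a j. ph (s, scH c a, j) = c * ph (s, a, j)" shows "multilinear scH sc (%w. contract t ph w Ps)"
proof -
 have add: "Ps (u @ (s, a + b, j) # v) = Ps (u @ (s, a, j) # v) + Ps (u @ (s, b, j) # v)"
  and scale: "Ps (u @ (s, scH c a, j) # v) = sc c (Ps (u @ (s, a, j) # v))" for u v s a b c j using Ps by (auto simp: multilinear_def)
 have add': "Ps (w @ u @ (s, a + b, j) # v) = Ps (w @ u @ (s, a, j) # v) + Ps (w @ u @ (s, b, j) # v)"
  and scale': "Ps (w @ u @ (s, scH c a, j) # v) = sc c (Ps (w @ u @ (s, a, j) # v))" for u v w s a b c j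
  using add[of "w @ u"] scale[of "w @ u"] by simp_all
 show ?thesis unfolding multilinear_def by (simp add: contract_append add scale add' scale' assms contract_add contract_scale algebra_simps)
qed

end

section \<open>Freeness of the creation words over the coefficient space\<close>

context mode_module
begin

text \<open>The action on creation words as dictated by \<open>A_super_neg\<close>: a negative mode
  adds a letter, any other mode is contracted with a letter or reaches the coefficient space with
  the sign of having passed them all.\<close>

definition transp ::
 "(complex => 'y => 'y) => 'h gen => ('h word => 'm => 'y) =>
  'h word => 'm => 'y::ab_group_add" where
 "transp scY g F = (case g of
   Mode s a k => (%w m. if k < 0 then F ((s, a, nat (- k)) # w) m
    else complex_space.contract scY s (%x. kap (s, a, k) (neg x)) w (%v. F v m) +
       scY (sign_prod s w) (F w (actM (Mode s a k) m)))
  | KB => (%w m. scY lB (F w m)) | KF => (%w m. scY lF (F w m)))"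

lemma kap_neg_add: "kap x (neg (s, a + b, j)) = kap x (neg (s, a, j)) + kap x (neg (s, b, j))"
 and kap_neg_scale: "kap x (neg (s, scH c a, j)) = c * kap x (neg (s, a, j))" by (simp_all add: kap_add kap_scale)

text \<open>Creation words act freely on the coefficient space: \<open>transp\<close> respects all
  relators, so the universal property applies. The well-definedness of vertex operators and the
  directness of the grading rest on this.\<close>

lemma creation_extend:
 fixes f :: "'h word => 'm => 'y::ab_group_add"
 assumes scY: "vector_space scY"
  and f_multilinear: "!!m. multilinear scH scY (%w. f w m)" and f_linear: "!!w. lin scM scY (f w)"
 shows "\<exists>l. lin scW scY l & (\<forall>xs\<in>CW. \<forall>m. l (create A xs (io m)) = f xs m)"
proof -
 interpret Y: complex_space scY using scY by (simp add: complex_space_def)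
 define L where "L = {F :: 'h word => 'm => 'y.
  (\<forall>m. multilinear scH scY (%w. F w m)) & (\<forall>w. lin scM scY (F w))}"
 let ?T = "transp scY"
 have M_add: "F w (x + y) = F w x + F w y" and M_scale: "F w (scM c x) = scY c (F w x)"
  and M_0: "F w 0 = 0" if "F \<in> L" for F w x y c
 proof -
  interpret F: Vector_Spaces.linear scM scY "F w" using that by (simp add: L_def)
  show "F w (x + y) = F w x + F w y" "F w (scM c x) = scY c (F w x)" "F w 0 = 0" by (fact F.add F.scale F.zero)+
 qed
 have F_add: "F ((s, a + b, j) # v) m = F ((s, a, j) # v) m + F ((s, b, j) # v) m"
  and F_scale: "F ((s, scH c a, j) # v) m = scY c (F ((s, a, j) # v) m)" if "F \<in> L" for F s a b c j v m
  using that unfolding L_def multilinear_def by (metis (mono_tags, lifting) append_Nil mem_Collect_eq)+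
 have act_lin: "actM g (x + y) = actM g x + actM g y" "actM g (scM c x) = scM c (actM g x)" for g x y c
  using actM[of g] by (simp_all add: Vector_Spaces.linear_iff)
 have act_0: "actM g 0 = 0" for g using act_lin(2)[of g 0 0] by simp
 have T_L: "?T g F \<in> L" if F: "F \<in> L" for g F
 proof -
  have mF: "multilinear scH scY (%w. F w m)" for m using F by (simp add: L_def)
  have "multilinear scH scY (%w. ?T g F w m)" for m
  proof (cases g)
   case (Mode s a k)
   have "multilinear scH scY (%w. Y.contract s (%x. kap (s, a, k) (neg x)) w (%v. F v m))"
    by (rule Y.contract_multilinear[OF mF]) (simp_all add: kap_neg_add kap_neg_scale del: neg_simps)
   thus ?thesis using mF[of m] mF[of "actM (Mode s a k) m"] multilinear_Cons[OF mF, of "(s, a, nat (- k))" m]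
    by (simp add: Mode transp_def multilinear_def algebra_simps)
  next
   case KB
   thus ?thesis using mF[of m] by (simp add: transp_def multilinear_def algebra_simps)
  next
   case KF
   thus ?thesis using mF[of m] by (simp add: transp_def multilinear_def algebra_simps)
  qed
  moreover have "lin scM scY (?T g F w)" for w by unfold_locales
    (simp_all add: transp_def M_add[OF F] M_scale[OF F] act_lin Y.contract_add Y.contract_scale algebra_simps
     split: gen.splits)
  ultimately show ?thesis by (simp add: L_def)
 qed
 have neg_contract: "Y.contract s (%x. kap (s, a, k) (neg x)) w Ps = 0" if "dg d s k = 0" for s a k w Ps using that by (simp add: kap_nonpos)
 have T_R: "pm_sum (%u c. scY c (fold ?T u F w m)) r = 0" if F: "F \<in> L" and r: "r \<in> mode_relators scH frm d"
  for F r w m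
 proof -
  define R where "R r = pm_sum (%u c. scY c (fold ?T u F w m)) r" for r
  have R_add: "R (r + r') = R r + R r'" and R_diff: "R (r - r') = R r - R r'"
   and R_single: "R (sgl u c) = scY c (fold ?T u F w m)" for r r' u c unfolding R_def
   by (rule pm_sum_add pm_sum_add_diff, simp add: Y.scale_left_distrib)+ (simp add: pm_sum_single)
  have R_scomm: "R (scomm g h) = ?T h (?T g F) w m - scY ((- 1) ^ (gpar g * gpar h)) (?T g (?T h F) w m)" for g h
   by (simp add: scomm_eq R_diff R_single)
  have scale_T: "?T g (%w m. scY c (F w m)) w m = scY c (?T g F w m)" for g c
   by (simp add: transp_def Y.contract_scale algebra_simps split: gen.splits)
  from r have "R r = 0"
  proof cases
   case (m_add s a b k)
   have "kap (s, a + b, k) (neg x) = kap (s, a, k) (neg x) + kap (s, b, k) (neg x)" for x by (rule kap_add)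
   thus ?thesis by (simp add: m_add G_def R_diff R_add R_single transp_def F_add[OF F] act_add M_add[OF F]
      Y.contract_add_left algebra_simps)
  next
   case (m_scale s c a k)
   have "kap (s, scH c a, k) (neg x) = c * kap (s, a, k) (neg x)" for x by (rule kap_scale)
   thus ?thesis by (simp add: m_scale Const_mult_G R_diff)
     (simp add: G_def R_single transp_def F_scale[OF F] act_scale M_scale[OF F]
      Y.contract_scale_left algebra_simps)
  next
   case m_central
   thus ?thesis by (simp add: R_scomm transp_def algebra_simps)
  next
   case (m_central_s s a k s')
   have "gpar (center s' :: 'h gen) = 0" by (cases s') simp_all
   moreover have "?T (center s') H = (%w m. scY (case s' of Bos => lB | Fer => lF) (H w m))" for H by (cases s') (simp_all add: transp_def)
   ultimately show ?thesis by (simp add: m_central_s R_scomm scale_T)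
  next
   case (m_zero s k s' j a b)
   have j: "~ j < 0" using m_zero dg_neg_iff[of s' j] by simp
   show ?thesis
   proof (cases "k < 0")
    case True
    thus ?thesis using j by (simp add: m_zero R_scomm power_par_eq_sg transp_def neg_contract sg_sym[of s' s])
   next
    case False
    hence k: "dg d s k > 0" using m_zero(2) dg_neg_iff[of s k] by linarith
    \<comment> \<open>\<open>kap\<close> vanishes unless the contracted letter has parity
      \<open>s\<close>, so losing that letter changes the sign by the fixed factor
      \<open>sg s' s\<close>.\<close>
    have hom: "kap (s, a, k) (neg x) = sg s' s * sg s' (fst x) * kap (s, a, k) (neg x)" for x
     using kap_homog[of neg "(s, a, k)"] by (cases x; cases "fst x = s") (auto simp: homog_def)
    have "Y.contract s (%x. kap (s, a, k) (neg x)) w (%v. scY (sign_prod s' v) (F v (actM (Mode s' b j) m))) =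
     scY (sg s' s * sign_prod s' w) (Y.contract s (%x. kap (s, a, k) (neg x)) w (%v. F v (actM (Mode s' b j) m)))"
     by (rule Y.contract_weight) (rule hom)
    thus ?thesis using j False by (simp add: m_zero R_scomm power_par_eq_sg transp_def neg_contract act_pos[OF k] M_0[OF F]
       M_0[OF T_L[OF F]] act_0 Y.scale_right_distrib sg_sym[of s' s] flip: mult.assoc)
   qed
  next
   case (m_comm s k j a b)
   have k: "~ k < 0" using m_comm dg_neg_iff[of s k] by simp
   have "contr_coeff frm d 1 1 (s, a, k) (s, b, j) * (case s of Bos => lB | Fer => lF) =
    kap (s, a, k) (s, b, j)" by (cases s) (simp_all add: contr_coeff_def)
   moreover have "?T (center s) F = (%w m. scY (case s of Bos => lB | Fer => lF) (F w m))" by (cases s) (simp_all add: transp_def)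
   ultimately have "R (sgl [center s] (contr_coeff frm d 1 1 (s, a, k) (s, b, j))) =
     scY (kap (s, a, k) (s, b, j)) (F w m)" by (simp add: R_single)
   \<comment> \<open>The contraction with the newly added letter \<open>b\<close> produces the
     scalar; all other terms cancel.\<close>
   moreover have "R (scomm (Mode s a k) (Mode s b j)) = scY (kap (s, a, k) (s, b, j)) (F w m)" using k m_comm(2,3)
    by (simp add: R_scomm power_par_eq_sg transp_def act_pos M_0[OF F] M_0[OF T_L[OF F]] Y.scale_right_distrib)
   ultimately show ?thesis by (simp add: m_comm(1) R_diff)
  next
   case (m_comm_BF k n a b)
   have 0: "kap (s, a, k) (neg (t, b, j)) = 0" if "s ~= t" for s t a b k j using that by (simp add: contr_coeff_def)
   from m_comm_BF(2) show ?thesis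
   proof
    assume *: "dg d Bos k > 0 & n < 0"
    hence "~ k < 0" using dg_neg_iff[of Bos k] by simp
    thus ?thesis using * 0[of Bos Fer a k b "nat (- n)"] by (simp add: m_comm_BF R_scomm transp_def act_pos M_0[OF F] M_0[OF T_L[OF F]])
   next
    assume *: "k < 0 & dg d Fer n > 0"
    hence "~ n < 0" using dg_neg_iff[of Fer n] by simp
    thus ?thesis using * 0[of Fer Bos b n a "nat (- k)"] by (simp add: m_comm_BF R_scomm transp_def act_pos M_0[OF F] M_0[OF T_L[OF F]])
   qed
  qed
  thus ?thesis by (simp add: R_def)
 qed
 have "\<exists>l. lin scW scY l & (\<forall>u m. l (wv u m) = fold ?T u f [] m)"
 proof (rule induced_extend[where L = L])
  show "?T g F [] m = F [] (actM g m)" if "F \<in> L" "g \<in> nonneg_gens" for F g m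
   using that by (auto simp: nonneg_gens_def transp_def act_KB act_KF M_scale)
  show "f \<in> L" using f_multilinear f_linear by (simp add: L_def)
  show "lin scM scY (F w)" if "F \<in> L" for F w using that by (simp add: L_def)
  show "?T g (%w m. F w m + F' w m) = (%w m. ?T g F w m + ?T g F' w m)" for g F F'
   by (intro ext) (simp add: transp_def Y.contract_add algebra_simps split: gen.splits)
  show "?T g (%w m. scY c (F w m)) = (%w m. scY c (?T g F w m))" for g F c
   by (intro ext) (simp add: transp_def Y.contract_scale algebra_simps split: gen.splits)
 qed (rule scY T_L T_R; assumption)+
 then obtain l where l: "lin scW scY l" "!!u m. l (wv u m) = fold ?T u f [] m" by blast
 have "create A xs (io m) = wv (map (%(s, a, j). Mode s a (- int j)) xs) m" for xs m by (induction xs) (auto simp: io_def, simp add: mode_op_def)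
 moreover have "fold ?T (map (%(s, a, j). Mode s a (- int j)) xs) F v m = F (xs @ v) m"
  if "xs \<in> CW" for xs F v m using that by (induction xs arbitrary: F) (auto simp: transp_def)
 ultimately show ?thesis using l by (intro exI[of _ l]) simp
qed

end

section \<open>Normal ordering as a Wick exponential\<close>

lemma sign_prod_Fer: "sign_prod Fer w = (- 1) ^ length (filter (%y. fst y = Fer) w)" by (induction w) (auto simp: sg_def)

lemma prod_list_1 [simp]: "(PROD x<-w. 1 :: complex) = 1" by (induction w) simp_all

lemma sign_prod_sign_prod [simp]: "sign_prod s w * sign_prod s w = 1" "sign_prod s w * (sign_prod s w * c) = c"
proof -
 show "sign_prod s w * sign_prod s w = 1" by (induction w) (simp_all add: mult_ac)
 thus "sign_prod s w * (sign_prod s w * c) = c" by (simp flip: mult.assoc)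
qed

text \<open>An inversion either involves the first position or lies in the tail.\<close>

lemma fermion_sign_Cons:
 "fermion_sign g (x # L) =
   sign_prod (fst x) (filter (%y. mode_group g y < mode_group g x) L) * fermion_sign g L"
proof -
 let ?P = "%L i j. i < j & j < length L & fst (L ! i) = Fer & fst (L ! j) = Fer &
  mode_group g (L ! j) < mode_group g (L ! i)"
 let ?A = "%L. {(i, j). ?P L i j}"
 let ?B = "{j. j < length L & fst x = Fer & fst (L ! j) = Fer & mode_group g (L ! j) < mode_group g x}"
 have "?A (x # L) = (%j. (0, Suc j)) ` ?B \<union> (%(i, j). (Suc i, Suc j)) ` ?A L"
 proof (rule set_eqI, clarify)
  fix i j
  show "(i, j) \<in> ?A (x # L) \<longleftrightarrow> (i, j) \<in> (%j. (0, Suc j)) ` ?B \<union> (%(i, j). (Suc i, Suc j)) ` ?A L"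
   by (cases i; cases j) auto
 qed
 moreover have "finite (?A L)" by (rule finite_subset[of _ "{..<length L} \<times> {..<length L}"]) auto
 moreover have "inj_on (%(i, j). (Suc i, Suc j)) (?A L)" "inj_on (%j. (0::nat, Suc j)) ?B" by (auto simp: inj_on_def)
 ultimately have "card (?A (x # L)) = card ?B + card (?A L)" by (subst \<open>?A (x # L) = _\<close>, subst card_Un_disjoint) (auto simp: card_image)
 moreover have "(- 1 :: complex) ^ card ?B = sign_prod (fst x) (filter (%y. mode_group g y < mode_group g x) L)"
 proof (cases "fst x")
  case Fer
  hence "card ?B = length (filter (%y. fst y = Fer & mode_group g y < mode_group g x) L)" by (simp add: length_filter_conv_card)
  thus ?thesis using Fer by (simp add: sign_prod_Fer conj_commute)
 qed simp
 ultimately show ?thesis by (simp add: fermion_sign_def power_add)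
qed

context mode_module
begin

abbreviation "hdeg == %s k. real_of_int (dg d s k) / 2"

definition zero_contr :: "stat \<times> 'h => stat \<times> 'h => complex" where
 "zero_contr x y = (if fst x = Fer & fst y = Fer then lF * frm (snd x) (snd y) / 2 else 0)"

text \<open>The contraction of two modes: supercommutators, and half of them for two zero modes.\<close>

definition kapn :: "'h mode => 'h mode => complex" where
 "kapn = (%(s, a, k) (s', b, j). kap (s, a, k) (s', b, j) +
   (if dg d s k = 0 & dg d s' j = 0 then zero_contr (s, a) (s', b) else 0))"

definition Ap :: "'h mode => 'w => 'w" where
 "Ap = (%(s, a, k). A s a k)"

definition zno :: "'h mode list => 'w => 'w" where
 "zno z = zero_normal_order frm lF scW A (map (%(s, a, k). (s, a)) z)"

definition NO :: "'h mode list => 'w => 'w" where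
 "NO ms w = scW (fermion_sign hdeg ms)
   (apply_modes A (modes_in hdeg 0 ms @ modes_in hdeg 1 ms) (zno (modes_in hdeg 2 ms) w))"

lemma apply_modes_simps [simp]: "apply_modes A [] w = w"
 "apply_modes A (x # ms) w = Ap x (apply_modes A ms w)" by (simp_all add: apply_modes_def Ap_def case_prod_unfold)

lemma apply_modes_append: "apply_modes A (u @ v) w = apply_modes A u (apply_modes A v w)" by (simp add: apply_modes_def)

lemma Ap_linear: "lin scW scW (Ap x)" using A_linear by (cases x) (simp add: Ap_def)

lemma Ap_add: "Ap x (v + w) = Ap x v + Ap x w"
 and Ap_diff: "Ap x (v - w) = Ap x v - Ap x w"
 and Ap_scale: "Ap x (scW c v) = scW c (Ap x v)" and Ap_0 [simp]: "Ap x 0 = 0" by (cases x; simp add: Ap_def A_add A_diff A_scale)+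

lemma lin_id: "lin scW scW (%x. x)" by unfold_locales simp_all

lemma apply_modes_linear: "lin scW scW (apply_modes A ms)"
proof (induction ms)
 case (Cons x ms)
 thus ?case using Vector_Spaces.linear_compose[OF Cons Ap_linear[of x]] by (simp add: comp_def)
qed (simp add: lin_id)

lemma apply_add: "apply_modes A ms (v + w) = apply_modes A ms v + apply_modes A ms w"
 and apply_diff: "apply_modes A ms (v - w) = apply_modes A ms v - apply_modes A ms w"
 and apply_scale: "apply_modes A ms (scW c v) = scW c (apply_modes A ms v)" by (induction ms) (simp_all add: Ap_add Ap_diff Ap_scale)

lemma kapn_homog: "homog (fst x) (kapn x)" by (auto simp: homog_def kapn_def contr_coeff_def zero_contr_def split: prod.splits)

text \<open>Distributes the letters over the three groups from the right end, each with the sign of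
  passing the fermions already placed in earlier groups. Unlike the count of inversions in
  \<open>fermion_sign\<close>, this recursion matches that of \<open>contract\<close>.\<close>

primrec sorted_modes ::
 "'h mode list => ('h mode list => 'h mode list => 'h mode list => 'w) => 'w"
where
 "sorted_modes [] f = f [] [] []"
| "sorted_modes (x # L) f = sorted_modes L (%n p z.
   if mode_group hdeg x = 0 then f (x # n) p z
   else if mode_group hdeg x = 1 then scW (sign_prod (fst x) n) (f n (x # p) z)
   else scW (sign_prod (fst x) n * sign_prod (fst x) p) (f n p (x # z)))"

lemma mode_group_cases:
 obtains "mode_group hdeg x = 0" "dg d (fst x) (snd (snd x)) < 0"
 | "mode_group hdeg x = 1" "dg d (fst x) (snd (snd x)) > 0"
 | "mode_group hdeg x = 2" "dg d (fst x) (snd (snd x)) = 0" by (cases "dg d (fst x) (snd (snd x))" "0 :: int" rule: linorder_cases)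
  (use that in "auto simp: mode_group_def case_prod_unfold")

lemma sorted_modes_eq:
 "sorted_modes L f = scW (fermion_sign hdeg L) (f (modes_in hdeg 0 L) (modes_in hdeg 1 L) (modes_in hdeg 2 L))"
proof (induction L arbitrary: f)
 case Nil
 thus ?case by (simp add: fermion_sign_def modes_in_def)
next
 case (Cons x L)
 have le: "mode_group hdeg y <= 2" for y :: "'h mode" by (cases y rule: mode_group_cases) simp_all
 have split: "sign_prod s (filter (%y. mode_group hdeg y < 2) L) =
   sign_prod s (modes_in hdeg 0 L) * sign_prod s (modes_in hdeg 1 L)" for s
 proof (induction L)
  case (Cons y L)
  thus ?case by (cases y rule: mode_group_cases) (simp_all add: modes_in_def)
 qed (simp add: modes_in_def)
 show ?case
 proof (cases x rule: mode_group_cases)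
  case 1
  thus ?thesis by (simp add: Cons fermion_sign_Cons modes_in_def)
 next
  case 2
  thus ?thesis by (simp add: Cons fermion_sign_Cons modes_in_def mult_ac)
 next
  case 3
  thus ?thesis by (simp add: Cons fermion_sign_Cons split) (simp add: modes_in_def mult_ac)
 qed
qed

lemma sorted_modes_add: "sorted_modes L (%n p z. f n p z + f' n p z) = sorted_modes L f + sorted_modes L f'"
 and sorted_modes_scale: "sorted_modes L (%n p z. scW c (f n p z)) = scW c (sorted_modes L f)"
 and sorted_modes_zero [simp]: "sorted_modes L (%n p z. 0) = 0" by (simp_all add: sorted_modes_eq algebra_simps)

lemma NO_eq_sorted: "NO L w = sorted_modes L (%n p z. apply_modes A n (apply_modes A p (zno z w)))"
 by (simp add: NO_def sorted_modes_eq apply_modes_append)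

lemma contract_sign_prod:
 assumes "homog t ph" shows "W.contract t ph n (%v. scW (sign_prod s v) (Ps v)) = scW (sg s t * sign_prod s n) (W.contract t ph n Ps)"
proof (rule W.contract_weight)
 fix y show "ph y = sg s t * sg s (fst y) * ph y" using assms by (cases y; cases "fst y = t") (auto simp: homog_def)
qed

text \<open>The negative group stands leftmost, so a contraction that sees only negative modes acts
  inside it without a further sign.\<close>

lemma contract_sorted_neg:
 assumes ph: "homog t ph" and "!!y. mode_group hdeg y ~= 0 ==> ph y = 0"
 shows "W.contract t ph L (%v. sorted_modes v f) = sorted_modes L (%n p z. W.contract t ph n (%n'. f n' p z))"
proof (induction L arbitrary: f)
 case (Cons y L)
 show ?case
 proof (cases y rule: mode_group_cases)
  case 1
  thus ?thesis by (simp add: Cons sorted_modes_add sorted_modes_scale)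
 next
  case 2
  thus ?thesis by (simp add: Cons assms(2) contract_sign_prod[OF ph] sg_sym[of "fst y" t] flip: sorted_modes_scale)
 next
  case 3
  have *: "W.contract t ph n (%n'. scW (sign_prod (fst y) n' * sign_prod (fst y) p) (f n' p (y # z))) =
    scW (sg t (fst y) * (sign_prod (fst y) n * sign_prod (fst y) p)) (W.contract t ph n (%n'. f n' p (y # z)))" for n p z
   using contract_sign_prod[OF ph, of n "fst y" "%n'. scW (sign_prod (fst y) p) (f n' p (y # z))"]
   by (simp add: W.contract_scale sg_sym[of "fst y" t] mult_ac)
  from 3 show ?thesis by (simp add: Cons assms(2) * flip: sorted_modes_scale)
 qed
qed simp

text \<open>The zero modes stand last, hence the sign of passing the two other groups.\<close>

lemma contract_sorted_zero:
 assumes ph: "homog t ph" and "!!y. mode_group hdeg y ~= 2 ==> ph y = 0" shows "W.contract t ph L (%v. sorted_modes v f) =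
   sorted_modes L (%n p z. scW (sign_prod t n * sign_prod t p) (W.contract t ph z (%z'. f n p z')))"
proof (induction L arbitrary: f)
 case (Cons y L)
 show ?case
 proof (cases y rule: mode_group_cases)
  case 1
  thus ?thesis by (simp add: Cons assms(2) mult_ac flip: sorted_modes_scale)
 next
  case 2
  thus ?thesis by (simp add: Cons assms(2) W.contract_scale flip: sorted_modes_scale) (simp add: mult_ac)
 next
  case 3
  have "ph y = 0 | fst y = t" using ph by (cases y) (auto simp: homog_def)
  hence *: "scW (sign_prod t n * (sign_prod t p * (sign_prod (fst y) n * sign_prod (fst y) p)))
    (scW (ph y) v + u) = scW (ph y) v + scW (sign_prod t n * (sign_prod t p * (sign_prod (fst y) n * sign_prod (fst y) p))) u" for n p u v
   by (auto simp: W.scale_right_distrib mult_ac)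
  from 3 show ?thesis by (simp add: Cons W.contract_scale flip: sorted_modes_scale)
    (simp add: * mult_ac sorted_modes_add)
 qed
qed simp

lemma Ap_apply_neg:
 assumes "\<forall>y\<in>set n. mode_group hdeg y = 0" and "dg d (fst x) (snd (snd x)) >= 0"
 shows "Ap x (apply_modes A n w) = scW (sign_prod (fst x) n) (apply_modes A n (Ap x w)) +
   W.contract (fst x) (kap x) n (%v. apply_modes A v w)" using assms(1)
proof (induction n)
 case (Cons y n)
 obtain s a k s' b j where xy: "x = (s, a, k)" "y = (s', b, j)" by (cases x, cases y)
 have "j < 0" using Cons.prems xy dg_neg_iff[of s' j] by (cases y rule: mode_group_cases) auto
 hence "Ap x (Ap y v) = scW (sg s s') (Ap y (Ap x v)) + scW (kap x y) v" for v using A_super_neg[of s k j a s' b v] assms(2) xy by (simp add: Ap_def)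
 moreover have "Ap y (W.contract s ph n Ps) = W.contract s ph n (%v. Ap y (Ps v))" for ph Ps by (rule linear_contract[OF Ap_linear])
 ultimately show ?case using Cons xy by (simp add: Ap_add Ap_scale algebra_simps)
qed simp

lemma Ap_apply_pos:
 assumes "\<forall>y\<in>set p. mode_group hdeg y = 1" and "dg d (fst x) (snd (snd x)) = 0"
 shows "Ap x (apply_modes A p w) = scW (sign_prod (fst x) p) (apply_modes A p (Ap x w))" using assms(1)
proof (induction p)
 case (Cons y p)
 obtain s a k s' b j where xy: "x = (s, a, k)" "y = (s', b, j)" by (cases x, cases y)
 have "dg d s' j > 0" using Cons.prems xy by (cases y rule: mode_group_cases) auto
 hence "A s' b j (A s a k v) = scW (sg s s') (A s a k (A s' b j v))" for v using A_super_zero[of s' j s k b a v] assms(2) xy by (simp add: sg_sym)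
 hence "Ap x (Ap y v) = scW (sg s s') (Ap y (Ap x v))" for v using xy by (simp add: Ap_def)
 thus ?case using Cons xy by (simp add: Ap_scale mult_ac)
qed simp

text \<open>Recognizes the recursion for zero modes as a Wick step with contraction
  \<open>- zero_contr\<close>.\<close>

lemma zero_normal_order_Cons:
 "zero_normal_order frm lF scW A (x # gs) w = A (fst x) (snd x) 0 (zero_normal_order frm lF scW A gs w)
   - W.contract (fst x) (zero_contr x) gs (%v. zero_normal_order frm lF scW A v w)"
proof (cases "fst x")
 case Bos
 hence "zero_contr x = (%y. 0)" by (simp add: zero_contr_def fun_eq_iff)
 with Bos show ?thesis by (cases x) simp
next
 case Fer
 \<comment> \<open>The exponent also counts the contracted factor itself, whence the minus
   sign.\<close>
 have "(- 1) ^ length (filter (%(s', b). s' = Fer) (take (Suc i) gs)) = - sign_prod Fer (take i gs)"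
  if "i < length gs" "fst (gs ! i) = Fer" for i using that by (simp add: sign_prod_Fer take_Suc_conv_app_nth case_prod_unfold)
 thus ?thesis using Fer by (cases x) (auto simp: W.contract_eq_sum interv_sum_list_conv_sum_set_nat zero_contr_def del_def
    atLeast0LessThan sum_negf[symmetric] intro!: sum.cong)
qed

lemma NO_Nil [simp]: "NO [] w = w" by (simp add: NO_def modes_in_def fermion_sign_def zno_def)

text \<open>A negative mode is already in place. A positive one has to pass the negative group and
  collects supercommutators; a zero mode passes both groups without any contraction and meets the
  recursion for zero modes.\<close>

lemma NO_Cons: "NO (x # L) w = Ap x (NO L w) - W.contract (fst x) (kapn x) L (%v. NO v w)"
proof -
 let ?n = "modes_in hdeg 0 L" and ?p = "modes_in hdeg 1 L" and ?z = "modes_in hdeg 2 L"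
 have n: "\<forall>y\<in>set ?n. mode_group hdeg y = 0" and p: "\<forall>y\<in>set ?p. mode_group hdeg y = 1"
  and z: "\<forall>y\<in>set ?z. mode_group hdeg y = 2" by (auto simp: modes_in_def)
 show ?thesis
 proof (cases x rule: mode_group_cases)
  case 1
  have "kapn x = (%y. 0)" using 1 by (cases x) (auto simp: kapn_def kap_nonpos)
  thus ?thesis using 1 by (simp only: NO_eq_sorted sorted_modes.simps) (simp add: sorted_modes_eq Ap_scale)
 next
  case 2
  have k: "kapn x = kap x" using 2 by (cases x) (auto simp: kapn_def)
  have "kap x y = 0" if "mode_group hdeg y ~= 0" for y using 2 that d_Bos d_Fer by (cases y rule: mode_group_cases; cases x; cases y)
    (auto simp: contr_coeff_def dg_def)
  moreover have "homog (fst x) (kap x)" using kap_homog[of "%y. y" x] by simp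
  ultimately have "W.contract (fst x) (kapn x) L (%v. NO v w) = sorted_modes L
    (%n p z. W.contract (fst x) (kap x) n (%n'. apply_modes A n' (apply_modes A p (zno z w))))"
   unfolding NO_eq_sorted k by (intro contract_sorted_neg)
  thus ?thesis using 2 n by (simp only: NO_eq_sorted sorted_modes.simps)
    (simp add: sorted_modes_eq Ap_scale Ap_apply_neg W.scale_right_distrib mult_ac)
 next
  case 3
  have kap0: "kap x = (%y. 0)" using 3 by (cases x) (auto simp: kap_nonpos)
  have "kapn x y = 0" if "mode_group hdeg y ~= 2" for y using 3 that kap0 by (cases y rule: mode_group_cases; cases x; cases y) (auto simp: kapn_def)
  hence *: "W.contract (fst x) (kapn x) L (%v. NO v w) = sorted_modes L
    (%n p z. scW (sign_prod (fst x) n * sign_prod (fst x) p) (W.contract (fst x) (kapn x) z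
      (%z'. apply_modes A n (apply_modes A p (zno z' w)))))" unfolding NO_eq_sorted by (intro contract_sorted_zero kapn_homog)
  have "zno (x # ?z) w = Ap x (zno ?z w) - W.contract (fst x) (kapn x) ?z (%v. zno v w)"
  proof -
   obtain s a k where x: "x = (s, a, k)" by (cases x)
   have [simp]: "k = 0" using 3 x d_cases[of s] by (auto simp: dg_def)
   have "W.contract s (kapn x) ?z (%v. zno v w) =
     W.contract s (%y. zero_contr (s, a) (fst y, fst (snd y))) ?z (%v. zno v w)"
   proof (rule W.contract_cong, intro conjI impI)
    fix u y v assume "?z = u @ y # v"
    hence "mode_group hdeg y = 2" using z by auto
    thus "kapn x y = zero_contr (s, a) (fst y, fst (snd y))" using 3 x kap0 by (cases y rule: mode_group_cases; cases y) (auto simp: kapn_def)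
   qed simp
   thus ?thesis by (simp add: x zno_def zero_normal_order_Cons W.contract_map Ap_def case_prod_unfold del: zero_normal_order.simps)
  qed
  moreover have apply_contract: "apply_modes A m (W.contract s ph n Ps) = W.contract s ph n (%v. apply_modes A m (Ps v))" for m s n ph Ps
   by (rule linear_contract[OF apply_modes_linear])
  ultimately show ?thesis using 3 n p by (subst *, simp only: NO_eq_sorted sorted_modes.simps)
    (simp add: sorted_modes_eq Ap_scale Ap_apply_neg Ap_apply_pos kap0 apply_contract
     apply_diff apply_scale W.scale_right_diff_distrib mult_ac)
 qed
qed

text \<open>\<open>NO_Cons\<close> and \<open>wick_Cons\<close> are the same recursion.\<close>

lemma NO_eq_wick: "NO L w = W.wick (%x y. - kapn x y) L (%ms. apply_modes A ms w)"
proof (induction "length L" arbitrary: L rule: less_induct)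
 case less
 have hom: "homog (fst x) (%y. - kapn x y)" for x using kapn_homog[of x] by (simp add: homog_def)
 show ?case
 proof (cases L)
  case (Cons x L')
  have "W.contract (fst x) (kapn x) L' (%v. NO v w) =
    W.contract (fst x) (kapn x) L' (%v. W.wick (%x y. - kapn x y) v (%ms. apply_modes A ms w))" by (rule W.contract_cong) (use less Cons in auto)
  moreover have "Ap x (NO L' w) = W.wick (%x y. - kapn x y) L' (%ms. Ap x (apply_modes A ms w))"
   using less Cons by (simp add: linear_wick[OF Ap_linear])
  ultimately show ?thesis using W.wick_Cons[OF hom, of x L'] by (simp add: Cons NO_Cons W.contract_minus_left del: W.wick.simps(2))
 qed simp
qed

text \<open>Wick's theorem for a plain product of modes, by inverting the exponential.\<close>

lemma apply_eq_wick_NO: "apply_modes A L w = W.wick kapn L (%ms. NO ms w)"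
proof -
 have hom: "homog (fst x) (%y. - kapn x y)" for x using kapn_homog[of x] by (simp add: homog_def)
 show ?thesis by (simp add: NO_eq_wick W.wick_wick[OF kapn_homog hom])
qed

end

section \<open>Coefficients of normal ordered products\<close>

context complex_space
begin

lemma wick_multilinear:
 assumes c: "!!x s a b j. c x (s, a + b, j) = c x (s, a, j) + c x (s, b, j)"
   "!!x s k a j. c x (s, scH k a, j) = k * c x (s, a, j)"
   "!!x s a b j. c (s, a + b, j) x = c (s, a, j) x + c (s, b, j) x"
   "!!x s k a j. c (s, scH k a, j) x = k * c (s, a, j) x"
  and Ph: "multilinear scH sc Ph" shows "multilinear scH sc (%w. wick c w Ph)"
proof -
 have mult: "multilinear scH sc (%v. Ph (x # v) + contract (fst x) (c x) v Ph)" if "multilinear scH sc Ph" for x Ph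
 proof -
  have "multilinear scH sc (%v. contract (fst x) (c x) v Ph)" by (rule contract_multilinear[OF that]) (simp_all add: c)
  thus ?thesis using multilinear_Cons[OF that, of x] by (simp add: multilinear_def algebra_simps)
 qed
 have "wick c (u @ (s, a + b, j) # v) Ph = wick c (u @ (s, a, j) # v) Ph + wick c (u @ (s, b, j) # v) Ph &
   wick c (u @ (s, scH k a, j) # v) Ph = sc k (wick c (u @ (s, a, j) # v) Ph)"
  if "multilinear scH sc Ph" for u s a b j v k using that
 proof (induction u arbitrary: Ph)
  case Nil
  hence "Ph ((s, a + b, j) # w) = Ph ((s, a, j) # w) + Ph ((s, b, j) # w)"
   and "Ph ((s, scH k a, j) # w) = sc k (Ph ((s, a, j) # w))" for w unfolding multilinear_def by (metis append_Nil)+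
  moreover have "c (s, a + b, j) = (%x. c (s, a, j) x + c (s, b, j) x)" "c (s, scH k a, j) = (%x. k * c (s, a, j) x)" by (simp_all add: c fun_eq_iff)
  ultimately show ?case by (simp add: contract_add_left contract_scale_left flip: wick_add wick_scale)
    (simp add: algebra_simps)
 next
  case (Cons x u)
  show ?case using Cons.IH[OF mult[OF Cons.prems, of x]] by simp
 qed
 thus ?thesis using Ph by (simp add: multilinear_def)
qed

end

lemma has_sum_Sum_any:
 assumes "finite {x. g x ~= 0}" and "h 0 = (0 :: complex)" and "!!x y. h (x + y) = h x + h y" shows "((%x. h (g x)) has_sum h (Sum_any g)) UNIV"
proof (rule has_sum_finite_neutralI[OF assms(1)])
 have "h (sum g F) = (SUM x:F. h (g x))" for F by (induction F rule: infinite_finite_induct) (simp_all add: assms)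
 thus "h (Sum_any g) = (SUM x:{x. g x ~= 0}. h (g x))" by (simp add: Sum_any.expand_set)
qed (use assms(2) in auto)

lemma Sum_any_add:
 assumes "finite {x. f x ~= 0}" "finite {x. g x ~= 0}" shows "Sum_any (%x. f x + g x) = Sum_any f + Sum_any g" using assms by (rule Sum_any.distrib)

definition md :: "stat \<times> ('h \<times> 'r) \<times> int => 'h mode" where
 "md x = (fst x, fst (fst (snd x)), snd (snd x))"

lemma fst_md [simp]: "fst (md x) = fst x" by (simp add: md_def)

lemma md_ix [simp]: "md (ix (s, a, r) n) = (s, a, n)" by (simp add: md_def ix_def)

definition mcoeff :: "(stat => int => complex) => 'h letter => int => complex" where
 "mcoeff ex x n = ex (fst x) n gchoose (snd (snd x) - 1)"

section \<open>Local finiteness and the coefficients of normal ordered products\<close>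

context mode_module
begin

text \<open>Twice the weight that the creation operators of the word add.\<close>

definition level :: "'h word => int" where
 "level xs = (SUM x<-xs. 2 * int (snd (snd x)) - d (fst x))"

text \<open>Measures creation words alone and is therefore independent of any grading of the
  coefficient space. A mode of doubled degree \<open>e\<close> lowers the filtration by
  \<open>e\<close>, and below 0 it is trivial, so large positive modes annihilate a given
  vector.\<close>

definition filt :: "int => 'w set" where
 "filt K = W.span {create A xs (io m) | xs m. xs \<in> CW & level xs <= K}"

lemma level_simps [simp]: "level [] = 0" "level ((s, a, m) # xs) = 2 * int m - d s + level xs" by (simp_all add: level_def)

lemma level_nonneg: "xs \<in> CW ==> level xs >= 0"
proof (induction xs)
 case (Cons x xs)
 thus ?case using d_cases[of "fst x"] by (cases x) auto
qed simp

lemma filt_mono: "K <= K' ==> filt K \<subseteq> filt K'" unfolding filt_def by (rule W.span_mono) auto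

lemma filt_neg:
 assumes "K < 0" shows "filt K = {0}"
proof -
 have "{create A xs (io m) | xs m. xs \<in> CW & level xs <= K} = {}" using level_nonneg assms by force
 thus ?thesis unfolding filt_def by (simp only: W.span_empty)
qed

lemma filt_subspace: "W.subspace (filt K)" by (simp add: filt_def)

lemma filt_create: "xs \<in> CW ==> level xs <= K ==> create A xs (io m) \<in> filt K" unfolding filt_def by (rule W.span_base) blast

lemma filt_exhausts: "\<exists>K. w \<in> filt K"
proof -
 have "w \<in> W.span {create A xs (io m) | xs m. xs \<in> CW}" unfolding create_span by simp
 thus ?thesis
 proof (induction rule: W.span_induct_alt)
  case base
  show ?case using filt_subspace W.subspace_0 by blast
 next
  case (step c y z)
  then obtain xs m K where y: "y = create A xs (io m)" "xs \<in> CW" and z: "z \<in> filt K" by blast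
  let ?K = "max K (level xs)"
  have "y \<in> filt ?K" "z \<in> filt ?K" using y z filt_create filt_mono[of K ?K] by auto
  hence "scW c y + z \<in> filt ?K" using filt_subspace[of ?K] by (simp add: W.subspace_add W.subspace_scale)
  thus ?case by blast
 qed
qed

text \<open>A mode contracts only with a letter of opposite degree, so the lost letter accounts
  exactly for the drop in level.\<close>

lemma A_filt: "w \<in> filt K ==> A s a k w \<in> filt (K - dg d s k)"
proof -
 have create: "A s a k (create A xs (io m)) \<in> filt (level xs - dg d s k)" if "xs \<in> CW" for xs m s a k
 proof (cases "k < 0")
  case True
  have "create A ((s, a, nat (- k)) # xs) (io m) \<in> filt (level xs - dg d s k)" by (rule filt_create) (use that True in "auto simp: dg_def")
  thus ?thesis using True by simp
 next
  case False
  hence k: "dg d s k >= 0" using dg_neg_iff by (meson linorder_not_less)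
  show ?thesis using that
  proof (induction xs)
   case Nil
   have "io m' \<in> filt 0" for m' using filt_create[of "[]" 0 m'] by simp
   moreover have "A s a k (io m) = 0" if "dg d s k ~= 0" using k that by (simp add: A_io_pos)
   ultimately show ?case using k filt_subspace W.subspace_0 by (cases "dg d s k = 0") (auto simp: A_io)
  next
   case (Cons x xs)
   obtain s' b j where x: "x = (s', b, j)" by (cases x)
   have j: "- int j < 0" "xs \<in> CW" "j >= 1" using Cons.prems x by simp_all
   have neg: "A s' b (- int j) w \<in> filt (K + (2 * int j - d s'))" if "w \<in> filt K" for w K using that unfolding filt_def[of K]
   proof (induction rule: W.span_induct_alt)
    case base
    show ?case using filt_subspace W.subspace_0 by auto
   next
    case (step c y z)
    then obtain ys m' where y: "y = create A ys (io m')" "ys \<in> CW" "level ys <= K" by blast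
    have "create A ((s', b, j) # ys) (io m') \<in> filt (K + (2 * int j - d s'))" by (rule filt_create) (use y j in auto)
    thus ?case using step y filt_subspace by (simp add: A_add A_scale W.subspace_add W.subspace_scale)
   qed
   have "A s' b (- int j) (A s a k (create A xs (io m))) \<in> filt (level (x # xs) - dg d s k)"
    using neg[OF Cons.IH[OF j(2)]] by (simp add: x algebra_simps)
   moreover have "scW (kap (s, a, k) (s', b, - int j)) (create A xs (io m)) \<in> filt (level (x # xs) - dg d s k)"
   proof (cases "kap (s, a, k) (s', b, - int j) = 0")
    case True
    thus ?thesis using filt_subspace W.subspace_0 by simp
   next
    case False
    hence "s = s'" "k - int j + d s = 0" by (auto simp: contr_coeff_def split: if_splits)
    hence "level (x # xs) - dg d s k = level xs" by (simp add: x dg_def)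
    thus ?thesis using filt_create[OF j(2)] filt_subspace by (simp add: W.subspace_scale)
   qed
   ultimately show ?case using filt_subspace by (simp add: x A_super_neg[OF k j(1)] W.subspace_add W.subspace_scale)
  qed
 qed
 assume "w \<in> filt K"
 thus ?thesis unfolding filt_def[of K]
 proof (induction rule: W.span_induct_alt)
  case base
  show ?case using filt_subspace W.subspace_0 by simp
 next
  case (step c y z)
  then obtain xs m where y: "y = create A xs (io m)" "xs \<in> CW" "level xs <= K" by blast
  hence "A s a k y \<in> filt (K - dg d s k)" using create filt_mono[of "level xs - dg d s k" "K - dg d s k"] by auto
  thus ?case using step filt_subspace by (simp add: A_add A_scale W.subspace_add W.subspace_scale)
 qed
qed

lemma zno_filt:
 assumes "w \<in> filt K" "\<forall>x\<in>set z. mode_group hdeg x = 2" shows "zno z w \<in> filt K"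
proof -
 have "dg d (fst x) 0 = 0" if "x \<in> set z" for x
 proof -
  have "mode_group hdeg x = 2" using assms(2) that by blast
  hence "dg d (fst x) (snd (snd x)) = 0" by (cases x rule: mode_group_cases) auto
  thus ?thesis using d_cases[of "fst x"] by (auto simp: dg_def) presburger
 qed
 hence "\<forall>g\<in>set (map (%(s, a, k). (s, a)) z). dg d (fst g) 0 = 0" by auto
 thus ?thesis unfolding zno_def
 proof (induction "map (%(s, a, k). (s, a)) z" arbitrary: rule: measure_induct_rule[of length])
  case less
  have "zero_normal_order frm lF scW A gs w \<in> filt K" if "\<forall>g\<in>set gs. dg d (fst g) 0 = 0" for gs using that
  proof (induction "length gs" arbitrary: gs rule: less_induct)
   case less
   show ?case
   proof (cases gs)
    case Nil
    thus ?thesis using assms by simp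
   next
    case (Cons g gs')
    have "A (fst g) (snd g) 0 (zero_normal_order frm lF scW A gs' w) \<in> filt K"
     using A_filt[of "zero_normal_order frm lF scW A gs' w" K "fst g" "snd g" 0] less Cons by simp
    moreover have "W.contract (fst g) (zero_contr g) gs' (%v. zero_normal_order frm lF scW A v w) \<in> filt K" unfolding W.contract_eq_sum
     by (rule W.subspace_sum[OF filt_subspace], rule W.subspace_scale[OF filt_subspace], rule less)
      (use less Cons set_del[of _ gs'] in "auto simp: length_del")
    ultimately show ?thesis unfolding Cons zero_normal_order_Cons using filt_subspace by (simp add: W.subspace_diff)
   qed
  qed
  thus ?case using less.prems by blast
 qed
qed

definition pos_degree :: "'h mode list => int" where
 "pos_degree ms = (SUM x<-ms. max 0 (dg d (fst x) (snd (snd x))))"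

lemma NO_eq_0:
 assumes "w \<in> filt K" "pos_degree ms > K" shows "NO ms w = 0"
proof -
 have "apply_modes A (modes_in hdeg 1 ms) v \<in> filt (K - pos_degree ms)" if "v \<in> filt K" for v using that
 proof (induction ms)
  case (Cons y ms)
  thus ?case using A_filt[of "apply_modes A (modes_in hdeg 1 ms) v" "K - pos_degree ms" "fst y" "fst (snd y)" "snd (snd y)"]
   by (cases y rule: mode_group_cases)
    (simp_all add: modes_in_def pos_degree_def Ap_def case_prod_unfold algebra_simps)
 qed (simp add: modes_in_def pos_degree_def)
 hence "apply_modes A (modes_in hdeg 1 ms) (zno (modes_in hdeg 2 ms) w) \<in> filt (K - pos_degree ms)"
  by (simp add: zno_filt[OF assms(1)] modes_in_def)
 hence "apply_modes A (modes_in hdeg 1 ms) (zno (modes_in hdeg 2 ms) w) = 0" using filt_neg[of "K - pos_degree ms"] assms(2) by auto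
 thus ?thesis using apply_scale[of _ 0 0] by (simp add: NO_def apply_modes_append)
qed

text \<open>The positive degrees add up to at most the filtration level of \<open>w\<close>, which
  bounds every index from above; the finite set of totals then bounds each index from below.\<close>

lemma NO_finite:
 fixes xs :: "(stat \<times> 'h \<times> 'r) list"
 assumes "finite T" shows "finite {ns. length ns = length xs & sum_list ns \<in> T & NO (map md (indexed xs ns)) w ~= 0}"
proof -
 obtain K where K: "w \<in> filt K" using filt_exhausts by blast
 obtain b where b: "!!t. t \<in> T ==> t >= b" using finite_has_minimal2 assms by (metis Min_le)
 let ?r = "int (length xs)"
 let ?I = "{b - ?r * (\<bar>K\<bar> + 1) - 1 .. \<bar>K\<bar> + 1}"
 have "ns \<in> {ns. set ns \<subseteq> ?I & length ns = length xs}"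
  if ns: "length ns = length xs" "sum_list ns \<in> T" "NO (map md (indexed xs ns)) w ~= 0" for ns
 proof -
  have pd: "pos_degree (map md (indexed xs ns)) <= K" using NO_eq_0[OF K] ns(3) by (meson linorder_not_less)
  have "(SUM n<-ns. max 0 (2 * n)) <= pos_degree (map md (indexed xs ns))" using ns(1)
  proof (induction xs ns rule: list_induct2')
   case (4 x xs n ns)
   thus ?case using d_cases[of "fst x"] by (auto simp: pos_degree_def dg_def md_def ix_def)
  qed (auto simp: pos_degree_def)
  hence le: "(SUM n<-ns. max 0 (2 * n)) <= K" using pd by simp
  have up: "n <= \<bar>K\<bar>" if "n \<in> set ns" for n
  proof -
   have "max 0 (2 * n) <= (SUM n<-ns. max 0 (2 * n))" by (rule member_le_sum_list) (use that in auto)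
   thus ?thesis using le by simp
  qed
  have lo: "sum_list ns <= n + (?r) * (\<bar>K\<bar> + 1)" if "n \<in> set ns" for n
  proof -
   obtain u v where uv: "ns = u @ n # v" using split_list[OF \<open>n \<in> set ns\<close>] by blast
   have bound: "sum_list l <= int (length l) * (\<bar>K\<bar> + 1)" if "set l \<subseteq> set ns" for l using that
   proof (induction l)
    case (Cons y l)
    thus ?case using up[of y] by (simp add: distrib_right)
   qed simp
   have "set u \<subseteq> set ns" "set v \<subseteq> set ns" using uv by auto
   from bound[OF this(1)] bound[OF this(2)] uv have "sum_list ns <= n + int (length u + length v) * (\<bar>K\<bar> + 1)" by (simp add: distrib_right)
   also have "... <= n + ?r * (\<bar>K\<bar> + 1)" using uv ns(1) by (intro add_left_mono mult_right_mono) auto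
   finally show ?thesis .
  qed
  have "n \<in> ?I" if "n \<in> set ns" for n using up[OF that] lo[OF that] b[OF ns(2)] by simp
  thus ?thesis using ns(1) by blast
 qed
 hence "{ns. length ns = length xs & sum_list ns \<in> T & NO (map md (indexed xs ns)) w ~= 0}
   \<subseteq> {ns. set ns \<subseteq> ?I & length ns = length xs}" by blast
 thus ?thesis by (rule finite_subset) (simp add: finite_lists_length_eq)
qed

lemma kapn_add: "kapn (s, a + b, k) y = kapn (s, a, k) y + kapn (s, b, k) y"
  "kapn y (s, a + b, k) = kapn y (s, a, k) + kapn y (s, b, k)"
 and kapn_scale: "kapn (s, scH c a, k) y = c * kapn (s, a, k) y" "kapn y (s, scH c a, k) = c * kapn y (s, a, k)"
 by (cases y; simp add: kapn_def kap_add kap_scale zero_contr_def frm_add frm_scale algebra_simps add_divide_distrib)+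

lemma NO_multilinear: "multilinear scH scW (%ms. NO ms w)"
proof -
 have "multilinear scH scW (%ms. apply_modes A ms w)" unfolding multilinear_def
  by (simp add: apply_modes_append Ap_def A_add_left A_scale_left apply_add apply_scale)
 thus ?thesis unfolding NO_eq_wick by (intro W.wick_multilinear) (simp_all add: kapn_add kapn_scale)
qed

lemma NO_linear: "lin scW scW (NO ms)"
proof -
 have "NO ms w = W.wick (%x y. - kapn x y) ms (%ms. apply_modes A ms w)" for w by (rule NO_eq_wick)
 thus ?thesis by unfold_locales (simp_all add: apply_add apply_scale W.wick_add W.wick_scale)
qed

text \<open>\<open>npc ex xs j\<close> collects the terms of a normal ordered product that lower the weight by \<open>j / 2\<close>.\<close>

definition npc :: "(stat => int => complex) => 'h word => int => 'w => 'w" where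
 "npc ex xs j w = Sum_any (%ns. if length ns = length xs & 2 * sum_list ns = j
   then scW (iprod (mcoeff ex) xs ns) (NO (map md (indexed xs ns)) w) else 0)"

lemma finite_half: "finite {t::int. 2 * t = j}" by (rule finite_subset[of _ "{j div 2}"]) auto

lemma npc_finite: "finite {ns. (if length ns = length xs & 2 * sum_list ns = j
   then scW (iprod (mcoeff ex) xs ns) (NO (map md (indexed xs ns)) w) else 0) ~= 0}"
 by (rule finite_subset[OF _ NO_finite[OF finite_half, of xs j w]]) auto

lemma npc_add: "npc ex xs j (v + w) = npc ex xs j v + npc ex xs j w"
 and npc_scale: "npc ex xs j (scW c w) = scW c (npc ex xs j w)"
proof -
 have NO_add: "NO ms (v + w) = NO ms v + NO ms w" and NO_scale: "NO ms (scW c w) = scW c (NO ms w)" for ms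
  using NO_linear[of ms] by (simp_all add: Vector_Spaces.linear_iff)
 show "npc ex xs j (v + w) = npc ex xs j v + npc ex xs j w" unfolding npc_def by (subst Sum_any_add[OF npc_finite npc_finite, symmetric])
   (auto simp: NO_add W.scale_right_distrib intro!: Sum_any.cong)
 show "npc ex xs j (scW c w) = scW c (npc ex xs j w)"
 proof (cases "c = 0")
  case True
  have "NO ms 0 = 0" for ms using NO_scale[of ms] NO_linear[of ms] by (metis W.scale_zero_left Vector_Spaces.linear_iff)
  hence "npc ex xs j 0 = 0" by (simp add: npc_def cong: if_cong)
  thus ?thesis using True by simp
 next
  case False
  have *: "scW c (Sum_any g) = Sum_any (%x. scW c (g x))" for g :: "int list => 'w" using False by (simp add: Sum_any.expand_set W.scale_sum_right)
  thus ?thesis unfolding npc_def by (subst NO_scale) (simp add: * if_distrib mult_ac cong: if_cong)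
 qed
qed

lemma npc_has_sum:
 assumes "lin scW (*) mu" shows "((%ns. if 2 * sum_list ns = j then iprod (mcoeff ex) xs ns * mu (NO (map md (indexed xs ns)) w) else 0)
   has_sum mu (npc ex xs j w)) (lists_of (length xs))"
proof -
 interpret mu: Vector_Spaces.linear scW "(*)" mu by fact
 let ?g = "%ns. if length ns = length xs & 2 * sum_list ns = j
   then scW (iprod (mcoeff ex) xs ns) (NO (map md (indexed xs ns)) w) else 0"
 have "((%ns. mu (?g ns)) has_sum mu (npc ex xs j w)) UNIV" unfolding npc_def by (rule has_sum_Sum_any[OF npc_finite mu.zero mu.add])
 also have "?this \<longleftrightarrow> ?thesis" by (rule has_sum_cong_neutral) (auto simp: lists_of_def mu.zero mu.scale)
 finally show ?thesis .
qed

text \<open>The exponents add up to a constant of the word minus the total mode index, so a power of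
  \<open>x\<close> prescribes that index. The doubled value \<open>j\<close> accommodates
  half-integral powers; for odd \<open>j\<close> both sides are zero.\<close>

lemma normal_product_coeff_eq:
 assumes ex: "!!s n. ex s n = - of_int n - 1 + r s"
  and e: "!!t. (2 * t = j) \<longleftrightarrow> (- of_int t + (SUM x<-xs. r (fst x) - 1 - of_nat (snd (snd x) - 1)) = e)"
 shows "normal_product_coeff scW NO ex xs e w = npc ex xs j w"
proof -
 have "(\<Sum>((s, a, m), n)\<leftarrow>zip xs ns. ex s n - of_nat (m - 1)) =
   - of_int (sum_list ns) + (SUM x<-xs. r (fst x) - 1 - of_nat (snd (snd x) - 1))"
  if "length ns = length xs" for ns using that by (induction xs ns rule: list_induct2') (auto simp: ex algebra_simps)
 hence 1: "length ns = length xs & (\<Sum>((s, a, m), n)\<leftarrow>zip xs ns. ex s n - of_nat (m - 1)) = e \<longleftrightarrow>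
   length ns = length xs & 2 * sum_list ns = j" for ns using e by auto
 have 2: "(\<Prod>((s, a, m), n)\<leftarrow>zip xs ns. ex s n gchoose (m - 1)) = iprod (mcoeff ex) xs ns"
  and 3: "map (%((s, a, m), n). (s, a, n)) (zip xs ns) = map md (indexed xs ns)"
  for ns by (simp_all add: iprod_def indexed_def mcoeff_def md_def ix_def case_prod_unfold)
 show ?thesis unfolding normal_product_coeff_def npc_def 1 2 3 ..
qed

lemma normal_product_coeff_multilinear:
 assumes ex: "!!s n. ex s n = - of_int n - 1 + r s" shows "multilinear scH scW (%xs. normal_product_coeff scW NO ex xs e w)"
proof -
 let ?t = "%xs ns. if length ns = length xs & (\<Sum>((s, a, m), n)\<leftarrow>zip xs ns. ex s n - of_nat (m - 1)) = e
   then scW (\<Prod>((s, a, m), n)\<leftarrow>zip xs ns. ex s n gchoose (m - 1))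
      (NO (map (%((s, a, m), n). (s, a, n)) (zip xs ns)) w) else 0"
 have fin: "finite {ns. ?t xs ns ~= 0}" for xs
 proof -
  let ?c = "SUM x<-xs. r (fst x) - 1 - of_nat (snd (snd x) - 1)"
  have sum: "(\<Sum>((s, a, m), n)\<leftarrow>zip xs ns. ex s n - of_nat (m - 1)) = - of_int (sum_list ns) + ?c"
   if "length ns = length xs" for ns using that by (induction xs ns rule: list_induct2') (auto simp: ex algebra_simps)
  have fin1: "finite {t :: int. - of_int t + ?c = e}"
  proof (cases "\<exists>t :: int. - of_int t + ?c = e")
   case True
   then obtain t :: int where "- of_int t + ?c = e" by blast
   hence "{t :: int. - of_int t + ?c = e} \<subseteq> {t}" by auto
   thus ?thesis by (rule finite_subset) simp
  qed simp
  have 3: "map (%((s, a, m), n). (s, a, n)) (zip xs ns) = map md (indexed xs ns)" for ns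
   by (induction xs ns rule: list_induct2') (auto simp: md_def ix_def)
  show ?thesis
  proof (rule finite_subset[OF subsetI NO_finite[OF fin1, of xs w]], unfold mem_Collect_eq)
   fix ns assume "?t xs ns ~= 0"
   hence "length ns = length xs" "(\<Sum>((s, a, m), n)\<leftarrow>zip xs ns. ex s n - of_nat (m - 1)) = e"
    "NO (map (%((s, a, m), n). (s, a, n)) (zip xs ns)) w ~= 0" by (auto split: if_splits)
   thus "length ns = length xs & - of_int (sum_list ns) + ?c = e & NO (map md (indexed xs ns)) w ~= 0" by (simp only: sum 3 simp_thms)
  qed
 qed
 have NO: "NO (u @ (s, a + b, j) # v) w = NO (u @ (s, a, j) # v) w + NO (u @ (s, b, j) # v) w"
  "NO (u @ (s, scH c a, j) # v) w = scW c (NO (u @ (s, a, j) # v) w)" for u s a b c j v using NO_multilinear[of w] by (auto simp: multilinear_def)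
 have split: "\<exists>n1 n n2. ns = n1 @ n # n2 & length n1 = length u & length n2 = length v"
  if "length ns = length u + Suc (length v)" for ns :: "int list" and u v :: "'h word"
  by (rule exI[of _ "take (length u) ns"], rule exI[of _ "ns ! length u"], rule exI[of _ "drop (Suc (length u)) ns"])
   (use that in "auto simp flip: id_take_nth_drop")
 have add: "?t (u @ (s, a + b, m) # v) ns = ?t (u @ (s, a, m) # v) ns + ?t (u @ (s, b, m) # v) ns"
  and scale: "?t (u @ (s, scH c a, m) # v) ns = scW c (?t (u @ (s, a, m) # v) ns)" for u s a b c m v ns
  by (cases "length ns = length u + Suc (length v)",
    use split[of ns u v] in \<open>force simp: NO W.scale_right_distrib mult_ac\<close>, simp)+
 show ?thesis unfolding multilinear_def normal_product_coeff_def
 proof (intro conjI allI)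
  fix u s a b m v
  show "Sum_any (?t (u @ (s, a + b, m) # v)) = Sum_any (?t (u @ (s, a, m) # v)) + Sum_any (?t (u @ (s, b, m) # v))"
   unfolding add by (rule Sum_any_add[OF fin fin])
 next
  fix u s c a m v
  show "Sum_any (?t (u @ (s, scH c a, m) # v)) = scW c (Sum_any (?t (u @ (s, a, m) # v)))"
   unfolding scale by (cases "c = 0") (simp_all add: Sum_any.expand_set W.scale_sum_right)
 qed
qed

end

lemma lin_eq_on_span:
 assumes "lin s1 s2 f" "lin s1 s2 g" "module.span s1 B = UNIV" "!!b. b \<in> B ==> f b = g b" shows "f = g"
proof
 fix x
 interpret vector_space_pair s1 s2 using assms(1) by (simp add: Vector_Spaces.linear_def vector_space_pair_def)
 show "f x = g x" by (rule linear_eq_on[OF assms(1,2), of _ B]) (use assms in auto)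
qed

lemma lin_comp: "lin s1 s2 f ==> lin s2 s3 g ==> lin s1 s3 (%x. g (f x))" using Vector_Spaces.linear_compose[of s1 s2 f s3 g] by (simp add: comp_def)

section \<open>Positive modes acting as contractions\<close>

context mode_module
begin

lemma create_neg: "create A xs w = apply_modes A (map neg xs) w" by (induction xs) (auto simp: Ap_def)

lemma A_pos_create:
 assumes "dg d s k > 0" "xs \<in> CW" shows "A s a k (create A xs (io m)) = W.contract s (%y. kap (s, a, k) (neg y)) xs (%v. create A v (io m))"
 using assms(2)
proof (induction xs)
 case Nil
 thus ?case using assms by (simp add: A_io_pos)
next
 case (Cons x xs)
 obtain s' b j where x: "x = (s', b, j)" by (cases x)
 have "- int j < 0" "xs \<in> CW" using Cons.prems x by simp_all
 thus ?case using Cons.IH assms(1) A_super_neg[of s k "- int j" a s' b "create A xs (io m)"] by (simp add: x linear_contract[OF A_linear])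
qed

lemma creation_words_del: "u @ y # v \<in> CW ==> u @ v \<in> CW" by (auto simp: creation_words_def)

text \<open>The algebra has no relation between two positive modes, but on the module they act on
  creation words by contractions, and these supercommute.\<close>

lemma A_super_pos:
 assumes k: "dg d s k > 0" and j: "dg d s' j > 0" shows "A s a k (A s' b j w) = scW (sg s s') (A s' b j (A s a k w))"
proof -
 have hom: "homog s (%y. kap (s, a, k) (neg y))" for s a k using kap_homog[of neg "(s, a, k)"] by simp
 have *: "A s a k (A s' b j (create A xs (io m))) = W.contract s' (%y. kap (s', b, j) (neg y)) xs
   (%v. W.contract s (%y. kap (s, a, k) (neg y)) v (%u. create A u (io m)))"
  if "dg d s k > 0" "dg d s' j > 0" "xs \<in> CW" for s a k s' b j xs m unfolding A_pos_create[OF that(2,3)] linear_contract[OF A_linear]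
 proof (rule W.contract_cong, intro conjI impI)
  fix u y v assume "xs = u @ y # v"
  hence "u @ v \<in> CW" using that(3) creation_words_del by blast
  thus "A s a k (create A (u @ v) (io m)) =
    W.contract s (%y. kap (s, a, k) (neg y)) (u @ v) (%u. create A u (io m))" by (rule A_pos_create[OF that(1)])
 qed simp
 have "(%w. A s a k (A s' b j w)) = (%w. scW (sg s s') (A s' b j (A s a k w)))"
 proof (rule lin_eq_on_span[OF _ _ create_span])
  show "lin scW scW (%w. A s a k (A s' b j w))" by (rule lin_comp[OF A_linear A_linear])
  show "lin scW scW (%w. scW (sg s s') (A s' b j (A s a k w)))" by unfold_locales (simp_all add: A_add A_scale algebra_simps)
 next
  fix y assume "y \<in> {create A xs (io m) | xs m. xs \<in> CW}"
  then obtain xs m where y: "y = create A xs (io m)" "xs \<in> CW" by blast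
  show "A s a k (A s' b j y) = scW (sg s s') (A s' b j (A s a k y))" unfolding y(1) *[OF k j y(2)] *[OF j k y(2)]
   by (subst W.contract_contract[OF hom hom]) (simp add: sg_sym)
 qed
 thus ?thesis by (rule fun_cong)
qed

end

section \<open>The algebra V, the space W and vertex operators on creation words\<close>

locale setting =
 fixes scH :: "complex => 'h::ab_group_add => 'h"
  and frm :: "'h => 'h => complex"
  and lB lF :: complex
  and es :: "'h list"
  and scV :: "complex => 'v::ab_group_add => 'v"
  and \<pi>V :: "('h gen list \<Rightarrow>\<^sub>0 complex) => 'v"
  and scM :: "complex => 'm::ab_group_add => 'm"
  and act :: "stat => 'h => 'm => 'm"
  and Mgr :: "complex \<times> cmod2 => 'm set"
  and scW :: "complex => 'w::ab_group_add => 'w"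
  and \<pi>W :: "('h gen list \<Rightarrow>\<^sub>0 'm) => 'w"
 assumes scH: "vector_space scH"
  and frm: "nondegenerate_symmetric_form scH frm"
  and lF: "lF ~= 0"
  and es: "orthonormal_basis scH frm es"
  and V: "is_V scH frm lB lF scV \<pi>V"
  and M: "graded_T_module scH scM act Mgr"
  and W: "is_W scH frm lB lF scM act scW \<pi>W"
begin

sublocale V: mode_module "(*)" scH frm "%s. int (par s)" "vacuum_act lB lF" scV \<pi>V lB lF
proof (intro mode_module.intro induced.intro mode_module_axioms.intro)
 show "vector_space ((*) :: complex => complex => complex)" by unfold_locales (simp_all add: algebra_simps)
 show "Vector_Spaces.linear (*) (*) (vacuum_act lB lF g)" for g :: "'h gen" by (cases g) (unfold_locales, simp_all add: algebra_simps)
 show "induced_module (*) (two_sided_ideal (mode_relators scH frm (%s. int (par s)))) nonneg_gens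
   (vacuum_act lB lF) scV \<pi>V" using V by (simp add: is_V_def untwisted_relators_eq)
 show "lin scH (*) (frm a)" "frm a b = frm b a" for a b using frm by (auto simp: nondegenerate_symmetric_form_def)
qed (auto simp: algebra_simps)

sublocale W: mode_module scM scH frm "%s. 0" "M_act scM act lB lF" scW \<pi>W lB lF
proof (intro mode_module.intro induced.intro mode_module_axioms.intro)
 have act: "lin scM scM (act s a)" "lin scH scM (%a. act s a m)" for s a m using M by (auto simp: graded_T_module_def)
 have vs: "vector_space scM" using M by (simp add: graded_T_module_def)
 then interpret M: vector_space scM .
 show "vector_space scM" by (fact vs)
 show "Vector_Spaces.linear scM scM (M_act scM act lB lF g)" for g :: "'h gen"
 proof (cases g)
  case (Mode s a n)
  show ?thesis
  proof (cases "n = 0")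
   case True
   thus ?thesis using act(1)[of s a] by (simp add: Mode)
  next
   case False
   thus ?thesis by (simp add: Mode, unfold_locales) simp_all
  qed
 next
  case KB
  thus ?thesis by (simp, unfold_locales)
 next
  case KF
  thus ?thesis by (simp, unfold_locales)
 qed
 show "induced_module scM (two_sided_ideal (mode_relators scH frm (%s. 0))) nonneg_gens
   (M_act scM act lB lF) scW \<pi>W" using W by (simp add: is_W_def twisted_relators_eq)
 show "lin scH (*) (frm a)" "frm a b = frm b a" for a b using frm by (auto simp: nondegenerate_symmetric_form_def)
 show "M_act scM act lB lF (Mode s (a + b) k) m = M_act scM act lB lF (Mode s a k) m + M_act scM act lB lF (Mode s b k) m"
  "M_act scM act lB lF (Mode s (scH c a) k) m = scM c (M_act scM act lB lF (Mode s a k) m)" for s a b k m c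
  using act(2)[of s m] by (simp_all add: Vector_Spaces.linear_iff)
qed (auto simp: dg_def)

lemma vac_eq: "vac \<pi>V = V.io 1" by (simp add: vac_def V.io_def V.wv_def)

abbreviation "vv == V_vec \<pi>V"

lemma V_vec_eq: "vv xs = create V.A xs (V.io 1)" by (simp add: V_vec_def vac_eq)

lemma V_vec_simps [simp]: "vv [] = vac \<pi>V" "vv ((s, a, m) # xs) = V.A s a (- int m) (vv xs)" by (simp_all add: V_vec_eq vac_eq)

lemma V_io: "V.io c = scV c (vac \<pi>V)" using V.io_linear by (simp add: vac_eq Vector_Spaces.linear_iff) (metis mult.right_neutral)

lemma V_create_io: "create V.A xs (V.io c) = scV c (vv xs)"
proof (induction xs)
 case (Cons x xs)
 thus ?case by (cases x) (simp add: V.A_scale)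
qed (simp add: V_io)

lemma V_span: "V.W.span (vv ` CW) = UNIV"
proof -
 have "create V.A xs (V.io m) \<in> V.W.span (vv ` CW)" if "xs \<in> CW" for xs m using that by (simp add: V_create_io V.W.span_scale V.W.span_base)
 hence "V.W.span {create V.A xs (V.io m) | xs m. xs \<in> CW} \<subseteq> V.W.span (vv ` CW)" by (intro V.W.span_minimal) auto
 thus ?thesis by (simp only: V.create_span) auto
qed

text \<open>Existence comes from freeness of the creation words, uniqueness from their spanning V;
  so the definite description in \<open>lin_extend\<close> denotes.\<close>

lemma V_lin_extend:
 assumes "vector_space scY" "multilinear scH scY f" shows "lin scV scY (lin_extend scV scY CW vv f)"
  and "xs \<in> CW ==> lin_extend scV scY CW vv f (vv xs) = f xs"
proof -
 interpret Y: vector_space scY by fact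
 let ?F = "%xs c. scY c (f xs)"
 have "\<exists>l. lin scV scY l & (\<forall>xs\<in>CW. \<forall>m. l (create V.A xs (V.io m)) = ?F xs m)"
 proof (rule V.creation_extend[OF assms(1)])
  show "multilinear scH scY (%w. scY m (f w))" for m using assms(2) by (simp add: multilinear_def algebra_simps)
  show "lin (*) scY (?F w)" for w by unfold_locales (simp_all add: algebra_simps)
 qed
 then obtain l where l: "lin scV scY l" "\<forall>xs\<in>CW. l (vv xs) = f xs" by (auto simp: V_vec_eq)
 have "lin_extend scV scY CW vv f = l" unfolding lin_extend_def
 proof (rule the_equality)
  fix l' assume "lin scV scY l' & (\<forall>x\<in>CW. l' (vv x) = f x)"
  thus "l' = l" using l by (intro lin_eq_on_span[OF _ l(1) V_span]) auto
 qed (use l in blast)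
 with l show "lin scV scY (lin_extend scV scY CW vv f)"
  and "xs \<in> CW ==> lin_extend scV scY CW vv f (vv xs) = f xs" by auto
qed

text \<open>On V only bosons have zero modes, while the correction for zero modes concerns fermions
  only.\<close>

lemma V_normal_order_eq: "V_normal_order scV (mode_op \<pi>V) = V.NO"
proof (intro ext)
 fix ms :: "'h mode list" and v
 have deg: "V_degree = V.hdeg" by (auto simp: V_degree_def dg_def fun_eq_iff field_simps)
 have "V.zno z v = apply_modes V.A z v" if "\<forall>x\<in>set z. mode_group V.hdeg x = 2" for z using that
 proof (induction z)
  case (Cons x z)
  obtain s a k where x: "x = (s, a, k)" by (cases x)
  have "2 * k + int (par s) = 0" using Cons.prems by (cases x rule: V.mode_group_cases) (auto simp: x dg_def)
  hence "s = Bos" "k = 0" by (cases s; simp; presburger)+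
  thus ?case using Cons by (simp add: x V.zno_def V.Ap_def)
 qed (simp add: V.zno_def)
 moreover have "\<forall>x\<in>set (modes_in V.hdeg 2 ms). mode_group V.hdeg x = 2" by (simp add: modes_in_def)
 ultimately show "V_normal_order scV (mode_op \<pi>V) ms v = V.NO ms v" by (simp add: V_normal_order_def V.NO_def deg V.apply_modes_append)
qed

lemma W_normal_order_eq: "W_normal_order frm lF scW (mode_op \<pi>W) = W.NO"
proof (intro ext)
 fix ms v
 have "W_degree = W.hdeg" by (auto simp: W_degree_def dg_def fun_eq_iff)
 thus "W_normal_order frm lF scW (mode_op \<pi>W) ms v = W.NO ms v" by (simp add: W_normal_order_def W.NO_def W.zno_def)
qed

abbreviation exV :: "stat => int => complex" where
 "exV == %s k. - of_int k - 1"

abbreviation exW :: "stat => int => complex" where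
 "exW == %s n. - of_int n - 1 + of_nat (par s) / 2"

abbreviation "YV == Y_V scV \<pi>V"
abbreviation "YWb == Y_W_bar frm lF scV \<pi>V scW \<pi>W"
abbreviation "YW == Y_W frm lF es scV \<pi>V scW \<pi>W"

lemma YV_linear: "lin scV scV (%u. YV n u v)"
 and YV_vec: "xs \<in> CW ==>
  YV n (vv xs) v = V.npc exV xs (2 * (n + 1 - (SUM x<-xs. int (snd (snd x))))) v"
proof -
 have m: "multilinear scH scV (%xs. normal_product_coeff scV V.NO exV xs (- of_int n - 1) v)"
  by (rule V.normal_product_coeff_multilinear[where r = "%_. 0"]) simp
 note E = V_lin_extend[OF V.W.vector_space_axioms m]
 show "lin scV scV (%u. YV n u v)" using E(1) by (simp add: Y_V_def V_normal_order_eq)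
 assume xs: "xs \<in> CW"
 have "(SUM x<-xs. 0 - 1 - of_nat (snd (snd x) - 1)) = - (of_int (SUM x<-xs. int (snd (snd x))) :: complex)"
  using xs by (induction xs) (auto simp: creation_words_def of_nat_diff)
 hence "normal_product_coeff scV V.NO exV xs (- of_int n - 1) v =
   V.npc exV xs (2 * (n + 1 - (SUM x<-xs. int (snd (snd x))))) v"
 proof (intro V.normal_product_coeff_eq[where r = "%_. 0"])
  fix t
  have "- of_int t + - of_int S = - of_int n - (1 :: complex) \<longleftrightarrow> 2 * t = 2 * (n + 1 - S)" for S
  proof -
   have "- of_int t + - of_int S = - of_int n - (1 :: complex) \<longleftrightarrow> of_int t = (of_int (n + 1 - S) :: complex)"
    by (auto simp: algebra_simps)
   also have "... \<longleftrightarrow> t = n + 1 - S" by (rule of_int_eq_iff)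
   also have "... \<longleftrightarrow> 2 * t = 2 * (n + 1 - S)" by presburger
   finally show ?thesis .
  qed
  thus "(2 * t = 2 * (n + 1 - (SUM x<-xs. int (snd (snd x))))) =
   (- of_int t + (SUM x<-xs. 0 - 1 - of_nat (snd (snd x) - 1)) = - of_int n - (1 :: complex))"
   unfolding \<open>(SUM x<-xs. 0 - 1 - of_nat (snd (snd x) - 1)) = _\<close> by (simp only:)
 qed simp
 thus "YV n (vv xs) v = V.npc exV xs (2 * (n + 1 - (SUM x<-xs. int (snd (snd x))))) v" using E(2)[OF xs] by (simp add: Y_V_def V_normal_order_eq)
qed

lemma YWb_linear: "lin scV scW (%u. YWb k u w)"
 and YWb_vec: "xs \<in> CW ==> YWb k (vv xs) w = W.npc exW xs (k + 2 - V.level xs) w"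
proof -
 have m: "multilinear scH scW (%xs. normal_product_coeff scW W.NO exW xs (- of_int k / 2 - 1) w)"
  by (rule W.normal_product_coeff_multilinear[where r = "%s. of_nat (par s) / 2"]) simp
 note E = V_lin_extend[OF W.W.vector_space_axioms m]
 show "lin scV scW (%u. YWb k u w)" using E(1) by (simp add: Y_W_bar_def W_normal_order_eq)
 assume xs: "xs \<in> CW"
 have sum: "(SUM x<-xs. of_nat (par (fst x)) / 2 - 1 - of_nat (snd (snd x) - 1)) = - (of_int (V.level xs) / 2 :: complex)"
  using xs by (induction xs) (auto simp: creation_words_def of_nat_diff field_simps)
 have "normal_product_coeff scW W.NO exW xs (- of_int k / 2 - 1) w = W.npc exW xs (k + 2 - V.level xs) w"
 proof (rule W.normal_product_coeff_eq[where r = "%s. of_nat (par s) / 2"])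
  fix t
  have "- of_int t + - (of_int (V.level xs) / 2) = - of_int k / 2 - (1 :: complex) \<longleftrightarrow>
    of_int (2 * t) = (of_int (k + 2 - V.level xs) :: complex)"
  proof -
   have "- of_int t + - (of_int (V.level xs) / 2) - (- of_int k / 2 - (1 :: complex)) =
     (of_int (k + 2 - V.level xs) - of_int (2 * t)) / 2" by (simp add: field_simps)
   thus ?thesis by (metis (no_types, lifting) div_0 divide_eq_0_iff eq_iff_diff_eq_0 zero_neq_numeral)
  qed
  thus "(2 * t = k + 2 - V.level xs) =
   (- of_int t + (SUM x<-xs. of_nat (par (fst x)) / 2 - 1 - of_nat (snd (snd x) - 1)) = - of_int k / 2 - (1 :: complex))"
   unfolding sum by (simp only: of_int_eq_iff)
 qed simp
 thus "YWb k (vv xs) w = W.npc exW xs (k + 2 - V.level xs) w" using E(2)[OF xs] by (simp add: Y_W_bar_def W_normal_order_eq)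
qed

end

section \<open>The exponential of \<open>\<Delta>(x)\<close> as a Wick exponential\<close>

lemma sum_triangle_swap:
 fixes f :: "nat => nat => 'a::comm_monoid_add" shows "(SUM p<=q. SUM p'<=q - p. f p p') = (SUM p'<=q. SUM p<=q - p'. f p p')"
 by (subst (1 2) sum.Sigma) (auto intro!: sum.reindex_bij_witness[where i = prod.swap and j = prod.swap])

lemma C_coeff_antisym: "C_coeff n m = - C_coeff m n"
proof -
 have "(of_nat n - of_nat m) / (of_nat n + of_nat m - 1) = - ((of_nat m - of_nat n) / (of_nat m + of_nat n - 1 :: complex))"
  by (simp only: minus_diff_eq minus_divide_left add.commute)
 thus ?thesis by (simp add: C_coeff_def)
qed

context setting
begin

abbreviation "D p == Delta_coeff lF es scV \<pi>V p"
abbreviation "DT == Delta_power_coeff lF es scV \<pi>V"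
abbreviation "DE == exp_Delta_coeff lF es scV \<pi>V"

text \<open>The two modes of \<Delta> meet a pair of letters in either order; by antisymmetry of
  \<open>C_coeff\<close> the two contributions agree and cancel the factor 1/2. Of the two factors
  \<open>lF\<close> one cancels against \<open>1 / lF\<close>.\<close>

definition Delta_contr :: "'h letter => 'h letter => complex" where
 "Delta_contr = (%(s, a, m) (s', b, n). if s = Fer & s' = Fer then - C_coeff m n * (lF * frm a b) else 0)"

lemma Delta_contr_homog: "homog (fst x) (Delta_contr x)" by (auto simp: homog_def Delta_contr_def split: prod.splits)

lemma scH_expand: "a = (SUM e<-es. scH (frm e a) e)"
proof -
 interpret H: vector_space scH by (rule scH)
 have span: "H.span (set es) = UNIV"
  and orth: "!!i j. i < length es ==> j < length es ==> frm (es ! i) (es ! j) = (if i = j then 1 else 0)"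
  using es by (auto simp: orthonormal_basis_def)
 have "a \<in> H.span (set es)" using span by simp
 thus ?thesis
 proof (induction rule: H.span_induct_alt)
  case base
  have "frm e 0 = 0" for e using V.frm_scale(1)[of e 0 0] by simp
  thus ?case by (simp add: sum_list_0)
 next
  case (step c x y)
  from step(1) obtain j where j: "j < length es" "x = es ! j" by (metis in_set_conv_nth)
  have "(SUM e<-es. scH (frm e x) e) = (SUM i<length es. scH (frm (es ! i) x) (es ! i))" by (simp add: sum_list_sum_nth atLeast0LessThan)
  also have "... = (SUM i<length es. if i = j then es ! i else 0)" by (rule sum.cong) (auto simp: orth j)
  also have "... = x" using j by simp
  finally have x: "(SUM e<-es. scH (frm e x) e) = x" .
  have "(SUM e<-es. scH (frm e (scH c x + y)) e) =
    scH c (SUM e<-es. scH (frm e x) e) + (SUM e<-es. scH (frm e y) e)" by (induction es) (simp_all add: V.frm_add V.frm_scale algebra_simps)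
  thus ?case using step(2) by (simp add: x)
 qed
qed

abbreviation "pairs p == {(m :: nat, n :: nat). m >= 1 & n >= 1 & m + n = p + 1}"

lemma finite_pairs: "finite (pairs p)" by (rule finite_subset[of _ "{..p + 1} \<times> {..p + 1}"]) auto

lemma D_linear: "lin scV scV (D p)"
proof -
 have add: "(SUM e<-es. f e + g e) = (SUM e<-es. f e) + (SUM e<-es. g e)"
  and scale: "(SUM e<-es. scV c (f e)) = scV c (SUM e<-es. f e)" for f g :: "'h => 'v" and c by (induction es) (simp_all add: algebra_simps)
 have "(\<Sum>(m, n)\<in>pairs p. scV (1/2 * C_coeff m n / lF) (V.A Fer e (int m - 1) (V.A Fer e (int n - 1) (scV r u)))) =
   scV r (\<Sum>(m, n)\<in>pairs p. scV (1/2 * C_coeff m n / lF) (V.A Fer e (int m - 1) (V.A Fer e (int n - 1) u)))" for e r u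
  unfolding V.W.scale_sum_right by (rule sum.cong) (auto simp: V.A_scale mult.commute)
 hence "D p (scV r u) = scV r (D p u)" for r u unfolding Delta_coeff_def by (simp only: scale)
 moreover have "D p (u + v) = D p u + D p v" for u v by (simp add: Delta_coeff_def case_prod_unfold V.A_add V.W.scale_right_distrib sum.distrib add)
 ultimately show ?thesis by unfold_locales
qed

lemma D_add: "D p (u + v) = D p u + D p v" and D_scale: "D p (scV c u) = scV c (D p u)"
 and D_zero [simp]: "D p 0 = 0"
proof -
 interpret D: Vector_Spaces.linear scV scV "D p" by (rule D_linear)
 show "D p (u + v) = D p u + D p v" "D p (scV c u) = scV c (D p u)" "D p 0 = 0" by (fact D.add D.scale D.zero)+
qed

lemma D_minus: "D p (- u) = - D p u" using D_scale[of p "-1" u] by simp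

lemma D_sum: "D p (SUM i:I. f i) = (SUM i:I. D p (f i))" by (induction I rule: infinite_finite_induct) (simp_all add: D_add)

lemma D_0 [simp]: "D 0 u = 0"
proof -
 have "pairs 0 = {}" by auto
 thus ?thesis unfolding Delta_coeff_def by (simp only: sum.empty sum_list_0)
qed

text \<open>The commutator of the coefficient \<open>p\<close> of \<open>\<Delta>(x)\<close> with a creation operator.\<close>

definition Dc :: "'h letter => nat => 'v => 'v" where
 "Dc = (%(s, a, m) p u. if s = Fer & 1 <= m & m <= p
   then scV (- C_coeff m (p + 1 - m)) (V.A Fer a (int p - int m) u) else 0)"

lemma Dc_linear: "lin scV scV (Dc x p)" by unfold_locales (auto simp: Dc_def V.A_add V.A_scale algebra_simps split: prod.splits)

lemma Dc_add: "Dc x p (u + v) = Dc x p u + Dc x p v" and Dc_scale: "Dc x p (scV c u) = scV c (Dc x p u)"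
 and Dc_zero [simp]: "Dc x p 0 = 0"
proof -
 interpret D: Vector_Spaces.linear scV scV "Dc x p" by (rule Dc_linear)
 show "Dc x p (u + v) = Dc x p u + Dc x p v" "Dc x p (scV c u) = scV c (Dc x p u)" "Dc x p 0 = 0" by (fact D.add D.scale D.zero)+
qed

lemma Dc_sum: "Dc x p (SUM i:I. f i) = (SUM i:I. Dc x p (f i))" by (induction I rule: infinite_finite_induct) (simp_all add: Dc_add)

text \<open>\<Delta> is quadratic in positive modes, so its commutator with a creation operator is
  linear in them; summing over the orthonormal basis recovers a mode of \<open>a\<close>
  itself.\<close>

lemma D_create:
 assumes m: "m >= 1" shows "D p (V.A s a (- int m) u) = V.A s a (- int m) (D p u) + Dc (s, a, m) p u"
proof -
 let ?E = "%e i. V.A Fer e (int i - 1)"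
 let ?A = "V.A s a (- int m)"
 have A_sum: "?A (SUM i:I. f i) = (SUM i:I. ?A (f i))" for I :: "(nat \<times> nat) set" and f
  by (induction I rule: infinite_finite_induct) (simp_all add: V.A_add)
 have A_sum_list: "?A (SUM e<-es. f e) = (SUM e<-es. ?A (f e))" for f by (induction es) (simp_all add: V.A_add)
 have E: "?E e i (?A v) = scV (sg Fer s) (?A (?E e i v)) + scV (if s = Fer & i = m then lF * frm e a else 0) v"
  if "i >= 1" for e i v using that m V.A_super_neg[of Fer "int i - 1" "- int m" e s a v] by (simp add: dg_def contr_coeff_def split: if_splits)
 show ?thesis
 proof (cases s)
  case Bos
  have "?E e i (?A v) = ?A (?E e i v)" if "i >= 1" for e i v using E[OF that] Bos by simp
  hence "D p (?A u) = ?A (D p u)" unfolding Delta_coeff_def A_sum_list A_sum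
   by (intro arg_cong[of _ _ sum_list] map_cong sum.cong) (auto simp: V.A_scale)
  thus ?thesis by (simp add: Bos Dc_def)
 next
  case Fer
  let ?k = "%e i. if i = m then lF * frm e a else 0"
  have EE: "?E e i (?E e j (?A u)) = ?A (?E e i (?E e j u)) + scV (?k e j) (?E e i u) - scV (?k e i) (?E e j u)"
   if "i >= 1" "j >= 1" for e i j using that E[of i e] E[of j e] by (simp add: Fer V.A_add V.A_scale V.A_minus V.A_diff)
  have 1: "D p (?A u) = ?A (D p u) + (SUM e<-es. \<Sum>(i, j)\<in>pairs p.
    scV (1/2 * C_coeff i j / lF) (scV (?k e j) (?E e i u) - scV (?k e i) (?E e j u)))"
  proof -
   have "(\<Sum>(i, j)\<in>pairs p. scV (1/2 * C_coeff i j / lF) (?E e i (?E e j (?A u)))) =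
    ?A (\<Sum>(i, j)\<in>pairs p. scV (1/2 * C_coeff i j / lF) (?E e i (?E e j u))) +
    (\<Sum>(i, j)\<in>pairs p. scV (1/2 * C_coeff i j / lF) (scV (?k e j) (?E e i u) - scV (?k e i) (?E e j u)))" for e
    unfolding A_sum sum.distrib[symmetric] by (rule sum.cong) (auto simp: EE V.A_scale V.W.scale_right_distrib simp flip: add_diff_eq)
   hence "D p (?A u) = (SUM e<-es. ?A (\<Sum>(i, j)\<in>pairs p. scV (1/2 * C_coeff i j / lF) (?E e i (?E e j u))) +
    (\<Sum>(i, j)\<in>pairs p. scV (1/2 * C_coeff i j / lF) (scV (?k e j) (?E e i u) - scV (?k e i) (?E e j u))))" unfolding Delta_coeff_def by simp
   thus ?thesis unfolding Delta_coeff_def A_sum_list by (simp add: sum_list_addf)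
  qed
  \<comment> \<open>Only the pairs \<open>(p + 1 - m, m)\<close> and \<open>(m, p + 1 - m)\<close>
    meet the creation operator, and by antisymmetry they contribute equally.\<close>
  have 2: "(\<Sum>(i, j)\<in>pairs p. scV (1/2 * C_coeff i j / lF) (scV (?k e j) (?E e i u) - scV (?k e i) (?E e j u))) =
    scV (frm e a) (if m <= p then scV (- C_coeff m (p + 1 - m)) (V.A Fer e (int p - int m) u) else 0)" for e
  proof (cases "m <= p")
   case True
   have "(\<Sum>(i, j)\<in>pairs p. scV (1/2 * C_coeff i j / lF) (scV (?k e j) (?E e i u))) =
     scV (1/2 * C_coeff (p + 1 - m) m * frm e a) (?E e (p + 1 - m) u)" using True m lF
    by (subst sum.mono_neutral_right[OF finite_pairs, of "{(p + 1 - m, m)}"]) (auto split: if_splits)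
   moreover have "(\<Sum>(i, j)\<in>pairs p. scV (1/2 * C_coeff i j / lF) (scV (?k e i) (?E e j u))) =
     scV (1/2 * C_coeff m (p + 1 - m) * frm e a) (?E e (p + 1 - m) u)" using True m lF
    by (subst sum.mono_neutral_right[OF finite_pairs, of "{(m, p + 1 - m)}"]) (auto split: if_splits)
   moreover have "int (p + 1 - m) - 1 = int p - int m" using True by simp
   moreover have "scV (1/2 * C_coeff (p + 1 - m) m * frm e a) v - scV (1/2 * C_coeff m (p + 1 - m) * frm e a) v =
     scV (frm e a) (scV (- C_coeff m (p + 1 - m)) v)" for v unfolding V.W.scale_scale V.W.scale_left_diff_distrib[symmetric]
    by (rule arg_cong[of _ _ "%c. scV c v"]) (subst C_coeff_antisym[of "p + 1 - m" m], simp)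
   ultimately show ?thesis using True by (simp only: V.W.scale_right_diff_distrib case_prod_unfold sum_subtractf if_True)
  next
   case False
   hence "(\<Sum>(i, j)\<in>pairs p. scV (1/2 * C_coeff i j / lF) (scV (?k e j) (?E e i u) - scV (?k e i) (?E e j u))) = 0"
    by (intro sum.neutral) auto
   thus ?thesis using False by simp
  qed
  have 3: "(SUM e<-es. scV (frm e a) (if m <= p then scV (- C_coeff m (p + 1 - m)) (V.A Fer e (int p - int m) u) else 0)) =
    Dc (Fer, a, m) p u"
  proof -
   have expand: "(SUM e<-es. scV (frm e a) (V.A Fer e k u)) = V.A Fer a k u" for k
   proof -
    have "V.A Fer (SUM e<-l. scH (frm e a) e) k u = (SUM e<-l. scV (frm e a) (V.A Fer e k u))" for l
    proof (induction l)
     case Nil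
     have "V.A Fer 0 k u = 0" using V.A_add_left[of Fer 0 0 k u] by simp
     thus ?case by simp
    qed (simp add: V.A_add_left V.A_scale_left)
    thus ?thesis using scH_expand[of a] by metis
   qed
   have pull: "(SUM e<-l. scV (frm e a) (scV c (f e))) = scV c (SUM e<-l. scV (frm e a) (f e))" for c f l
    by (induction l) (simp_all add: V.W.scale_right_distrib mult.commute)
   show ?thesis
   proof (cases "m <= p")
    case True
    thus ?thesis using m by (simp only: if_True pull expand) (simp add: Dc_def)
   qed (simp add: Dc_def)
  qed
  show ?thesis using 1 unfolding 2 3 by (simp only: Fer)
 qed
qed

text \<open>\<open>Dc\<close> is a multiple of a single positive mode, which anticommutes with both
  modes of each summand of \<Delta>.\<close>

lemma D_Dc: "D p (Dc x p' u) = Dc x p' (D p u)"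
proof (cases "fst x = Fer & 1 <= snd (snd x) & snd (snd x) <= p'")
 case True
 obtain a m where x: "x = (Fer, a, m)" "1 <= m" "m <= p'" using True by (cases x) auto
 let ?A = "V.A Fer a (int p' - int m)"
 let ?E = "%e i. V.A Fer e (int i - 1)"
 have A_sum: "?A (SUM i:I. f i) = (SUM i:I. ?A (f i))" for I :: "(nat \<times> nat) set" and f
  by (induction I rule: infinite_finite_induct) (simp_all add: V.A_add)
 have A_sum_list: "?A (SUM e<-es. f e) = (SUM e<-es. ?A (f e))" for f by (induction es) (simp_all add: V.A_add)
 have "?E e i (?A v) = - ?A (?E e i v)" if "i >= 1" for e i v
  using that x V.A_super_pos[of Fer "int i - 1" Fer "int p' - int m" e a v] by (simp add: dg_def)
 hence "D p (?A u) = ?A (D p u)" unfolding Delta_coeff_def A_sum_list A_sum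
  by (intro arg_cong[of _ _ sum_list] map_cong sum.cong) (auto simp: V.A_scale V.A_minus)
 thus ?thesis using x by (simp add: Dc_def D_scale D_minus)
qed (auto simp: Dc_def split: prod.splits)

text \<open>The commutator \<open>Dc\<close> commutes with \<Delta>, so the power rule of a
  derivation holds. For \<open>t = 0\<close> the truncated \<open>t - 1\<close> is harmless because
  of the factor \<open>of_nat t\<close>.\<close>

lemma DT_create:
 assumes m: "m >= 1" shows "DT t q (V.A s a (- int m) u) = V.A s a (- int m) (DT t q u)
   + scV (of_nat t) (SUM p<=q. Dc (s, a, m) p (DT (t - 1) (q - p) u))"
proof (induction t arbitrary: q)
 case 0
 thus ?case by simp
next
 case (Suc t)
 let ?A = "V.A s a (- int m)" and ?x = "(s, a, m)"
 have A_sum: "?A (SUM i:I. f i) = (SUM i:I. ?A (f i))" for I :: "nat set" and f by (induction I rule: infinite_finite_induct) (simp_all add: V.A_add)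
 have *: "scV (of_nat t) (SUM p<=q. SUM p'<=q - p. D p (Dc ?x p' (DT (t - 1) (q - p - p') u))) =
   scV (of_nat t) (SUM p'<=q. Dc ?x p' (DT t (q - p') u))"
 proof (cases t)
  case (Suc t')
  have "(SUM p<=q. SUM p'<=q - p. D p (Dc ?x p' (DT t' (q - p - p') u))) =
    (SUM p'<=q. SUM p<=q - p'. D p (Dc ?x p' (DT t' (q - p - p') u)))" by (rule sum_triangle_swap)
  also have "... = (SUM p'<=q. Dc ?x p' (DT t (q - p') u))" by (simp add: D_Dc Suc Dc_sum add.commute)
  finally show ?thesis using Suc by simp
 qed simp
 have "DT (Suc t) q (?A u) = (SUM p<=q. ?A (D p (DT t (q - p) u)) + Dc ?x p (DT t (q - p) u) +
   scV (of_nat t) (SUM p'<=q - p. D p (Dc ?x p' (DT (t - 1) (q - p - p') u))))" by (simp add: Suc D_add D_create[OF m] D_scale D_sum)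
 also have "... = ?A (DT (Suc t) q u) + (SUM p<=q. Dc ?x p (DT t (q - p) u)) +
   scV (of_nat t) (SUM p<=q. SUM p'<=q - p. D p (Dc ?x p' (DT (t - 1) (q - p - p') u)))" by (simp add: sum.distrib A_sum V.W.scale_sum_right)
 also have "... = ?A (DT (Suc t) q u) + scV (of_nat (Suc t)) (SUM p<=q. Dc ?x p (DT t (q - p) u))" unfolding * by (simp add: algebra_simps)
 finally show ?case by simp
qed

text \<open>\<Delta> has no coefficient of order 0, so its \<open>t\<close>-th power starts at order
  \<open>t\<close>.\<close>

lemma DT_eq_0: "t > q ==> DT t q u = 0"
proof (induction t arbitrary: q)
 case (Suc t)
 have "D p (DT t (q - p) u) = 0" if "p <= q" for p
 proof (cases "p = 0")
  case False
  hence "q - p < t" using Suc.prems that by linarith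
  thus ?thesis by (simp add: Suc.IH)
 qed simp
 thus ?case by simp
qed simp

lemma DE_eq: "N >= q ==> DE q u = (SUM t<=N. scV (1 / fact t) (DT t q u))" unfolding exp_Delta_coeff_def
 by (rule Sum_any.expand_superset) (auto, metis DT_eq_0 V.W.scale_zero_right leI order.strict_trans1)

lemma DE_linear: "lin scV scV (DE q)"
proof -
 have "DT t q (u + v) = DT t q u + DT t q v" "DT t q (scV c u) = scV c (DT t q u)" for t q u v c
  by (induction t arbitrary: q) (simp_all add: D_add D_scale sum.distrib V.W.scale_sum_right)
 thus ?thesis by unfold_locales (simp_all add: DE_eq[OF order_refl] V.W.scale_right_distrib sum.distrib
    V.W.scale_sum_right mult.commute)
qed

lemma DE_create:
 assumes m: "m >= 1" shows "DE q (V.A s a (- int m) u) = V.A s a (- int m) (DE q u) + (SUM p<=q. Dc (s, a, m) p (DE (q - p) u))"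
proof -
 let ?A = "V.A s a (- int m)" and ?x = "(s, a, m)"
 have A_sum: "?A (SUM i:I. f i) = (SUM i:I. ?A (f i))" for I :: "nat set" and f by (induction I rule: infinite_finite_induct) (simp_all add: V.A_add)
 have "DE q (?A u) = (SUM t<=Suc q. scV (1 / fact t) (DT t q (?A u)))" by (rule DE_eq) simp
 also have "... = ?A (SUM t<=Suc q. scV (1 / fact t) (DT t q u)) +
   (SUM t<=Suc q. scV (of_nat t / fact t) (SUM p<=q. Dc ?x p (DT (t - 1) (q - p) u)))"
  by (simp add: DT_create[OF m] A_sum V.A_scale V.W.scale_right_distrib sum.distrib del: sum.atMost_Suc)
 also have "(SUM t<=Suc q. scV (1 / fact t) (DT t q u)) = DE q u" by (rule DE_eq[symmetric]) simp
 also have "(SUM t<=Suc q. scV (of_nat t / fact t) (SUM p<=q. Dc ?x p (DT (t - 1) (q - p) u))) =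
   (SUM t<=q. scV (1 / fact t) (SUM p<=q. Dc ?x p (DT t (q - p) u)))" by (subst sum.atMost_Suc_shift) (simp add: divide_simps del: of_nat_Suc)
 also have "... = (SUM p<=q. Dc ?x p (SUM t<=q. scV (1 / fact t) (DT t (q - p) u)))"
  by (simp add: V.W.scale_sum_right Dc_sum Dc_scale) (rule sum.swap)
 also have "... = (SUM p<=q. Dc ?x p (DE (q - p) u))" by (intro sum.cong refl) (simp add: DE_eq[of _ q])
 finally show ?thesis .
qed

lemma DE_vac: "DE q (vac \<pi>V) = (if q = 0 then vac \<pi>V else 0)"
proof -
 have D: "D p (vac \<pi>V) = 0" for p
 proof -
  have "(\<Sum>(m, n)\<in>pairs p. scV (1/2 * C_coeff m n / lF)
    (V.A Fer e (int m - 1) (V.A Fer e (int n - 1) (vac \<pi>V)))) = 0" for e by (rule sum.neutral) (auto simp: vac_eq V.A_io_pos dg_def)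
  thus ?thesis unfolding Delta_coeff_def by simp
 qed
 have "DT (Suc t) q (vac \<pi>V) = 0" for t q
 proof (induction t arbitrary: q)
  case 0
  have "D p (if C then vac \<pi>V else 0) = 0" for p C by (simp add: D)
  thus ?case by simp
 next
  case (Suc t)
  thus ?case by (subst Delta_power_coeff.simps(2)) (simp only: D_zero sum.neutral_const)
 qed
 thus ?thesis by (simp add: DE_eq[of q "Suc q"] sum.atMost_Suc_shift del: sum.atMost_Suc)
qed

lemma level_sum: "V.level xs = (SUM x<-xs. 2 * int (snd (snd x)) - int (par (fst x)))" by (simp add: V.level_def)

lemma V_level_append: "V.level (u @ v) = V.level u + V.level v" by (simp add: V.level_def)

text \<open>By \<open>DE_create\<close> a new letter is either kept or contracted with a survivor,
  as in the recursion of \<open>wick\<close>. The order \<open>q\<close> can be read off at the end,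
  since every contraction lowers the level by twice its order.\<close>

lemma DE_vec:
 assumes "xs \<in> CW" shows "DE q (vv xs) = V.W.wick Delta_contr xs (%v. if V.level v + 2 * int q = V.level xs then vv v else 0)" using assms
proof (induction xs arbitrary: q)
 case Nil
 thus ?case by (simp add: DE_vac)
next
 case (Cons x xs)
 obtain s a m where x: "x = (s, a, m)" by (cases x)
 have m: "m >= 1" and xs: "xs \<in> CW" using Cons.prems x by auto
 let ?P = "%v. v \<in> CW & V.level v <= V.level xs"
 have step: "V.A s a (- int m) (if V.level v + 2 * int q = V.level xs then vv v else 0) +
   (SUM p<=q. Dc x p (if V.level v + 2 * int (q - p) = V.level xs then vv v else 0)) =
   (if V.level (x # v) + 2 * int q = V.level (x # xs) then vv (x # v) else 0) +
   V.W.contract (fst x) (Delta_contr x) v (%u. if V.level u + 2 * int q = V.level (x # xs) then vv u else 0)"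
  if P: "?P v" for v
 proof -
  \<comment> \<open>The order of a contraction of \<open>x\<close> with \<open>y\<close> is
    determined by the two letters: \<open>p = m + n - 1\<close>.\<close>
  let ?c = "%p y. if fst y = Fer & m + snd (snd y) = p + 1 & V.level v + 2 * int (q - p) = V.level xs
    then Delta_contr x y else 0"
  have Dc_v: "Dc x p (if V.level v + 2 * int (q - p) = V.level xs then vv v else 0) =
    V.W.contract (fst x) (?c p) v vv" if "p <= q" for p
  proof (cases "V.level v + 2 * int (q - p) = V.level xs")
   case True
   show ?thesis
   proof (cases "s = Fer & m <= p")
    case sm: True
    have "Dc x p (vv v) = V.W.contract Fer (%y. - C_coeff m (p + 1 - m) * V.kap (Fer, a, int p - int m) (neg y)) v vv"
    proof -
     have "Dc x p (vv v) = scV (- C_coeff m (p + 1 - m)) (V.A Fer a (int p - int m) (vv v))" using sm m by (simp add: x Dc_def)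
     also have "V.A Fer a (int p - int m) (vv v) =
       V.W.contract Fer (%y. V.kap (Fer, a, int p - int m) (neg y)) v vv"
      using sm P V.A_pos_create[of Fer "int p - int m" v a 1] by (simp add: dg_def V_vec_eq[abs_def])
     finally show ?thesis by (simp only: V.W.contract_scale_left)
    qed
    also have "... = V.W.contract Fer (?c p) v vv"
    proof (rule V.W.contract_cong, intro conjI)
     fix u y w assume v: "v = u @ y # w"
     obtain s' b n where y: "y = (s', b, n)" by (cases y)
     have "int p - int m - int n + 1 = 0 \<longleftrightarrow> m + n = p + 1" by auto
     thus "- C_coeff m (p + 1 - m) * V.kap (Fer, a, int p - int m) (neg y) = ?c p y" using sm True by (cases "m + n = p + 1")
       (auto simp: y x contr_coeff_def dg_def Delta_contr_def, metis add_diff_cancel_left')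
    qed simp
    finally show ?thesis using True sm by (simp add: x)
   next
    case False
    have "?c p y = 0" if "y \<in> set v" for y
    proof -
     have "snd (snd y) >= 1" using P that by (auto simp: creation_words_def)
     thus ?thesis using False by (auto simp: x Delta_contr_def split: prod.splits)
    qed
    hence "V.W.contract (fst x) (?c p) v vv = 0" by (rule V.W.contract_eq_0)
    moreover have "Dc x p (vv v) = 0" using False by (auto simp: x Dc_def)
    ultimately show ?thesis using True by simp
   qed
  next
   case False
   hence "?c p = (%y. 0)" by auto
   thus ?thesis using False by simp
  qed
  have sum_contract: "(SUM p:I. V.W.contract t (c p) v vv) = V.W.contract t (%y. SUM p:I. c p y) v vv"
   for I :: "nat set" and c t by (induction I rule: infinite_finite_induct) (simp_all add: V.W.contract_add_left)
  have "(SUM p<=q. Dc x p (if V.level v + 2 * int (q - p) = V.level xs then vv v else 0)) =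
    V.W.contract (fst x) (%y. SUM p<=q. ?c p y) v vv" unfolding sum_contract[symmetric] by (intro sum.cong refl Dc_v) simp
  also have "... = V.W.contract (fst x) (%y. if V.level v - V.level [y] + 2 * int q = V.level (x # xs)
    then Delta_contr x y else 0) v vv"
  proof (rule V.W.contract_cong, intro conjI)
   fix u y w assume v: "v = u @ y # w"
   obtain s' b n where y: "y = (s', b, n)" by (cases y)
   have n: "n >= 1" using P v y by (auto simp: creation_words_def)
   show "(SUM p<=q. ?c p y) = (if V.level v - V.level [y] + 2 * int q = V.level (x # xs)
    then Delta_contr x y else 0)"
   proof (cases "s = Fer & s' = Fer")
    case True
    have "(SUM p<=q. ?c p y) = (SUM p<=q. if p = m + n - 1 then
      (if V.level v + 2 * int (q - p) = V.level xs then Delta_contr x y else 0) else 0)" using m by (intro sum.cong) (auto simp: y True)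
    also have "... = (if m + n - 1 <= q then
      (if V.level v + 2 * int (q - (m + n - 1)) = V.level xs then Delta_contr x y else 0) else 0)" by (simp add: sum.delta)
    also have "... = (if V.level v - V.level [y] + 2 * int q = V.level (x # xs) then Delta_contr x y else 0)" using P m n True by (auto simp: x y)
    finally show ?thesis .
   next
    case False
    hence "Delta_contr x y = 0" by (auto simp: x y Delta_contr_def)
    thus ?thesis by (simp cong: if_cong)
   qed
  qed simp
  also have "... = V.W.contract (fst x) (Delta_contr x) v
    (%u. if V.level u + 2 * int q = V.level (x # xs) then vv u else 0)"
  proof -
   have "V.W.contract t (%y. if V.level v - V.level [y] + j = k then ph y else 0) v Ps =
     V.W.contract t ph v (%u. if V.level u + j = k then Ps u else 0)" for t j k ph Ps unfolding V.W.contract_eq_sum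
   proof (intro sum.cong refl)
    fix p assume "p \<in> {..<length v}"
    hence "V.level v = V.level (del p v) + V.level [v ! p]" using id_take_nth_drop[of p v] V_level_append[of "take p v" "v ! p # drop (Suc p) v"]
      V_level_append[of "[v ! p]" "drop (Suc p) v"] by (simp add: del_def V_level_append)
    hence *: "V.level v - V.level [v ! p] = V.level (del p v)" by simp
    show "scV ((PROD x<-take p v. sg t (fst x)) * (if V.level v - V.level [v ! p] + j = k then ph (v ! p) else 0)) (Ps (del p v)) =
     scV ((PROD x<-take p v. sg t (fst x)) * ph (v ! p)) (if V.level (del p v) + j = k then Ps (del p v) else 0)" unfolding * by simp
   qed
   thus ?thesis .
  qed
  finally show ?thesis by (simp add: x)
 qed
 have wick_A: "V.A s a k (V.W.wick c w Ph) = V.W.wick c w (%v. V.A s a k (Ph v))" for k c w Ph by (rule linear_wick[OF V.A_linear])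
 have wick_Dc: "Dc x p (V.W.wick c w Ph) = V.W.wick c w (%v. Dc x p (Ph v))" for p c w Ph by (rule linear_wick[OF Dc_linear])
 have wick_sum: "(SUM p:I. V.W.wick c w (Ph p)) = V.W.wick c w (%v. SUM p:I. Ph p v)" for I :: "nat set" and c w Ph
  by (induction I rule: infinite_finite_induct) (simp_all add: V.W.wick_add)
 have "DE q (vv (x # xs)) = V.W.wick Delta_contr xs (%v.
   V.A s a (- int m) (if V.level v + 2 * int q = V.level xs then vv v else 0) +
   (SUM p<=q. Dc x p (if V.level v + 2 * int (q - p) = V.level xs then vv v else 0)))"
 proof -
  have "DE q (vv (x # xs)) = V.A s a (- int m) (DE q (vv xs)) + (SUM p<=q. Dc x p (DE (q - p) (vv xs)))" using DE_create[OF m] by (simp add: x)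
  thus ?thesis unfolding Cons.IH[OF xs] wick_A wick_Dc wick_sum V.W.wick_add .
 qed
 also have "... = V.W.wick Delta_contr (x # xs)
   (%v. if V.level v + 2 * int q = V.level (x # xs) then vv v else 0)" unfolding V.W.wick.simps
 proof (rule V.W.wick_cong[where P = ?P, OF Delta_contr_homog Delta_contr_homog])
  fix u x v y t
  assume P: "u @ x # v @ y # t \<in> CW & V.level (u @ x # v @ y # t) <= V.level xs"
  hence "[x] \<in> CW" "[y] \<in> CW" by (auto simp: creation_words_def)
  hence "V.level [x] >= 0" "V.level [y] >= 0" by (auto intro: V.level_nonneg)
  moreover have "V.level (u @ x # v @ y # t) = V.level (u @ v @ t) + V.level [x] + V.level [y]" by (simp add: V.level_def)
  ultimately show "Delta_contr x y = Delta_contr x y &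
    (Delta_contr x y ~= 0 --> u @ v @ t \<in> CW & V.level (u @ v @ t) <= V.level xs)" using P by (auto simp: creation_words_def)
 qed (use xs step in auto)
 finally show ?case .
qed

lemma DE_eq_0:
 obtains Q where "!!q. q > Q ==> DE q u = 0"
proof -
 have "\<exists>Q. \<forall>q>Q. DE q u = 0"
 proof -
  have "u \<in> V.W.span (vv ` CW)" using V_span by simp
  thus ?thesis
  proof (induction rule: V.W.span_induct_alt)
   case base
   have "DE q 0 = 0" for q using DE_linear[of q] by (metis V.W.scale_zero_left Vector_Spaces.linear_iff)
   thus ?case by simp
  next
   case (step c x y)
   then obtain xs Q where xs: "x = vv xs" "xs \<in> CW" and Q: "\<forall>q>Q. DE q y = 0" by blast
   have "DE q (vv xs) = 0" if "int q > V.level xs" for q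
   proof -
    have "V.W.wick Delta_contr xs (%v. if V.level v + 2 * int q = V.level xs then vv v else 0) =
      V.W.wick Delta_contr xs (%v. 0)"
    proof (rule V.W.wick_cong[OF Delta_contr_homog Delta_contr_homog,
       where P = "%v. v \<in> CW"])
     fix v :: "'h word" assume "v \<in> CW"
     hence "V.level v >= 0" by (rule V.level_nonneg)
     thus "(if V.level v + 2 * int q = V.level xs then vv v else 0) = 0" using that by auto
    qed (use xs in "auto simp: creation_words_def")
    thus ?thesis by (simp add: DE_vec[OF xs(2)])
   qed
   hence "DE q (scV c x + y) = 0" if "q > max Q (nat (V.level xs))" for q
   proof -
    have "V.level xs < int q" using that by linarith
    thus ?thesis using that Q DE_linear[of q] \<open>!!q. V.level xs < int q ==> DE q (vv xs) = 0\<close>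
     by (simp add: xs(1) Vector_Spaces.linear_iff)
   qed
   thus ?case by blast
  qed
 qed
 thus ?thesis using that by blast
qed

lemma YW_eq_sum:
 assumes "!!q. q > Q ==> DE q u = 0" shows "YW k u w = (SUM q<=Q. YWb (k - 2 * int q) (DE q u) w)"
proof -
 have "YWb k 0 w = 0" for k using YWb_linear[of k w] by (metis V.W.scale_zero_left W.W.scale_zero_left Vector_Spaces.linear_iff)
 thus ?thesis unfolding Y_W_def using assms by (intro Sum_any.expand_superset) (auto, metis not_le)
qed

lemma YW_linear_left: "lin scV scW (%u. YW k u w)"
proof -
 have E: "DE q (u + v) = DE q u + DE q v" "DE q (scV c u) = scV c (DE q u)" for q u v c using DE_linear[of q] by (auto simp: Vector_Spaces.linear_iff)
 have B: "YWb k (u + v) w = YWb k u w + YWb k v w" "YWb k (scV c u) w = scW c (YWb k u w)" for k u v c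
  using YWb_linear[of k w] by (auto simp: Vector_Spaces.linear_iff)
 show ?thesis
 proof unfold_locales
  fix u v c
  obtain Q1 where Q1: "!!q. q > Q1 ==> DE q u = 0" by (rule DE_eq_0[of u]) blast
  obtain Q2 where Q2: "!!q. q > Q2 ==> DE q v = 0" by (rule DE_eq_0[of v]) blast
  let ?Q = "max Q1 Q2"
  have *: "YW k u w = (SUM q<=?Q. YWb (k - 2 * int q) (DE q u) w)"
   "YW k v w = (SUM q<=?Q. YWb (k - 2 * int q) (DE q v) w)"
   "YW k (u + v) w = (SUM q<=?Q. YWb (k - 2 * int q) (DE q (u + v)) w)"
   "YW k (scV c u) w = (SUM q<=?Q. YWb (k - 2 * int q) (DE q (scV c u)) w)" by (rule YW_eq_sum; simp add: E Q1 Q2)+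
  show "YW k (u + v) w = YW k u w + YW k v w" "YW k (scV c u) w = scW c (YW k u w)" unfolding * by (simp_all add: E B sum.distrib W.W.scale_sum_right)
 qed
qed

text \<open>Shifting \<open>k\<close> by \<open>2q\<close> is compensated by the drop in level of
  the survivors, so the same total index serves all matchings and the sum over \<open>q\<close>
  disappears.\<close>

lemma YW_vec:
 assumes U: "U \<in> CW" shows "YW k (vv U) w = W.W.wick Delta_contr U (%v. W.npc exW v (k + 2 - V.level U) w)"
proof -
 let ?X = "%v. W.npc exW v (k + 2 - V.level U) w"
 let ?Q = "nat (V.level U)"
 note hom = Delta_contr_homog
 have B: "YWb (k - 2 * int q) (DE q (vv U)) w = W.W.wick Delta_contr U
   (%v. if V.level v + 2 * int q = V.level U then ?X v else 0)" for q
 proof -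
  have "YWb (k - 2 * int q) (DE q (vv U)) w = W.W.wick Delta_contr U
    (%v. YWb (k - 2 * int q) (if V.level v + 2 * int q = V.level U then vv v else 0) w)" unfolding DE_vec[OF U] by (rule linear_wick[OF YWb_linear])
  also have "... = W.W.wick Delta_contr U (%v. if V.level v + 2 * int q = V.level U then ?X v else 0)"
  proof (rule W.W.wick_cong[OF hom hom, where P = "%v. v \<in> CW"])
   fix v :: "'h word" assume v: "v \<in> CW"
   have "YWb k 0 w = 0" for k using YWb_linear[of k w] by (metis V.W.scale_zero_left W.W.scale_zero_left Vector_Spaces.linear_iff)
   moreover have "YWb (k - 2 * int q) (vv v) w = ?X v" if "V.level v + 2 * int q = V.level U"
   proof -
    have "k - 2 * int q + 2 - V.level v = k + 2 - V.level U" using that by simp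
    thus ?thesis using YWb_vec[OF v, of "k - 2 * int q" w] by (simp only:)
   qed
   ultimately show "YWb (k - 2 * int q) (if V.level v + 2 * int q = V.level U then vv v else 0) w =
     (if V.level v + 2 * int q = V.level U then ?X v else 0)" by simp
  qed (use U in "auto simp: creation_words_def")
  finally show ?thesis .
 qed
 have DE0: "YWb (k - 2 * int q) (DE q (vv U)) w = 0" if "q > ?Q" for q
 proof -
  have "W.W.wick Delta_contr U (%v. if V.level v + 2 * int q = V.level U then ?X v else 0) =
   W.W.wick Delta_contr U (%v. 0)"
  proof (rule W.W.wick_cong[OF hom hom, where P = "%v. v \<in> CW"])
   fix v :: "'h word" assume "v \<in> CW"
   hence "V.level v >= 0" by (rule V.level_nonneg)
   thus "(if V.level v + 2 * int q = V.level U then ?X v else 0) = 0" using that by auto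
  qed (use U in "auto simp: creation_words_def")
  thus ?thesis by (simp add: B)
 qed
 have wick_sum: "(SUM p:I. W.W.wick Delta_contr U (Ph p)) = W.W.wick Delta_contr U (%v. SUM p:I. Ph p v)"
  for I :: "nat set" and Ph by (induction I rule: infinite_finite_induct) (simp_all add: W.W.wick_add)
 have "YW k (vv U) w = (SUM q<=?Q. YWb (k - 2 * int q) (DE q (vv U)) w)"
  unfolding Y_W_def using DE0 by (intro Sum_any.expand_superset) (auto, metis not_le)
 also have "... = W.W.wick Delta_contr U (%v. SUM q<=?Q. if V.level v + 2 * int q = V.level U then ?X v else 0)" by (simp only: B wick_sum)
 also have "... = W.W.wick Delta_contr U ?X"
 proof (rule W.W.wick_cong[OF hom hom, where P = "%v. v \<in> CW & V.level v <= V.level U & even (V.level U - V.level v)"])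
  fix v :: "'h word"
  assume v: "v \<in> CW & V.level v <= V.level U & even (V.level U - V.level v)"
  then obtain i where i: "V.level U - V.level v = 2 * i" by blast
  have "(SUM q<=?Q. if V.level v + 2 * int q = V.level U then ?X v else 0) = (SUM q<=?Q. if q = nat i then ?X v else 0)"
   using v i by (intro sum.cong) auto
  also have "... = ?X v"
  proof -
   have "V.level v >= 0" using v V.level_nonneg by blast
   hence "nat i <= ?Q" using v i by linarith
   thus ?thesis by (simp add: sum.delta)
  qed
  finally show "(SUM q<=?Q. if V.level v + 2 * int q = V.level U then ?X v else 0) = ?X v" .
 next
  fix u v t :: "'h word" and x y
  let ?l = "u @ x # v @ y # t"
  assume P: "?l \<in> CW & V.level ?l <= V.level U & even (V.level U - V.level ?l)"
  show "Delta_contr x y = Delta_contr x y & (Delta_contr x y ~= 0 -->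
    u @ v @ t \<in> CW & V.level (u @ v @ t) <= V.level U & even (V.level U - V.level (u @ v @ t)))"
  proof (intro conjI impI refl)
   assume "Delta_contr x y ~= 0"
   then obtain a m b n where xy: "x = (Fer, a, m)" "y = (Fer, b, n)" by (cases x; cases y) (auto simp: Delta_contr_def split: if_splits)
   have "m >= 1" "n >= 1" using P xy by (auto simp: creation_words_def)
   moreover have "V.level ?l = V.level (u @ v @ t) + 2 * (int m + int n - 1)" by (simp add: V.level_def xy)
   ultimately show "V.level (u @ v @ t) <= V.level U" "even (V.level U - V.level (u @ v @ t))" using P by auto
   show "u @ v @ t \<in> CW" using P by (auto simp: creation_words_def)
  qed
 qed (use U in auto)
 finally show ?thesis .
qed

lemma YW_linear_right: "lin scW scW (YW k u)"
proof -
 have lin: "YW k' (u + v) w = YW k' u w + YW k' v w" "YW k' (scV c u) w = scW c (YW k' u w)" for u v c w k'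
  using YW_linear_left[of k' w] by (auto simp: Vector_Spaces.linear_iff)
 have "u \<in> V.W.span (vv ` CW)" using V_span by simp
 hence "\<forall>w w' c. YW k u (w + w') = YW k u w + YW k u w' & YW k u (scW c w) = scW c (YW k u w)"
 proof (induction rule: V.W.span_induct_alt)
  case base
  have "YW k 0 w = 0" for w using lin(2)[of k 0 0 w] by simp
  thus ?case by simp
 next
  case (step c x y)
  then obtain xs where xs: "x = vv xs" "xs \<in> CW" by blast
  show ?case using step(2) by (simp add: lin xs(1) YW_vec[OF xs(2)] W.npc_add W.npc_scale W.W.wick_add W.W.wick_scale algebra_simps)
 qed
 thus ?thesis by unfold_locales auto
qed

text \<open>
 The contraction \<open>Delta_contr\<close>, seen as a contraction of zero modes: the binomial coefficients
 in \<open>C_coeff\<close> are the coefficients of the zero modes in the derived fields.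
\<close>

definition zero_mode_contr ::
 "stat \<times> ('h \<times> nat) \<times> int => stat \<times> ('h \<times> nat) \<times> int => complex" where
 "zero_mode_contr = (%(s, (a, m), i) (s', (b, n), j).
   if s = Fer & s' = Fer & i = 0 & j = 0
   then - (1/2 * ((of_nat m - of_nat n) / (of_nat m + of_nat n - 1))) * (lF * frm a b) else 0)"

text \<open>\<Delta> contributes \<open>zero_mode_contr\<close>, and expressing normal ordered
  products by plain ones contributes \<open>- kapn\<close>.\<close>

definition W_contr ::
 "stat \<times> ('h \<times> nat) \<times> int => stat \<times> ('h \<times> nat) \<times> int => complex" where
 "W_contr x y = zero_mode_contr x y - W.kapn (md x) (md y)"

lemma zero_mode_contr_homog: "homog (fst x) (zero_mode_contr x)" by (auto simp: homog_def zero_mode_contr_def split: prod.splits)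

lemma kapn_md_homog: "homog (fst x) (%y. W.kapn (md x) (md y))"
proof -
 have "homog (fst (md x)) (W.kapn (md x))" by (rule W.kapn_homog)
 thus ?thesis unfolding homog_def by (metis fst_md)
qed

lemma W_contr_homog: "homog (fst x) (W_contr x)" using zero_mode_contr_homog[of x] kapn_md_homog[of x]
 unfolding homog_def W_contr_def by (metis diff_self)

definition index_sum :: "(stat \<times> 'r \<times> int) list => int" where
 "index_sum w = (SUM x<-w. snd (snd x))"

lemma index_sum_indexed: "length ns = length w ==> index_sum (indexed w ns) = sum_list ns"
 by (induction w ns rule: list_induct2') (auto simp: index_sum_def ix_def)

lemma zero_mode_pair:
 "((%(i, j). mcoeff exW x i * mcoeff exW y j * zero_mode_contr (ix x i) (ix y j))
   has_sum Delta_contr x y) UNIV"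
proof (rule has_sum_finite_neutralI[of "{(0, 0)}"])
 obtain s a m s' b n where [simp]: "x = (s, a, m)" "y = (s', b, n)" by (cases x; cases y)
 have 1: "exW Fer 0 = - (1/2)" by simp
 show "Delta_contr x y = (\<Sum>(i, j)\<in>{(0, 0)}. mcoeff exW x i * mcoeff exW y j *
   zero_mode_contr (ix x i) (ix y j))" by (auto simp: Delta_contr_def zero_mode_contr_def ix_def mcoeff_def C_coeff_def)
qed (auto simp: zero_mode_contr_def ix_def split: prod.splits)

text \<open>Each summand is a combination of plain products of modes, the form in which several
  vertex operators can be composed. The modes removed by \<Delta> have index 0, so all its matchings
  have the same total index.\<close>

lemma YW_vec_has_sum:
 assumes U: "U \<in> CW" and mu: "lin scW (*) mu" shows "((%ns. if 2 * sum_list ns = k + 2 - V.level U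
   then iprod (mcoeff exW) U ns *
    mu (W.W.wick W_contr (indexed U ns) (%u. apply_modes W.A (map md u) w)) else 0)
   has_sum mu (YW k (vv U) w)) (lists_of (length U))"
proof -
 let ?j = "k + 2 - V.level U"
 let ?Ph = "%v. if 2 * index_sum v = ?j then mu (W.NO (map md v) w) else 0"
 note hom = zero_mode_contr_homog
 have "((%ns. iprod (mcoeff exW) U ns * cx.wick zero_mode_contr (indexed U ns) ?Ph)
   has_sum cx.wick Delta_contr U (%v. mu (W.npc exW v ?j w))) (lists_of (length U))"
 proof (rule wick_has_sum[OF hom Delta_contr_homog zero_mode_pair])
  fix v :: "'h word" assume "set v \<subseteq> set U"
  have "((%ns. if 2 * sum_list ns = ?j then iprod (mcoeff exW) v ns * mu (W.NO (map md (indexed v ns)) w) else 0)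
    has_sum mu (W.npc exW v ?j w)) (lists_of (length v))" by (rule W.npc_has_sum[OF mu])
  thus "((%ns. iprod (mcoeff exW) v ns * ?Ph (indexed v ns))
    has_sum mu (W.npc exW v ?j w)) (lists_of (length v))" by (rule has_sum_cong[THEN iffD1, rotated]) (auto simp: lists_of_def index_sum_indexed)
 qed
 also have "cx.wick Delta_contr U (%v. mu (W.npc exW v ?j w)) = mu (YW k (vv U) w)" unfolding YW_vec[OF U] by (rule linear_wick[OF mu, symmetric])
 finally show ?thesis
 proof (rule has_sum_cong[THEN iffD1, rotated])
  fix ns :: "int list" assume ns: "ns \<in> lists_of (length U)"
  have "cx.wick zero_mode_contr (indexed U ns) ?Ph =
    cx.wick zero_mode_contr (indexed U ns) (%v. if 2 * sum_list ns = ?j then mu (W.NO (map md v) w) else 0)"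
  proof (rule cx.wick_cong[OF hom hom, where P = "%v. index_sum v = sum_list ns"])
   show "index_sum (indexed U ns) = sum_list ns" using ns by (simp add: index_sum_indexed lists_of_def)
  qed (auto simp: index_sum_def zero_mode_contr_def split: if_splits prod.splits)
  also have "... = (if 2 * sum_list ns = ?j then
    cx.wick zero_mode_contr (indexed U ns) (%v. mu (W.NO (map md v) w)) else 0)" by simp
  also have "cx.wick zero_mode_contr (indexed U ns) (%v. mu (W.NO (map md v) w)) =
    mu (W.W.wick zero_mode_contr (indexed U ns) (%v. W.NO (map md v) w))" by (rule linear_wick[OF mu, symmetric])
  also have "W.W.wick zero_mode_contr (indexed U ns) (%v. W.NO (map md v) w) =
    W.W.wick W_contr (indexed U ns) (%u. apply_modes W.A (map md u) w)"
  proof -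
   have hom': "homog (fst x) (%y. - W.kapn (md x) (md y))" for x :: "stat \<times> ('h \<times> nat) \<times> int"
    using kapn_md_homog[of x] by (simp add: homog_def)
   show ?thesis unfolding W.NO_eq_wick W.W.wick_map[of md, OF fst_md] W.W.wick_wick[OF hom hom'] by (simp add: W_contr_def[abs_def])
  qed
  finally show "iprod (mcoeff exW) U ns * cx.wick zero_mode_contr (indexed U ns) ?Ph =
    (if 2 * sum_list ns = ?j then iprod (mcoeff exW) U ns *
     mu (W.W.wick W_contr (indexed U ns) (%u. apply_modes W.A (map md u) w)) else 0)" by simp
 qed
qed

end

section \<open>Products of vertex operators\<close>

text \<open>The label records the vertex operator that a letter comes from.\<close>

definition lab :: "nat => 'h letter => 'h labelled" where
 "lab j x = (fst x, fst (snd x), snd (snd x), j)"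

definition unlab :: "'h labelled => 'h letter" where
 "unlab x = (fst x, fst (snd x), fst (snd (snd x)))"

definition label :: "'h labelled => nat" where
 "label x = snd (snd (snd x))"

lemma lab_simps [simp]: "fst (lab j x) = fst x" "unlab (lab j x) = x" "label (lab j x) = j"
 "fst (unlab y) = fst y" "lab j (s, a, m) = (s, a, m, j)" "unlab (s, a, m, j) = (s, a, m)" "label (s, a, m, j) = j"
 by (simp_all add: lab_def unlab_def label_def)

definition ilab :: "nat => stat \<times> ('h \<times> nat) \<times> 'i => stat \<times> ('h \<times> nat \<times> nat) \<times> 'i" where
 "ilab j x = (fst x, (fst (fst (snd x)), snd (fst (snd x)), j), snd (snd x))"

definition iunlab :: "stat \<times> ('h \<times> nat \<times> nat) \<times> 'i => stat \<times> ('h \<times> nat) \<times> 'i" where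
 "iunlab x = (fst x, (fst (fst (snd x)), fst (snd (fst (snd x)))), snd (snd x))"

definition ilabel :: "stat \<times> ('h \<times> nat \<times> nat) \<times> 'i => nat" where
 "ilabel x = snd (snd (fst (snd x)))"

lemma ilab_simps [simp]: "fst (ilab j x) = fst x" "iunlab (ilab j x) = x" "ilabel (ilab j x) = j"
 "fst (iunlab y) = fst y" "md (ilab j z) = md z" "ilabel (ix l i) = label l" "iunlab (ix l i) = ix (unlab l) i"
 by (simp_all add: ilab_def iunlab_def ilabel_def md_def ix_def label_def unlab_def)

lemma indexed_lab: "indexed (map (lab j) U) ns = map (ilab j) (indexed U ns)"
 by (induction U ns rule: list_induct2') (auto simp: ix_def ilab_def lab_def)

definition lev :: "'h letter => int" where
 "lev x = 2 * int (snd (snd x)) - int (par (fst x))"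

definition blocks :: "(nat => 'h word) => nat list => ('h labelled) list" where
 "blocks U I = concat (map (%j. map (lab j) (U j)) I)"

lemma blocks_simps [simp]: "blocks U [] = []" "blocks U (j # I) = map (lab j) (U j) @ blocks U I" by (simp_all add: blocks_def)

lemma label_blocks: "x \<in> set (blocks U I) ==> label x \<in> set I" by (induction I) auto

lemma set_indexed: "length is = length w ==> z \<in> set (indexed w is) ==> \<exists>x\<in>set w. \<exists>i\<in>set is. z = ix x i"
 by (induction w "is" rule: list_induct2') auto

context setting
begin

text \<open>The coefficient of the mode \<open>n\<close> in the derived field at
  \<open>x = t^2\<close>: the power of \<open>x\<close> is \<open>- n - lev / 2\<close>, doubled to
  become a power of the root.\<close>

definition lcoeff :: "(nat => complex) => 'h labelled => int => complex" where
 "lcoeff t x n = mcoeff exW (unlab x) n * t (label x) powi (- 2 * n - lev (unlab x))"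

text \<open>One term of a product of vertex operators: all mode indices are fixed, and each operator
  takes its block of the list.\<close>

primrec block_vec :: "(nat => 'h word) => nat list => int list => 'w => 'w" where
 "block_vec U [] is w = w"
| "block_vec U (j # I) is w = scW (iprod (mcoeff exW) (U j) (take (length (U j)) is))
   (W.W.wick W_contr (indexed (U j) (take (length (U j)) is))
    (%u. apply_modes W.A (map md u) (block_vec U I (drop (length (U j)) is) w)))"

text \<open>Solves the condition on the total index in \<open>YW_vec_has_sum\<close> for
  \<open>k\<close>.\<close>

primrec block_indices :: "(nat => 'h word) => nat list => int list => int list" where
 "block_indices U [] is = []"
| "block_indices U (j # I) is = (2 * sum_list (take (length (U j)) is) + V.level (U j) - 2) #
   block_indices U I (drop (length (U j)) is)"

lemma length_block_indices [simp]: "length (block_indices U I is) = length I" by (induction I arbitrary: "is") simp_all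

text \<open>The sums over the modes of the factors are nested, an inner one forming the vector to
  which the next factor is applied; summability of the whole family permits this.\<close>

lemma block_has_sum:
 assumes "\<forall>j\<in>set I. U j \<in> CW" "length ks = length I" "lin scW (*) mu"
  and "(%is. mu (block_vec U I is w)) summable_on {is \<in> lists_of (length (blocks U I)). block_indices U I is = ks}"
 shows "((%is. mu (block_vec U I is w)) has_sum mu (foldr (%(j, k). YW k (vv (U j))) (zip I ks) w))
  {is \<in> lists_of (length (blocks U I)). block_indices U I is = ks}" using assms
proof (induction I arbitrary: ks mu)
 case Nil
 hence "{is \<in> lists_of (length (blocks U [])). block_indices U [] is = ks} = {[]}" by (auto simp: lists_of_def)
 thus ?case by (simp add: has_sum_finite_iff)
next
 case (Cons j I)
 obtain k ks' where ks: "ks = k # ks'" "length ks' = length I" using Cons.prems(2) by (cases ks) auto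
 let ?n = "length (U j)"
 let ?A = "{ns \<in> lists_of ?n. 2 * sum_list ns + V.level (U j) - 2 = k}"
 let ?B = "{is \<in> lists_of (length (blocks U I)). block_indices U I is = ks'}"
 let ?X = "foldr (%(j, k). YW k (vv (U j))) (zip I ks') w"
 define nu where "nu ns X = mu (scW (iprod (mcoeff exW) (U j) ns)
   (W.W.wick W_contr (indexed (U j) ns) (%u. apply_modes W.A (map md u) X)))" for ns X
 have nu: "lin scW (*) (nu ns)" for ns
 proof -
  interpret mu: Vector_Spaces.linear scW "(*)" mu by (rule Cons.prems)
  show ?thesis by unfold_locales (simp_all add: nu_def W.apply_add W.apply_scale W.W.wick_add W.W.wick_scale mu.add mu.scale
     distrib_left W.W.scale_right_distrib)
 qed
 have bij: "bij_betw (%(a, b). a @ b) (?A \<times> ?B)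
   {is \<in> lists_of (length (blocks U (j # I))). block_indices U (j # I) is = ks}"
  by (rule bij_betwI[where g = "%l. (take ?n l, drop ?n l)"]) (auto simp: lists_of_def ks)
 have mu_eq: "mu (block_vec U (j # I) (case x of (a, b) => a @ b) w) = (case x of (a, b) => nu a (block_vec U I b w))"
  if "x \<in> ?A \<times> ?B" for x using that by (auto simp: nu_def lists_of_def)
 have summable: "(%(a, b). nu a (block_vec U I b w)) summable_on ?A \<times> ?B"
  using summable_on_reindex_bij_betw[OF bij, of "%is. mu (block_vec U (j # I) is w)", THEN iffD2, OF Cons.prems(4)]
  by (rule summable_on_cong[THEN iffD1, rotated]) (rule mu_eq)
 have "((%(a, b). nu a (block_vec U I b w)) has_sum mu (YW k (vv (U j)) ?X)) (?A \<times> ?B)"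
 proof (rule has_sum_SigmaI[OF _ _ summable])
  fix ns assume ns: "ns \<in> ?A"
  have "(%b. nu ns (block_vec U I b w)) summable_on ?B" using summable_on_SigmaD1[OF summable ns] by simp
  hence "((%b. nu ns (block_vec U I b w)) has_sum nu ns ?X) ?B" using Cons.prems ks by (intro Cons.IH nu) auto
  thus "((%y. case (ns, y) of (a, b) => nu a (block_vec U I b w)) has_sum nu ns ?X) ?B" by simp
 next
  have "((%ns. if 2 * sum_list ns = k + 2 - V.level (U j)
   then iprod (mcoeff exW) (U j) ns *
    mu (W.W.wick W_contr (indexed (U j) ns) (%u. apply_modes W.A (map md u) ?X)) else 0)
   has_sum mu (YW k (vv (U j)) ?X)) (lists_of ?n)" using Cons.prems by (intro YW_vec_has_sum) auto
  also have "?this \<longleftrightarrow> ((%ns. nu ns ?X) has_sum mu (YW k (vv (U j)) ?X)) ?A"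
  proof (rule has_sum_cong_neutral)
   interpret mu: Vector_Spaces.linear scW "(*)" mu by (rule Cons.prems)
   show "(if 2 * sum_list ns = k + 2 - V.level (U j)
    then iprod (mcoeff exW) (U j) ns *
    mu (W.W.wick W_contr (indexed (U j) ns) (%u. apply_modes W.A (map md u) ?X)) else 0) = nu ns ?X"
    if "ns \<in> lists_of ?n \<inter> ?A" for ns using that by (auto simp: nu_def mu.scale)
  qed auto
  finally show "((%ns. nu ns ?X) has_sum mu (YW k (vv (U j)) ?X)) ?A" .
 qed
 hence "((%x. mu (block_vec U (j # I) (case x of (a, b) => a @ b) w)) has_sum mu (YW k (vv (U j)) ?X)) (?A \<times> ?B)"
  by (rule has_sum_cong[THEN iffD1, rotated]) (rule mu_eq[symmetric])
 from has_sum_reindex_bij_betw[OF bij, of "%is. mu (block_vec U (j # I) is w)", THEN iffD1, OF this]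
 show ?case by (simp only: ks zip_Cons_Cons foldr.simps comp_def case_prod_conv)
qed

definition block_contr ::
 "stat \<times> ('h \<times> nat \<times> nat) \<times> int => stat \<times> ('h \<times> nat \<times> nat) \<times> int => complex" where
 "block_contr x y = (if ilabel x = ilabel y then zero_mode_contr (iunlab x) (iunlab y)
   else if ilabel x < ilabel y then W.kapn (md x) (md y) else 0)"

lemma block_contr_homog: "homog (fst x) (block_contr x)" using zero_mode_contr_homog[of "iunlab x"] kapn_md_homog[of x]
 unfolding homog_def block_contr_def by (metis ilab_simps(4))

text \<open>Reordering the whole product contributes \<open>kapn\<close> for every pair. Inside a
  block this cancels the \<open>- kapn\<close> of \<open>W_contr\<close> and leaves
  \<open>zero_mode_contr\<close>; between blocks it survives.\<close>

lemma block_vec_eq: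
 assumes "length is = length (blocks U I)" "sorted_wrt (<) I" shows "block_vec U I is w = scW (iprod (%x. mcoeff exW (unlab x)) (blocks U I) is)
   (W.W.wick block_contr (indexed (blocks U I) is) (%u. W.NO (map md u) w))"
proof -
 define H where "H x y = (if ilabel x = ilabel y then W_contr (iunlab x) (iunlab y) else 0)"
  for x y :: "stat \<times> ('h \<times> nat \<times> nat) \<times> int"
 have H: "homog (fst x) (H x)" for x using W_contr_homog[of "iunlab x"] unfolding homog_def H_def by (metis ilab_simps(4))
 have "block_vec U I is w = scW (iprod (%x. mcoeff exW (unlab x)) (blocks U I) is)
   (W.W.wick H (indexed (blocks U I) is) (%u. apply_modes W.A (map md u) w))" using assms
 proof (induction I arbitrary: "is")
  case (Cons j I)
  let ?n = "length (U j)"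
  let ?a = "take ?n is" and ?b = "drop ?n is"
  have len: "length ?a = ?n" "length ?b = length (blocks U I)" using Cons.prems by auto
  have idx: "indexed (blocks U (j # I)) is = map (ilab j) (indexed (U j) ?a) @ indexed (blocks U I) ?b"
   using indexed_append[of ?a "map (lab j) (U j)" "blocks U I" ?b] len by (simp add: indexed_lab)
  have "iprod (%x. mcoeff exW (unlab x)) (map (lab j) v) ns = iprod (mcoeff exW) v ns"
   for v :: "'h word" and ns by (induction v ns rule: list_induct2') (auto simp: iprod_def)
  hence prod: "iprod (%x. mcoeff exW (unlab x)) (blocks U (j # I)) is =
    iprod (mcoeff exW) (U j) ?a * iprod (%x. mcoeff exW (unlab x)) (blocks U I) ?b"
   using iprod_append[of ?a "map (lab j) (U j)" "%x. mcoeff exW (unlab x)" "blocks U I" ?b] len by simp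
  have 0: "H x y = 0" if x: "x \<in> set (map (ilab j) (indexed (U j) ?a))" and y: "y \<in> set (indexed (blocks U I) ?b)" for x y
  proof -
   obtain l i where y: "y = ix l i" "l \<in> set (blocks U I)" using set_indexed[OF len(2) y] by blast
   have "label l ~= j" using label_blocks[OF y(2)] Cons.prems(2) by auto
   moreover have "ilabel x = j" using x by auto
   ultimately show ?thesis using y by (simp add: H_def)
  qed
  have apply_wick: "apply_modes W.A u (W.W.wick c v Ph) = W.W.wick c v (%v. apply_modes W.A u (Ph v))"
   for u c Ph and v :: "(stat \<times> ('h \<times> nat \<times> nat) \<times> int) list" by (rule linear_wick[OF W.apply_modes_linear])
  have IH: "block_vec U I ?b w = scW (iprod (%x. mcoeff exW (unlab x)) (blocks U I) ?b)
    (W.W.wick H (indexed (blocks U I) ?b) (%u. apply_modes W.A (map md u) w))" using Cons.prems len by (intro Cons.IH) auto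
  have "W.W.wick H (indexed (blocks U (j # I)) is) (%u. apply_modes W.A (map md u) w) =
    W.W.wick W_contr (indexed (U j) ?a) (%u.
     W.W.wick H (indexed (blocks U I) ?b) (%v. apply_modes W.A (map md u) (apply_modes W.A (map md v) w)))"
  proof -
   have "W.W.wick H (map (ilab j) (indexed (U j) ?a) @ indexed (blocks U I) ?b) Ph =
     W.W.wick H (map (ilab j) (indexed (U j) ?a)) (%u. W.W.wick H (indexed (blocks U I) ?b) (%v. Ph (u @ v)))" for Ph
    by (rule W.W.wick_append[OF _ H]) (rule 0)
   moreover have "(%x y. H (ilab j x) (ilab j y)) = W_contr" by (simp add: H_def fun_eq_iff)
   ultimately show ?thesis unfolding idx by (simp add: W.W.wick_map[of "ilab j", OF ilab_simps(1)] W.apply_modes_append comp_def)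
  qed
  thus ?case by (simp add: IH prod W.apply_scale apply_wick W.W.wick_scale del: blocks_simps(2))
 qed simp
 also have "W.W.wick H (indexed (blocks U I) is) (%u. apply_modes W.A (map md u) w) =
   W.W.wick (%x y. H x y + W.kapn (md x) (md y)) (indexed (blocks U I) is) (%u. W.NO (map md u) w)"
  unfolding W.apply_eq_wick_NO W.W.wick_map[of md, OF fst_md] W.W.wick_wick[OF H kapn_md_homog] ..
 also have "... = W.W.wick block_contr (indexed (blocks U I) is) (%u. W.NO (map md u) w)"
 proof (rule W.W.wick_cong[where P = "%v. sorted (map ilabel v)"])
  show "homog (fst x) (%y. H x y + W.kapn (md x) (md y))" for x using H[of x] kapn_md_homog[of x] unfolding homog_def by (metis add.left_neutral)
  have "map ilabel (indexed v js) = map label v"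
   if "length js = length v" for v :: "('h labelled) list" and js :: "int list" using that by (induction v js rule: list_induct2') auto
  moreover have "sorted (map label (blocks U I))" using assms(2)
  proof (induction I)
   case (Cons j I)
   have "j <= label y" if "y \<in> set (blocks U I)" for y using Cons.prems label_blocks[OF that] by (simp add: less_imp_le)
   thus ?case using Cons by (simp add: sorted_append comp_def map_replicate_const)
  qed simp
  ultimately show "sorted (map ilabel (indexed (blocks U I) is))" using assms(1) by simp
 next
  fix u v t :: "(stat \<times> ('h \<times> nat \<times> nat) \<times> int) list" and x y
  assume "sorted (map ilabel (u @ x # v @ y # t))"
  thus "H x y + W.kapn (md x) (md y) = block_contr x y &
    (H x y + W.kapn (md x) (md y) ~= 0 --> sorted (map ilabel (u @ v @ t)))"
   by (auto simp: sorted_append H_def block_contr_def W_contr_def iunlab_def md_def ilabel_def)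
 qed (simp_all add: block_contr_homog)
 finally show ?thesis .
qed

lemma lcoeff_blocks:
 assumes "length is = length (blocks U I)" "!!j. j \<in> set I ==> t j ~= 0" shows "iprod (lcoeff t) (blocks U I) is =
   iprod (%x. mcoeff exW (unlab x)) (blocks U I) is *
   (\<Prod>(j, k)\<leftarrow>zip I (block_indices U I is). t j powi (- k - 2))" using assms
proof (induction I arbitrary: "is")
 case (Cons j I)
 let ?n = "length (U j)"
 let ?a = "take ?n is" and ?b = "drop ?n is"
 have len: "length ?a = ?n" "length ?b = length (blocks U I)" using Cons.prems by auto
 have "iprod (lcoeff t) (map (lab j) v) ns =
   iprod (%x. mcoeff exW (unlab x)) (map (lab j) v) ns * t j powi (- 2 * sum_list ns - V.level v)"
  if "length ns = length v" for v ns using that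
 proof (induction v ns rule: list_induct2')
  case (4 x v n ns)
  have 1: "t j powi (- 2 * n - lev x + (- 2 * sum_list ns - V.level v)) =
    t j powi (- 2 * n - lev x) * t j powi (- 2 * sum_list ns - V.level v)" using Cons.prems(2)[of j] by (intro power_int_add) simp
  have 2: "- 2 * n - lev x + (- 2 * sum_list ns - V.level v) = - 2 * sum_list (n # ns) - V.level (x # v)" by (simp add: lev_def level_sum)
  have 3: "iprod (lcoeff t) (map (lab j) v) ns =
    iprod (%x. mcoeff exW (unlab x)) (map (lab j) v) ns * t j powi (- 2 * sum_list ns - V.level v)" using 4 by simp
  show ?case unfolding 1[unfolded 2] list.map iprod_simps 3 by (simp only: lcoeff_def lab_simps mult_ac)
 qed auto
 moreover have e: "- (2 * sum_list ?a + V.level (U j) - 2) - 2 = - 2 * sum_list ?a - V.level (U j)" by simp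
 ultimately have 1: "iprod (lcoeff t) (map (lab j) (U j)) ?a =
   iprod (%x. mcoeff exW (unlab x)) (map (lab j) (U j)) ?a *
   t j powi (- (2 * sum_list ?a + V.level (U j) - 2) - 2)" unfolding e using len(1) by blast
 have 2: "iprod f (blocks U (j # I)) is = iprod f (map (lab j) (U j)) ?a * iprod f (blocks U I) ?b" for f
  using iprod_append[of ?a "map (lab j) (U j)" f "blocks U I" ?b] len by simp
 have 3: "iprod (lcoeff t) (blocks U I) ?b =
   iprod (%x. mcoeff exW (unlab x)) (blocks U I) ?b *
   (\<Prod>(j, k)\<leftarrow>zip I (block_indices U I ?b). t j powi (- k - 2))" using Cons.prems(2) by (intro Cons.IH len) auto
 show ?case unfolding 2 1 3 block_indices.simps zip_Cons_Cons list.map prod_list.Cons prod.case by (simp only: mult_ac)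
qed simp

lemma zero_mode_pair_label:
 assumes "t (label x) ~= 0" "label x = label y" shows "((%(i, j). lcoeff t x i * lcoeff t y j * zero_mode_contr (ix (unlab x) i) (ix (unlab y) j))
   has_sum Delta_contr (unlab x) (unlab y) * t (label x) powi (- lev (unlab x) - lev (unlab y))) UNIV"
proof -
 have "((%a. (case a of (i, j) => mcoeff exW (unlab x) i * mcoeff exW (unlab y) j *
   zero_mode_contr (ix (unlab x) i) (ix (unlab y) j)) * t (label x) powi (- lev (unlab x) - lev (unlab y)))
  has_sum Delta_contr (unlab x) (unlab y) * t (label x) powi (- lev (unlab x) - lev (unlab y))) UNIV" by (rule has_sum_cmult_left[OF zero_mode_pair])
 thus ?thesis
 proof (rule has_sum_cong[THEN iffD1, rotated], clarify)
  fix i j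
  show "mcoeff exW (unlab x) i * mcoeff exW (unlab y) j *
   zero_mode_contr (ix (unlab x) i) (ix (unlab y) j) * t (label x) powi (- lev (unlab x) - lev (unlab y)) =
   lcoeff t x i * lcoeff t y j * zero_mode_contr (ix (unlab x) i) (ix (unlab y) j)"
  proof (cases "i = 0 & j = 0")
   case True
   have "t (label x) powi (- lev (unlab x) - lev (unlab y)) =
     t (label x) powi (- lev (unlab x)) * t (label x) powi (- lev (unlab y))"
    using power_int_add[of "t (label x)" "- lev (unlab x)" "- lev (unlab y)"] assms by simp
   thus ?thesis using True assms(2) by (simp add: lcoeff_def)
  next
   case False
   hence "zero_mode_contr (ix (unlab x) i) (ix (unlab y) j) = 0" by (auto simp: zero_mode_contr_def ix_def split: prod.splits)
   thus ?thesis by simp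
  qed
 qed
qed

text \<open>Summing the mode indices pair by pair evaluates all contractions; grouping the same
  family by the exponents recovers the series of the product.\<close>

lemma product_has_sum:
 fixes U :: "nat => 'h word"
 assumes U: "!!j. j < n ==> U j \<in> CW" and t: "!!j. j < n ==> t j ~= 0" and mu: "lin scW (*) mu"
  and cb: "!!x. homog (fst x) (cb x)"
  and cb_eq: "!!x y. label x = label y ==>
    cb x y = Delta_contr (unlab x) (unlab y) * t (label x) powi (- lev (unlab x) - lev (unlab y))"
  and cb_gt: "!!x y. label x > label y ==> cb x y = 0"
  and cb_less: "!!x y. x \<in> set (blocks U [0..<n]) ==> y \<in> set (blocks U [0..<n]) ==> label x < label y ==>
    ((%(i, j). lcoeff t x i * lcoeff t y j * W.kapn (md (ix x i)) (md (ix y j))) has_sum cb x y) UNIV"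
  and Ph: "!!v. set v \<subseteq> set (blocks U [0..<n]) ==>
    ((%is. iprod (lcoeff t) v is * mu (W.NO (map md (indexed v is)) w)) has_sum Phb v) (lists_of (length v))"
 shows "((%ks. mu (foldr (%j. YW (ks ! j) (vv (U j))) [0..<n] w) * (PROD j<n. t j powi (- (ks ! j) - 2)))
   has_sum cx.wick cb (blocks U [0..<n]) Phb) {ks. length ks = n}"
proof -
 let ?I = "[0..<n]"
 let ?L = "blocks U ?I"
 interpret mu: Vector_Spaces.linear scW "(*)" mu by (rule mu)
 define F where "F is = iprod (lcoeff t) ?L is *
   cx.wick block_contr (indexed ?L is) (%u. mu (W.NO (map md u) w))" for "is"
 have "((%is. F is) has_sum cx.wick cb ?L Phb) (lists_of (length ?L))" unfolding F_def
 proof (rule wick_has_sum[OF block_contr_homog cb])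
  fix x y assume xy: "x \<in> set ?L" "y \<in> set ?L"
  consider "label x = label y" | "label x < label y" | "label x > label y" by linarith
  thus "((%(i, j). lcoeff t x i * lcoeff t y j * block_contr (ix x i) (ix y j)) has_sum cb x y) UNIV"
  proof cases
   case 1
   have "t (label x) ~= 0" using t label_blocks[OF xy(1)] by auto
   thus ?thesis using zero_mode_pair_label[of t x y] 1 by (simp add: block_contr_def cb_eq)
  next
   case 2
   thus ?thesis using cb_less[OF xy] by (simp add: block_contr_def)
  next
   case 3
   thus ?thesis by (simp add: block_contr_def cb_gt case_prod_unfold)
  qed
 qed (rule Ph)
 moreover have F: "F is = mu (block_vec U ?I is w) * (\<Prod>(j, k)\<leftarrow>zip ?I (block_indices U ?I is). t j powi (- k - 2))"
  if "is \<in> lists_of (length ?L)" for "is"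
 proof -
  have len: "length is = length ?L" using that by (simp add: lists_of_def)
  have "sorted_wrt (<) ?I" by simp
  from block_vec_eq[OF len this, of w] lcoeff_blocks[OF len, of t] show ?thesis using t by (simp add: F_def mu.scale linear_wick[OF mu, symmetric])
 qed
 \<comment> \<open>Regrouping by \<open>block_indices\<close>, the indices of the coefficients of
   the vertex operators.\<close>
 ultimately have S: "((%(ks, is). F is) has_sum cx.wick cb ?L Phb)
   (Sigma {ks. length ks = n} (%ks. {is \<in> lists_of (length ?L). block_indices U ?I is = ks}))"
  by (subst has_sum_reindex_bij_witness[where i = "%is. (block_indices U ?I is, is)" and j = snd and
     T = "lists_of (length ?L)" and h = F]) auto
 show ?thesis
 proof (rule has_sum_SigmaD[OF S])
  fix ks assume "ks \<in> {ks :: int list. length ks = n}"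
  hence ks: "length ks = n" by simp
  let ?D = "{is \<in> lists_of (length ?L). block_indices U ?I is = ks}"
  define c where "c = (PROD j<n. t j powi (- (ks ! j) - 2))"
  have zip: "zip ?I ks = map (%j. (j, ks ! j)) ?I" using ks by (auto intro!: nth_equalityI)
  have "(\<Prod>(j, k)\<leftarrow>zip ?I ks. t j powi (- k - 2)) = c"
   unfolding c_def zip by (simp add: comp_def prod.distinct_set_conv_list[symmetric] atLeast0LessThan)
  hence F': "F is = c * mu (block_vec U ?I is w)" if "is \<in> ?D" for "is" using F[of "is"] that by (auto simp: mult.commute)
  have "F summable_on ?D" using summable_on_SigmaD1[OF has_sum_imp_summable[OF S], of ks] ks by simp
  hence "(%is. c * mu (block_vec U ?I is w)) summable_on ?D" by (rule summable_on_cong[THEN iffD1, rotated]) (rule F')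
  moreover have "lin scW (*) (%X. c * mu X)" by unfold_locales (simp_all add: mu.add mu.scale distrib_left)
  ultimately have "((%is. c * mu (block_vec U ?I is w)) has_sum c * mu (foldr (%(j, k). YW k (vv (U j))) (zip ?I ks) w)) ?D"
   using U ks by (intro block_has_sum[of _ _ _ "%X. c * mu X"]) auto
  hence "(F has_sum c * mu (foldr (%(j, k). YW k (vv (U j))) (zip ?I ks) w)) ?D" by (rule has_sum_cong[THEN iffD1, rotated]) (rule F'[symmetric])
  thus "((%is. case (ks, is) of (ks, is) => F is) has_sum
    mu (foldr (%j. YW (ks ! j) (vv (U j))) ?I w) * (PROD j<n. t j powi (- (ks ! j) - 2))) ?D"
   unfolding zip c_def by (simp add: foldr_map comp_def mult.commute)
 qed
qed

end

lemma has_sum_inj_support: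
 assumes "inj g" "!!x. x \<notin> range g ==> f x = 0" "((%n. f (g n)) has_sum S) UNIV" shows "(f has_sum S) UNIV"
proof -
 have "(f has_sum S) (range g)" using assms(1,3) by (simp add: has_sum_reindex comp_def)
 thus ?thesis by (rule has_sum_cong_neutral[THEN iffD1, rotated -1]) (use assms(2) in auto)
qed

lemma powi_eq_inverse_power: "k = - int n ==> w powi k = inverse w ^ n" for w :: complex by (simp add: power_int_minus power_inverse)

lemma powi_eq_quotient: "w ~= 0 ==> k = int n - int m ==> w powi k = w ^ n * inverse w ^ m" for w :: complex
 by (simp add: power_int_diff divide_inverse power_inverse)

section \<open>Contractions between different vertex operators\<close>

context setting
begin

definition pair_fn :: "'h letter => 'h letter => complex => complex => complex" where
 "pair_fn = (%(s, a, m) (s', b, n) t u.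
   if s ~= s' then 0
   else if s = Fer then lF * frm a b * fermion_fn (m - 1) (n - 1) t u
   else lB * frm a b * boson_fn (m - 1) (n - 1) (t^2) (u^2))"

text \<open>Only opposite indices contract, so the double series reduces to the single series of
  \<open>fterm\<close> or \<open>bterm\<close>.\<close>

lemma pair_fn_has_sum:
 assumes t: "t (label x) ~= 0" "t (label y) ~= 0" "norm (t (label y)) < norm (t (label x))"
  and xy: "snd (snd (unlab x)) >= 1" "snd (snd (unlab y)) >= 1" shows "((%(i, j). lcoeff t x i * lcoeff t y j * W.kapn (md (ix x i)) (md (ix y j)))
   has_sum pair_fn (unlab x) (unlab y) (t (label x)) (t (label y))) UNIV"
proof -
 obtain s a i' l where x: "x = (s, a, Suc i', l)" using xy(1) by (cases x) (auto simp: unlab_def gr0_conv_Suc Suc_le_eq)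
 obtain s' b j' l' where y: "y = (s', b, Suc j', l')" using xy(2) by (cases y) (auto simp: unlab_def gr0_conv_Suc Suc_le_eq)
 let ?f = "%(i, j). lcoeff t x i * lcoeff t y j * W.kapn (md (ix x i)) (md (ix y j))"
 have tx: "t l ~= 0" "t l' ~= 0" and norm: "norm (t l') < norm (t l)" using t by (simp_all add: x y)
 consider "s ~= s'" | "s = Fer" "s' = Fer" | "s = Bos" "s' = Bos" by (cases s; cases s') auto
 thus ?thesis
 proof cases
  case 1
  have "?f p = 0" for p using 1 by (cases p) (auto simp: x y W.kapn_def contr_coeff_def W.zero_contr_def)
  hence "(?f has_sum 0) UNIV" by (rule has_sum_0)
  moreover have "pair_fn (unlab x) (unlab y) (t (label x)) (t (label y)) = 0" using 1 by (simp add: x y pair_fn_def)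
  ultimately show ?thesis by (simp only:)
 next
  case 2
  let ?u = "lF * frm a b"
  \<comment> \<open>\<open>kapn\<close> gives the pair of zero modes half the weight of the others,
    so half of the zeroth \<open>fterm\<close> is removed, in agreement with
    \<open>fterm_sums\<close>.\<close>
  have "((%n. ?u * (fterm (t l) (t l') i' j' n + (if n \<in> {0} then - fterm (t l) (t l') i' j' 0 / 2 else 0)))
    has_sum (?u * (fermion_fn i' j' (t l) (t l') + hbeta i' (t l) * hbeta j' (t l') / 2 + (- fterm (t l) (t l') i' j' 0 / 2)))) UNIV"
   by (intro has_sum_cmult_right has_sum_add norm_summable_imp_has_sum[OF fterm_summable fterm_sums]
     norm tx has_sum_finite_neutralI[of "{0}"]) auto
  hence S: "((%n. ?u * (fterm (t l) (t l') i' j' n + (if n = 0 then - fterm (t l) (t l') i' j' 0 / 2 else 0)))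
    has_sum pair_fn (unlab x) (unlab y) (t (label x)) (t (label y))) UNIV" by (simp add: fterm_0 pair_fn_def x y 2)
  show ?thesis
  proof (rule has_sum_inj_support[where g = "%n. (int n, - int n)"])
   show "inj (%n. (int n, - int n))" by (rule injI) simp
   show "?f p = 0" if "p \<notin> range (%n. (int n, - int n))" for p
   proof (cases p)
    case (Pair i j)
    have "~ (i >= 0 & j = - i)"
    proof
     assume "i >= 0 & j = - i"
     hence "p = (int (nat i), - int (nat i))" by (simp add: Pair)
     thus False using that by blast
    qed
    hence "W.kapn (md (ix x i)) (md (ix y j)) = 0" by (auto simp: x y W.kapn_def contr_coeff_def W.zero_contr_def dg_def)
    thus ?thesis by (simp add: Pair)
   qed
   have "?f (int n, - int n) = ?u * (fterm (t l) (t l') i' j' n + (if n = 0 then - fterm (t l) (t l') i' j' 0 / 2 else 0))" for n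
   proof -
    have k: "W.kapn (md (ix x (int n))) (md (ix y (- int n))) = (if n = 0 then ?u / 2 else ?u)"
     by (simp add: x y 2 W.kapn_def contr_coeff_def W.zero_contr_def dg_def)
    have "lcoeff t x (int n) * lcoeff t y (- int n) = fterm (t l) (t l') i' j' n"
    proof -
     have "t l powi (- 2 * int n - lev (unlab x)) = inverse (t l) ^ (2 * n + 2 * i' + 1)" by (rule powi_eq_inverse_power) (simp add: x 2 lev_def)
     moreover have "t l' powi (- 2 * - int n - lev (unlab y)) = t l' ^ (2 * n) * inverse (t l') ^ (2 * j' + 1)"
      by (rule powi_eq_quotient[OF tx(2)]) (simp add: y 2 lev_def)
     moreover have "exW Fer (int n) = - of_nat n - 1/2" "exW Fer (- int n) = of_nat n - 1/2"
     proof -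
      have "b - 1 + 1/2 = b + (- 1 + 1/2)" for b :: complex by (simp only: add.assoc diff_conv_add_uminus)
      hence "b - 1 + 1/2 = b - 1/2" for b :: complex by simp
      thus "exW Fer (int n) = - of_nat n - 1/2" "exW Fer (- int n) = of_nat n - 1/2"
       by (simp_all only: of_int_of_nat_eq of_int_minus par.simps of_nat_1 minus_minus)
     qed
     moreover have "fst (unlab x) = Fer" "fst (unlab y) = Fer" "snd (snd (unlab x)) - 1 = i'" "snd (snd (unlab y)) - 1 = j'"
       "label x = l" "label y = l'" by (simp_all add: x y 2)
     ultimately show ?thesis unfolding lcoeff_def mcoeff_def fterm_def by (simp only: mult_ac)
    qed
    thus ?thesis by (simp add: k)
   qed
   thus "((%n. ?f (int n, - int n)) has_sum pair_fn (unlab x) (unlab y) (t (label x)) (t (label y))) UNIV" using S by simp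
  qed
 next
  case 3
  let ?u = "lB * frm a b"
  have "norm ((t l')^2) < norm ((t l)^2)" using norm by (simp add: norm_power power_strict_mono)
  hence S: "((%n. ?u * bterm ((t l)^2) ((t l')^2) i' j' n) has_sum pair_fn (unlab x) (unlab y) (t (label x)) (t (label y))) UNIV"
   using tx by (simp add: pair_fn_def x y 3)
    (intro has_sum_cmult_right norm_summable_imp_has_sum[OF bterm_summable bterm_sums], simp_all)
  show ?thesis
  proof (rule has_sum_inj_support[where g = "%n. (int (Suc n), - int (Suc n))"])
   show "inj (%n. (int (Suc n), - int (Suc n)))" by (rule injI) simp
   show "?f p = 0" if "p \<notin> range (%n. (int (Suc n), - int (Suc n)))" for p
   proof (cases p)
    case (Pair i j)
    have "~ (i > 0 & j = - i)"
    proof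
     assume "i > 0 & j = - i"
     hence "p = (int (Suc (nat (i - 1))), - int (Suc (nat (i - 1))))" by (simp add: Pair)
     thus False using that by blast
    qed
    hence "W.kapn (md (ix x i)) (md (ix y j)) = 0" by (auto simp: x y 3 W.kapn_def contr_coeff_def W.zero_contr_def dg_def)
    thus ?thesis by (simp add: Pair)
   qed
   have "?f (int (Suc n), - int (Suc n)) = ?u * bterm ((t l)^2) ((t l')^2) i' j' n" for n
   proof -
    have k: "W.kapn (md (ix x (int (Suc n)))) (md (ix y (- int (Suc n)))) = of_nat (Suc n) * ?u"
    proof -
     have "W.kapn (md (ix x k)) (md (ix y (- k))) = of_int k * ?u" if "k > 0" for k using that by (simp add: x y 3 W.kapn_def contr_coeff_def dg_def)
     from this[of "int (Suc n)"] show ?thesis by (simp only: of_int_of_nat_eq of_nat_0_less_iff zero_less_Suc simp_thms)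
    qed
    have "t l powi (- 2 * int (Suc n) - lev (unlab x)) = inverse (t l) ^ (2 * (n + i' + 2))" by (rule powi_eq_inverse_power) (simp add: x 3 lev_def)
    moreover have "t l' powi (- 2 * - int (Suc n) - lev (unlab y)) = t l' ^ (2 * n) * inverse (t l') ^ (2 * j')"
     by (rule powi_eq_quotient[OF tx(2)]) (simp add: y 3 lev_def)
    moreover have "exW Bos (int (Suc n)) = - of_nat n - 2" "exW Bos (- int (Suc n)) = of_nat n" by simp_all
    ultimately have "lcoeff t x (int (Suc n)) * lcoeff t y (- int (Suc n)) * of_nat (Suc n) =
      bterm ((t l)^2) ((t l')^2) i' j' n"
    proof -
     assume 1: "t l powi (- 2 * int (Suc n) - lev (unlab x)) = inverse (t l) ^ (2 * (n + i' + 2))"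
      "t l' powi (- 2 * - int (Suc n) - lev (unlab y)) = t l' ^ (2 * n) * inverse (t l') ^ (2 * j')"
      "exW Bos (int (Suc n)) = - of_nat n - 2" "exW Bos (- int (Suc n)) = of_nat n"
     have "fst (unlab x) = Bos" "fst (unlab y) = Bos" "snd (snd (unlab x)) - 1 = i'" "snd (snd (unlab y)) - 1 = j'"
       "label x = l" "label y = l'" by (simp_all add: x y 3)
     with 1 show ?thesis unfolding lcoeff_def mcoeff_def bterm_def power_inverse[symmetric] power_mult[symmetric] by (simp only: mult_ac)
    qed
    from arg_cong[OF this, of "%v. ?u * v"] show ?thesis unfolding k prod.case by (simp only: mult_ac)
   qed
   thus "((%n. ?f (int (Suc n), - int (Suc n))) has_sum pair_fn (unlab x) (unlab y) (t (label x)) (t (label y))) UNIV" using S by simp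
  qed
 qed
qed

definition root_contr ::
 "(nat => complex) => 'h labelled => 'h labelled => complex" where
 "root_contr t x y =
   (if label x = label y then Delta_contr (unlab x) (unlab y) * t (label x) powi (- lev (unlab x) - lev (unlab y))
   else if label x < label y then pair_fn (unlab x) (unlab y) (t (label x)) (t (label y)) else 0)"

lemma root_contr_homog: "homog (fst x) (root_contr t x)" unfolding homog_def
proof (intro allI impI)
 fix y :: "'h labelled" assume "fst y ~= fst x"
 thus "root_contr t x y = 0" by (cases x; cases y) (auto simp: root_contr_def Delta_contr_def pair_fn_def)
qed

end

text \<open>
 A matrix coefficient: the functional \<open>mu\<close> vanishes on the values at \<open>w\<close> of the normal ordered
 products of modes whose degree lies outside of the finite set \<open>T\<close>.
\<close>

locale matrix_element = setting scH frm lB lF es scV \<pi>V scM act Mgr scW \<pi>W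
 for scH :: "complex => 'h::ab_group_add => 'h" and frm lB lF es
  and scV :: "complex => 'v::ab_group_add => 'v" and \<pi>V
  and scM :: "complex => 'm::ab_group_add => 'm" and act Mgr
  and scW :: "complex => 'w::ab_group_add => 'w" and \<pi>W +
 fixes mu :: "'w => complex" and w :: 'w and T :: "int set"
 assumes mu: "lin scW (*) mu" and T: "finite T"
  and mu_eq_0: "(SUM x<-ms. snd (snd x)) \<notin> T ==> mu (W.NO ms w) = 0"
begin

lemma sum_md_indexed: "length ns = length v ==> (SUM x<-map md (indexed v ns). snd (snd x)) = sum_list ns"
 by (induction v ns rule: list_induct2') (auto simp: md_def ix_def)

definition mode_lists :: "(stat \<times> 'h \<times> 'r) list => int list set" where
 "mode_lists v = {ns. length ns = length v & mu (W.NO (map md (indexed v ns)) w) ~= 0}"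

lemma finite_mode_lists: "finite (mode_lists v)"
proof (rule finite_subset[OF _ W.NO_finite[OF T, of v w]], rule subsetI)
 interpret mu: Vector_Spaces.linear scW "(*)" mu by (rule mu)
 fix ns assume "ns \<in> mode_lists v"
 hence ns: "length ns = length v" "mu (W.NO (map md (indexed v ns)) w) ~= 0" by (auto simp: mode_lists_def)
 hence "sum_list ns \<in> T" using mu_eq_0[of "map md (indexed v ns)"] by (metis sum_md_indexed)
 moreover have "W.NO (map md (indexed v ns)) w ~= 0" using ns(2) mu.zero by metis
 ultimately show "ns \<in> {ns. length ns = length v & sum_list ns \<in> T & W.NO (map md (indexed v ns)) w ~= 0}" using ns(1) by blast
qed

definition block_value :: "(nat => complex) => ('h labelled) list => complex" where
 "block_value t v = (SUM ns:mode_lists v. iprod (lcoeff t) v ns * mu (W.NO (map md (indexed v ns)) w))"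

lemma block_value_has_sum:
 "((%ns. iprod (lcoeff t) v ns * mu (W.NO (map md (indexed v ns)) w)) has_sum block_value t v) (lists_of (length v))" unfolding block_value_def
 by (rule has_sum_finite_neutralI[OF finite_mode_lists]) (auto simp: mode_lists_def lists_of_def)

text \<open>The common value of products and iterates as a function of the roots; the choice of
  branch enters only through these.\<close>

definition correlation :: "(nat => 'h word) => nat => (nat => complex) => complex" where
 "correlation U n t = cx.wick (root_contr t) (blocks U [0..<n]) (block_value t)"

lemma blocks_creation:
 assumes "\<forall>j<n. U j \<in> CW" "x \<in> set (blocks U [0..<n])" shows "snd (snd (unlab x)) >= 1" "label x < n"
proof -
 obtain j x' where "j < n" "x' \<in> set (U j)" "x = lab j x'" using assms(2) by (auto simp: blocks_def)
 thus "snd (snd (unlab x)) >= 1" "label x < n" using assms(1) by (cases x', fastforce simp: creation_words_def)+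
qed

theorem product_correlation:
 assumes U: "!!j. j < n ==> U j \<in> CW" and t: "!!j. j < n ==> t j ~= 0"
  and norm: "!!j l. j < l ==> l < n ==> norm (t l) < norm (t j)"
 shows "((%ks. mu (foldr (%j. YW (ks ! j) (vv (U j))) [0..<n] w) * (PROD j<n. t j powi (- (ks ! j) - 2)))
   has_sum correlation U n t) {ks. length ks = n}" unfolding correlation_def
proof (rule product_has_sum[OF U t mu root_contr_homog])
 fix x y assume xy: "x \<in> set (blocks U [0..<n])" "y \<in> set (blocks U [0..<n])" "label x < label y"
 have U': "\<forall>j<n. U j \<in> CW" using U by blast
 note l = blocks_creation(2)[OF U' xy(1)] blocks_creation(2)[OF U' xy(2)]
 have "root_contr t x y = pair_fn (unlab x) (unlab y) (t (label x)) (t (label y))" using xy(3) by (simp add: root_contr_def)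
 thus "((%(i, j). lcoeff t x i * lcoeff t y j * W.kapn (md (ix x i)) (md (ix y j))) has_sum root_contr t x y) UNIV"
  using pair_fn_has_sum[OF t[OF l(1)] t[OF l(2)] norm[OF xy(3) l(2)] blocks_creation(1)[OF U' xy(1)] blocks_creation(1)[OF U' xy(2)]] by (simp only:)
qed (auto simp: root_contr_def block_value_has_sum)

end

section \<open>Iterates of vertex operators\<close>

lemma iprod_has_sum:
 fixes f :: "stat \<times> 'r => 'i => complex"
 assumes "!!x. x \<in> set v ==> (f x has_sum h x) UNIV" shows "(iprod f v has_sum (PROD x<-v. h x)) (lists_of (length v))" using assms
proof (induction v)
 case Nil
 have "lists_of 0 = {[] :: 'i list}" by (auto simp: lists_of_def)
 thus ?case by (simp add: has_sum_finite_iff)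
next
 case (Cons x v)
 have "((%(k, ks). f x k * iprod f v ks) has_sum h x * (PROD x<-v. h x)) (UNIV \<times> lists_of (length v))"
  by (intro has_sum_product_complex Cons) (simp_all add: Cons.prems)
 hence "(iprod f (x # v) has_sum h x * (PROD x<-v. h x)) (lists_of (length (x # v)))"
  by (subst has_sum_reindex_bij_witness[where i = "%(k, ks). k # ks" and j = "%l. (hd l, tl l)" and
     T = "UNIV \<times> lists_of (length v)" and h = "%(k, ks). f x k * iprod f v ks"])
   (auto simp: lists_of_def length_Suc_conv)
 thus ?case by simp
qed

lemma has_sum_single:
 assumes "!!x. x ~= a ==> f x = 0" "f a = s" shows "(f has_sum s) UNIV" by (rule has_sum_finite_neutralI[of "{a}"]) (use assms in auto)

text \<open>The letter of V created by a negative mode; for a nonnegative mode the value is an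
  irrelevant default.\<close>

definition created :: "stat \<times> ('h \<times> nat \<times> nat) \<times> int => 'h letter" where
 "created x = (fst x, fst (fst (snd x)), nat (- snd (snd x)))"

lemma created_simps [simp]: "fst (created x) = fst x" "created (ix (s, a, r) k) = (s, a, nat (- k))" by (simp_all add: created_def ix_def)

text \<open>
 The weight of the \<open>k\<close>-th mode of a letter in \<open>Y\<^sub>W(Y(v\<^sub>1, z)v\<^sub>2, u\<^sup>2)\<close>. The letters of \<open>v\<^sub>1\<close> have label 0;
 those of \<open>v\<^sub>2\<close> have label 1, and only one of their modes occurs.
\<close>

definition iterate_weight :: "complex => complex => 'h labelled => int => complex" where
 "iterate_weight z u = (%(s, a, m, l) k.
   (if l = 0 then ((- of_int k - 1) gchoose (m - 1)) * z powi (- k - int m) else if k = - int m then 1 else 0) *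
   u powi (2 * k + int (par s)))"

lemma iterate_weight_0:
 "iterate_weight z u (s, a, Suc i, 0) (- int k - 1) = shcoeff z i k * u powi (- 2 * int k - 2 + int (par s))"
proof -
 have "- (- int k - 1) - int (Suc i) = int k - int i" "2 * (- int k - 1) + int (par s) = - 2 * int k - 2 + int (par s)" by simp_all
 moreover have "- of_int (- int k - 1) - 1 = (of_nat k :: complex)" by simp
 ultimately show ?thesis unfolding iterate_weight_def shcoeff_def by (simp only: prod.case if_True diff_Suc_1 simp_thms)
qed

lemma C_coeff_eq: "- C_coeff (Suc k) (Suc l) = delta_fn k l"
proof -
 have "(- 1 / 2 :: complex) = - (1 / 2)" by simp
 moreover have "of_nat (Suc k) - of_nat (Suc l) = (of_nat k - of_nat l :: complex)"
  "of_nat (Suc k) + of_nat (Suc l) - 1 = (of_nat (k + l) + 1 :: complex)" by simp_all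
 ultimately show ?thesis unfolding C_coeff_def delta_fn_def by (simp only: diff_Suc_1 mult_minus_left)
qed

section \<open>Contractions of an iterate, summed over mode indices\<close>

context setting
begin

text \<open>Between letters of the two vectors V contributes its own contraction; letters that
  survive as creation modes can be contracted by \<Delta> in the outer vertex operator.\<close>

definition iterate_contr ::
 "stat \<times> ('h \<times> nat \<times> nat) \<times> int => stat \<times> ('h \<times> nat \<times> nat) \<times> int => complex" where
 "iterate_contr x y = (if ilabel x > ilabel y then 0
   else (if snd (snd x) < 0 & snd (snd y) < 0 then Delta_contr (created x) (created y) else 0) +
    (if ilabel x < ilabel y then V.kapn (md x) (md y) else 0))"

lemma V_kapn_eq: "V.kapn (s, a, k) (s', b, j) =
  (if s = s' & 2 * k + int (par s) > 0 & k + j + int (par s) = 0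
   then (case s of Bos => lB * (of_int k * frm a b) | Fer => lF * frm a b) else 0)"
 by (cases s; cases s') (auto simp: V.kapn_def contr_coeff_def V.zero_contr_def dg_def)

lemma iterate_contr_homog: "homog (fst x) (iterate_contr x)" unfolding homog_def
proof (intro allI impI)
 fix y :: "stat \<times> ('h \<times> nat \<times> nat) \<times> int" assume "fst y ~= fst x"
 thus "iterate_contr x y = 0" by (cases x; cases y) (auto simp: iterate_contr_def Delta_contr_def created_def md_def V_kapn_eq)
qed

text \<open>Both letters come from the first vector: the case of \<open>diagonal_has_sum\<close>,
  where the index \<open>- k - 1\<close> creates the letter of order \<open>k + 1\<close>.\<close>

lemma iterate_pair_00:
 assumes s: "shifted_root u z t" shows "((%(i, j). iterate_weight z u (Fer, a, Suc i', 0) i * iterate_weight z u (Fer, b, Suc j', 0) j *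
   Delta_contr (Fer, a, nat (- i)) (Fer, b, nat (- j)) * of_bool (i < 0 & j < 0)) has_sum
   (Delta_contr (Fer, a, Suc i') (Fer, b, Suc j') * t powi (- 2 * int i' - 2 * int j' - 2))) UNIV"
proof (rule has_sum_inj_support[where g = "%(l, k). (- int k - 1, - int l - 1)"])
 interpret shifted_root u z t by (rule s)
 let ?f = "%(i, j). iterate_weight z u (Fer, a, Suc i', 0) i * iterate_weight z u (Fer, b, Suc j', 0) j *
   Delta_contr (Fer, a, nat (- i)) (Fer, b, nat (- j)) * of_bool (i < 0 & j < 0)"
 show "inj (%(l, k). (- int k - 1, - int l - 1))" by (rule injI) auto
 show "?f p = 0" if "p \<notin> range (%(l, k). (- int k - 1, - int l - 1))" for p
 proof (cases p)
  case (Pair i j)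
  have "~ (i < 0 & j < 0)"
  proof
   assume "i < 0 & j < 0"
   hence "p = (%(l, k). (- int k - 1, - int l - 1)) (nat (- j - 1), nat (- i - 1))" by (simp add: Pair)
   thus False using that by blast
  qed
  thus ?thesis by (simp add: Pair)
 qed
 have 1: "t powi (- 2 * int i' - 2 * int j' - 2) = inverse t ^ (2 * (i' + j' + 1))" by (rule powi_eq_inverse_power) simp
 have "?f ((%(l, k). (- int k - 1, - int l - 1)) q) = lF * frm a b * (case q of (l, k) => shcoeff z j' l * iterate_term' i' l k)" for q
 proof (cases q)
  case (Pair l k)
  have "nat (- (- int k - 1)) = Suc k" "nat (- (- int l - 1)) = Suc l" by simp_all
  moreover have "u powi (- 2 * int k - 2 + int (par Fer)) = inverse u ^ (2 * k + 1)"
   "u powi (- 2 * int l - 2 + int (par Fer)) = inverse u ^ (2 * l + 1)" by (rule powi_eq_inverse_power, simp)+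
  moreover have "Delta_contr (Fer, a, Suc k) (Fer, b, Suc l) = lF * frm a b * delta_fn k l" by (simp add: Delta_contr_def C_coeff_eq[symmetric])
  moreover have "of_bool (- int k - 1 < 0 & - int l - 1 < 0) = (1 :: complex)" by simp
  ultimately show ?thesis unfolding Pair prod.case iterate_weight_0 iterate_term'_def inverse_u_power by (simp only: mult_ac mult_1_left)
 qed
 moreover have "Delta_contr (Fer, a, Suc i') (Fer, b, Suc j') = lF * frm a b * delta_fn i' j'" by (simp add: Delta_contr_def C_coeff_eq[symmetric])
 ultimately show "((%q. ?f ((%(l, k). (- int k - 1, - int l - 1)) q)) has_sum
   (Delta_contr (Fer, a, Suc i') (Fer, b, Suc j') * t powi (- 2 * int i' - 2 * int j' - 2))) UNIV"
  using has_sum_cmult_right[OF diagonal_has_sum[of j' i'], of "lF * frm a b"] unfolding 1 UNIV_Times_UNIV by (simp only: mult.assoc)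
qed

text \<open>The creation modes of the first letter sum to the regular part, and the single mode
  \<open>j'\<close> supplies the contraction on V.\<close>

lemma iterate_pair_01_Fer:
 assumes s: "shifted_root u z t" shows "((%i. iterate_weight z u (Fer, a, Suc i', 0) i * u powi (- 2 * int j' - 1) *
   ((if i < 0 then Delta_contr (Fer, a, nat (- i)) (Fer, b, Suc j') else 0) +
    V.kapn (Fer, a, i) (Fer, b, - int (Suc j')))) has_sum (lF * frm a b * fermion_fn i' j' t u)) UNIV"
proof -
 interpret shifted_root u z t by (rule s)
 let ?w = "%i. iterate_weight z u (Fer, a, Suc i', 0) i * u powi (- 2 * int j' - 1)"
 have u': "u powi (- 2 * int j' - 1) = inverse u ^ (2 * j' + 1)" by (rule powi_eq_inverse_power) simp
 have N: "((%i. ?w i * (if i < 0 then Delta_contr (Fer, a, nat (- i)) (Fer, b, Suc j') else 0)) has_sum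
   lF * frm a b * (fermion_fn i' j' t u - V_contr_fn i' j')) UNIV"
 proof (rule has_sum_inj_support[where g = "%k. - int k - 1"])
  show "inj (%k. - int k - 1)" by (rule injI) auto
  show "?w i * (if i < 0 then Delta_contr (Fer, a, nat (- i)) (Fer, b, Suc j') else 0) = 0"
   if "i \<notin> range (%k. - int k - 1)" for i
  proof -
   have "~ i < 0"
   proof
    assume "i < 0"
    hence "i = - int (nat (- i - 1)) - 1" by simp
    thus False using that by blast
   qed
   thus ?thesis by simp
  qed
  have "?w (- int k - 1) * (if - int k - 1 < 0 then Delta_contr (Fer, a, nat (- (- int k - 1))) (Fer, b, Suc j') else 0) =
    lF * frm a b * iterate_term' i' j' k" for k
  proof -
   have "nat (- (- int k - 1)) = Suc k" "- int k - 1 < 0" by simp_all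
   moreover have "u powi (- 2 * int k - 2 + int (par Fer)) = inverse u ^ (2 * k + 1)" by (rule powi_eq_inverse_power) simp
   moreover have "Delta_contr (Fer, a, Suc k) (Fer, b, Suc j') = lF * frm a b * delta_fn k j'" by (simp add: Delta_contr_def C_coeff_eq[symmetric])
   ultimately show ?thesis unfolding iterate_weight_0 iterate_term'_def inverse_u_power u' by (simp only: if_True mult_ac)
  qed
  thus "((%k. ?w (- int k - 1) * (if - int k - 1 < 0 then Delta_contr (Fer, a, nat (- (- int k - 1))) (Fer, b, Suc j') else 0)) has_sum
   lF * frm a b * (fermion_fn i' j' t u - V_contr_fn i' j')) UNIV" by (simp only: has_sum_cmult_right[OF cross_has_sum])
 qed
 have P: "((%i. ?w i * V.kapn (Fer, a, i) (Fer, b, - int (Suc j'))) has_sum lF * frm a b * V_contr_fn i' j') UNIV"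
 proof (rule has_sum_single[of "int j'"])
  have "- of_int (int j') - 1 = (- of_nat j' - 1 :: complex)" by simp
  moreover have "- int j' - int (Suc i') = - int (i' + j' + 1)" by simp
  hence "z powi (- int j' - int (Suc i')) = inverse z ^ (i' + j' + 1)" by (rule powi_eq_inverse_power)
  moreover have "u powi (2 * int j' + int (par Fer)) * inverse u ^ (2 * j' + 1) = 1"
  proof -
   have "2 * int j' + int (par Fer) = int (2 * j' + 1)" by simp
   thus ?thesis using u by (simp only: power_int_of_nat power_mult_distrib[symmetric] right_inverse power_one not_False_eq_True)
  qed
  ultimately have "?w (int j') = V_contr_fn i' j'" unfolding iterate_weight_def V_contr_fn_def u' prod.case
   by (simp only: if_True simp_thms diff_Suc_1 mult.assoc mult_1_right)
  moreover have "V.kapn (Fer, a, int j') (Fer, b, - int (Suc j')) = lF * frm a b" by (simp add: V_kapn_eq)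
  ultimately show "?w (int j') * V.kapn (Fer, a, int j') (Fer, b, - int (Suc j')) = lF * frm a b * V_contr_fn i' j'" by (simp only: mult.commute)
  show "?w i * V.kapn (Fer, a, i) (Fer, b, - int (Suc j')) = 0" if "i ~= int j'" for i using that by (simp add: V_kapn_eq)
 qed
 have "lF * frm a b * (fermion_fn i' j' t u - V_contr_fn i' j') + lF * frm a b * V_contr_fn i' j' = lF * frm a b * fermion_fn i' j' t u"
  by (simp only: right_diff_distrib diff_add_cancel)
 thus ?thesis using has_sum_add[OF N P] by (simp only: distrib_left)
qed

text \<open>The heart of associativity: once the indices are summed, the contractions of an iterate
  are those of a product, for every combination of statistics and labels.\<close>

lemma iterate_pair:
 assumes s: "shifted_root u z t"
  and xy: "snd (snd (unlab x)) >= 1" "snd (snd (unlab y)) >= 1" "label x < 2" "label y < 2"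
 shows "((%(i, j). iterate_weight z u x i * iterate_weight z u y j * iterate_contr (ix x i) (ix y j)) has_sum
   root_contr (%j. if j = 0 then t else u) x y) UNIV"
proof -
 interpret shifted_root u z t by (rule s)
 obtain s a i' l where x: "x = (s, a, Suc i', l)" using xy(1) by (cases x) (auto simp: unlab_def gr0_conv_Suc Suc_le_eq)
 obtain s' b j' l' where y: "y = (s', b, Suc j', l')" using xy(2) by (cases y) (auto simp: unlab_def gr0_conv_Suc Suc_le_eq)
 let ?f = "%(i, j). iterate_weight z u x i * iterate_weight z u y j * iterate_contr (ix x i) (ix y j)"
 let ?r = "root_contr (%j. if j = 0 then t else u) x y"
 have ix: "md (ix x i) = (s, a, i)" "md (ix y i) = (s', b, i)" "created (ix x i) = (s, a, nat (- i))"
  "created (ix y i) = (s', b, nat (- i))" "snd (snd (ix x i)) = i" "snd (snd (ix y i)) = i"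
  "ilabel (ix x i) = l" "ilabel (ix y i) = l'" "label x = l" "label y = l'" for i by (simp_all add: x y) (simp_all add: ix_def)
 note c = iterate_contr_def ix
 have l: "l = 0 | l = 1" "l' = 0 | l' = 1" using xy(3,4) by (auto simp: x y)
 consider (ne) "s ~= s'" | (gt) "l > l'" | (Bos) "s = Bos" "s' = Bos" "l = l'" | (B01) "s = Bos" "s' = Bos" "l = 0" "l' = 1"
  | (F00) "s = Fer" "s' = Fer" "l = 0" "l' = 0" | (F11) "s = Fer" "s' = Fer" "l = 1" "l' = 1" | (F01) "s = Fer" "s' = Fer" "l = 0" "l' = 1"
  using l by (cases s; cases s') auto
 thus ?thesis
 proof cases
  case ne
  have "?f p = 0" for p using ne by (cases p) (auto simp: c Delta_contr_def V_kapn_eq)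
  hence "(?f has_sum 0) UNIV" by (rule has_sum_0)
  moreover have "?r = 0" using ne by (auto simp: x y root_contr_def Delta_contr_def pair_fn_def)
  ultimately show ?thesis by (simp only:)
 next
  case gt
  have "?f p = 0" for p using gt by (cases p) (auto simp: c)
  hence "(?f has_sum 0) UNIV" by (rule has_sum_0)
  moreover have "?r = 0" using gt by (auto simp: x y root_contr_def)
  ultimately show ?thesis by (simp only:)
 next
  case Bos
  have "?f p = 0" for p using Bos by (cases p) (auto simp: c Delta_contr_def)
  hence "(?f has_sum 0) UNIV" by (rule has_sum_0)
  moreover have "?r = 0" using Bos by (auto simp: x y root_contr_def Delta_contr_def)
  ultimately show ?thesis by (simp only:)
 next
  \<comment> \<open>The bosonic contraction is the same on V and on W, and the one mode
    \<open>j' + 1\<close> accounts for it; nothing has to be restored by \<Delta>.\<close>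
  case B01
  show ?thesis
  proof (rule has_sum_single[of "(int (Suc j'), - int (Suc j'))"])
   have 1: "z powi (- int (Suc j') - int (Suc i')) = inverse z ^ (i' + j' + 2)" by (rule powi_eq_inverse_power) simp
   have 2: "u powi (2 * int (Suc j') + int (par Bos)) * u powi (2 * - int (Suc j') + int (par Bos)) = 1"
    using u by (simp add: power_int_minus del: of_nat_Suc)
   have 3: "iterate_contr (ix x (int (Suc j'))) (ix y (- int (Suc j'))) = lB * (of_nat (Suc j') * frm a b)"
    unfolding c using B01 by (simp add: V_kapn_eq)
   have 4: "- of_int (int (Suc j')) - 1 = (- of_nat j' - 2 :: complex)" by simp
   have wx: "iterate_weight z u x (int (Suc j')) =
     ((- of_nat j' - 2) gchoose i') * inverse z ^ (i' + j' + 2) * u powi (2 * int (Suc j') + int (par Bos))"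
    unfolding x B01 iterate_weight_def prod.case 4 1 by (simp only: if_True simp_thms diff_Suc_1)
   have wy: "iterate_weight z u y (- int (Suc j')) = u powi (2 * - int (Suc j') + int (par Bos))"
    unfolding y B01 iterate_weight_def prod.case by (simp only: if_True if_False one_neq_zero simp_thms mult_1_left)
   have "?f (int (Suc j'), - int (Suc j')) = ((- of_nat j' - 2) gchoose i') * inverse z ^ (i' + j' + 2) * (lB * (of_nat (Suc j') * frm a b)) *
     (u powi (2 * int (Suc j') + int (par Bos)) * u powi (2 * - int (Suc j') + int (par Bos)))" unfolding prod.case 3 wx wy by (simp only: mult_ac)
   moreover have "?r = lB * frm a b * boson_fn i' j' (t^2) (u^2)" by (simp add: x y B01 root_contr_def pair_fn_def)
   ultimately show "?f (int (Suc j'), - int (Suc j')) = ?r"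
    unfolding 2 boson_fn_def t_square add_diff_cancel_left' by (simp only: mult_ac mult_1_left mult_1_right)
   fix p assume "p ~= (int (Suc j'), - int (Suc j'))"
   thus "?f p = 0" by (cases p) (auto simp: c x y B01 Delta_contr_def V_kapn_eq iterate_weight_def)
  qed
 next
  case F00
  have e: "?r = Delta_contr (Fer, a, Suc i') (Fer, b, Suc j') * t powi (- 2 * int i' - 2 * int j' - 2)"
  proof -
   have "- lev (Fer, a, Suc i') - lev (Fer, b, Suc j') = - 2 * int i' - 2 * int j' - 2" by (simp add: lev_def)
   moreover have "?r = Delta_contr (Fer, a, Suc i') (Fer, b, Suc j') * t powi (- lev (Fer, a, Suc i') - lev (Fer, b, Suc j'))"
    by (simp add: x y F00 root_contr_def)
   ultimately show ?thesis by (simp only:)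
  qed
  have h: "?f p = (%(i, j). iterate_weight z u (Fer, a, Suc i', 0) i * iterate_weight z u (Fer, b, Suc j', 0) j *
   Delta_contr (Fer, a, nat (- i)) (Fer, b, nat (- j)) * of_bool (i < 0 & j < 0)) p" for p by (cases p) (simp add: c F00, simp add: x y F00)
  show ?thesis unfolding e by (rule has_sum_cong[THEN iffD2, OF h iterate_pair_00[OF s]])
 next
  case F11
  show ?thesis
  proof (rule has_sum_single[of "(- int (Suc i'), - int (Suc j'))"])
   have "u powi (2 * - int (Suc i') + int (par Fer)) * u powi (2 * - int (Suc j') + int (par Fer)) =
     u powi (- lev (unlab x) - lev (unlab y))" using u by (simp add: x y F11 lev_def power_int_add[symmetric] del: of_nat_Suc)
   moreover have "iterate_weight z u x (- int (Suc i')) = u powi (2 * - int (Suc i') + int (par Fer))"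
    unfolding x F11 iterate_weight_def prod.case by (simp only: if_True if_False one_neq_zero simp_thms mult_1_left)
   moreover have "iterate_weight z u y (- int (Suc j')) = u powi (2 * - int (Suc j') + int (par Fer))"
    unfolding y F11 iterate_weight_def prod.case by (simp only: if_True if_False one_neq_zero simp_thms mult_1_left)
   moreover have "iterate_contr (ix x (- int (Suc i'))) (ix y (- int (Suc j'))) = Delta_contr (unlab x) (unlab y)"
    unfolding c by (simp add: x y F11 del: of_nat_Suc)
   moreover have "?r = Delta_contr (unlab x) (unlab y) * u powi (- lev (unlab x) - lev (unlab y))" by (simp add: root_contr_def x y F11)
   ultimately show "?f (- int (Suc i'), - int (Suc j')) = ?r" by (simp only: prod.case mult_ac)
   fix p assume "p ~= (- int (Suc i'), - int (Suc j'))"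
   thus "?f p = 0" by (cases p) (auto simp: x y F11 iterate_weight_def)
  qed
 next
  case F01
  show ?thesis
  proof (rule has_sum_inj_support[where g = "%i. (i, - int (Suc j'))"])
   show "inj (%i :: int. (i, - int (Suc j')))" by (rule injI) simp
   show "?f p = 0" if "p \<notin> range (%i. (i, - int (Suc j')))" for p
   proof (cases p)
    case (Pair i j)
    hence "j ~= - int (Suc j')" using that by blast
    thus ?thesis by (simp add: Pair y F01 iterate_weight_def)
   qed
   have "?f (i, - int (Suc j')) = iterate_weight z u (Fer, a, Suc i', 0) i * u powi (- 2 * int j' - 1) *
    ((if i < 0 then Delta_contr (Fer, a, nat (- i)) (Fer, b, Suc j') else 0) +
     V.kapn (Fer, a, i) (Fer, b, - int (Suc j')))" for i
   proof -
    have "iterate_weight z u y (- int (Suc j')) = u powi (- 2 * int j' - 1)"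
    proof -
     have "2 * - int (Suc j') + int (par Fer) = - 2 * int j' - 1" by simp
     thus ?thesis unfolding y F01 iterate_weight_def prod.case by (simp only: if_True if_False one_neq_zero simp_thms mult_1_left)
    qed
    moreover have "nat (- (- int (Suc j'))) = Suc j'" "- int (Suc j') < 0" by simp_all
    ultimately show ?thesis unfolding prod.case c by (simp only: x F01 simp_thms if_True if_False less_irrefl less_one zero_less_one not_one_less_zero)
   qed
   moreover have "?r = lF * frm a b * fermion_fn i' j' t u" by (simp add: x y F01 root_contr_def pair_fn_def)
   ultimately show "((%i. ?f (i, - int (Suc j'))) has_sum ?r) UNIV" using iterate_pair_01_Fer[OF s, of a i' j' b] by (simp only:)
  qed
 qed
qed

text \<open>For an uncontracted letter of the first vector the creation modes on V re-expand the
  field at \<open>y\<close> into the field at \<open>y + z\<close>, by \<open>shift_has_sum\<close>.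
  A letter of the second vector keeps its single index.\<close>

lemma iterate_letter_has_sum:
 assumes s: "shifted_root u z t" and x: "snd (snd (unlab x)) >= 1" "label x < 2"
 shows "((%k. iterate_weight z u x k * (if k < 0 then mcoeff exW (created (ix x k)) n else 0)) has_sum
   (lcoeff (%j. if j = 0 then t else u) x n * u powi (2 * n))) UNIV"
proof -
 interpret shifted_root u z t by (rule s)
 obtain s a i l where xe: "x = (s, a, Suc i, l)" using x(1) by (cases x) (auto simp: unlab_def gr0_conv_Suc Suc_le_eq)
 let ?f = "%k. iterate_weight z u x k * (if k < 0 then mcoeff exW (created (ix x k)) n else 0)"
 show ?thesis
 proof (cases "l = 0")
  case True
  define E where "E = - 2 * n - 2 + int (par s)"
  have E: "exW s n = of_int E / 2" by (simp add: E_def field_simps)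
  show ?thesis
  proof (rule has_sum_inj_support[where g = "%k. - int k - 1"])
   show "inj (%k. - int k - 1)" by (rule injI) auto
   show "?f k = 0" if "k \<notin> range (%k. - int k - 1)" for k
   proof -
    have "~ k < 0"
    proof
     assume "k < 0"
     hence "k = - int (nat (- k - 1)) - 1" by simp
     thus False using that by blast
    qed
    thus ?thesis by simp
   qed
   have "?f (- int k - 1) = shcoeff z i k * ((of_int E / 2) gchoose k) * u powi (E - 2 * int k) * u powi (2 * n)" for k
   proof -
    have "nat (- (- int k - 1)) = Suc k" "- int k - 1 < 0" by simp_all
    moreover have "u powi (- 2 * int k - 2 + int (par s)) = u powi (E - 2 * int k) * u powi (2 * n)"
     using u by (simp add: power_int_add[symmetric] E_def algebra_simps)
    ultimately show ?thesis unfolding xe True iterate_weight_0 mcoeff_def created_simps(2)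
     by (simp only: if_True fst_conv snd_conv E diff_Suc_1 mult_ac)
   qed
   moreover have "lcoeff (%j. if j = 0 then t else u) x n = ((of_int E / 2) gchoose i) * t powi (E - 2 * int i)"
   proof -
    have "- 2 * n - lev (unlab x) = E - 2 * int i" by (simp add: xe lev_def E_def)
    moreover have "mcoeff exW (unlab x) n = ((of_int E / 2) gchoose i)" unfolding mcoeff_def xe lab_simps fst_conv snd_conv E diff_Suc_1 ..
    ultimately show ?thesis unfolding lcoeff_def by (simp only:) (simp add: xe True)
   qed
   ultimately show "((%k. ?f (- int k - 1)) has_sum (lcoeff (%j. if j = 0 then t else u) x n * u powi (2 * n))) UNIV"
    by (simp only: has_sum_cmult_left[OF shift_has_sum])
  qed
 next
  case False
  hence l: "l = 1" using x(2) by (simp add: xe)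
  show ?thesis
  proof (rule has_sum_single[of "- int (Suc i)"])
   have "u powi (2 * - int (Suc i) + int (par s)) = u powi (- 2 * n - lev (unlab x)) * u powi (2 * n)"
   proof -
    have "2 * - int (Suc i) + int (par s) = (- 2 * n - lev (unlab x)) + 2 * n" by (simp add: xe lev_def)
    thus ?thesis by (simp only: power_int_add[OF disjI1[OF u]])
   qed
   moreover have "created (ix x (- int (Suc i))) = unlab x" by (simp add: xe)
   moreover have "iterate_weight z u x (- int (Suc i)) = u powi (2 * - int (Suc i) + int (par s))"
    unfolding xe l iterate_weight_def prod.case by (simp only: if_True if_False one_neq_zero simp_thms mult_1_left)
   moreover have "label x = 1" "- int (Suc i) < 0" by (simp_all add: xe l)
   ultimately show "?f (- int (Suc i)) = lcoeff (%j. if j = 0 then t else u) x n * u powi (2 * n)"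
    unfolding lcoeff_def by (simp only: if_True if_False one_neq_zero mult_ac)
   fix k assume "k ~= - int (Suc i)"
   thus "?f k = 0" by (simp add: xe l iterate_weight_def)
  qed
 qed
qed

end

section \<open>Normal ordered modes of the inner vertex operator\<close>

definition neg_letters :: "(stat \<times> 'r \<times> int) list => bool" where
 "neg_letters v \<longleftrightarrow> (\<forall>x\<in>set v. snd (snd x) < 0)"

text \<open>The level of the created word, extended to words of arbitrary modes so that contractions
  on V conserve it.\<close>

definition ltotal :: "(stat \<times> 'r \<times> int) list => int" where
 "ltotal v = (SUM x<-v. - 2 * snd (snd x) - int (par (fst x)))"

lemma ltotal_simps [simp]: "ltotal [] = 0"
 "ltotal (x # v) = - 2 * snd (snd x) - int (par (fst x)) + ltotal v"
 "ltotal (u @ v) = ltotal u + ltotal v" by (simp_all add: ltotal_def)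

lemma neg_letters_simps [simp]: "neg_letters []"
 "neg_letters (x # v) \<longleftrightarrow> snd (snd x) < 0 & neg_letters v" by (simp_all add: neg_letters_def)

lemma created_in_creation_words: "neg_letters v ==> map created v \<in> CW" by (induction v) (auto simp: created_def creation_words_def)

lemma homog_add: "homog t ph ==> homog t \<psi> ==> homog t (%y. ph y + \<psi> y)" unfolding homog_def by (metis add.right_neutral)

lemma snd_snd_md [simp]: "snd (snd (md x)) = snd (snd x)" by (simp add: md_def)

context setting
begin

lemma V_zero_mode: "U \<in> CW ==> V.A Bos a 0 (vv U) = 0"
proof (induction U)
 case Nil
 have "V.A Bos a 0 (V.io 1) = V.io 0" by (simp add: V.A_io dg_def)
 thus ?case by (simp add: V_io)
next
 case (Cons x U)
 obtain s b m where x: "x = (s, b, m)" by (cases x)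
 have "- int m < 0" "U \<in> CW" using Cons.prems by (auto simp: x)
 thus ?case using Cons.IH V.A_super_neg[of Bos 0 "- int m" a s b] by (simp add: x dg_def V.kap_nonpos)
qed

text \<open>Positive modes and bosonic zero modes leave nothing of the vacuum or of what negative
  modes create from it in normal order.\<close>

lemma V_NO_vac:
 "V.NO (map md v) (vac \<pi>V) = (if neg_letters v then vv (map created v) else 0)"
proof (induction v)
 case (Cons x v)
 obtain s a m l k where x: "x = (s, (a, m, l), k)" by (cases x) auto
 have md: "md x = (s, a, k)" "created x = (s, a, nat (- k))" "snd (snd x) = k" by (simp_all add: x md_def created_def)
 consider "k < 0" | "2 * k + int (par s) > 0" | "s = Bos" "k = 0" by (cases s) fastforce+
 thus ?case
 proof cases
  case 1
  have "V.kapn (md x) = (%y. 0)"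
  proof
   fix y show "V.kapn (md x) y = 0" using 1 by (cases y; cases s) (auto simp: md V_kapn_eq)
  qed
  hence "V.NO (md x # map md v) (vac \<pi>V) = V.A s a k (V.NO (map md v) (vac \<pi>V))" by (simp add: V.NO_Cons V.Ap_def md)
  thus ?thesis using 1 Cons by (simp add: md)
 next
  case 2
  have "vac \<pi>V \<in> V.filt 0" unfolding V.filt_def vac_eq by (rule V.W.span_base) (auto intro!: exI[of _ "[]"])
  moreover have "V.pos_degree (map md (x # v)) > 0"
  proof -
   have "0 <= V.pos_degree (map md v)" unfolding V.pos_degree_def by (intro sum_list_nonneg) auto
   thus ?thesis using 2 by (simp add: V.pos_degree_def md dg_def)
  qed
  ultimately have "V.NO (map md (x # v)) (vac \<pi>V) = 0" by (rule V.NO_eq_0)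
  moreover have "~ neg_letters (x # v)" using 2 by (cases s) (auto simp: md)
  ultimately show ?thesis by auto
 next
  case 3
  have "V.kapn (md x) = (%y. 0)"
  proof
   fix y show "V.kapn (md x) y = 0" using 3 by (cases y) (auto simp: md V_kapn_eq)
  qed
  hence "V.NO (md x # map md v) (vac \<pi>V) = V.A Bos a 0 (V.NO (map md v) (vac \<pi>V))" by (simp add: V.NO_Cons V.Ap_def md 3)
  thus ?thesis using 3 Cons by (auto simp: md V_zero_mode created_in_creation_words)
 qed
qed simp

lemma V_level_created: "neg_letters v ==> V.level (map created v) = ltotal v" by (induction v) (auto simp: V.level_def created_def)

text \<open>Writing \<open>vv U2\<close> as modes acting on the vacuum joins the letters of both
  vectors in one word, to which Wick's theorem on V and the contraction of \<Delta> apply.\<close>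

lemma YW_V_NO:
 fixes U1 U2 :: "'h word" and ks :: "int list"
 assumes U2: "U2 \<in> CW" and ks: "length ks = length U1" and mu: "lin scW (*) mu"
 defines "X == map (ilab 0) (indexed U1 ks) @ map (ilab 1) (indexed U2 (map (%x. - int (snd (snd x))) U2))"
 shows "mu (YW k (V.NO (map md (indexed U1 ks)) (vv U2)) w) = cx.wick iterate_contr X
   (%v. if neg_letters v then mu (W.npc exW (map created v) (k + 2 - ltotal X) w) else 0)"
proof -
 let ?A = "indexed U1 ks" and ?B = "indexed U2 (map (%x. - int (snd (snd x))) U2)"
 interpret mu: Vector_Spaces.linear scW "(*)" mu by (rule mu)
 have nu: "lin scV (*) (%v. mu (YW k v w))" using Vector_Spaces.linear_compose[OF YW_linear_left mu, of k w] by (simp add: comp_def)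
 define H where "H x y = (if ilabel x = 0 & ilabel y = 0 then - V.kapn (md x) (md y) else 0)"
  for x y :: "stat \<times> ('h \<times> nat \<times> nat) \<times> int"
 have hk: "homog (fst x) (%y. V.kapn (md x) (md y))" for x :: "stat \<times> ('h \<times> nat \<times> nat) \<times> int"
  using V.kapn_homog[of "md x"] unfolding homog_def by (metis fst_md)
 have hH: "homog (fst x) (H x)" for x using hk[of x] unfolding homog_def H_def by (metis neg_0_equal_iff_equal)
 have h1: "homog (fst x) (%y. if ilabel x < ilabel y then V.kapn (md x) (md y) else 0)"
  and h2: "homog (fst x) (%y. if snd (snd x) < 0 & snd (snd y) < 0 then Delta_contr (created x) (created y) else 0)"
  for x :: "stat \<times> ('h \<times> nat \<times> nat) \<times> int"
  using hk[of x] Delta_contr_homog[of "created x"] unfolding homog_def by (metis, metis created_simps(1))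
 have B: "map md ?B = map neg U2" by (induction U2) (auto simp: neg_def)
 have vvU: "vv U2 = apply_modes V.A (map md ?B) (vac \<pi>V)" unfolding B V_vec_def by (rule V.create_neg)
 have "V.NO (map md ?A) (vv U2) = V.W.wick (%x y. - V.kapn (md x) (md y)) ?A (%u. apply_modes V.A (map md u @ map md ?B) (vac \<pi>V))"
  unfolding V.NO_eq_wick V.W.wick_map[of md, OF fst_md] vvU V.apply_modes_append ..
 also have "... = V.W.wick H X (%u. apply_modes V.A (map md u) (vac \<pi>V))"
 proof -
  have "V.W.wick H X Ps = V.W.wick H (map (ilab 0) ?A) (%u. V.W.wick H (map (ilab 1) ?B) (%v. Ps (u @ v)))" for Ps
   unfolding X_def by (rule V.W.wick_append[OF _ hH]) (auto simp: H_def)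
  moreover have "(%x y. H (ilab 0 x) (ilab 0 y)) = (%x y. - V.kapn (md x) (md y))" "(%x y. H (ilab 1 x) (ilab 1 y)) = (%x y. 0)"
   by (simp_all add: H_def fun_eq_iff)
  moreover have "map md (map (ilab j) v) = map md v" for j and v :: "(stat \<times> ('h \<times> nat) \<times> int) list" by simp
  ultimately show ?thesis by (simp only: V.W.wick_map[of "ilab _", OF ilab_simps(1)] V.W.wick_zero_left map_append)
 qed
 also have "... = V.W.wick (%x y. H x y + V.kapn (md x) (md y)) X (%u. V.NO (map md u) (vac \<pi>V))"
  unfolding V.apply_eq_wick_NO V.W.wick_map[of md, OF fst_md] V.W.wick_wick[OF hH hk] ..
 finally have "mu (YW k (V.NO (map md ?A) (vv U2)) w) =
   cx.wick (%x y. H x y + V.kapn (md x) (md y)) X (%u. mu (YW k (V.NO (map md u) (vac \<pi>V)) w))" by (simp only: linear_wick[OF nu])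
 also have "... = cx.wick (%x y. if ilabel x < ilabel y then V.kapn (md x) (md y) else 0) X
   (%v. if neg_letters v then cx.wick Delta_contr (map created v) (%v. mu (W.npc exW v (k + 2 - ltotal X) w)) else 0)"
 \<comment> \<open>The labels stay sorted, the letters of the second vector are negative modes, and
   a contraction on V removes two modes of total level zero. Hence \<open>kapn\<close> survives only
   between different labels.\<close>
 proof (rule cx.wick_cong[where P = "%v. sorted (map ilabel v) & (\<forall>x\<in>set v. ilabel x <= 1 & (ilabel x = 1 --> snd (snd x) < 0)) &
   ltotal v = ltotal X"])
  show "homog (fst x) (%y. H x y + V.kapn (md x) (md y))" for x by (intro homog_add hH hk)
  show "homog (fst x) (%y. if ilabel x < ilabel y then V.kapn (md x) (md y) else 0)" for x by (rule h1)
  have n: "snd (snd x) < 0" if "x \<in> set ?B" for x using that U2 by (induction U2) (auto simp: ix_def)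
  have "ilabel x <= 1 & (ilabel x = 1 --> snd (snd x) < 0)" if "x \<in> set X" for x
  proof -
   have "(\<exists>y. x = ilab 0 y) | (\<exists>y\<in>set ?B. x = ilab 1 y)" using that unfolding X_def set_append set_map by blast
   moreover have "snd (snd (ilab 1 y)) = snd (snd y)" for y :: "stat \<times> ('h \<times> nat) \<times> int" by (simp add: ilab_def)
   ultimately show ?thesis using n by auto
  qed
  moreover have "sorted (map ilabel X)" by (auto simp: X_def sorted_append comp_def map_replicate_const)
  ultimately show "sorted (map ilabel X) & (\<forall>x\<in>set X. ilabel x <= 1 & (ilabel x = 1 --> snd (snd x) < 0)) & ltotal X = ltotal X" by blast
 next
  fix u v r :: "(stat \<times> ('h \<times> nat \<times> nat) \<times> int) list" and x y :: "stat \<times> ('h \<times> nat \<times> nat) \<times> int"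
  assume P: "sorted (map ilabel (u @ x # v @ y # r)) & (\<forall>x\<in>set (u @ x # v @ y # r). ilabel x <= 1 & (ilabel x = 1 --> snd (snd x) < 0)) &
   ltotal (u @ x # v @ y # r) = ltotal X"
  obtain s a m l i where x: "x = (s, (a, m, l), i)" by (cases x) auto
  obtain s' b m' l' j where y: "y = (s', (b, m', l'), j)" by (cases y) auto
  have l: "l <= l'" "l' <= 1" "l = 1 ==> i < 0" using P by (auto simp: sorted_append x y ilabel_def)
  have "H x y + V.kapn (md x) (md y) = (if ilabel x < ilabel y then V.kapn (md x) (md y) else 0)"
  proof (cases "l = 0")
   case True
   thus ?thesis using l by (auto simp: H_def x y ilabel_def)
  next
   case False
   hence "l = 1" "l' = 1" "i < 0" using l by auto
   thus ?thesis by (cases s) (auto simp: H_def x y ilabel_def md_def V_kapn_eq)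
  qed
  moreover have "ltotal (u @ v @ r) = ltotal X" if "V.kapn (md x) (md y) ~= 0" using that P by (auto simp: x y md_def V_kapn_eq split: if_splits)
  ultimately show "H x y + V.kapn (md x) (md y) = (if ilabel x < ilabel y then V.kapn (md x) (md y) else 0) &
   (H x y + V.kapn (md x) (md y) ~= 0 --> sorted (map ilabel (u @ v @ r)) &
    (\<forall>x\<in>set (u @ v @ r). ilabel x <= 1 & (ilabel x = 1 --> snd (snd x) < 0)) & ltotal (u @ v @ r) = ltotal X)"
   using P by (auto simp: sorted_append split: if_splits)
 next
  fix v :: "(stat \<times> ('h \<times> nat \<times> nat) \<times> int) list"
  assume P: "sorted (map ilabel v) & (\<forall>x\<in>set v. ilabel x <= 1 & (ilabel x = 1 --> snd (snd x) < 0)) & ltotal v = ltotal X"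
  interpret nu: Vector_Spaces.linear scV "(*)" "%v. mu (YW k v w)" by (rule nu)
  show "mu (YW k (V.NO (map md v) (vac \<pi>V)) w) = (if neg_letters v
   then cx.wick Delta_contr (map created v) (%v. mu (W.npc exW v (k + 2 - ltotal X) w)) else 0)"
  proof (cases "neg_letters v")
   case True
   thus ?thesis using P by (simp add: V_NO_vac YW_vec[OF created_in_creation_words] linear_wick[OF mu] V_level_created)
  qed (simp add: V_NO_vac nu.zero)
 qed
 also have "... = cx.wick (%x y. if ilabel x < ilabel y then V.kapn (md x) (md y) else 0) X
   (%v. cx.wick (%x y. if snd (snd x) < 0 & snd (snd y) < 0 then Delta_contr (created x) (created y) else 0) v
    (%v. if neg_letters v then mu (W.npc exW (map created v) (k + 2 - ltotal X) w) else 0))"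
 proof -
  \<comment> \<open>The restriction to words of negative modes is a product of weights 0 and 1,
    which \<open>wick_weight\<close> carries into the contraction.\<close>
  have prod: "(PROD x<-v. if snd (snd x) < 0 then 1 else 0) = (if neg_letters v then 1 else 0 :: complex)"
   for v :: "(stat \<times> ('h \<times> nat \<times> nat) \<times> int) list" by (induction v) auto
  have e: "(if neg_letters v then 1 else 0) * f = (if neg_letters v then f else 0)" for f :: complex
   and v :: "(stat \<times> ('h \<times> nat \<times> nat) \<times> int) list" by simp
  have "cx.wick (%x y. if snd (snd x) < 0 & snd (snd y) < 0 then Delta_contr (created x) (created y) else 0) v
    (%v. (PROD x<-v. if snd (snd x) < 0 then 1 else 0) * Ps (map created v)) =
    (PROD x<-v. if snd (snd x) < 0 then 1 else 0) * cx.wick (%x y. Delta_contr (created x) (created y)) v (%v. Ps (map created v))"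
   for v :: "(stat \<times> ('h \<times> nat \<times> nat) \<times> int) list" and Ps by (rule cx.wick_weight) simp
  from this[of _ "%v. mu (W.npc exW v (k + 2 - ltotal X) w)"] show ?thesis
   unfolding prod e cx.wick_map[of created, OF created_simps(1)] by (simp only:)
 qed
 also have "... = cx.wick (%x y. (if ilabel x < ilabel y then V.kapn (md x) (md y) else 0) +
    (if snd (snd x) < 0 & snd (snd y) < 0 then Delta_contr (created x) (created y) else 0)) X
   (%v. if neg_letters v then mu (W.npc exW (map created v) (k + 2 - ltotal X) w) else 0)" by (rule cx.wick_wick[OF h1 h2])
 also have "... = cx.wick iterate_contr X
   (%v. if neg_letters v then mu (W.npc exW (map created v) (k + 2 - ltotal X) w) else 0)"
 proof (rule cx.wick_cong[where P = "%v. sorted (map ilabel v)"])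
  show "homog (fst x) (%y. (if ilabel x < ilabel y then V.kapn (md x) (md y) else 0) +
    (if snd (snd x) < 0 & snd (snd y) < 0 then Delta_contr (created x) (created y) else 0))" for x by (intro homog_add h1 h2)
  show "sorted (map ilabel X)" by (auto simp: X_def sorted_append comp_def map_replicate_const)
  fix u v r :: "(stat \<times> ('h \<times> nat \<times> nat) \<times> int) list" and x y :: "stat \<times> ('h \<times> nat \<times> nat) \<times> int"
  assume P: "sorted (map ilabel (u @ x # v @ y # r))"
  hence "ilabel x <= ilabel y" by (auto simp: sorted_append)
  hence "~ ilabel y < ilabel x" by simp
  moreover have "sorted (map ilabel (u @ v @ r))" using P by (auto simp: sorted_append)
  ultimately show "(if ilabel x < ilabel y then V.kapn (md x) (md y) else 0) +
    (if snd (snd x) < 0 & snd (snd y) < 0 then Delta_contr (created x) (created y) else 0) = iterate_contr x y &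
    ((if ilabel x < ilabel y then V.kapn (md x) (md y) else 0) +
    (if snd (snd x) < 0 & snd (snd y) < 0 then Delta_contr (created x) (created y) else 0) ~= 0 --> sorted (map ilabel (u @ v @ r)))"
   by (simp only: iterate_contr_def if_False add.commute simp_thms)
 qed (simp_all add: iterate_contr_homog)
 finally show ?thesis .
qed

end

lemma iprod_eq_0: "length is = length v ==> j < length v ==> f (v ! j) (is ! j) = 0 ==> iprod f v is = 0"
proof (induction v "is" arbitrary: j rule: list_induct2')
 case (4 x v i "is")
 thus ?case by (cases j) auto
qed auto

context matrix_element
begin

lemma mu_npc_has_sum:
 assumes "finite M" "!!ns. length ns = length xs ==> 2 * sum_list ns = K ==> mu (W.NO (map md (indexed xs ns)) w) ~= 0 ==> ns \<in> M"
  and "!!ns. ns \<in> M ==> length ns = length xs & 2 * sum_list ns = K"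
 shows "mu (W.npc ex xs K w) = (SUM ns:M. iprod (mcoeff ex) xs ns * mu (W.NO (map md (indexed xs ns)) w))"
proof -
 have "((%ns. if 2 * sum_list ns = K then iprod (mcoeff ex) xs ns * mu (W.NO (map md (indexed xs ns)) w) else 0)
   has_sum (SUM ns:M. iprod (mcoeff ex) xs ns * mu (W.NO (map md (indexed xs ns)) w))) (lists_of (length xs))"
  by (rule has_sum_finite_neutralI[OF assms(1)]) (use assms(2,3) in "auto simp: lists_of_def intro!: sum.cong")
 thus ?thesis using W.npc_has_sum[OF mu, of K ex xs w] by (rule has_sum_unique[rotated])
qed

lemma mode_lists_sum: "sum_list ns \<in> T" if "ns \<in> mode_lists v"
proof -
 have len: "length ns = length v" and "mu (W.NO (map md (indexed v ns)) w) ~= 0" using that by (auto simp: mode_lists_def)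
 thus ?thesis using mu_eq_0[of "map md (indexed v ns)"] unfolding sum_md_indexed[OF len] by blast
qed

lemma map_md_created: "length ks = length v ==> length ns = length v ==>
  map md (indexed (map created (indexed v ks)) ns) = map md (indexed v ns)"
 for v :: "('h labelled) list"
proof (induction v arbitrary: ks ns)
 case (Cons x v)
 thus ?case by (cases ks; cases ns) (auto simp: md_def ix_def created_def)
qed simp

text \<open>Fixing the total index \<open>j\<close> of the modes acting on \<open>w\<close> ties
  \<open>k\<close> to \<open>n\<close>, and only \<open>j\<close> in the finite set \<open>T\<close>
  contribute. For each \<open>j\<close> the double series becomes a single one, and the sum over the
  modes of the inner operator is evaluated by \<open>wick_has_sum\<close>.\<close>

theorem iterate_correlation:
 assumes U1: "U1 \<in> CW" and U2: "U2 \<in> CW" and s: "shifted_root u z t"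
 shows "((%(n, k). mu (YW k (YV n (vv U1) (vv U2)) w) * z powi (- n - 1) * u powi (- k - 2)) has_sum
   correlation (%j. if j = 0 then U1 else U2) 2 (%j. if j = 0 then t else u)) UNIV"
proof -
 interpret shifted_root u z t by (rule s)
 interpret mu: Vector_Spaces.linear scW "(*)" mu by (rule mu)
 let ?U = "%j. if j = (0::nat) then U1 else U2" and ?t = "%j. if j = (0::nat) then t else u"
 let ?L = "blocks ?U [0..<2]"
 let ?negs = "map (%x. - int (snd (snd x))) U2"
 define wt :: "'h labelled => int => complex" where "wt = iterate_weight z u"
 define it where "it n k = mu (YW k (YV n (vv U1) (vv U2)) w) * z powi (- n - 1) * u powi (- k - 2)" for n k
 have L: "?L = map (lab 0) U1 @ map (lab 1) U2" by (simp add: upt_rec)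
 have len: "length ?L = length U1 + length U2" by (simp add: L)
 have Lx: "snd (snd (unlab x)) >= 1" "label x < 2" if "x \<in> set ?L" for x using blocks_creation[OF _ that] U1 U2 by auto
 define Ph where "Ph j v = u powi (- 2 * j) * (if neg_letters v then mu (W.npc exW (map created v) (2 * j) w) else 0)"
  for j and v :: "(stat \<times> ('h \<times> nat \<times> nat) \<times> int) list"
 define M where "M j v = {ns \<in> mode_lists v. sum_list ns = j}" for j and v :: "('h labelled) list"
 define Phb where "Phb j v = (SUM ns:M j v. iprod (lcoeff ?t) v ns * mu (W.NO (map md (indexed v ns)) w))"
  for j and v :: "('h labelled) list"
 have finM: "finite (M j v)" for j v unfolding M_def by (rule finite_subset[OF _ finite_mode_lists[of v]]) auto
 define G where "G j ks = iprod wt ?L ks * cx.wick iterate_contr (indexed ?L ks) (Ph j)" for j ks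
 have S1: "(G j has_sum cx.wick (root_contr ?t) ?L (Phb j)) (lists_of (length ?L))" for j unfolding G_def
 proof (rule wick_has_sum[OF iterate_contr_homog root_contr_homog])
  fix x y assume "x \<in> set ?L" "y \<in> set ?L"
  thus "((%(i, j). wt x i * wt y j * iterate_contr (ix x i) (ix y j)) has_sum root_contr ?t x y) UNIV"
   unfolding wt_def by (intro iterate_pair[OF s] Lx)
 next
  fix v :: "('h labelled) list" assume v: "set v \<subseteq> set ?L"
  \<comment> \<open>The sum over the surviving modes on W is finite; exchanging it with the infinite
    sum over the modes on V leaves, for each letter, the series of
    \<open>iterate_letter_has_sum\<close>.\<close>
  define F where "F y k = wt (fst y, fst (snd y)) k *
    (if k < 0 then mcoeff exW (created (ix (fst y, fst (snd y)) k)) (snd (snd y)) else 0)"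
   for y :: "stat \<times> ('h \<times> nat \<times> nat) \<times> int" and k
  have FS: "((%ks. SUM ns:M j v. u powi (- 2 * j) * mu (W.NO (map md (indexed v ns)) w) * iprod F (indexed v ns) ks) has_sum
    (SUM ns:M j v. u powi (- 2 * j) * mu (W.NO (map md (indexed v ns)) w) *
      (PROD y<-indexed v ns. lcoeff ?t (fst y, fst (snd y)) (snd (snd y)) * u powi (2 * snd (snd y))))) (lists_of (length v))"
  proof (intro has_sum_sum has_sum_cmult_right)
   fix ns assume "ns \<in> M j v"
   hence ns: "length ns = length v" by (simp add: M_def mode_lists_def)
   have "(iprod F (indexed v ns) has_sum
    (PROD y<-indexed v ns. lcoeff ?t (fst y, fst (snd y)) (snd (snd y)) * u powi (2 * snd (snd y)))) (lists_of (length (indexed v ns)))"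
   proof (rule iprod_has_sum)
    fix y assume "y \<in> set (indexed v ns)"
    then obtain x n where y: "x \<in> set v" "y = ix x n" using set_indexed[OF ns] by blast
    hence "(fst y, fst (snd y)) = x" "snd (snd y) = n" by (simp_all add: ix_def)
    thus "(F y has_sum lcoeff ?t (fst y, fst (snd y)) (snd (snd y)) * u powi (2 * snd (snd y))) UNIV"
    proof -
     assume e: "(fst y, fst (snd y)) = x" "snd (snd y) = n"
     have xL: "x \<in> set ?L" using y(1) v by blast
     have "F y = (%k. iterate_weight z u x k * (if k < 0 then mcoeff exW (created (ix x k)) n else 0))" unfolding F_def e wt_def ..
     thus ?thesis unfolding e using iterate_letter_has_sum[OF s Lx(1)[OF xL] Lx(2)[OF xL], of n] by (simp only:)
    qed
   qed
   thus "(iprod F (indexed v ns) has_sum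
    (PROD y<-indexed v ns. lcoeff ?t (fst y, fst (snd y)) (snd (snd y)) * u powi (2 * snd (snd y)))) (lists_of (length v))"
    using ns by (simp add: indexed_def)
  qed
  have FA: "(SUM ns:M j v. u powi (- 2 * j) * mu (W.NO (map md (indexed v ns)) w) *
      (PROD y<-indexed v ns. lcoeff ?t (fst y, fst (snd y)) (snd (snd y)) * u powi (2 * snd (snd y)))) = Phb j v" unfolding Phb_def
  proof (rule sum.cong)
   fix ns assume "ns \<in> M j v"
   hence ns: "length ns = length v" "sum_list ns = j" by (simp_all add: M_def mode_lists_def)
   have "(PROD y<-indexed v ns. lcoeff ?t (fst y, fst (snd y)) (snd (snd y)) * u powi (2 * snd (snd y))) =
     iprod (lcoeff ?t) v ns * u powi (2 * sum_list ns)"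
    using ns(1) u by (induction v ns rule: list_induct2') (auto simp: ix_def power_int_add distrib_left)
   moreover have "u powi (- 2 * j) * u powi (2 * j) = 1" using u by (simp add: power_int_minus)
   ultimately show "u powi (- 2 * j) * mu (W.NO (map md (indexed v ns)) w) *
     (PROD y<-indexed v ns. lcoeff ?t (fst y, fst (snd y)) (snd (snd y)) * u powi (2 * snd (snd y))) =
     iprod (lcoeff ?t) v ns * mu (W.NO (map md (indexed v ns)) w)" unfolding ns(2) by (simp add: mult_ac)
  qed simp
  have FB: "iprod wt v ks * Ph j (indexed v ks) =
    (SUM ns:M j v. u powi (- 2 * j) * mu (W.NO (map md (indexed v ns)) w) * iprod F (indexed v ns) ks)"
   if ks: "ks \<in> lists_of (length v)" for ks
  proof -
   have lk: "length ks = length v" using ks by (simp add: lists_of_def)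
   have IF: "iprod F (indexed v ns) ks = iprod wt v ks *
     (if neg_letters (indexed v ks) then iprod (mcoeff exW) (map created (indexed v ks)) ns else 0)"
    if "length ns = length v" for ns using lk that
   proof (induction v arbitrary: ks ns)
    case (Cons x v)
    obtain k ks' n ns' where e: "ks = k # ks'" "ns = n # ns'" using Cons.prems by (cases ks; cases ns) auto
    have "F (ix x n) k = wt x k * (if k < 0 then mcoeff exW (created (ix x k)) n else 0)" by (simp add: F_def ix_def)
    thus ?case using Cons.IH[of ks' ns'] Cons.prems by (simp add: e ix_def)
   qed simp
   have "mu (W.npc exW (map created (indexed v ks)) (2 * j) w) =
    (SUM ns:M j v. iprod (mcoeff exW) (map created (indexed v ks)) ns *
     mu (W.NO (map md (indexed (map created (indexed v ks)) ns)) w))"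
   proof (rule mu_npc_has_sum[OF finM])
    have li: "length (map created (indexed v ks)) = length v" using lk by (simp add: indexed_def)
    show "ns \<in> M j v" if "length ns = length (map created (indexed v ks))" "2 * sum_list ns = 2 * j"
     "mu (W.NO (map md (indexed (map created (indexed v ks)) ns)) w) ~= 0" for ns using that(2,3) unfolding map_md_created[OF lk that(1)[unfolded li]]
     by (simp add: M_def mode_lists_def that(1)[unfolded li])
    show "length ns = length (map created (indexed v ks)) & 2 * sum_list ns = 2 * j" if "ns \<in> M j v" for ns
     using that unfolding li by (simp add: M_def mode_lists_def)
   qed
   also have "... = (SUM ns:M j v. iprod (mcoeff exW) (map created (indexed v ks)) ns * mu (W.NO (map md (indexed v ns)) w))"
    by (intro sum.cong refl) (simp add: M_def mode_lists_def map_md_created[OF lk])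
   finally have e: "mu (W.npc exW (map created (indexed v ks)) (2 * j) w) =
    (SUM ns:M j v. iprod (mcoeff exW) (map created (indexed v ks)) ns * mu (W.NO (map md (indexed v ns)) w))" .
   have "iprod wt v ks * Ph j (indexed v ks) = (SUM ns:M j v. u powi (- 2 * j) * mu (W.NO (map md (indexed v ns)) w) *
     (iprod wt v ks * (if neg_letters (indexed v ks) then iprod (mcoeff exW) (map created (indexed v ks)) ns else 0)))"
   proof (cases "neg_letters (indexed v ks)")
    case True
    thus ?thesis unfolding Ph_def e by (simp only: if_True sum_distrib_left mult_ac)
   qed (simp add: Ph_def)
   also have "... = (SUM ns:M j v. u powi (- 2 * j) * mu (W.NO (map md (indexed v ns)) w) * iprod F (indexed v ns) ks)"
    by (intro sum.cong refl) (simp add: M_def mode_lists_def IF)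
   finally show ?thesis .
  qed
  show "((%ks. iprod wt v ks * Ph j (indexed v ks)) has_sum Phb j v) (lists_of (length v))"
   using FS unfolding FA by (rule has_sum_cong[THEN iffD2, rotated]) (rule FB)
 qed
 \<comment> \<open>\<open>N ks\<close> is the index \<open>n\<close> of the inner vertex operator to
   which the mode list \<open>ks\<close> belongs, and \<open>2 * j + C - 2 * n\<close> is the index
   \<open>k\<close> of the outer one.\<close>
 define C where "C = V.level U1 + V.level U2 - 4"
 define N where "N ks = sum_list ks + (SUM x<-U1. int (snd (snd x))) - 1" for ks :: "int list"
 have X: "indexed ?L (ks @ ?negs) = map (ilab 0) (indexed U1 ks) @ map (ilab 1) (indexed U2 ?negs)"
  and tot: "ltotal (indexed ?L (ks @ ?negs)) = C - 2 * N ks + 2" if "length ks = length U1" for ks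
 proof -
  show 1: "indexed ?L (ks @ ?negs) = map (ilab 0) (indexed U1 ks) @ map (ilab 1) (indexed U2 ?negs)"
   unfolding L using that by (simp add: indexed_append indexed_lab)
  have "ltotal (map (ilab 0) (indexed U1 ks)) = - 2 * sum_list ks - 2 * (SUM x<-U1. int (snd (snd x))) + V.level U1"
   using that by (induction U1 ks rule: list_induct2') (auto simp: V.level_def ilab_def ix_def)
  moreover have "ltotal (map (ilab 1) (indexed U2 ?negs)) = V.level U2" by (induction U2) (auto simp: V.level_def ilab_def ix_def)
  ultimately show "ltotal (indexed ?L (ks @ ?negs)) = C - 2 * N ks + 2" unfolding 1 ltotal_simps C_def N_def by simp
 qed
 have G: "G j (ks @ ?negs) = iprod (mcoeff exV) U1 ks *
   mu (YW (2 * j + C - 2 * N ks) (V.NO (map md (indexed U1 ks)) (vv U2)) w) *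
   z powi (- N ks - 1) * u powi (- (2 * j + C - 2 * N ks) - 2)" if ks: "length ks = length U1" for j ks
 proof -
  let ?k = "2 * j + C - 2 * N ks"
  have e: "?k + 2 - ltotal (indexed ?L (ks @ ?negs)) = 2 * j" unfolding tot[OF ks] by simp
  have 1: "mu (YW ?k (V.NO (map md (indexed U1 ks)) (vv U2)) w) = cx.wick iterate_contr (indexed ?L (ks @ ?negs))
    (%v. if neg_letters v then mu (W.npc exW (map created v) (2 * j) w) else 0)" using YW_V_NO[OF U2 ks mu, of ?k w] unfolding X[OF ks, symmetric] e .
  have 2: "iprod wt (map (lab 0) U1) ks = iprod (mcoeff exV) U1 ks * z powi (- N ks - 1) *
    u powi (- ltotal (map (ilab 0) (indexed U1 ks)))" unfolding N_def using ks u z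
  proof (induction U1 ks rule: list_induct2')
   case (4 x U1 k ks)
   obtain s a m where x: "x = (s, a, m)" by (cases x)
   have e: "- (k + sum_list ks + (int m + (SUM x<-U1. int (snd (snd x)))) - 1) - 1 =
     (- k - int m) + (- (sum_list ks + (SUM x<-U1. int (snd (snd x))) - 1) - 1)" by simp
   have zf: "z powi (- (sum_list (k # ks) + (SUM x<-x # U1. int (snd (snd x))) - 1) - 1) =
     z powi (- k - int m) * z powi (- (sum_list ks + (SUM x<-U1. int (snd (snd x))) - 1) - 1)"
    unfolding sum_list.Cons list.map x snd_conv add.assoc[symmetric]
    using power_int_add[OF disjI1[OF z], of "- k - int m"] e by (simp only: add.assoc)
   have uf: "u powi (- ltotal (map (ilab 0) (indexed (x # U1) (k # ks)))) =
     u powi (2 * k + int (par s)) * u powi (- ltotal (map (ilab 0) (indexed U1 ks)))"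
   proof -
    have "- ltotal (map (ilab 0) (indexed (x # U1) (k # ks))) = (2 * k + int (par s)) + - ltotal (map (ilab 0) (indexed U1 ks))"
     by (simp add: x ix_def ilab_def)
    thus ?thesis by (simp only: power_int_add[OF disjI1[OF u]])
   qed
   have wf: "wt (lab 0 x) k = mcoeff exV x k * z powi (- k - int m) * u powi (2 * k + int (par s))"
    by (simp add: wt_def x iterate_weight_def mcoeff_def)
   have ih: "iprod wt (map (lab 0) U1) ks = iprod (mcoeff exV) U1 ks *
     z powi (- (sum_list ks + (SUM x<-U1. int (snd (snd x))) - 1) - 1) * u powi (- ltotal (map (ilab 0) (indexed U1 ks)))" using 4 by simp
   show ?case unfolding zf uf unfolding list.map iprod_simps wf ih by (simp only: mult_ac)
  qed auto
  have 3: "iprod wt (map (lab 1) U2) ?negs = u powi (- ltotal (map (ilab 1) (indexed U2 ?negs)))"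
  proof (induction U2)
   case (Cons x U2)
   obtain s a m where x: "x = (s, a, m)" by (cases x)
   have "- ltotal (map (ilab 1) (indexed (x # U2) (map (%x. - int (snd (snd x))) (x # U2)))) =
     (2 * - int m + int (par s)) + - ltotal (map (ilab 1) (indexed U2 (map (%x. - int (snd (snd x))) U2)))" by (simp add: x ix_def ilab_def)
   hence "u powi - ltotal (map (ilab 1) (indexed (x # U2) (map (%x. - int (snd (snd x))) (x # U2)))) =
     u powi (2 * - int m + int (par s)) * u powi - ltotal (map (ilab 1) (indexed U2 (map (%x. - int (snd (snd x))) U2)))"
    by (simp only: power_int_add[OF disjI1[OF u]])
   moreover have "wt (lab 1 x) (- int m) = u powi (2 * - int m + int (par s))" by (simp add: wt_def x iterate_weight_def)
   ultimately show ?case using Cons.IH by (simp add: x)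
  qed simp
  have "iprod wt ?L (ks @ ?negs) = iprod wt (map (lab 0) U1) ks * iprod wt (map (lab 1) U2) ?negs" unfolding L using ks by (simp add: iprod_append)
  also have "... = iprod (mcoeff exV) U1 ks * z powi (- N ks - 1) * u powi (- ltotal (indexed ?L (ks @ ?negs)))"
   unfolding 2 3 X[OF ks] ltotal_simps minus_add_distrib power_int_add[OF disjI1[OF u]] by (simp only: mult.assoc)
  finally have 4: "iprod wt ?L (ks @ ?negs) = iprod (mcoeff exV) U1 ks * z powi (- N ks - 1) * u powi (- ltotal (indexed ?L (ks @ ?negs)))" .
  have "- ?k - 2 = - 2 * j + - ltotal (indexed ?L (ks @ ?negs))" unfolding tot[OF ks] by simp
  hence 5: "u powi (- ?k - 2) = u powi (- 2 * j) * u powi (- ltotal (indexed ?L (ks @ ?negs)))" by (simp only: power_int_add[OF disjI1[OF u]])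
  show ?thesis unfolding G_def 4 5 1 Ph_def cx.wick_scale by (simp only: mult_ac)
 qed
 have S3: "((%ks. G j (ks @ ?negs)) has_sum cx.wick (root_contr ?t) ?L (Phb j)) (lists_of (length U1))" for j
 proof -
  \<comment> \<open>A letter of the second vector has weight zero unless its index is the one
    prescribed by \<open>U2\<close>, so only the indices of the first vector are summed.\<close>
  have "G j ks = 0" if ks: "ks \<in> lists_of (length ?L)" "ks \<notin> (%a. a @ ?negs) ` lists_of (length U1)" for ks
  proof -
   have lk: "length ks = length U1 + length U2" using ks(1) len by (simp add: lists_of_def)
   have "take (length U1) ks \<in> lists_of (length U1)" using lk by (simp add: lists_of_def)
   hence "drop (length U1) ks ~= ?negs" using ks(2) by (metis append_take_drop_id image_eqI)
   moreover have "length (drop (length U1) ks) = length U2" using lk by simp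
   ultimately obtain p where p: "p < length U2" "drop (length U1) ks ! p ~= ?negs ! p" using nth_equalityI[of "drop (length U1) ks" ?negs] by force
   have "wt (map (lab 1) U2 ! p) (drop (length U1) ks ! p) = 0"
   proof -
    obtain s a m where x: "U2 ! p = (s, a, m)" by (cases "U2 ! p")
    have "drop (length U1) ks ! p ~= - int m" using p x by simp
    thus ?thesis using p(1) x by (simp only: wt_def iterate_weight_def nth_map lab_simps prod.case if_False one_neq_zero mult_zero_left)
   qed
   hence "iprod wt (map (lab 1) U2) (drop (length U1) ks) = 0" using p(1) lk by (intro iprod_eq_0[where j = p]) simp_all
   moreover have "iprod wt ?L (take (length U1) ks @ drop (length U1) ks) =
     iprod wt (map (lab 0) U1) (take (length U1) ks) * iprod wt (map (lab 1) U2) (drop (length U1) ks)"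
    unfolding L using lk by (intro iprod_append) simp
   ultimately show ?thesis by (simp add: G_def)
  qed
  hence "(G j has_sum cx.wick (root_contr ?t) ?L (Phb j)) ((%a. a @ ?negs) ` lists_of (length U1))"
  proof -
   assume zero: "!!ks. ks \<in> lists_of (length ?L) ==> ks \<notin> (%a. a @ ?negs) ` lists_of (length U1) ==> G j ks = 0"
   have "(%a. a @ ?negs) ` lists_of (length U1) \<subseteq> lists_of (length ?L)" unfolding len lists_of_def by auto
   thus ?thesis using S1[of j] by (intro has_sum_cong_neutral[THEN iffD1, OF _ _ _ S1[of j]]) (use zero in blast)+
  qed
  thus ?thesis by (subst (asm) has_sum_reindex) (simp_all add: inj_on_def comp_def)
 qed
 have nu: "lin scV (*) (%v. mu (YW k v w))" for k using Vector_Spaces.linear_compose[OF YW_linear_left mu, of k w] by (simp add: comp_def)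
 have YV_sum: "((%ks. iprod (mcoeff exV) U1 ks * mu (YW k (V.NO (map md (indexed U1 ks)) (vv U2)) w)) has_sum
   mu (YW k (YV n (vv U1) (vv U2)) w)) {ks \<in> lists_of (length U1). N ks = n}" for n k
 proof -
  have "((%ks. if 2 * sum_list ks = 2 * (n + 1 - (SUM x<-U1. int (snd (snd x)))) then
    iprod (mcoeff exV) U1 ks * mu (YW k (V.NO (map md (indexed U1 ks)) (vv U2)) w) else 0) has_sum
   mu (YW k (YV n (vv U1) (vv U2)) w)) (lists_of (length U1))" unfolding YV_vec[OF U1] by (rule V.npc_has_sum[OF nu])
  thus ?thesis by (rule has_sum_cong_neutral[THEN iffD1, rotated -1]) (auto simp: N_def)
 qed
 have S4: "((%n. it n (2 * j + C - 2 * n)) has_sum cx.wick (root_contr ?t) ?L (Phb j)) UNIV" for j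
 proof (rule has_sum_SigmaD)
  show "((%(n, ks). G j (ks @ ?negs)) has_sum cx.wick (root_contr ?t) ?L (Phb j))
    (Sigma UNIV (%n. {ks \<in> lists_of (length U1). N ks = n}))"
   using S3[of j] by (subst has_sum_reindex_bij_witness[where i = "%ks. (N ks, ks)" and j = snd and
     T = "lists_of (length U1)" and h = "%ks. G j (ks @ ?negs)"]) auto
  fix n
  have h: "((%ks. iprod (mcoeff exV) U1 ks * mu (YW (2 * j + C - 2 * n) (V.NO (map md (indexed U1 ks)) (vv U2)) w) *
    (z powi (- n - 1) * u powi (- (2 * j + C - 2 * n) - 2))) has_sum it n (2 * j + C - 2 * n)) {ks \<in> lists_of (length U1). N ks = n}"
   unfolding it_def mult.assoc[of _ "z powi _"] by (rule has_sum_cmult_left[OF YV_sum])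
  show "((%ks. case (n, ks) of (n, ks) => G j (ks @ ?negs)) has_sum it n (2 * j + C - 2 * n)) {ks \<in> lists_of (length U1). N ks = n}"
  proof (rule has_sum_cong[THEN iffD1, OF _ h])
   fix ks assume "ks \<in> {ks \<in> lists_of (length U1). N ks = n}"
   hence lk: "length ks = length U1" and N: "N ks = n" by (auto simp: lists_of_def)
   show "iprod (mcoeff exV) U1 ks * mu (YW (2 * j + C - 2 * n) (V.NO (map md (indexed U1 ks)) (vv U2)) w) *
    (z powi (- n - 1) * u powi (- (2 * j + C - 2 * n) - 2)) = (case (n, ks) of (n, ks) => G j (ks @ ?negs))"
    unfolding prod.case G[OF lk] N by (simp only: mult.assoc)
  qed
 qed
 have it_0: "it n k = 0" if k: "!!j. j \<in> T ==> k ~= 2 * j + C - 2 * n" for n k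
 proof -
  have "mu (YW k (V.NO (map md (indexed U1 ks)) (vv U2)) w) = 0" if ks: "ks \<in> {ks \<in> lists_of (length U1). N ks = n}" for ks
  proof -
   have lk: "length ks = length U1" and N: "N ks = n" using ks by (auto simp: lists_of_def)
   have "mu (W.npc exW v (k + 2 - ltotal (indexed ?L (ks @ ?negs))) w) = 0" for v
   proof -
    have "mu (W.NO (map md (indexed v ns)) w) = 0" if "length ns = length v"
      "2 * sum_list ns = k + 2 - ltotal (indexed ?L (ks @ ?negs))" for ns
    proof -
     have "k = 2 * sum_list ns + C - 2 * n" using that(2) unfolding tot[OF lk] N by simp
     hence "sum_list ns \<notin> T" using k by blast
     thus ?thesis using mu_eq_0[of "map md (indexed v ns)"] unfolding sum_md_indexed[OF that(1)] by blast
    qed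
    thus ?thesis by (subst mu_npc_has_sum[of "{}"]) auto
   qed
   thus ?thesis using YW_V_NO[OF U2 lk mu, of k w] unfolding X[OF lk, symmetric] by (simp only: if_cancel cx.wick_0)
  qed
  hence "((%ks. iprod (mcoeff exV) U1 ks * mu (YW k (V.NO (map md (indexed U1 ks)) (vv U2)) w)) has_sum 0) {ks \<in> lists_of (length U1). N ks = n}"
   by (intro has_sum_0) simp
  hence "mu (YW k (YV n (vv U1) (vv U2)) w) = 0" using YV_sum by (rule has_sum_unique[rotated])
  thus ?thesis by (simp add: it_def)
 qed
 have "((%p. SUM j:T. case p of (n, k) => if k = 2 * j + C - 2 * n then it n k else 0) has_sum
   (SUM j:T. cx.wick (root_contr ?t) ?L (Phb j))) UNIV"
 proof (rule has_sum_sum)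
  fix j
  show "((%p. case p of (n, k) => if k = 2 * j + C - 2 * n then it n k else 0) has_sum cx.wick (root_contr ?t) ?L (Phb j)) UNIV"
  proof (rule has_sum_inj_support[where g = "%n. (n, 2 * j + C - 2 * n)"])
   show "inj (%n. (n, 2 * j + C - 2 * n))" by (rule injI) simp
  qed (use S4[of j] in auto)
 qed
 moreover have "(SUM j:T. case p of (n, k) => if k = 2 * j + C - 2 * n then it n k else 0) = (case p of (n, k) => it n k)" for p
 proof (cases p)
  case (Pair n k)
  show ?thesis
  proof (cases "\<exists>j\<in>T. k = 2 * j + C - 2 * n")
   case True
   then obtain j where j: "j \<in> T" "k = 2 * j + C - 2 * n" by blast
   hence "(SUM i:T. if k = 2 * i + C - 2 * n then it n k else 0) = (SUM i:T. if i = j then it n k else 0)" by (intro sum.cong) auto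
   thus ?thesis using j T by (simp add: Pair)
  next
   case False
   thus ?thesis using it_0[of k n] by (auto simp: Pair intro!: sum.neutral)
  qed
 qed
 \<comment> \<open>\<open>wick\<close> is additive in the word functional, and the pieces of total
   index \<open>j\<close> in \<open>T\<close> make up \<open>block_value\<close>.\<close>
 moreover have "(SUM j:T. cx.wick (root_contr ?t) ?L (Phb j)) = correlation ?U 2 ?t"
 proof -
  have "(SUM j:S. cx.wick (root_contr ?t) ?L (Phb j)) = cx.wick (root_contr ?t) ?L (%v. SUM j:S. Phb j v)" if "finite S" for S
   using that by (induction S) (simp_all add: cx.wick_add)
  from this[OF T] have "(SUM j:T. cx.wick (root_contr ?t) ?L (Phb j)) = cx.wick (root_contr ?t) ?L (%v. SUM j:T. Phb j v)" .
  moreover have "(SUM j:T. Phb j v) = block_value ?t v" for v unfolding Phb_def block_value_def M_def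
   by (rule sum.group[OF finite_mode_lists T]) (auto simp: mode_lists_sum)
  ultimately show ?thesis by (simp add: correlation_def)
 qed
 ultimately show ?thesis unfolding it_def by simp
qed

end

section \<open>Rational functions of the roots\<close>

definition mon :: "(nat \<Rightarrow>\<^sub>0 nat) => (nat => complex) => complex" where
 "mon mu z = (PROD i:Poly_Mapping.keys mu. z i ^ Poly_Mapping.lookup mu i)"

lemma mon_superset: "finite A ==> Poly_Mapping.keys mu \<subseteq> A ==> mon mu z = (PROD i:A. z i ^ Poly_Mapping.lookup mu i)"
 unfolding mon_def by (intro prod.mono_neutral_left) (auto simp: in_keys_iff)

lemma mon_add: "mon (mu + nu) z = mon mu z * mon nu z"
proof -
 let ?A = "Poly_Mapping.keys mu \<union> Poly_Mapping.keys nu"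
 have "Poly_Mapping.keys (mu + nu) \<subseteq> ?A" by (rule Poly_Mapping.keys_add)
 thus ?thesis by (simp add: mon_superset[of ?A] lookup_add power_add prod.distrib)
qed

lemma cpoly_eval_superset: "finite A ==> Poly_Mapping.keys g \<subseteq> A ==> cpoly_eval g z = (\<Sum>mu\<in>A. Poly_Mapping.lookup g mu * mon mu z)"
 unfolding cpoly_eval_def mon_def by (intro sum.mono_neutral_left) (auto simp: in_keys_iff)

definition polyfn :: "nat => ((nat => complex) => complex) => bool" where
 "polyfn n h \<longleftrightarrow> (\<exists>g. cpoly_in n g & h = cpoly_eval g)"

lemma polyfn_add: "polyfn n f ==> polyfn n h ==> polyfn n (%z. f z + h z)"
proof -
 assume "polyfn n f" "polyfn n h"
 then obtain p q where pq: "cpoly_in n p" "f = cpoly_eval p" "cpoly_in n q" "h = cpoly_eval q" unfolding polyfn_def by blast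
 have k: "Poly_Mapping.keys (p + q) \<subseteq> Poly_Mapping.keys p \<union> Poly_Mapping.keys q" by (rule Poly_Mapping.keys_add)
 hence "cpoly_in n (p + q)" using pq unfolding cpoly_in_def by blast
 moreover have "(%z. f z + h z) = cpoly_eval (p + q)"
  using k by (intro ext) (simp add: pq cpoly_eval_superset[of "Poly_Mapping.keys p \<union> Poly_Mapping.keys q"] lookup_add sum.distrib distrib_right)
 ultimately show ?thesis unfolding polyfn_def by blast
qed

lemma polyfn_mon: "polyfn n (%z. c * mon mu z)" if "Poly_Mapping.keys mu \<subseteq> {..<n}" unfolding polyfn_def
 by (intro exI[of _ "sgl mu c"]) (use that in \<open>auto simp: cpoly_in_def cpoly_eval_superset[of "{mu}"] fun_eq_iff\<close>)

lemma polyfn_const: "polyfn n (%z. c)" using polyfn_mon[of 0 n c] by (simp add: mon_def)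

lemma polyfn_var: "j < n ==> polyfn n (%z. z j)" using polyfn_mon[of "sgl j 1" n 1] by (simp add: mon_superset[of "{j}"])

lemma polyfn_sum: "(!!a. a \<in> A ==> polyfn n (f a)) ==> polyfn n (%z. SUM a:A. f a z)"
 by (induction A rule: infinite_finite_induct) (simp_all add: polyfn_const polyfn_add)

lemma polyfn_mult: "polyfn n f ==> polyfn n h ==> polyfn n (%z. f z * h z)"
proof -
 assume "polyfn n f" "polyfn n h"
 then obtain p q where pq: "cpoly_in n p" "f = cpoly_eval p" "cpoly_in n q" "h = cpoly_eval q" unfolding polyfn_def by blast
 have "(%z. f z * h z) = (%z. \<Sum>mu\<in>Poly_Mapping.keys p. \<Sum>nu\<in>Poly_Mapping.keys q.
   (Poly_Mapping.lookup p mu * Poly_Mapping.lookup q nu) * mon (mu + nu) z)"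
  by (simp add: pq cpoly_eval_superset[OF finite_keys order.refl] sum_product mon_add mult_ac)
 moreover have "polyfn n ..."
 proof (intro polyfn_sum polyfn_mon)
  fix mu nu assume "mu \<in> Poly_Mapping.keys p" "nu \<in> Poly_Mapping.keys q"
  thus "Poly_Mapping.keys (mu + nu) \<subseteq> {..<n}" using pq Poly_Mapping.keys_add[of mu nu] unfolding cpoly_in_def by blast
 qed
 ultimately show ?thesis by (simp only:)
qed

lemma polyfn_diff: "polyfn n f ==> polyfn n h ==> polyfn n (%z. f z - h z)"
 using polyfn_add[OF _ polyfn_mult[OF polyfn_const[of n "- 1"]], of f h] by simp

lemma polyfn_prod: "(!!a. a \<in> A ==> polyfn n (f a)) ==> polyfn n (%z. PROD a:A. f a z)"
 by (induction A rule: infinite_finite_induct) (simp_all add: polyfn_const polyfn_mult)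

lemma polyfn_power: "polyfn n f ==> polyfn n (%z. f z ^ k)" by (induction k) (simp_all add: polyfn_const polyfn_mult)

text \<open>A common denominator, divisible by every variable and by every difference
  \<open>z j - z l\<close> with \<open>j < l\<close>.\<close>

definition disc :: "nat => (nat => complex) => complex" where
 "disc n z = (PROD j<n. z j) * (PROD l<n. PROD j<l. z j - z l)"

lemma polyfn_disc: "polyfn n (disc n)" unfolding disc_def[abs_def] by (intro polyfn_mult polyfn_prod polyfn_diff polyfn_var) auto

definition root_domain :: "nat => (nat => complex) => bool" where
 "root_domain n t \<longleftrightarrow> (\<forall>j<n. t j ~= 0) & (\<forall>j l. j < l & l < n --> (t j)^2 ~= (t l)^2)"

lemma disc_nonzero: "root_domain n t ==> disc n (%j. (t j)^2) ~= 0" by (auto simp: disc_def root_domain_def)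

text \<open>The exponents \<open>e\<close> count modulo 2, since even powers of the roots are powers of the variables.\<close>

definition ratfn :: "nat => (nat => nat) => ((nat => complex) => complex) => bool" where
 "ratfn n e f \<longleftrightarrow> (\<exists>h Q. polyfn n h & (\<forall>t. root_domain n t -->
   f t = h (%j. (t j)^2) * (PROD j<n. t j ^ (e j mod 2)) * inverse (disc n (%j. (t j)^2)) ^ Q))"

lemma ratfnI: "polyfn n h ==> (!!t. root_domain n t ==>
   f t = h (%j. (t j)^2) * (PROD j<n. t j ^ (e j mod 2)) * inverse (disc n (%j. (t j)^2)) ^ Q) ==> ratfn n e f" unfolding ratfn_def by blast

lemma ratfn_parity: "ratfn n e f ==> (!!j. j < n ==> even (e j + e' j)) ==> ratfn n e' f"
proof -
 assume f: "ratfn n e f" and e: "!!j. j < n ==> even (e j + e' j)"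
 have "e j mod 2 = e' j mod 2" if "j < n" for j using e[OF that] by presburger
 hence "(PROD j<n. t j ^ (e j mod 2)) = (PROD j<n. t j ^ (e' j mod 2))" for t :: "nat => complex" by (intro prod.cong) auto
 thus ?thesis using f unfolding ratfn_def by simp
qed

lemma ratfn_cong: "ratfn n e f ==> (!!t. root_domain n t ==> f t = f' t) ==> ratfn n e f'"
proof -
 assume f: "ratfn n e f" and eq: "!!t. root_domain n t ==> f t = f' t"
 obtain h Q where h: "polyfn n h" "!!t. root_domain n t ==>
   f t = h (%j. (t j)^2) * (PROD j<n. t j ^ (e j mod 2)) * inverse (disc n (%j. (t j)^2)) ^ Q" using f unfolding ratfn_def by blast
 show "ratfn n e f'" by (rule ratfnI[OF h(1)], subst eq[symmetric]) (assumption, rule h(2))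
qed

lemma ratfn_zero: "ratfn n e (%t. 0)" by (rule ratfnI[OF polyfn_const[of n 0]]) simp

lemma ratfn_const: "ratfn n (%_. 0) (%t. c)" by (rule ratfnI[OF polyfn_const[of n c], where Q = 0]) simp

lemma ratfn_add:
 assumes "ratfn n e f" "ratfn n e f'" shows "ratfn n e (%t. f t + f' t)"
proof -
 obtain h Q where h: "polyfn n h" "!!t. root_domain n t ==>
   f t = h (%j. (t j)^2) * (PROD j<n. t j ^ (e j mod 2)) * inverse (disc n (%j. (t j)^2)) ^ Q" using assms(1) unfolding ratfn_def by blast
 obtain h' Q' where h': "polyfn n h'" "!!t. root_domain n t ==>
   f' t = h' (%j. (t j)^2) * (PROD j<n. t j ^ (e j mod 2)) * inverse (disc n (%j. (t j)^2)) ^ Q'" using assms(2) unfolding ratfn_def by blast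
 show ?thesis
 proof (rule ratfnI)
  show "polyfn n (%z. h z * disc n z ^ Q' + h' z * disc n z ^ Q)" by (intro polyfn_add polyfn_mult polyfn_power polyfn_disc h h')
  fix t assume t: "root_domain n t"
  define d where "d = disc n (%j. (t j)^2)"
  have c: "d ^ m * inverse d ^ (Q + Q') = inverse d ^ (Q + Q' - m)" if "m <= Q + Q'" for m
   using disc_nonzero[OF t] that by (simp add: d_def field_simps power_add[symmetric])
  have e: "inverse d ^ Q = d ^ Q' * inverse d ^ (Q + Q')" "inverse d ^ Q' = d ^ Q * inverse d ^ (Q + Q')" using c[of Q'] c[of Q] by simp_all
  show "f t + f' t = (h (%j. (t j)^2) * disc n (%j. (t j)^2) ^ Q' + h' (%j. (t j)^2) * disc n (%j. (t j)^2) ^ Q) *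
   (PROD j<n. t j ^ (e j mod 2)) * inverse (disc n (%j. (t j)^2)) ^ (Q + Q')" unfolding h(2)[OF t] h'(2)[OF t] d_def[symmetric] e
   by (simp only: distrib_left distrib_right mult_ac)
 qed
qed

text \<open>Two odd powers of the same root combine to a power of the variable, which moves into the
  polynomial; \<open>?c\<close> counts these carries.\<close>

lemma ratfn_mult:
 assumes "ratfn n e f" "ratfn n e' f'" shows "ratfn n (%j. e j + e' j) (%t. f t * f' t)"
proof -
 obtain h Q where h: "polyfn n h" "!!t. root_domain n t ==>
   f t = h (%j. (t j)^2) * (PROD j<n. t j ^ (e j mod 2)) * inverse (disc n (%j. (t j)^2)) ^ Q" using assms(1) unfolding ratfn_def by blast
 obtain h' Q' where h': "polyfn n h'" "!!t. root_domain n t ==>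
   f' t = h' (%j. (t j)^2) * (PROD j<n. t j ^ (e' j mod 2)) * inverse (disc n (%j. (t j)^2)) ^ Q'" using assms(2) unfolding ratfn_def by blast
 let ?c = "%j. (e j mod 2 + e' j mod 2) div 2"
 show ?thesis
 proof (rule ratfnI)
  show "polyfn n (%z. h z * h' z * (PROD j<n. z j ^ ?c j))" by (intro polyfn_mult polyfn_prod polyfn_power polyfn_var h h') auto
  fix t assume t: "root_domain n t"
  have "t j ^ (e j mod 2) * t j ^ (e' j mod 2) = ((t j)^2) ^ ?c j * t j ^ ((e j + e' j) mod 2)" for j
  proof -
   have "e j mod 2 + e' j mod 2 = 2 * ?c j + (e j + e' j) mod 2" by presburger
   thus ?thesis by (simp only: power_add[symmetric] power_mult[symmetric])
  qed
  hence "(PROD j<n. t j ^ (e j mod 2)) * (PROD j<n. t j ^ (e' j mod 2)) = (PROD j<n. ((t j)^2) ^ ?c j) * (PROD j<n. t j ^ ((e j + e' j) mod 2))"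
   by (simp only: prod.distrib[symmetric])
  moreover have "f t * f' t = h (%j. (t j)^2) * h' (%j. (t j)^2) * ((PROD j<n. t j ^ (e j mod 2)) * (PROD j<n. t j ^ (e' j mod 2))) *
    inverse (disc n (%j. (t j)^2)) ^ (Q + Q')" unfolding h(2)[OF t] h'(2)[OF t] power_add by (simp only: mult_ac)
  ultimately show "f t * f' t = h (%j. (t j)^2) * h' (%j. (t j)^2) * (PROD j<n. ((t j)^2) ^ ?c j) *
   (PROD j<n. t j ^ ((e j + e' j) mod 2)) * inverse (disc n (%j. (t j)^2)) ^ (Q + Q')" by (simp only: mult.assoc)
 qed
qed

lemma ratfn_cmult: "ratfn n e f ==> ratfn n e (%t. c * f t)" using ratfn_mult[OF ratfn_const] by simp

lemma ratfn_sum: "(!!a. a \<in> A ==> ratfn n e (f a)) ==> ratfn n e (%t. SUM a:A. f a t)"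
 by (induction A rule: infinite_finite_induct) (simp_all add: ratfn_zero ratfn_add)

lemma ratfn_power: "ratfn n e f ==> ratfn n (%j. k * e j) (%t. f t ^ k)"
proof (induction k)
 case (Suc k)
 thus ?case using ratfn_mult[of n e f "%j. k * e j" "%t. f t ^ k"] by simp
qed (simp add: ratfn_const)

lemma ratfn_inverse_factor:
 assumes "polyfn n h" "!!z. disc n z = a z * h z" shows "ratfn n (%_. 0) (%t. inverse (a (%j. (t j)^2)))"
proof (rule ratfnI[OF assms(1), where Q = 1])
 fix t assume "root_domain n t"
 hence "a (%j. (t j)^2) * h (%j. (t j)^2) ~= 0" using disc_nonzero assms(2) by metis
 thus "inverse (a (%j. (t j)^2)) = h (%j. (t j)^2) * (PROD j<n. t j ^ (0 mod 2)) * inverse (disc n (%j. (t j)^2)) ^ 1"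
  unfolding assms(2) by (simp add: field_simps)
qed

lemma ratfn_var: "j < n ==> ratfn n (%i. of_bool (i = j)) (%t. t j)"
proof (rule ratfnI[OF polyfn_const[of n 1], where Q = 0])
 fix t :: "nat => complex" assume "j < n"
 have "(PROD i<n. t i ^ (of_bool (i = j) mod 2)) = (PROD i<n. if i = j then t i else 1)" by (intro prod.cong) auto
 thus "t j = 1 * (PROD i<n. t i ^ (of_bool (i = j) mod 2)) * inverse (disc n (%j. (t j)^2)) ^ 0" using \<open>j < n\<close> by simp
qed

lemma ratfn_inverse_var: "j < n ==> ratfn n (%i. of_bool (i = j)) (%t. inverse (t j))"
proof -
 assume j: "j < n"
 have "polyfn n (%z. (PROD i:{..<n} - {j}. z i) * (PROD l<n. PROD j<l. z j - z l))" by (intro polyfn_mult polyfn_prod polyfn_diff polyfn_var) auto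
 moreover have "disc n z = z j * ((PROD i:{..<n} - {j}. z i) * (PROD l<n. PROD j<l. z j - z l))" for z
  unfolding disc_def using j by (subst prod.remove[of _ j]) (auto simp: mult_ac)
 ultimately have "ratfn n (%_. 0) (%t. inverse ((t j)^2))" by (rule ratfn_inverse_factor[where a = "%z. z j"])
 from ratfn_mult[OF this ratfn_var[OF j]] have "ratfn n (%i. of_bool (i = j)) (%t. inverse ((t j)^2) * t j)" by simp
 thus ?thesis by (rule ratfn_cong) (use j in "simp add: root_domain_def power2_eq_square")
qed

lemma ratfn_inverse_diff: "j < l ==> l < n ==> ratfn n (%_. 0) (%t. inverse ((t j)^2 - (t l)^2))"
proof -
 assume jl: "j < l" "l < n"
 let ?h = "%z. (PROD j<n. z j) * ((PROD i:{..<l} - {j}. z i - z l) * (PROD l:{..<n} - {l}. PROD j<l. z j - z l)) :: complex"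
 have "polyfn n ?h" using jl by (intro polyfn_mult polyfn_prod polyfn_diff polyfn_var) auto
 moreover have "disc n z = (z j - z l) * ?h z" for z
 proof -
  have "(PROD l<n. PROD j<l. z j - z l) = (PROD j<l. z j - z l) * (PROD l:{..<n} - {l}. PROD j<l. z j - z l)" using jl by (intro prod.remove) auto
  also have "(PROD j<l. z j - z l) = (z j - z l) * (PROD i:{..<l} - {j}. z i - z l)" using jl by (intro prod.remove) auto
  finally show ?thesis unfolding disc_def by (simp only: mult_ac)
 qed
 ultimately show ?thesis by (rule ratfn_inverse_factor[where a = "%z. z j - z l"])
qed

lemma ratfn_powi: "j < n ==> ratfn n (%i. nat \<bar>k\<bar> * of_bool (i = j)) (%t. t j powi k)"
 using ratfn_power[OF ratfn_var, of j n "nat \<bar>k\<bar>"] ratfn_power[OF ratfn_inverse_var, of j n "nat \<bar>k\<bar>"]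
 by (cases "k >= 0") (simp_all add: power_int_def)

lemma ratfn_hbeta: "j < n ==> ratfn n (%i. of_bool (i = j)) (%t. hbeta k (t j))"
proof -
 assume "j < n"
 from ratfn_cmult[OF ratfn_power[OF ratfn_inverse_var[OF this], of "2 * k + 1"]] show ?thesis unfolding hbeta_def by (rule ratfn_parity) simp
qed

text \<open>Induction along the recursion: each step divides by the difference of the variables and
  preserves the odd parity in both roots.\<close>

lemma ratfn_fermion_fn:
 assumes jl: "j < l" "l < n" shows "ratfn n (%i. of_bool (i = j) + of_bool (i = l)) (%t. fermion_fn a b (t j) (t l))"
proof -
 let ?e = "%i. of_bool (i = j) + of_bool (i = l) :: nat"
 have j: "j < n" using jl by simp
 note var = ratfn_power[OF ratfn_var[OF j], of 2] ratfn_power[OF ratfn_var[OF jl(2)], of 2]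
 have defect: "ratfn n ?e (%t. defect (t j) (t l) a b)" for a b
 proof -
  have "ratfn n ?e (%t. 1/2 * ((hbeta a (t j) * (of_nat (Suc b) * hbeta (Suc b) (t l))) + (- 1) * ((of_nat (Suc a) * hbeta (Suc a) (t j)) * hbeta b (t l))))"
   by (intro ratfn_cmult ratfn_add ratfn_mult ratfn_hbeta j jl)
  thus ?thesis by (simp add: defect_def)
 qed
 have step: "ratfn n ?e (%t. (c * f t - (t k)^2 * g t) / (s * ((t j)^2 - (t l)^2) * c'))"
  if "ratfn n ?e f" "ratfn n ?e g" "k = j | k = l" for c s c' f g k
 proof -
  have k: "k < n" using that(3) j jl by auto
  have "ratfn n ?e (%t. (t k)^2 * g t)" by (rule ratfn_parity[OF ratfn_mult[OF ratfn_power[OF ratfn_var[OF k], of 2] that(2)]]) simp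
  hence "ratfn n (%i. 0 + ?e i) (%t. inverse ((t j)^2 - (t l)^2) * (inverse (s * c') * (c * f t + (- 1) * ((t k)^2 * g t))))"
   by (intro ratfn_mult[OF ratfn_inverse_diff[OF jl]] ratfn_cmult[OF ratfn_add] ratfn_cmult that(1))
  moreover have "(c * x - y) / (s * d * c') = inverse d * (inverse (s * c') * (c * x + (- 1) * y))" for x y d :: complex by (simp add: field_simps)
  ultimately show ?thesis by (simp only: add_0)
 qed
 have 0: "ratfn n ?e (%t. fermion_fn0 b (t j) (t l))" for b
 proof (induction b)
  case 0
  have "ratfn n (%_. 0) (%t. (t j)^2 + (t l)^2)" by (intro ratfn_add) (rule ratfn_parity[OF var(1)], simp, rule ratfn_parity[OF var(2)], simp)
  from ratfn_mult[OF ratfn_mult[OF this ratfn_cmult[OF ratfn_inverse_diff[OF jl], of "1/2"]] ratfn_mult[OF ratfn_inverse_var[OF j] ratfn_inverse_var[OF jl(2)]]]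
  have "ratfn n ?e (%t. ((t j)^2 + (t l)^2) * (1/2 * inverse ((t j)^2 - (t l)^2)) * (inverse (t j) * inverse (t l)))" by (simp only: add_0)
  moreover have "a / (2 * d * p * q) = a * (1/2 * inverse d) * (inverse p * inverse q)" for a d p q :: complex
   by (cases "d = 0"; cases "p = 0"; cases "q = 0") (simp_all add: field_simps)
  ultimately show ?case by (simp only: fermion_fn0.simps)
 next
  case (Suc b)
  have e: "((t l)^2 - (t j)^2) * of_nat (Suc b) = (- 1) * ((t j)^2 - (t l)^2) * of_nat (Suc b)" for t :: "nat => complex"
   by (simp only: minus_diff_eq mult_minus1)
  show ?case using step[OF Suc defect[of 0 b], where k = j and c = "- (of_nat b + 1)" and s = "- 1" and c' = "of_nat (Suc b)"]
   unfolding fermion_fn0.simps e by (simp only: simp_thms)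
 qed
 show ?thesis
 proof (induction a)
  case (Suc a)
  show ?case using step[OF Suc defect[of a b], where k = l and c = "- (of_nat (a + b) + 1)" and s = 1 and c' = "of_nat (Suc a)"]
   unfolding fermion_fn.simps by (simp only: mult_1_left simp_thms)
 qed (simp add: 0)
qed

lemma ratfn_contract:
 assumes "!!y. y \<in> set w ==> ratfn n (%i. a i + e y i) (%t. ph t y)"
  and "!!v. set v \<subseteq> set w ==> ratfn n (%i. b i + (SUM x<-v. e x i)) (%t. Ps t v)"
 shows "ratfn n (%i. a i + b i + (SUM x<-w. e x i)) (%t. cx.contract s (ph t) w (Ps t))" using assms
proof (induction w arbitrary: Ps b)
 case (Cons y w)
 have "ratfn n (%i. a i + (b i + e y i) + (SUM x<-w. e x i)) (%t. cx.contract s (ph t) w (%v. Ps t (y # v)))"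
 proof (rule Cons.IH)
  show "ratfn n (%i. b i + e y i + (SUM x<-v. e x i)) (%t. Ps t (y # v))" if "set v \<subseteq> set w" for v
   using Cons.prems(2)[of "y # v"] that by (auto simp: add.assoc)
 qed (use Cons.prems in auto)
 from ratfn_cmult[OF this, of "sg s (fst y)"]
 have 1: "ratfn n (%i. a i + b i + (SUM x<-y # w. e x i)) (%t. sg s (fst y) * cx.contract s (ph t) w (%v. Ps t (y # v)))" by (simp add: add_ac)
 have "ratfn n (%i. (a i + e y i) + (b i + (SUM x<-w. e x i))) (%t. ph t y * Ps t w)" by (intro ratfn_mult) (use Cons.prems in auto)
 hence 2: "ratfn n (%i. a i + b i + (SUM x<-y # w. e x i)) (%t. ph t y * Ps t w)" by (simp add: add_ac)
 from ratfn_add[OF 2 1] show ?case by simp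
qed (simp add: ratfn_zero)

text \<open>A contracted pair contributes the parities of both its letters, so every matching has
  the parity of the whole word.\<close>

lemma ratfn_wick:
 assumes "!!x y. x \<in> set w ==> y \<in> set w ==> ratfn n (%i. e x i + e y i) (%t. c t x y)"
  and "!!v. set v \<subseteq> set w ==> ratfn n (%i. b i + (SUM x<-v. e x i)) (%t. Ph t v)"
 shows "ratfn n (%i. b i + (SUM x<-w. e x i)) (%t. cx.wick (c t) w (Ph t))" using assms
proof (induction w arbitrary: Ph b)
 case (Cons x w)
 have "ratfn n (%i. (b i + e x i) + (SUM x<-w. e x i)) (%t. cx.wick (c t) w (%v. Ph t (x # v) + cx.contract (fst x) (c t x) v (Ph t)))"
 proof (rule Cons.IH)
  fix v assume v: "set v \<subseteq> set w"
  have "ratfn n (%i. e x i + b i + (SUM x<-v. e x i)) (%t. cx.contract (fst x) (c t x) v (Ph t))"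
  proof (rule ratfn_contract)
   show "ratfn n (%i. e x i + e y i) (%t. c t x y)" if "y \<in> set v" for y by (rule Cons.prems(1)) (use that v in auto)
   show "ratfn n (%i. b i + (SUM x<-u. e x i)) (%t. Ph t u)" if "set u \<subseteq> set v" for u by (rule Cons.prems(2)) (use that v in auto)
  qed
  moreover have "ratfn n (%i. b i + (SUM x<-x # v. e x i)) (%t. Ph t (x # v))" by (rule Cons.prems(2)) (use v in auto)
  ultimately show "ratfn n (%i. b i + e x i + (SUM x<-v. e x i)) (%t. Ph t (x # v) + cx.contract (fst x) (c t x) v (Ph t))"
   by (intro ratfn_add) (simp_all add: add_ac)
 qed (use Cons.prems in auto)
 thus ?case by (simp add: add_ac)
qed simp

definition fcount :: "'h word => nat" where
 "fcount U = (SUM x<-U. par (fst x))"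

definition letter_parity :: "'h labelled => nat => nat" where
 "letter_parity x i = par (fst x) * of_bool (i = label x)"

lemma sum_letter_parity: "i < n ==> (SUM x<-blocks U [0..<n]. letter_parity x i) = fcount (U i)"
proof -
 have 1: "(SUM x<-map (lab j) v. letter_parity x i) = (if i = j then fcount v else 0)" for j and v :: "'h word"
  by (induction v) (auto simp: letter_parity_def fcount_def)
 have "(SUM x<-blocks U I. letter_parity x i) = (SUM j<-I. if i = j then fcount (U j) else 0)" for I
  by (induction I) (simp_all only: blocks_simps list.map map_append sum_list.append 1 sum_list.Cons sum_list.Nil)
 thus "i < n ==> ?thesis" by (simp add: interv_sum_list_conv_sum_set_nat)
qed

context matrix_element
begin

lemma ratfn_root_contr:
 assumes "label x < n" "label y < n" shows "ratfn n (%i. letter_parity x i + letter_parity y i) (%t. root_contr t x y)"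
proof -
 obtain s a m l where x: "x = (s, a, m, l)" by (cases x)
 obtain s' b m' l' where y: "y = (s', b, m', l')" by (cases y)
 have l: "l < n" "l' < n" using assms by (simp_all add: x y)
 consider "l = l'" "s = Fer" "s' = Fer" | "l < l'" "s = Fer" "s' = Fer" | "l < l'" "s = Bos" "s' = Bos"
  | "l > l' | l = l' & ~ (s = Fer & s' = Fer) | l < l' & s ~= s'" by (cases s; cases s') (auto, linarith+)
 thus ?thesis
 proof cases
  case 1
  have "ratfn n (%i. nat \<bar>- lev (unlab x) - lev (unlab y)\<bar> * of_bool (i = l))
    (%t. Delta_contr (unlab x) (unlab y) * t l powi (- lev (unlab x) - lev (unlab y)))" by (intro ratfn_cmult ratfn_powi l)
  hence "ratfn n (%i. letter_parity x i + letter_parity y i)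
    (%t. Delta_contr (unlab x) (unlab y) * t l powi (- lev (unlab x) - lev (unlab y)))"
   by (rule ratfn_parity) (auto simp: x y 1 letter_parity_def lev_def even_nat_iff)
  moreover have "root_contr t x y = Delta_contr (unlab x) (unlab y) * t l powi (- lev (unlab x) - lev (unlab y))" for t
   unfolding root_contr_def by (simp add: x y 1)
  ultimately show ?thesis by (simp only:)
 next
  case 2
  from ratfn_cmult[OF ratfn_fermion_fn[OF 2(1) l(2)], of "lF * frm a b" "m - 1" "m' - 1"]
  have "ratfn n (%i. letter_parity x i + letter_parity y i) (%t. lF * frm a b * fermion_fn (m - 1) (m' - 1) (t l) (t l'))"
   by (rule ratfn_parity) (simp add: x y 2 letter_parity_def)
  moreover have "root_contr t x y = lF * frm a b * fermion_fn (m - 1) (m' - 1) (t l) (t l')" for t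
   using 2 by (simp add: x y root_contr_def pair_fn_def)
  ultimately show ?thesis by (simp only:)
 next
  case 3
  from ratfn_cmult[where c = "lB * frm a b * (of_nat (Suc (m' - 1)) * ((- of_nat (m' - 1) - 2) gchoose (m - 1)))",
    OF ratfn_power[where k = "m - 1 + (m' - 1) + 2", OF ratfn_inverse_diff[OF 3(1) l(2)]]]
  have "ratfn n (%i. letter_parity x i + letter_parity y i) (%t. lB * frm a b *
    (of_nat (Suc (m' - 1)) * ((- of_nat (m' - 1) - 2) gchoose (m - 1))) * inverse ((t l)^2 - (t l')^2) ^ (m - 1 + (m' - 1) + 2))"
   by (rule ratfn_parity) (simp add: x y 3 letter_parity_def)
  moreover have "root_contr t x y = lB * frm a b *
    (of_nat (Suc (m' - 1)) * ((- of_nat (m' - 1) - 2) gchoose (m - 1))) * inverse ((t l)^2 - (t l')^2) ^ (m - 1 + (m' - 1) + 2)" for t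
  proof -
   have "root_contr t x y = lB * frm a b * boson_fn (m - 1) (m' - 1) ((t l)^2) ((t l')^2)" using 3 by (simp add: x y root_contr_def pair_fn_def)
   thus ?thesis by (simp only: boson_fn_def mult.assoc)
  qed
  ultimately show ?thesis by (simp only:)
 next
  case 4
  hence "root_contr t x y = 0" for t by (auto simp: x y root_contr_def pair_fn_def Delta_contr_def)
  thus ?thesis by (simp add: ratfn_zero)
 qed
qed

lemma ratfn_block_value:
 assumes "!!x. x \<in> set v ==> label x < n" shows "ratfn n (%i. SUM x<-v. letter_parity x i) (%t. block_value t v)"
proof -
 have "ratfn n (%i. SUM x<-v. letter_parity x i) (%t. iprod (lcoeff t) v ns)" if "length ns = length v" for ns using that assms
 proof (induction v ns rule: list_induct2')
  case (4 x v k ns)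
  have "ratfn n (%i. nat \<bar>- 2 * k - lev (unlab x)\<bar> * of_bool (i = label x)) (%t. mcoeff exW (unlab x) k * t (label x) powi (- 2 * k - lev (unlab x)))"
   by (intro ratfn_cmult ratfn_powi) (use 4 in auto)
  hence "ratfn n (letter_parity x) (%t. lcoeff t x k)"
   unfolding lcoeff_def by (rule ratfn_parity) (cases x, auto simp: letter_parity_def lev_def even_nat_iff)
  from ratfn_mult[OF this 4(1)] show ?case using 4(2,3) by simp
 qed (simp_all add: ratfn_const)
 hence "ratfn n (%i. SUM x<-v. letter_parity x i) (%t. SUM ns:mode_lists v. mu (W.NO (map md (indexed v ns)) w) * iprod (lcoeff t) v ns)"
  by (intro ratfn_sum ratfn_cmult) (simp add: mode_lists_def)
 thus ?thesis unfolding block_value_def by (simp add: mult.commute)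
qed

theorem ratfn_correlation: "ratfn n (%i. fcount (U i)) (correlation U n)"
proof -
 have "ratfn n (%i. 0 + (SUM x<-blocks U [0..<n]. letter_parity x i)) (%t. cx.wick (root_contr t) (blocks U [0..<n]) (block_value t))"
 proof (rule ratfn_wick)
  have l: "label x < n" if "x \<in> set (blocks U [0..<n])" for x using label_blocks[OF that] by simp
  show "ratfn n (%i. letter_parity x i + letter_parity y i) (%t. root_contr t x y)"
   if "x \<in> set (blocks U [0..<n])" "y \<in> set (blocks U [0..<n])" for x y by (intro ratfn_root_contr l that)
  show "ratfn n (%i. 0 + (SUM x<-v. letter_parity x i)) (%t. block_value t v)" if "set v \<subseteq> set (blocks U [0..<n])" for v
   unfolding add_0 by (rule ratfn_block_value) (use that l in blast)
 qed
 thus ?thesis unfolding correlation_def[abs_def] by (rule ratfn_parity) (simp add: sum_letter_parity)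
qed

end

section \<open>Gradings\<close>

lemma Sum_any_lin:
 assumes "lin s1 s2 D" "finite {i. f i ~= 0}" shows "D (Sum_any f) = Sum_any (%i. D (f i))"
proof -
 interpret Vector_Spaces.linear s1 s2 D by fact
 have "{i. D (f i) ~= 0} \<subseteq> {i. f i ~= 0}" using zero by auto
 from Sum_any.expand_superset[OF assms(2) this] show ?thesis unfolding Sum_any.expand_set[of f] sum by simp
qed

lemma Sum_any_single: "Sum_any (%j. if j = i then x else 0) = x" for x :: "'v::ab_group_add" by (simp add: Sum_any.expand_superset[of "{i}"])

lemma graded_ex: "graded sc A ==> \<exists>f. finite {i. f i ~= 0} & (\<forall>i. f i \<in> A i) & v = Sum_any f" unfolding graded_def by blast

lemma graded_span:
 assumes "graded sc A" "vector_space sc" shows "module.span sc (\<Union>(range A)) = UNIV"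
proof -
 interpret vector_space sc by fact
 have "v \<in> span (\<Union>(range A))" for v
 proof -
  obtain f where f: "finite {i. f i ~= 0}" "!!i. f i \<in> A i" "v = Sum_any f" using graded_ex[OF assms(1), of v] by blast
  show ?thesis unfolding f(3) Sum_any.expand_set by (intro span_sum span_base) (use f(2) in blast)
 qed
 thus ?thesis by blast
qed

lemma graded_diag:
 assumes g: "graded sc A" and vs: "vector_space sc" shows "\<exists>D. lin sc sc D & (\<forall>i. \<forall>v\<in>A i. D v = sc (c i) v)"
proof -
 interpret vector_space sc by fact
 have sub: "subspace (A i)" for i using g by (simp add: graded_def)
 define F where "F v = (SOME f. finite {i. f i ~= 0} & (\<forall>i. f i \<in> A i) & v = Sum_any f)" for v
 have F: "finite {i. F v i ~= 0}" "F v i \<in> A i" "v = Sum_any (F v)" for v i using someI_ex[OF graded_ex[OF g, of v]] unfolding F_def by blast+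
 have unique: "F v = f" if f: "finite {i. f i ~= 0}" "!!i. f i \<in> A i" "v = Sum_any f" for v f
 proof -
  have "\<exists>!f. finite {i. f i ~= 0} & (\<forall>i. f i \<in> A i) & v = Sum_any f" using g unfolding graded_def by blast
  thus ?thesis by (rule ex1E) (use f F[where v = v] in metis)
 qed
 have F_add: "F (v + w) = (%i. F v i + F w i)" for v w
 proof (rule unique)
  show "finite {i. F v i + F w i ~= 0}" by (rule finite_subset[OF _ finite_UnI[OF F(1)[of v] F(1)[of w]]]) auto
  show "v + w = Sum_any (%i. F v i + F w i)" using F(3)[of v] F(3)[of w] by (simp add: Sum_any_add[OF F(1) F(1)])
 qed (intro subspace_add[OF sub] F)
 have F_scale: "F (sc k v) = (%i. sc k (F v i))" for k v
 proof (rule unique)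
  show "finite {i. sc k (F v i) ~= 0}" by (rule finite_subset[OF _ F(1)[of v]]) auto
  have "lin sc sc (sc k)" by unfold_locales (simp_all add: algebra_simps)
  from Sum_any_lin[OF this F(1)[of v]] show "sc k v = Sum_any (%i. sc k (F v i))" using F(3)[of v] by simp
 qed (intro subspace_scale[OF sub] F)
 define D where "D v = Sum_any (%i. sc (c i) (F v i))" for v
 have fin: "finite {i. sc (c i) (F v i) ~= 0}" for v by (rule finite_subset[OF _ F(1)[of v]]) auto
 have "lin sc sc D"
 proof unfold_locales
  show "D (v + w) = D v + D w" for v w unfolding D_def F_add by (subst Sum_any_add[OF fin fin, symmetric]) (simp add: algebra_simps)
  show "D (sc k v) = sc k (D v)" for k v
  proof -
   have "lin sc sc (sc k)" by unfold_locales (simp_all add: algebra_simps)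
   from Sum_any_lin[OF this fin[of v]] show ?thesis unfolding D_def F_scale by (simp add: mult.commute)
  qed
 qed
 moreover have "D v = sc (c i) v" if "v \<in> A i" for i v
 proof -
  have "F v = (%j. if j = i then v else 0)"
  proof (rule unique)
   show "finite {j. (if j = i then v else 0) ~= 0}" by (rule finite_subset[of _ "{i}"]) auto
   show "(if j = i then v else 0) \<in> A j" for j using that subspace_0[OF sub] by auto
  qed (simp add: Sum_any_single)
  hence "D v = Sum_any (%j. if j = i then sc (c i) v else 0)" unfolding D_def by (intro arg_cong[of _ _ Sum_any] ext) simp
  thus ?thesis by (simp add: Sum_any_single)
 qed
 ultimately show ?thesis by blast
qed

text \<open>The projections \<open>P\<close> read off the components, which are therefore
  unique.\<close>

lemma gradedI:
 assumes vs: "vector_space sc" and sub: "!!i. module.subspace sc (A i)" and span: "module.span sc (\<Union>(range A)) = UNIV"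
  and P: "!!i. lin sc sc (P i)" "!!i v. v \<in> A i ==> P i v = v" "!!i j v. v \<in> A j ==> j ~= i ==> P i v = 0" shows "graded sc A"
proof -
 interpret vector_space sc by fact
 let ?Q = "%v f. finite {i. f i ~= 0} & (\<forall>i. f i \<in> A i) & v = Sum_any f"
 have "\<exists>f. ?Q v f" for v
 proof -
  have "v \<in> span (\<Union>(range A))" using span by simp
  thus ?thesis
  proof (induction rule: span_induct_alt)
   case base
   have "?Q 0 (%_. 0)" using subspace_0[OF sub] by simp
   thus ?case by (rule exI[of _ "%_. 0"])
  next
   case (step k a v)
   then obtain f i where f: "?Q v f" and i: "a \<in> A i" by blast
   let ?h = "%j. if j = i then sc k a else 0"
   have fin: "finite {j. ?h j ~= 0}" by (rule finite_subset[of _ "{i}"]) auto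
   have "?Q (sc k a + v) (%j. ?h j + f j)"
   proof (intro conjI allI)
    show "finite {j. ?h j + f j ~= 0}" by (rule finite_subset[of _ "{j. ?h j ~= 0} \<union> {j. f j ~= 0}"]) (use f fin in auto)
    show "?h j + f j \<in> A j" for j using f i by (intro subspace_add[OF sub]) (auto intro: subspace_scale[OF sub] subspace_0[OF sub])
    show "sc k a + v = Sum_any (%j. ?h j + f j)" using f by (subst Sum_any_add[OF fin]) (simp_all add: Sum_any_single)
   qed
   thus ?case by (rule exI[of _ "%j. ?h j + f j"])
  qed
 qed
 moreover have "f = g" if "?Q v f" "?Q v g" for v f g
 proof
  fix i
  have "P i v = h i" if h: "?Q v h" for h
  proof -
   have "P i v = Sum_any (%j. P i (h j))" using h Sum_any_lin[OF P(1)] by blast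
   also have "... = Sum_any (%j. if j = i then h i else 0)"
   proof (intro arg_cong[of _ _ Sum_any] ext)
    have hj: "h j \<in> A j" for j using h by blast
    show "P i (h j) = (if j = i then h i else 0)" for j by (cases "j = i") (simp_all add: P(2)[OF hj] P(3)[OF hj])
   qed
   finally show ?thesis by (simp add: Sum_any_single)
  qed
  thus "f i = g i" using that by metis
 qed
 ultimately show ?thesis unfolding graded_def using sub by blast
qed

lemma diag_op_eq:
 assumes "lin sc sc D" "!!i v. v \<in> A i ==> D v = sc (c i) v" "module.span sc (\<Union>(range A)) = UNIV" shows "diag_op sc A c = D"
 unfolding diag_op_def
proof (rule the_equality)
 show "D' = D" if "lin sc sc D' & (\<forall>i. \<forall>v\<in>A i. D' v = sc (c i) v)" for D'
  by (rule lin_eq_on_span[OF _ assms(1,3)]) (use that assms(2) in auto)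
qed (use assms in blast)

lift_definition cadd :: "complex => cmod2 => cmod2" is "%k x. x + k" by simp

lemma cadd_cadd: "cadd k (cadd l \<alpha>) = cadd (k + l) \<alpha>" by transfer (auto intro!: exI[of _ 0])

lemma cadd_even: "cadd (of_int (2 * k)) \<alpha> = \<alpha>" by transfer (auto intro!: exI[of _ k])

lemma cadd_cong: "even (a + b) ==> cadd (of_nat a) \<alpha> = cadd (of_nat b) \<alpha>"
proof -
 assume "even (a + b)"
 hence "even (int a - int b)" by simp
 then obtain k where "int a - int b = 2 * k" by blast
 hence "of_nat a = of_int (2 * k) + (of_nat b :: complex)" by (metis diff_add_cancel of_int_add of_int_of_nat_eq)
 thus ?thesis by (metis cadd_cadd cadd_even)
qed

lemma theta_eigenvalue_cadd: "theta_eigenvalue (cadd (of_nat k) \<alpha>) = (- 1) ^ k * theta_eigenvalue \<alpha>"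
proof (transfer fixing: k)
 fix \<alpha> :: complex
 have "exp (of_real pi * \<i> * of_nat k) = (- 1) ^ k" using exp_of_nat_mult[of k "of_real pi * \<i>"] by (simp add: mult_ac)
 moreover have "2 * of_real pi * \<i> * (\<alpha> + of_nat k) / 2 = of_real pi * \<i> * of_nat k + 2 * of_real pi * \<i> * \<alpha> / 2"
  by (simp add: field_simps)
 ultimately show "exp (2 * of_real pi * \<i> * (\<alpha> + of_nat k) / 2) = (- 1) ^ k * exp (2 * of_real pi * \<i> * \<alpha> / 2)"
  by (simp only: exp_add)
qed

definition word_weight :: "'h word => complex" where
 "word_weight xs = (SUM x<-xs. of_nat (snd (snd x)))"

definition shift_index :: "'h word => complex \<times> cmod2 => complex \<times> cmod2" where
 "shift_index xs i = (word_weight xs + fst i, cadd (of_nat (fcount xs)) (snd i))"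

lemma shift_index_Nil [simp]: "shift_index [] i = i" using cadd_even[of 0 "snd i"] by (simp add: shift_index_def word_weight_def fcount_def)

section \<open>The grading of W\<close>

context setting
begin

lemma M_vector_space: "vector_space scM" and M_graded: "graded scM Mgr" using M by (simp_all add: graded_T_module_def)

abbreviation "Wgr == W_grading scW Mgr \<pi>W"

lemma Wgr_eq: "Wgr i = W.W.span {create W.A xs (W.io m) | xs m j. xs \<in> CW & m \<in> Mgr j & i = shift_index xs j}"
proof -
 have s: "(\<Sum>(s, a, m)\<leftarrow>xs. of_nat m) = word_weight xs" "(\<Sum>(s, a, m)\<leftarrow>xs. of_nat (par s)) = of_nat (fcount xs)"
  for xs :: "'h word" by (induction xs) (auto simp: word_weight_def fcount_def)
 obtain n \<alpha> where i: "i = (n, \<alpha>)" by (cases i)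
 have "(\<exists>n' \<beta>. m \<in> Mgr (n', abs_cmod2 \<beta>) & n = word_weight xs + n' & \<alpha> = abs_cmod2 (\<beta> + of_nat (fcount xs))) \<longleftrightarrow>
   (\<exists>j. m \<in> Mgr j & i = shift_index xs j)" for m and xs :: "'h word"
 proof -
  have "(\<exists>j. m \<in> Mgr j & i = shift_index xs j) \<longleftrightarrow> (\<exists>n' \<gamma>. m \<in> Mgr (n', \<gamma>) & n = word_weight xs + n' & \<alpha> = cadd (of_nat (fcount xs)) \<gamma>)"
   by (auto simp: shift_index_def i)
  also have "... \<longleftrightarrow> (\<exists>n' \<beta>. m \<in> Mgr (n', abs_cmod2 \<beta>) & n = word_weight xs + n' & \<alpha> = cadd (of_nat (fcount xs)) (abs_cmod2 \<beta>))"
   by (metis Quotient3_abs_rep[OF Quotient3_cmod2])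
  finally show ?thesis by (simp add: cadd.abs_eq)
 qed
 thus ?thesis unfolding W_grading_def i prod.case s W.io_def W.wv_def by (intro arg_cong[of _ _ W.W.span]) blast
qed

lemma Wgr_subspace: "W.W.subspace (Wgr i)" unfolding Wgr_eq by (rule W.W.subspace_span)

lemma create_Wgr: "xs \<in> CW ==> m \<in> Mgr j ==> create W.A xs (W.io m) \<in> Wgr (shift_index xs j)"
 unfolding Wgr_eq by (rule W.W.span_base) blast

lemma create_io_linear: "lin scM scW (%m. create W.A xs (W.io m))" unfolding W.create_neg by (rule lin_comp[OF W.io_linear W.apply_modes_linear])

lemma Wgr_span: "W.W.span (\<Union>(range Wgr)) = UNIV"
proof -
 let ?S = "W.W.span (\<Union>(range Wgr))"
 have "create W.A xs (W.io m) \<in> ?S" if "xs \<in> CW" for xs m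
 proof -
  interpret c: Vector_Spaces.linear scM scW "%m. create W.A xs (W.io m)" by (rule create_io_linear)
  have "m \<in> W.M.span (\<Union>(range Mgr))" using graded_span[OF M_graded M_vector_space] by simp
  thus ?thesis
  proof (induction rule: W.M.span_induct_alt)
   case (step k m v)
   then obtain j where "m \<in> Mgr j" by blast
   hence "create W.A xs (W.io m) \<in> ?S" using create_Wgr[OF that] by (intro W.W.span_base) blast
   thus ?case using step(2) by (simp add: c.add c.scale W.W.span_add W.W.span_scale)
  qed (simp add: c.zero W.W.span_zero)
 qed
 hence "W.W.span {create W.A xs (W.io m) | xs m. xs \<in> CW} \<subseteq> ?S" by (intro W.W.span_minimal) auto
 thus ?thesis unfolding W.create_span by blast
qed

text \<open>On the part created by \<open>xs\<close>, act on the coefficient space by the diagonal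
  operator whose eigenvalues are shifted by \<open>xs\<close>; freeness of the creation words makes
  this well defined. The projections, and with them directness of the grading, are special
  cases.\<close>

lemma W_diag: "\<exists>D. lin scW scW D & (\<forall>i. \<forall>v\<in>Wgr i. D v = scW (c i) v)"
proof -
 define E where "E c' = (SOME D. lin scM scM D & (\<forall>i. \<forall>v\<in>Mgr i. D v = scM (c' i) v))" for c'
 have E: "lin scM scM (E c')" "!!i v. v \<in> Mgr i ==> E c' v = scM (c' i) v" for c'
  using someI_ex[OF graded_diag[OF M_graded M_vector_space, of c']] unfolding E_def by blast+
 let ?f = "%xs m. create W.A xs (W.io (E (%j. c (shift_index xs j)) m))"
 have "\<exists>l. lin scW scW l & (\<forall>xs\<in>CW. \<forall>m. l (create W.A xs (W.io m)) = ?f xs m)"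
 proof (rule W.creation_extend)
  show "vector_space scW" by (rule W.W.vector_space_axioms)
  show "lin scM scW (?f xs)" for xs by (rule lin_comp[OF E(1) create_io_linear])
  show "multilinear scH scW (%xs. ?f xs m)" for m
  proof -
   have 1: "shift_index (u @ (s, a, k) # v) = shift_index (u @ (s, b, k) # v)" for u v :: "'h word" and s a b k
    by (auto simp: shift_index_def word_weight_def fcount_def fun_eq_iff)
   have 2: "create W.A (u @ (s, a, k) # v) y = apply_modes W.A (map neg u) (W.A s a (- int k) (apply_modes W.A (map neg v) y))" for u v s a k y
    by (simp add: W.create_neg W.apply_modes_append W.Ap_def)
   show ?thesis unfolding multilinear_def
   proof (intro conjI allI)
    show "?f (u @ (s, a + b, j) # v) m = ?f (u @ (s, a, j) # v) m + ?f (u @ (s, b, j) # v) m" for u s a b j v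
     unfolding 1[of u s "a + b" j v 0] 1[of u s a j v 0] 1[of u s b j v 0] 2 by (simp add: W.A_add_left W.apply_add)
    show "?f (u @ (s, scH k a, j) # v) m = scW k (?f (u @ (s, a, j) # v) m)" for u s k a j v
     unfolding 1[of u s "scH k a" j v 0] 1[of u s a j v 0] 2 by (simp add: W.A_scale_left W.apply_scale)
   qed
  qed
 qed
 then obtain l where l: "lin scW scW l" "!!xs m. xs \<in> CW ==> l (create W.A xs (W.io m)) = ?f xs m" by blast
 interpret l: Vector_Spaces.linear scW scW l by fact
 have "l v = scW (c i) v" if "v \<in> Wgr i" for i v using that unfolding Wgr_eq
 proof (induction rule: W.W.span_induct_alt)
  case (step k x v)
  then obtain xs m j where x: "x = create W.A xs (W.io m)" "xs \<in> CW" "m \<in> Mgr j" "i = shift_index xs j" by blast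
  interpret c: Vector_Spaces.linear scM scW "%m. create W.A xs (W.io m)" by (rule create_io_linear)
  have "l x = scW (c i) x" using x by (simp add: l(2) E(2) c.scale)
  thus ?case using step(2) by (simp add: l.add l.scale W.W.scale_right_distrib mult.commute)
 qed (simp add: l.zero)
 thus ?thesis using l(1) by blast
qed

definition W_proj :: "complex \<times> cmod2 => 'w => 'w" where
 "W_proj i = (SOME D. lin scW scW D & (\<forall>j. \<forall>v\<in>Wgr j. D v = scW (of_bool (j = i)) v))"

lemma W_proj: "lin scW scW (W_proj i)" "v \<in> Wgr i ==> W_proj i v = v" "v \<in> Wgr j ==> j ~= i ==> W_proj i v = 0"
proof -
 have P: "lin scW scW (W_proj i) & (\<forall>j. \<forall>v\<in>Wgr j. W_proj i v = scW (of_bool (j = i)) v)"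
  unfolding W_proj_def by (rule someI_ex[OF W_diag])
 show "lin scW scW (W_proj i)" "v \<in> Wgr i ==> W_proj i v = v" "v \<in> Wgr j ==> j ~= i ==> W_proj i v = 0"
  using conjunct1[OF P] conjunct2[OF P, rule_format, of v] by simp_all
qed

lemma W_graded: "graded scW Wgr" by (rule gradedI[OF W.W.vector_space_axioms Wgr_subspace Wgr_span W_proj])

lemma W_proj_mem: "W_proj i v \<in> Wgr i"
proof -
 obtain f where f: "finite {i. f i ~= 0}" "!!i. f i \<in> Wgr i" "v = Sum_any f" using graded_ex[OF W_graded, of v] by blast
 have "W_proj i v = Sum_any (%j. W_proj i (f j))" unfolding f(3) by (rule Sum_any_lin[OF W_proj(1) f(1)])
 also have "... = Sum_any (%j. if j = i then f i else 0)"
 proof (intro arg_cong[of _ _ Sum_any] ext)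
  show "W_proj i (f j) = (if j = i then f i else 0)" for j by (cases "j = i") (simp_all add: W_proj(2)[OF f(2)] W_proj(3)[OF f(2)])
 qed
 finally show ?thesis using f(2)[of i] by (simp add: Sum_any_single)
qed

lemma W_diag_op: "lin scW scW (diag_op scW Wgr c)" "v \<in> Wgr i ==> diag_op scW Wgr c v = scW (c i) v"
proof -
 obtain D where D: "lin scW scW D" "!!i v. v \<in> Wgr i ==> D v = scW (c i) v" using W_diag[of c] by blast
 show "lin scW scW (diag_op scW Wgr c)" "v \<in> Wgr i ==> diag_op scW Wgr c v = scW (c i) v" using diag_op_eq[OF D Wgr_span] D by simp_all
qed

lemma lower_bounded: "\<exists>R::real. \<forall>m \<alpha>. Re m < R --> Wgr (m, \<alpha>) = {0}"
proof -
 obtain R :: real where R: "!!n \<alpha>. Re n < R ==> Mgr (n, \<alpha>) = {0}" using M unfolding graded_T_module_def by blast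
 have "Wgr (m, \<alpha>) = {0}" if m: "Re m < R" for m \<alpha>
 proof -
  have "{create W.A xs (W.io v) | xs v j. xs \<in> CW & v \<in> Mgr j & (m, \<alpha>) = shift_index xs j} \<subseteq> {0}"
  proof clarify
   fix xs :: "'h word" and v n \<beta> assume v: "v \<in> Mgr (n, \<beta>)" "(m, \<alpha>) = shift_index xs (n, \<beta>)"
   interpret c: Vector_Spaces.linear scM scW "%m. create W.A xs (W.io m)" by (rule create_io_linear)
   have "Re (word_weight xs) >= 0" unfolding word_weight_def by (induction xs) auto
   hence "Re n < R" using m v(2) by (auto simp: shift_index_def)
   thus "create W.A xs (W.io v) = 0" using R v(1) c.zero by auto
  qed
  hence "Wgr (m, \<alpha>) \<subseteq> {0}" unfolding Wgr_eq by (rule W.W.span_minimal) (simp add: W.W.subspace_def)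
  thus ?thesis using W.W.subspace_0[OF Wgr_subspace] by blast
 qed
 thus ?thesis by blast
qed

text \<open>The effect of a mode of index \<open>k\<close> and parity \<open>p\<close> on weight and
  \<theta>-weight.\<close>

definition move :: "int => nat => complex \<times> cmod2 => complex \<times> cmod2" where
 "move k p i = (fst i - of_int k, cadd (of_nat p) (snd i))"

lemma move_move: "move k p (move l q i) = move (k + l) (p + q) i" by (simp add: move_def cadd_cadd)

lemma move_cong: "even (p + q) ==> move k p i = move k q i" by (simp add: move_def cadd_cong[of p q])

lemma move_0 [simp]: "move 0 0 i = i" using cadd_even[of 0 "snd i"] by (simp add: move_def)

lemma shift_index_Cons: "shift_index ((s, a, m) # xs) j = move (- int m) (par s) (shift_index xs j)"
 by (simp add: shift_index_def move_def word_weight_def fcount_def cadd_cadd)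

lemma A_create_Wgr:
 assumes "xs \<in> CW" "v \<in> Mgr j" shows "W.A s a k (create W.A xs (W.io v)) \<in> Wgr (move k (par s) (shift_index xs j))"
proof (cases "k < 0")
 case True
 have "(s, a, nat (- k)) # xs \<in> CW" using True assms(1) by (auto simp: creation_words_def)
 from create_Wgr[OF this assms(2)] show ?thesis using True by (simp add: shift_index_Cons)
next
 case False
 show ?thesis using assms(1)
 proof (induction xs)
  case Nil
  have io: "W.io m \<in> Wgr i" if "m \<in> Mgr i" for m i using create_Wgr[of "[]" m i] that by (simp add: creation_words_def)
  obtain n \<beta> where j: "j = (n, abs_cmod2 \<beta>)" by (cases j) (metis Quotient3_abs_rep[OF Quotient3_cmod2])
  have "act s a v \<in> Mgr (n, abs_cmod2 (\<beta> + of_nat (par s)))" using M assms(2) unfolding graded_T_module_def j by blast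
  moreover have "W.io 0 = 0"
  proof -
   interpret io: Vector_Spaces.linear scM scW W.io by (rule W.io_linear)
   show ?thesis by (rule io.zero)
  qed
  moreover have "dg (%s. 0) s k >= 0" using False by (simp add: dg_def)
  ultimately show ?case using W.W.subspace_0[OF Wgr_subspace] io by (auto simp: W.A_io move_def j cadd.abs_eq)
 next
  case (Cons x xs)
  obtain s' b m where x: "x = (s', b, m)" by (cases x)
  have m: "- int m < 0" "xs \<in> CW" using Cons.prems by (auto simp: x)
  let ?i = "shift_index xs j"
  have step: "W.A s'' c k' w \<in> Wgr (move k' (par s'') i)" if "w \<in> Wgr i" "k' < 0" for s'' c k' w i using that(1) unfolding Wgr_eq[of i]
  proof (induction rule: W.W.span_induct_alt)
   case base
   thus ?case using W.W.subspace_0[OF Wgr_subspace] by simp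
  next
   case (step q y w)
   then obtain ys m l where y: "y = create W.A ys (W.io m)" "ys \<in> CW" "m \<in> Mgr l" "i = shift_index ys l" by blast
   have "(s'', c, nat (- k')) # ys \<in> CW" using that(2) y(2) by (auto simp: creation_words_def)
   from create_Wgr[OF this y(3)] have "W.A s'' c k' y \<in> Wgr (move k' (par s'') i)" using that(2) y by (simp add: shift_index_Cons)
   thus ?case using step(2) by (simp add: W.A_add W.A_scale W.W.subspace_add[OF Wgr_subspace] W.W.subspace_scale[OF Wgr_subspace])
  qed
  have i: "move k (par s) (shift_index (x # xs) j) = move (- int m) (par s') (move k (par s) ?i)"
   by (simp add: x shift_index_Cons move_move add.commute)
  have 1: "W.A s' b (- int m) (W.A s a k (create W.A xs (W.io v))) \<in> Wgr (move k (par s) (shift_index (x # xs) j))"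
   unfolding i by (rule step[OF Cons.IH[OF m(2)] m(1)])
  have 2: "scW (W.kap (s, a, k) (s', b, - int m)) (create W.A xs (W.io v)) \<in> Wgr (move k (par s) (shift_index (x # xs) j))"
  proof (cases "W.kap (s, a, k) (s', b, - int m) = 0")
   case False
   hence "s' = s" "k = int m" by (auto simp: contr_coeff_def split: if_splits)
   hence "move k (par s) (shift_index (x # xs) j) = ?i" unfolding i move_move using move_cong[of "par s' + par s" 0 0 ?i] by simp
   thus ?thesis using create_Wgr[OF m(2) assms(2)] by (simp add: W.W.subspace_scale[OF Wgr_subspace])
  qed (simp add: W.W.subspace_0[OF Wgr_subspace])
  have "dg (%s. 0) s k >= 0" using False by (simp add: dg_def)
  from W.A_super_neg[OF this m(1), of a s' b "create W.A xs (W.io v)"]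
  show ?case using W.W.subspace_add[OF Wgr_subspace W.W.subspace_scale[OF Wgr_subspace 1, of "sg s s'"] 2] by (simp add: x)
 qed
qed

lemma A_Wgr: "w \<in> Wgr i ==> W.A s a k w \<in> Wgr (move k (par s) i)" unfolding Wgr_eq[of i]
proof (induction rule: W.W.span_induct_alt)
 case base
 thus ?case using W.W.subspace_0[OF Wgr_subspace] by simp
next
 case (step q y w)
 hence "W.A s a k y \<in> Wgr (move k (par s) i)" using A_create_Wgr by blast
 thus ?case using step(2) by (simp add: W.A_add W.A_scale W.W.subspace_add[OF Wgr_subspace] W.W.subspace_scale[OF Wgr_subspace])
qed

text \<open>Membership in a weight space passes through \<open>wick\<close>, since it is expressed by a projection.\<close>

lemma wick_Wgr:
 assumes "!!x. homog (fst x) (c x)" "Q w"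
  and "!!u x v y t. Q (u @ x # v @ y # t) ==> c x y ~= 0 ==> Q (u @ v @ t)"
  and "!!v. Q v ==> Ph v \<in> Wgr i" shows "W.W.wick c w Ph \<in> Wgr i"
proof -
 have "W_proj i (W.W.wick c w Ph) = W.W.wick c w (%v. W_proj i (Ph v))" by (rule linear_wick[OF W_proj(1)])
 also have "... = W.W.wick c w Ph" by (rule W.W.wick_cong[where P = Q]) (use assms W_proj(2) in auto)
 finally show ?thesis using W_proj_mem by metis
qed

definition mode_sum :: "'h mode list => int" where
 "mode_sum ms = (SUM x<-ms. snd (snd x))"

definition parity_sum :: "(stat \<times> 'r) list => nat" where
 "parity_sum ms = (SUM x<-ms. par (fst x))"

text \<open>Contracted modes have opposite indices and equal statistics, so removing them changes
  the total shift only by an even \<theta>-weight, which is zero.\<close>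

lemma NO_Wgr:
 assumes w: "w \<in> Wgr i" shows "W.NO ms w \<in> Wgr (move (mode_sum ms) (parity_sum ms) i)"
proof -
 have "apply_modes W.A ms w \<in> Wgr (move (mode_sum ms) (parity_sum ms) i)" for ms
 proof (induction ms)
  case Nil
  thus ?case using w by (simp add: mode_sum_def parity_sum_def)
 next
  case (Cons x ms)
  thus ?case using A_Wgr[OF Cons, of "fst x" "fst (snd x)" "snd (snd x)"]
   by (simp add: W.Ap_def case_prod_unfold move_move mode_sum_def parity_sum_def)
 qed
 thus ?thesis unfolding W.NO_eq_wick
 proof (intro wick_Wgr[where Q = "%v. move (mode_sum v) (parity_sum v) i = move (mode_sum ms) (parity_sum ms) i"])
  show "homog (fst x) (%y. - W.kapn x y)" for x using W.kapn_homog[of x] by (simp add: homog_def)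
  fix u v t :: "'h mode list" and x y
  assume e: "move (mode_sum (u @ x # v @ y # t)) (parity_sum (u @ x # v @ y # t)) i = move (mode_sum ms) (parity_sum ms) i"
   and "- W.kapn x y ~= 0"
  hence "fst x = fst y" "snd (snd x) + snd (snd y) = 0"
   by (cases x; cases y; auto simp: W.kapn_def contr_coeff_def W.zero_contr_def dg_def split: if_splits)+
  hence "mode_sum (u @ x # v @ y # t) = mode_sum (u @ v @ t)" "even (parity_sum (u @ x # v @ y # t) + parity_sum (u @ v @ t))"
   by (auto simp: mode_sum_def parity_sum_def)
  thus "move (mode_sum (u @ v @ t)) (parity_sum (u @ v @ t)) i = move (mode_sum ms) (parity_sum ms) i" using e move_cong by metis
 qed metis+
qed

lemma V_weight: "(\<Sum>(s, a, m)\<leftarrow>U. of_nat m - of_nat (par s) / 2) = of_int (V.level U) / (2 :: complex)"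
 by (induction U) (auto simp: V.level_def add_divide_distrib diff_divide_distrib)

lemma YW_Wgr:
 assumes U: "U \<in> CW" and w: "w \<in> Wgr (n, \<alpha>)"
 shows "YW k (vv U) w \<in> Wgr (n - of_int k / 2 - 1 + of_int (V.level U) / 2, cadd (of_nat (fcount U)) \<alpha>)" unfolding YW_vec[OF U]
proof (rule wick_Wgr[where Q = "%v. even (fcount v + fcount U)", OF Delta_contr_homog])
 fix u v t :: "'h word" and x y
 assume "even (fcount (u @ x # v @ y # t) + fcount U)" "Delta_contr x y ~= 0"
 thus "even (fcount (u @ v @ t) + fcount U)" by (cases x; cases y) (auto simp: Delta_contr_def fcount_def split: if_splits)
next
 fix v :: "'h word" assume v: "even (fcount v + fcount U)"
 let ?K = "k + 2 - V.level U" and ?i = "(n - of_int k / 2 - 1 + of_int (V.level U) / 2, cadd (of_nat (fcount U)) \<alpha>)"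
 have "scW (iprod (mcoeff exW) v ns) (W.NO (map md (indexed v ns)) w) \<in> Wgr ?i"
  if ns: "length ns = length v" "2 * sum_list ns = ?K" for ns
 proof -
  have s: "mode_sum (map md (indexed v ns)) = sum_list ns" "parity_sum (map md (indexed v ns)) = fcount v"
   using ns(1) by (induction v ns rule: list_induct2') (auto simp: mode_sum_def parity_sum_def fcount_def md_def ix_def)
  have "of_int (sum_list ns) = (of_int ?K :: complex) / 2" using ns(2) by (metis nonzero_mult_div_cancel_left of_int_mult of_int_numeral zero_neq_numeral)
  hence "move (sum_list ns) (fcount v) (n, \<alpha>) = ?i" using cadd_cong[OF v] by (simp add: move_def diff_divide_distrib add_divide_distrib)
  thus ?thesis using NO_Wgr[OF w, of "map md (indexed v ns)"] unfolding s by (simp add: W.W.subspace_scale[OF Wgr_subspace])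
 qed
 thus "W.npc exW v ?K w \<in> Wgr ?i" unfolding W.npc_def Sum_any.expand_set
  by (intro W.W.subspace_sum[OF Wgr_subspace]) (auto simp: W.W.subspace_0[OF Wgr_subspace])
qed simp

section \<open>Weights and parity on V, and the graded dual of W\<close>

abbreviation "Vgr == V_grading scV \<pi>V"

lemma vv_Vgr: "U \<in> CW ==> vv U \<in> Vgr (of_int (V.level U) / 2)" unfolding V_grading_def V_weight by (rule V.W.span_base) blast

text \<open>A scalar that ignores the vectors in the letters keeps the map multilinear, so freeness
  of the creation words applies.\<close>

lemma V_extend:
 fixes g :: "'h word => complex"
 assumes "!!u s a b k v. g (u @ (s, a, k) # v) = g (u @ (s, b, k) # v)"
 shows "\<exists>D. lin scV scV D & (\<forall>U\<in>CW. D (vv U) = scV (g U) (vv U))"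
proof -
 have "multilinear scH scV (%U. scV (g U) (vv U))" unfolding multilinear_def
 proof (intro conjI allI)
  have 2: "vv (u @ (s, a, k) # v) = apply_modes V.A (map neg u) (V.A s a (- int k) (vv v))" for u v s a k
   by (simp add: V_vec_def V.create_neg V.apply_modes_append V.Ap_def)
  show "scV (g (u @ (s, a + b, j) # v)) (vv (u @ (s, a + b, j) # v)) =
    scV (g (u @ (s, a, j) # v)) (vv (u @ (s, a, j) # v)) + scV (g (u @ (s, b, j) # v)) (vv (u @ (s, b, j) # v))" for u s a b j v
   unfolding assms[of u s "a + b" j v 0] assms[of u s a j v 0] assms[of u s b j v 0] 2 by (simp add: V.A_add_left V.apply_add V.W.scale_right_distrib)
  show "scV (g (u @ (s, scH k a, j) # v)) (vv (u @ (s, scH k a, j) # v)) = scV k (scV (g (u @ (s, a, j) # v)) (vv (u @ (s, a, j) # v)))" for u s k a j v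
   unfolding assms[of u s "scH k a" j v 0] assms[of u s a j v 0] 2 by (simp add: V.A_scale_left V.apply_scale mult.commute)
 qed
 from V_lin_extend[OF V.W.vector_space_axioms this] show ?thesis by blast
qed

lemma V_diag_weight: shows "lin scV scV (diag_op scV Vgr (%n. n))"
  and "U \<in> CW ==> diag_op scV Vgr (%n. n) (vv U) = scV (of_int (V.level U) / 2) (vv U)"
proof -
 have "\<exists>D. lin scV scV D & (\<forall>U\<in>CW. D (vv U) = scV (of_int (V.level U) / 2) (vv U))" by (rule V_extend) (simp add: V.level_def)
 then obtain D where D: "lin scV scV D" "!!U. U \<in> CW ==> D (vv U) = scV (of_int (V.level U) / 2) (vv U)" by blast
 interpret D: Vector_Spaces.linear scV scV D by fact
 have "D v = scV n v" if "v \<in> Vgr n" for n v using that unfolding V_grading_def V_weight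
  by (induction rule: V.W.span_induct_alt) (auto simp: D.zero D.add D.scale D(2) V.W.scale_right_distrib mult.commute)
 moreover have "V.W.span (\<Union>(range Vgr)) = UNIV" using V.W.span_mono[of "vv ` CW" "\<Union>(range Vgr)"] vv_Vgr V_span by blast
 ultimately have "diag_op scV Vgr (%n. n) = D" by (intro diag_op_eq D(1))
 thus "lin scV scV (diag_op scV Vgr (%n. n))"
  "U \<in> CW ==> diag_op scV Vgr (%n. n) (vv U) = scV (of_int (V.level U) / 2) (vv U)" using D by simp_all
qed

text \<open>Each fermionic letter, and no other, makes a half-integral contribution to the weight of
  a creation word.\<close>

lemma parity_space_eq: "parity_space scV Vgr i = V.W.span {vv U | U. U \<in> CW & even (fcount U + i)}"
proof
 have par: "even (fcount U + V.level U)" for U :: "'h word" by (induction U) (auto simp: fcount_def V.level_def)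
 have iff: "of_int (V.level U) / 2 - of_nat i / 2 \<in> (\<int> :: complex set) \<longleftrightarrow> even (fcount U + i)" for U :: "'h word"
 proof -
  have "of_int (V.level U) / 2 - of_nat i / 2 = (of_int (V.level U - int i) / of_int 2 :: complex)" by (simp add: diff_divide_distrib)
  hence "of_int (V.level U) / 2 - of_nat i / 2 \<in> (\<int> :: complex set) \<longleftrightarrow> 2 dvd (V.level U - int i)"
   by (simp only: of_int_div_of_int_in_Ints_iff) simp
  thus ?thesis using par[of U] by presburger
 qed
 let ?S = "V.W.span {vv U | U. U \<in> CW & even (fcount U + i)}"
 have "Vgr n \<subseteq> ?S" if "n - of_nat i / 2 \<in> \<int>" for n unfolding V_grading_def V_weight by (rule V.W.span_mono) (use that iff in blast)
 thus "parity_space scV Vgr i \<subseteq> ?S" unfolding parity_space_def by (intro V.W.span_minimal) auto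
 show "?S \<subseteq> parity_space scV Vgr i" unfolding parity_space_def by (rule V.W.span_mono) (use vv_Vgr iff in blast)
qed

lemma V_parity_involution: shows "lin scV scV (parity_involution scV Vgr)"
  and "U \<in> CW ==> parity_involution scV Vgr (vv U) = scV ((- 1) ^ fcount U) (vv U)"
proof -
 have "\<exists>D. lin scV scV D & (\<forall>U\<in>CW. D (vv U) = scV ((- 1) ^ fcount U) (vv U))" by (rule V_extend) (simp add: fcount_def)
 then obtain D where D: "lin scV scV D" "!!U. U \<in> CW ==> D (vv U) = scV ((- 1) ^ fcount U) (vv U)" by blast
 interpret D: Vector_Spaces.linear scV scV D by fact
 have "D v = scV ((- 1) ^ i) v" if "v \<in> parity_space scV Vgr i" for i v using that unfolding parity_space_eq
 proof (induction rule: V.W.span_induct_alt)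
  case (step k x v)
  then obtain U where U: "x = vv U" "U \<in> CW" "even (fcount U + i)" by blast
  have "(- 1) ^ fcount U = ((- 1) ^ i :: complex)" using U(3) by (simp add: minus_one_power_iff)
  thus ?case using step(2) U by (simp add: D.add D.scale D(2) V.W.scale_right_distrib mult.commute)
 qed (simp add: D.zero)
 moreover have "V.W.span (\<Union>(range (parity_space scV Vgr))) = UNIV"
 proof -
  have "vv U \<in> \<Union>(range (parity_space scV Vgr))" if "U \<in> CW" for U
   unfolding parity_space_eq using that by (auto intro!: exI[of _ "fcount U"] V.W.span_base)
  thus ?thesis using V.W.span_mono[of "vv ` CW" "\<Union>(range (parity_space scV Vgr))"] V_span by blast
 qed
 ultimately have "parity_involution scV Vgr = D" unfolding parity_involution_def by (intro diag_op_eq D(1))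
 thus "lin scV scV (parity_involution scV Vgr)"
  "U \<in> CW ==> parity_involution scV Vgr (vv U) = scV ((- 1) ^ fcount U) (vv U)" using D by simp_all
qed

text \<open>The functional sees finitely many weights and \<open>w\<close> has finitely many
  components, each of which is shifted in weight by the total index of the modes.\<close>

lemma graded_dual_finite:
 assumes mu: "mu \<in> graded_dual scW Wgr" shows "\<exists>T. finite T & (\<forall>ms. mode_sum ms \<notin> T --> mu (W.NO ms w) = 0)"
proof -
 let ?I = "{i. \<exists>v\<in>Wgr i. mu v ~= 0}"
 have lin: "lin scW (*) mu" and fin: "finite ?I" using mu by (auto simp: graded_dual_def)
 interpret mu: Vector_Spaces.linear scW "(*)" mu by (rule lin)
 have "w \<in> W.W.span (\<Union>(range Wgr))" using Wgr_span by simp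
 thus ?thesis
 proof (induction rule: W.W.span_induct_alt)
  case base
  have "W.NO ms 0 = 0" for ms using W.NO_linear[of ms] by (metis Vector_Spaces.linear_iff W.W.scale_zero_left)
  thus ?case by (intro exI[of _ "{}"]) (simp add: mu.zero)
 next
  case (step c x v)
  then obtain T i where T: "finite T" "\<forall>ms. mode_sum ms \<notin> T --> mu (W.NO ms v) = 0" and x: "x \<in> Wgr i" by blast
  have N: "W.NO ms (scW c x + v) = scW c (W.NO ms x) + W.NO ms v" for ms using W.NO_linear[of ms] by (simp add: Vector_Spaces.linear_iff)
  let ?T = "{k :: int. fst i - of_int k \<in> fst ` ?I}"
  have "finite ?T"
  proof (rule finite_subset)
   show "?T \<subseteq> (%k. fst i - of_int k) -` (fst ` ?I)" by auto
   show "finite ((%k :: int. fst i - of_int k) -` (fst ` ?I))" using fin by (intro finite_vimageI) (auto simp: inj_def)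
  qed
  moreover have "mu (W.NO ms x) = 0" if "mode_sum ms \<notin> ?T" for ms
  proof -
   have "move (mode_sum ms) (parity_sum ms) i \<notin> ?I" using that by (force simp: move_def)
   thus ?thesis using NO_Wgr[OF x, of ms] by blast
  qed
  ultimately show ?case using T by (intro exI[of _ "T \<union> ?T"]) (auto simp: N mu.add mu.scale)
 qed
qed

end

section \<open>The twisted module\<close>

definition zroot :: "int => complex => complex" where
 "zroot p z = exp (log_branch p z / 2)"

lemma exp_log_branch: "z ~= 0 ==> exp (log_branch p z) = z"
proof -
 assume z: "z ~= 0"
 have "exp (log_branch p z) = exp (of_real (ln (norm z))) * exp (\<i> * of_real (Arg2pi z)) * exp (2 * of_int p * (of_real pi * \<i>))"
 proof -
  have "log_branch p z = of_real (ln (norm z)) + \<i> * of_real (Arg2pi z) + 2 * of_int p * (of_real pi * \<i>)"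
   by (simp add: log_branch_def algebra_simps)
  thus ?thesis by (simp only: exp_add)
 qed
 also have "exp (2 * of_int p * (of_real pi * \<i>)) = 1" using exp_integer_2pi[of "of_int p"] by (simp add: mult_ac)
 also have "exp (of_real (ln (norm z))) = (of_real (norm z) :: complex)" using z by (simp add: exp_of_real)
 finally show ?thesis using Arg2pi_eq[of z] by (simp add: mult_ac)
qed

lemma root_square: "z ~= 0 ==> (zroot p z)^2 = z" by (simp add: zroot_def exp_double[symmetric] exp_log_branch)

lemma root_nonzero [simp]: "zroot p z ~= 0" by (simp add: zroot_def)

lemma norm_root_less: "z ~= 0 ==> z' ~= 0 ==> norm z < norm z' ==> norm (zroot p z) < norm (zroot p z')"
 using root_square[of z p] root_square[of z' p] power2_less_imp_less[of "norm (zroot p z)" "norm (zroot p z')"] by (metis norm_power norm_ge_zero)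

lemma exp_log_branch_powi: "exp ((- of_int k / 2 - 1) * log_branch p z) = zroot p z powi (- k - 2)"
proof -
 have "(- of_int k / 2 - 1) * log_branch p z = of_int (- k - 2) * (log_branch p z / 2)" by (simp add: field_simps)
 thus ?thesis by (simp only: zroot_def exp_power_int)
qed

lemma exp_log_branch_power: "exp (of_nat i / 2 * log_branch p z) = zroot p z ^ i"
 using exp_of_nat_mult[of i "log_branch p z / 2"] by (simp add: zroot_def)

text \<open>The condition on the arguments makes the principal branch of the root of \<open>z\<^sub>1 / z\<^sub>2\<close> the quotient of the roots.\<close>

lemma root_shift:
 assumes z: "z1 ~= 0" "z2 ~= 0" and arg: "\<bar>Arg2pi z1 - Arg2pi z2\<bar> < pi / 2"
 shows "zroot p z2 * (1 + (z1 - z2) / (zroot p z2)^2) powr (1/2) = zroot p z1"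
proof -
 let ?L = "log_branch p z1 - log_branch p z2"
 have e: "1 + (z1 - z2) / (zroot p z2)^2 = z1 / z2" using z by (simp add: root_square field_simps)
 have "Ln (z1 / z2) = ?L"
 proof (rule Ln_unique)
  show "exp ?L = z1 / z2" using z by (simp add: exp_diff exp_log_branch)
  have "Im ?L = Arg2pi z1 - Arg2pi z2" by (simp add: log_branch_def)
  moreover have "\<bar>Arg2pi z1 - Arg2pi z2\<bar> < pi" using arg pi_gt_zero by linarith
  ultimately show "- pi < Im ?L" "Im ?L <= pi" by linarith+
 qed
 moreover have "z1 / z2 ~= 0" using z by simp
 ultimately have "(1 + (z1 - z2) / (zroot p z2)^2) powr (1/2) = exp (?L / 2)" unfolding e powr_def by simp
 thus ?thesis by (simp add: zroot_def exp_add[symmetric] diff_divide_distrib)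
qed

lemma cpoly_eval_cong: "cpoly_in n g ==> (!!j. j < n ==> z j = z' j) ==> cpoly_eval g z = cpoly_eval g z'"
 unfolding cpoly_eval_def cpoly_in_def by (intro sum.cong refl arg_cong2[of _ _ _ _ "(*)"] prod.cong) fastforce

text \<open>Exponents 0 and 1 are already reduced modulo 2, and the power of \<open>disc\<close> is
  written out as the denominators of generalized rationality, all with the same exponent
  \<open>Q\<close>.\<close>

lemma ratfn_shape:
 assumes "ratfn n i F" "!!j. j < n ==> i j \<in> {0, 1}"
 shows "\<exists>g Q. cpoly_in n g & (\<forall>t z. root_domain n t & (\<forall>j<n. z j = (t j)^2) -->
  F t = cpoly_eval g z * (PROD j<n. t j ^ i j * inverse (z j ^ Q)) * (PROD l<n. PROD j<l. inverse ((z j - z l) ^ Q)))"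
proof -
 obtain h Q where h: "polyfn n h" "!!t. root_domain n t ==>
   F t = h (%j. (t j)^2) * (PROD j<n. t j ^ (i j mod 2)) * inverse (disc n (%j. (t j)^2)) ^ Q" using assms(1) unfolding ratfn_def by blast
 obtain g where g: "cpoly_in n g" "h = cpoly_eval g" using h(1) unfolding polyfn_def by blast
 have "F t = cpoly_eval g z * (PROD j<n. t j ^ i j * inverse (z j ^ Q)) * (PROD l<n. PROD j<l. inverse ((z j - z l) ^ Q))"
  if t: "root_domain n t" "\<forall>j<n. z j = (t j)^2" for t z
 proof -
  have 1: "(PROD j<n. t j ^ (i j mod 2)) = (PROD j<n. t j ^ i j)" using assms(2) by (intro prod.cong) fastforce+
  have 2: "inverse (disc n z) ^ Q = (PROD j<n. inverse (z j ^ Q)) * (PROD l<n. PROD j<l. inverse ((z j - z l) ^ Q))"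
   by (simp add: disc_def power_mult_distrib prod_power_distrib prod_inversef[unfolded comp_def, symmetric] power_inverse)
  have 3: "disc n (%j. (t j)^2) = disc n z" unfolding disc_def using t(2) by (intro arg_cong2[of _ _ _ _ "(*)"] prod.cong refl) auto
  have 4: "cpoly_eval g (%j. (t j)^2) = cpoly_eval g z" using t(2) by (intro cpoly_eval_cong[OF g(1)]) auto
  show ?thesis unfolding h(2)[OF t(1)] g(2) 1 3 4 2 prod.distrib by (simp only: mult.assoc)
 qed
 thus ?thesis using g(1) by blast
qed

context setting
begin

lemma YV_linear_right: "lin scV scV (YV n u)"
proof -
 have lin: "YV n (u + v) w = YV n u w + YV n v w" "YV n (scV c u) w = scV c (YV n u w)" "YV n 0 w = 0" for u v c w
 proof -
  interpret Vector_Spaces.linear scV scV "%u. YV n u w" by (rule YV_linear)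
  show "YV n (u + v) w = YV n u w + YV n v w" "YV n (scV c u) w = scV c (YV n u w)" "YV n 0 w = 0" by (simp_all add: add scale zero)
 qed
 have "u \<in> V.W.span (vv ` CW)" using V_span by simp
 hence "\<forall>w w' c. YV n u (w + w') = YV n u w + YV n u w' & YV n u (scV c w) = scV c (YV n u w)"
 proof (induction rule: V.W.span_induct_alt)
  case (step c x v)
  then obtain U where "x = vv U" "U \<in> CW" by blast
  thus ?case using step(2) by (simp add: lin YV_vec V.npc_add V.npc_scale V.W.scale_right_distrib V.W.scale_left_commute add_ac)
 qed (simp add: lin)
 thus ?thesis by (auto simp: Vector_Spaces.linear_iff V.W.vector_space_axioms)
qed

text \<open>Passes from spanning vectors to arbitrary ones slot by slot: \<open>val\<close> respects
  linear combinations in each slot and \<open>R\<close> is closed under them, so the witness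
  \<open>F\<close> follows along.\<close>

lemma multislot:
 fixes val :: "(nat => 'v) => ((nat => complex) => complex) => bool"
 assumes add: "!!v k x y c F F'. k < n ==> val (v(k := x)) F ==> val (v(k := y)) F' ==> val (v(k := scV c x + y)) (%t. c * F t + F' t)"
  and zero: "!!v k. k < n ==> val (v(k := 0)) (%t. 0)"
  and R: "R (%t. 0)" "!!F F' c. R F ==> R F' ==> R (%t. c * F t + F' t)"
  and base: "!!b. (!!j. j < n ==> b j \<in> B j) ==> \<exists>F. R F & val b F"
  and v: "!!j. j < n ==> v j \<in> V.W.span (B j)" shows "\<exists>F. R F & val v F"
proof -
 have "\<exists>F. R F & val v F" if "!!j. j < n ==> (if j < m then v j \<in> V.W.span (B j) else v j \<in> B j)" "m <= n" for m v using that
 proof (induction m arbitrary: v)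
  case 0
  thus ?case by (intro base) auto
 next
  case (Suc m)
  hence m: "m < n" by simp
  have "\<exists>F. R F & val (v(m := x)) F" if "x \<in> V.W.span (B m)" for x using that
  proof (induction rule: V.W.span_induct_alt)
   case base
   show ?case using zero[OF m] R(1) by blast
  next
   case (step c x y)
   have "\<exists>F. R F & val (v(m := x)) F"
   proof (rule Suc.IH)
    show "if j < m then (v(m := x)) j \<in> V.W.span (B j) else (v(m := x)) j \<in> B j" if "j < n" for j
     using Suc.prems(1)[OF that] step(1) by (auto split: if_splits)
   qed (use m in simp)
   thus ?case using step add[OF m] R(2) by blast
  qed
  from this[of "v m"] show ?case using Suc.prems(1)[OF m] by simp
 qed
 from this[of n v] v show ?thesis by simp
qed

end

context matrix_element
begin

definition prod_val :: "nat => (nat => 'v) => ((nat => complex) => complex) => bool" where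
 "prod_val n v F \<longleftrightarrow> (\<forall>p z. (\<forall>j<n. z j ~= 0) & (\<forall>j l. j < l & l < n --> norm (z l) < norm (z j)) -->
   (product_term YW p n v z w mu has_sum F (%j. zroot p (z j))) {ks. length ks = n})"

lemma prod_val_vv:
 assumes "!!j. j < n ==> U j \<in> CW" "!!j. j < n ==> b j = vv (U j)" shows "prod_val n b (correlation U n)" unfolding prod_val_def
proof (intro allI impI)
 fix p and z :: "nat => complex" assume z: "(\<forall>j<n. z j ~= 0) & (\<forall>j l. j < l & l < n --> norm (z l) < norm (z j))"
 have "foldr (%j. YW (ks ! j) (b j)) [0..<n] w = foldr (%j. YW (ks ! j) (vv (U j))) [0..<n] w" for ks by (rule foldr_cong) (use assms(2) in auto)
 hence e: "product_term YW p n b z w mu =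
   (%ks. mu (foldr (%j. YW (ks ! j) (vv (U j))) [0..<n] w) * (PROD j<n. zroot p (z j) powi (- (ks ! j) - 2)))"
  by (intro ext) (simp only: product_term_def exp_log_branch_powi)
 show "(product_term YW p n b z w mu has_sum correlation U n (%j. zroot p (z j))) {ks. length ks = n}" unfolding e
 proof (rule product_correlation)
  show "norm (zroot p (z l)) < norm (zroot p (z j))" if "j < l" "l < n" for j l
  proof (rule norm_root_less)
   have "j < n" using that by simp
   thus "z l ~= 0" "z j ~= 0" "norm (z l) < norm (z j)" using z that by blast+
  qed
 qed (simp_all add: assms(1))
qed

lemma product_term_slot:
 assumes "k < n"
 shows "product_term YW p n (v(k := scV c x + y)) z w mu ks = c * product_term YW p n (v(k := x)) z w mu ks + product_term YW p n (v(k := y)) z w mu ks"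
  and "product_term YW p n (v(k := 0)) z w mu ks = 0"
proof -
 interpret mu: Vector_Spaces.linear scW "(*)" mu by (rule mu)
 have L: "YW q (scV c x + y) u = scW c (YW q x u) + YW q y u" "YW q 0 u = 0" for q x y u c
 proof -
  interpret Vector_Spaces.linear scV scW "%v. YW q v u" by (rule YW_linear_left)
  show "YW q (scV c x + y) u = scW c (YW q x u) + YW q y u" "YW q 0 u = 0" by (simp_all add: add scale zero)
 qed
 have Rr: "YW q x (scW c u + u') = scW c (YW q x u) + YW q x u'" "YW q x 0 = 0" for q x u u' c
 proof -
  interpret Vector_Spaces.linear scW scW "YW q x" by (rule YW_linear_right)
  show "YW q x (scW c u + u') = scW c (YW q x u) + YW q x u'" "YW q x 0 = 0" by (simp_all add: add scale zero)
 qed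
 let ?f = "%x I. foldr (%i. YW (ks ! i) ((v(k := x)) i)) I w"
 have same: "?f x I = ?f y I" if "k \<notin> set I" for I x y by (rule foldr_cong) (use that in auto)
 have 1: "?f (scV c x + y) I = scW c (?f x I) + ?f y I & ?f 0 I = 0" if "distinct I" "k \<in> set I" for I using that
 proof (induction I)
  case (Cons i I)
  show ?case
  proof (cases "i = k")
   case True
   hence k: "k \<notin> set I" using Cons.prems by simp
   show ?thesis using True L same[OF k, of "scV c x + y" 0] same[OF k, of x 0] same[OF k, of y 0] by simp
  next
   case False
   thus ?thesis using Cons Rr by simp
  qed
 qed simp
 have I: "distinct [0..<n]" "k \<in> set [0..<n]" using assms by auto
 have e: "?f (scV c x + y) [0..<n] = scW c (?f x [0..<n]) + ?f y [0..<n]" "?f 0 [0..<n] = 0" using 1[OF I] by blast+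
 show "product_term YW p n (v(k := scV c x + y)) z w mu ks = c * product_term YW p n (v(k := x)) z w mu ks + product_term YW p n (v(k := y)) z w mu ks"
  unfolding product_term_def e(1) mu.add mu.scale distrib_right mult.assoc ..
 show "product_term YW p n (v(k := 0)) z w mu ks = 0" unfolding product_term_def e(2) mu.zero mult_zero_left ..
qed

lemma prod_val_add:
 assumes k: "k < n" and "prod_val n (v(k := x)) F" "prod_val n (v(k := y)) F'" shows "prod_val n (v(k := scV c x + y)) (%t. c * F t + F' t)"
 unfolding prod_val_def ext[OF product_term_slot(1)[OF k]]
 using assms(2,3) unfolding prod_val_def by (intro allI impI has_sum_add has_sum_cmult_right) blast+

lemma prod_val_zero: "k < n ==> prod_val n (v(k := 0)) (%t. 0)"
 unfolding prod_val_def by (simp only: ext[OF product_term_slot(2)] has_sum_0 simp_thms)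

text \<open>The root at \<open>z1\<close> is built from the principal root of
  \<open>z1 / z2\<close>: convergence is required without a condition on the arguments, and under
  that condition \<open>root_shift\<close> identifies it with the chosen branch.\<close>

definition iter_val :: "'v => 'v => ((nat => complex) => complex) => bool" where
 "iter_val v1 v2 F \<longleftrightarrow> (\<forall>p z1 z2. norm z2 > norm (z1 - z2) & norm (z1 - z2) > 0 -->
   (iterate_term YV YW p v1 v2 z1 z2 w mu has_sum
    F (%j. if j = 0 then zroot p z2 * (1 + (z1 - z2) / (zroot p z2)^2) powr (1/2) else zroot p z2)) UNIV)"

lemma iter_val_vv:
 assumes "U1 \<in> CW" "U2 \<in> CW" shows "iter_val (vv U1) (vv U2) (correlation (%j. if j = 0 then U1 else U2) 2)" unfolding iter_val_def
proof (intro allI impI)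
 fix p :: int and z1 z2 :: complex assume z: "norm z2 > norm (z1 - z2) & norm (z1 - z2) > 0"
 hence "z2 ~= 0" "z1 ~= z2" by auto
 hence "shifted_root (zroot p z2) (z1 - z2) (zroot p z2 * (1 + (z1 - z2) / (zroot p z2)^2) powr (1/2))"
  using z by unfold_locales (auto simp: root_square)
 from iterate_correlation[OF assms this]
 show "(iterate_term YV YW p (vv U1) (vv U2) z1 z2 w mu has_sum correlation (%j. if j = 0 then U1 else U2) 2
   (%j. if j = 0 then zroot p z2 * (1 + (z1 - z2) / (zroot p z2)^2) powr (1/2) else zroot p z2)) UNIV"
  unfolding iterate_term_def exp_log_branch_powi .
qed

lemma iterate_term_linear:
 "iterate_term YV YW p (scV c x + y) v z1 z2 w mu q = c * iterate_term YV YW p x v z1 z2 w mu q + iterate_term YV YW p y v z1 z2 w mu q"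
 "iterate_term YV YW p v (scV c x + y) z1 z2 w mu q = c * iterate_term YV YW p v x z1 z2 w mu q + iterate_term YV YW p v y z1 z2 w mu q"
 "iterate_term YV YW p 0 v z1 z2 w mu q = 0" "iterate_term YV YW p v 0 z1 z2 w mu q = 0"
proof -
 obtain n k where q: "q = (n, k)" by (cases q)
 interpret a: Vector_Spaces.linear scV "(*)" "%u. mu (YW k (YV n u v) w)" by (rule lin_comp[OF lin_comp[OF YV_linear YW_linear_left] mu])
 interpret b: Vector_Spaces.linear scV "(*)" "%u. mu (YW k (YV n v u) w)" by (rule lin_comp[OF lin_comp[OF YV_linear_right YW_linear_left] mu])
 show "iterate_term YV YW p (scV c x + y) v z1 z2 w mu q = c * iterate_term YV YW p x v z1 z2 w mu q + iterate_term YV YW p y v z1 z2 w mu q"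
  "iterate_term YV YW p v (scV c x + y) z1 z2 w mu q = c * iterate_term YV YW p v x z1 z2 w mu q + iterate_term YV YW p v y z1 z2 w mu q"
  "iterate_term YV YW p 0 v z1 z2 w mu q = 0" "iterate_term YV YW p v 0 z1 z2 w mu q = 0"
  unfolding q iterate_term_def prod.case a.add a.scale a.zero b.add b.scale b.zero distrib_right mult.assoc mult_zero_left by (rule refl)+
qed

lemma iter_val_add:
 assumes "k < (2::nat)" "iter_val ((v(k := x)) 0) ((v(k := x)) 1) F" "iter_val ((v(k := y)) 0) ((v(k := y)) 1) F'"
 shows "iter_val ((v(k := scV c x + y)) 0) ((v(k := scV c x + y)) 1) (%t. c * F t + F' t)"
proof -
 have l: "iter_val (scV c x + y) b (%t. c * F t + F' t)" if "iter_val x b F" "iter_val y b F'" for b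
  using that unfolding iter_val_def ext[OF iterate_term_linear(1)] by (intro allI impI has_sum_add has_sum_cmult_right) blast+
 have r: "iter_val a (scV c x + y) (%t. c * F t + F' t)" if "iter_val a x F" "iter_val a y F'" for a
  using that unfolding iter_val_def ext[OF iterate_term_linear(2)] by (intro allI impI has_sum_add has_sum_cmult_right) blast+
 consider "k = 0" | "k = 1" using assms(1) by linarith
 thus ?thesis using assms(2,3) by cases (simp_all add: l r)
qed

lemma iter_val_zero: "k < (2::nat) ==> iter_val ((v(k := 0)) 0) ((v(k := 0)) 1) (%t. 0)" unfolding iter_val_def
 by (cases "k = 0") (simp_all add: ext[OF iterate_term_linear(3)] ext[OF iterate_term_linear(4)] less_2_cases_iff has_sum_0)

text \<open>One function \<open>F\<close> serves product and iterate at the same time, which makes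
  associativity immediate.\<close>

lemma joint_val:
 assumes R: "R (%t. 0)" "!!F F' c. R F ==> R F' ==> R (%t. c * F t + F' t)"
  and base: "!!U1 U2. vv U1 \<in> B 0 ==> vv U2 \<in> B 1 ==> U1 \<in> CW ==> U2 \<in> CW ==>
   ok U1 0 ==> ok U2 (1::nat) ==> R (correlation (%j. if j = 0 then U1 else U2) 2)"
  and B: "!!j. B j = {vv U | U. U \<in> CW & ok U j}"
  and v: "v1 \<in> V.W.span (B 0)" "v2 \<in> V.W.span (B 1)" shows "\<exists>F. R F & prod_val 2 (%j. if j = 0 then v1 else v2) F & iter_val v1 v2 F"
proof -
 let ?val = "%v F. prod_val 2 v F & iter_val (v 0) (v 1) F"
 have "\<exists>F. R F & ?val (%j. if j = 0 then v1 else v2) F"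
 proof (rule multislot[where val = ?val and n = 2 and B = B])
  fix v k x y c F F'
  assume "k < (2::nat)" "?val (v(k := x)) F" "?val (v(k := y)) F'"
  thus "?val (v(k := scV c x + y)) (%t. c * F t + F' t)" by (intro conjI prod_val_add iter_val_add) auto
 next
  fix v k assume "k < (2::nat)"
  thus "?val (v(k := 0)) (%t. 0)" by (intro conjI prod_val_zero iter_val_zero)
 next
  fix b :: "nat => 'v" assume b: "!!j. j < 2 ==> b j \<in> B j"
  obtain U1 U2 where U: "b 0 = vv U1" "U1 \<in> CW" "ok U1 0" "b 1 = vv U2" "U2 \<in> CW" "ok U2 1" using b[of 0] b[of 1] unfolding B by auto
  have "prod_val 2 b (correlation (%j. if j = 0 then U1 else U2) 2)" by (rule prod_val_vv) (use U in "auto simp: less_2_cases_iff")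
  moreover have "R (correlation (%j. if j = 0 then U1 else U2) 2)" using U b[of 0] b[of 1] by (intro base) auto
  ultimately show "\<exists>F. R F & ?val b F" using iter_val_vv[OF U(2,5)] U(1,4) by auto
 next
  fix j assume "j < (2::nat)"
  thus "(if j = 0 then v1 else v2) \<in> V.W.span (B j)" using v by (auto simp: less_2_cases_iff)
 qed (use R in auto)
 thus ?thesis by simp
qed

end

context setting
begin

lemma matrix_element_ex:
 assumes "mu \<in> graded_dual scW Wgr" shows "\<exists>T. matrix_element scH frm lB lF es scV \<pi>V scM act Mgr scW \<pi>W mu w T"
proof -
 obtain T where T: "finite T" "!!ms. mode_sum ms \<notin> T ==> mu (W.NO ms w) = 0" using graded_dual_finite[OF assms] by blast
 have "matrix_element scH frm lB lF es scV \<pi>V scM act Mgr scW \<pi>W mu w T"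
 proof (rule matrix_element.intro[OF setting_axioms matrix_element_axioms.intro])
  show "lin scW (*) mu" using assms unfolding graded_dual_def by (rule CollectE) (rule conjunct1)
 qed (fact T(1), rule T(2)[unfolded mode_sum_def])
 thus ?thesis by (rule exI)
qed

lemma has_sum_abs_sums_to: "(f has_sum S) A ==> abs_sums_to f A S"
 unfolding abs_sums_to_def by (simp add: has_sum_imp_summable flip: summable_on_iff_abs_summable_on_complex)

lemma root_domain_roots:
 assumes "\<forall>j<n. z j ~= 0" "\<forall>j l. j < l & l < n --> z l ~= z j" shows "root_domain n (%j. zroot p (z j))"
proof -
 have "(zroot p (z j))^2 ~= (zroot p (z l))^2" if "j < l" "l < n" for j l
 proof -
  have nz: "z j ~= 0" "z l ~= 0" and ne: "z l ~= z j" using assms that order.strict_trans[OF that] by blast+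
  show ?thesis unfolding root_square[OF nz(1)] root_square[OF nz(2)] using ne by (rule not_sym)
 qed
 thus ?thesis unfolding root_domain_def using root_nonzero by blast
qed

lemma product_rational:
 fixes i :: "nat => nat" and v :: "nat => 'v"
 assumes v: "\<forall>j<n. i j \<in> {0, 1} & v j \<in> parity_space scV Vgr (i j)" and mu: "mu \<in> graded_dual scW Wgr"
 shows "\<exists>g q qq. cpoly_in n g &
      (\<forall>p z. (\<forall>j<n. z j ~= 0) & (\<forall>j l. j < l & l < n --> norm (z l) < norm (z j)) -->
       abs_sums_to (product_term YW p n v z w mu) {ks. length ks = n}
        (cpoly_eval g z *
         (PROD j<n. exp (of_nat (i j) / 2 * log_branch p (z j)) * inverse (z j ^ q j)) *
         (PROD l<n. PROD j<l. inverse ((z j - z l) ^ qq j l))))"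
proof -
 obtain T where "matrix_element scH frm lB lF es scV \<pi>V scM act Mgr scW \<pi>W mu w T" using matrix_element_ex[OF mu] by blast
 then interpret matrix_element scH frm lB lF es scV \<pi>V scM act Mgr scW \<pi>W mu w T .
 let ?B = "%j. {vv U | U. U \<in> CW & even (fcount U + i j)}"
 have "\<exists>F. ratfn n i F & prod_val n v F"
 proof (rule multislot[where val = "prod_val n" and n = n and B = ?B])
  fix b assume b: "!!j. j < n ==> b j \<in> ?B j"
  then obtain U where U: "!!j. j < n ==> b j = vv (U j) & U j \<in> CW & even (fcount (U j) + i j)" by simp metis
  have "ratfn n i (correlation U n)" by (rule ratfn_parity[OF ratfn_correlation]) (use U in blast)
  thus "\<exists>F. ratfn n i F & prod_val n b F" using prod_val_vv[of n U b] U by blast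
 next
  fix j assume "j < n"
  thus "v j \<in> V.W.span (?B j)" using v unfolding parity_space_eq by blast
 qed (auto intro: prod_val_add prod_val_zero ratfn_zero ratfn_add ratfn_cmult)
 then obtain F where F: "ratfn n i F" "prod_val n v F" by blast
 obtain g Q where g: "cpoly_in n g" "!!t z. root_domain n t ==> \<forall>j<n. z j = (t j)^2 ==>
  F t = cpoly_eval g z * (PROD j<n. t j ^ i j * inverse (z j ^ Q)) * (PROD l<n. PROD j<l. inverse ((z j - z l) ^ Q))"
  using ratfn_shape[OF F(1)] v by blast
 have "abs_sums_to (product_term YW p n v z w mu) {ks. length ks = n}
   (cpoly_eval g z * (PROD j<n. exp (of_nat (i j) / 2 * log_branch p (z j)) * inverse (z j ^ Q)) *
    (PROD l<n. PROD j<l. inverse ((z j - z l) ^ Q)))"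
  if z: "(\<forall>j<n. z j ~= 0) & (\<forall>j l. j < l & l < n --> norm (z l) < norm (z j))" for p z
 proof -
  have "root_domain n (%j. zroot p (z j))" using z by (intro root_domain_roots) (auto, metis order.irrefl)
  moreover have "\<forall>j<n. z j = (zroot p (z j))^2" using z by (simp add: root_square)
  ultimately have e: "F (%j. zroot p (z j)) = cpoly_eval g z *
    (PROD j<n. exp (of_nat (i j) / 2 * log_branch p (z j)) * inverse (z j ^ Q)) * (PROD l<n. PROD j<l. inverse ((z j - z l) ^ Q))"
   unfolding exp_log_branch_power by (rule g(2))
  have "(product_term YW p n v z w mu has_sum F (%j. zroot p (z j))) {ks. length ks = n}" using F(2) z unfolding prod_val_def by blast
  from has_sum_abs_sums_to[OF this] show ?thesis unfolding e .
 qed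
 thus ?thesis using g(1) by (intro exI[of _ g] exI[of _ "%_. Q"] exI[of _ "%_ _. Q"]) blast
qed

lemma prod_less_2:
 "(PROD j<2::nat. f j) = f 0 * (f 1 :: complex)" "(PROD l<2::nat. PROD j<l. h j l) = (h 0 1 :: complex)" by (simp_all add: numeral_2_eq_2)

lemma iterate_rational:
 fixes i1 i2 :: nat
 assumes i: "i1 \<in> {0, 1}" "i2 \<in> {0, 1}" and v: "v1 \<in> parity_space scV Vgr i1" "v2 \<in> parity_space scV Vgr i2"
  and mu: "mu \<in> graded_dual scW Wgr" shows "\<exists>g q1 q2 t. cpoly_in 2 g &
      (\<forall>p z1 z2. norm z2 > norm (z1 - z2) & norm (z1 - z2) > 0 -->
       (%nk. norm (iterate_term YV YW p v1 v2 z1 z2 w mu nk)) summable_on UNIV &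
       (\<bar>Arg2pi z1 - Arg2pi z2\<bar> < pi / 2 -->
         (iterate_term YV YW p v1 v2 z1 z2 w mu has_sum
          cpoly_eval g (%j. if j = 0 then z1 else z2) *
          exp (of_nat i1 / 2 * log_branch p z1) * inverse (z1 ^ q1) *
          exp (of_nat i2 / 2 * log_branch p z2) * inverse (z2 ^ q2) *
          inverse ((z1 - z2) ^ t)) UNIV))"
proof -
 obtain T where "matrix_element scH frm lB lF es scV \<pi>V scM act Mgr scW \<pi>W mu w T" using matrix_element_ex[OF mu] by blast
 then interpret matrix_element scH frm lB lF es scV \<pi>V scM act Mgr scW \<pi>W mu w T .
 let ?i = "%j. if j = (0::nat) then i1 else i2"
 have "\<exists>F. ratfn 2 ?i F & prod_val 2 (%j. if j = 0 then v1 else v2) F & iter_val v1 v2 F"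
 proof (rule joint_val[where ok = "%U j. even (fcount U + ?i j)" and B = "%j. {vv U | U. U \<in> CW & even (fcount U + ?i j)}"])
  show "ratfn 2 ?i (correlation (%j. if j = 0 then U1 else U2) 2)"
   if "even (fcount U1 + ?i 0)" "even (fcount U2 + ?i 1)" for U1 U2
   by (rule ratfn_parity[OF ratfn_correlation]) (use that in "auto simp: less_2_cases_iff")
  show "v1 \<in> V.W.span {vv U | U. U \<in> CW & even (fcount U + ?i 0)}"
   "v2 \<in> V.W.span {vv U | U. U \<in> CW & even (fcount U + ?i 1)}" using v by (simp_all add: parity_space_eq)
 qed (rule refl ratfn_zero ratfn_add[OF ratfn_cmult] | assumption)+
 then obtain F where F: "ratfn 2 ?i F" "iter_val v1 v2 F" by blast
 have "?i j \<in> {0, 1}" for j using i by simp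
 from ratfn_shape[OF F(1) this] obtain g Q where g: "cpoly_in 2 g" "!!t z. root_domain 2 t ==> \<forall>j<2. z j = (t j)^2 ==>
  F t = cpoly_eval g z * (PROD j<2. t j ^ ?i j * inverse (z j ^ Q)) * (PROD l<2. PROD j<l. inverse ((z j - z l) ^ Q))" by blast
 have "(%nk. norm (iterate_term YV YW p v1 v2 z1 z2 w mu nk)) summable_on UNIV &
   (\<bar>Arg2pi z1 - Arg2pi z2\<bar> < pi / 2 -->
     (iterate_term YV YW p v1 v2 z1 z2 w mu has_sum
      cpoly_eval g (%j. if j = 0 then z1 else z2) *
      exp (of_nat i1 / 2 * log_branch p z1) * inverse (z1 ^ Q) *
      exp (of_nat i2 / 2 * log_branch p z2) * inverse (z2 ^ Q) *
      inverse ((z1 - z2) ^ Q)) UNIV)"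
  if z: "norm z2 > norm (z1 - z2) & norm (z1 - z2) > 0" for p z1 z2
 proof (intro conjI impI)
  note S = F(2)[unfolded iter_val_def, rule_format, OF z, of p]
  show "(%nk. norm (iterate_term YV YW p v1 v2 z1 z2 w mu nk)) summable_on UNIV" using has_sum_abs_sums_to[OF S] by (simp add: abs_sums_to_def)
  assume arg: "\<bar>Arg2pi z1 - Arg2pi z2\<bar> < pi / 2"
  let ?z = "%j. if j = (0::nat) then z1 else z2"
  have nz: "z1 ~= 0" "z2 ~= 0" "z1 ~= z2" using z by auto
  have r: "(%j::nat. if j = 0 then zroot p z2 * (1 + (z1 - z2) / (zroot p z2)^2) powr (1/2) else zroot p z2) = (%j. zroot p (?z j))"
   unfolding root_shift[OF nz(1,2) arg] by auto
  have e: "F (%j. zroot p (?z j)) = cpoly_eval g ?z * (PROD j<2. zroot p (?z j) ^ ?i j * inverse (?z j ^ Q)) *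
    (PROD l<2. PROD j<l. inverse ((?z j - ?z l) ^ Q))" by (rule g(2)) (use nz in "auto simp: root_square root_domain_def")
  show "(iterate_term YV YW p v1 v2 z1 z2 w mu has_sum
      cpoly_eval g ?z * exp (of_nat i1 / 2 * log_branch p z1) * inverse (z1 ^ Q) *
      exp (of_nat i2 / 2 * log_branch p z2) * inverse (z2 ^ Q) * inverse ((z1 - z2) ^ Q)) UNIV"
   using S unfolding r e exp_log_branch_power prod_less_2(2) unfolding prod_less_2(1) by (simp only: if_True if_False refl one_neq_zero mult.assoc)
 qed
 thus ?thesis using g(1) by blast
qed

lemma associative:
 assumes mu: "mu \<in> graded_dual scW Wgr" and z: "norm z1 > norm z2" "norm z2 > norm (z1 - z2)" "norm (z1 - z2) > 0"
  and arg: "\<bar>Arg2pi z1 - Arg2pi z2\<bar> < pi / 2"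
 shows "\<exists>S. abs_sums_to (product_term YW p 2 (%j. if j = 0 then v1 else v2) (%j. if j = 0 then z1 else z2) w mu) {ks. length ks = 2} S &
  abs_sums_to (iterate_term YV YW p v1 v2 z1 z2 w mu) UNIV S"
proof -
 obtain T where "matrix_element scH frm lB lF es scV \<pi>V scM act Mgr scW \<pi>W mu w T" using matrix_element_ex[OF mu] by blast
 then interpret matrix_element scH frm lB lF es scV \<pi>V scM act Mgr scW \<pi>W mu w T .
 have "\<exists>F. True & prod_val 2 (%j. if j = 0 then v1 else v2) F & iter_val v1 v2 F"
 proof (rule joint_val[where ok = "%U j. True" and R = "%_. True" and B = "%_. {vv U | U. U \<in> CW & True}"])
  have "{vv U | U. U \<in> CW & True} = vv ` CW" by auto
  thus "v1 \<in> V.W.span {vv U | U. U \<in> CW & True}" "v2 \<in> V.W.span {vv U | U. U \<in> CW & True}" using V_span by auto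
 qed auto
 then obtain F where F: "prod_val 2 (%j. if j = 0 then v1 else v2) F" "iter_val v1 v2 F" by blast
 let ?z = "%j. if j = (0::nat) then z1 else z2"
 have nz: "z1 ~= 0" "z2 ~= 0" using z by auto
 have "(\<forall>j<2. ?z j ~= 0) & (\<forall>j l. j < l & l < 2 --> norm (?z l) < norm (?z j))" using nz z(1) by auto
 from F(1)[unfolded prod_val_def, rule_format, OF this]
 have 1: "(product_term YW p 2 (%j. if j = 0 then v1 else v2) ?z w mu has_sum F (%j. zroot p (?z j))) {ks. length ks = 2}" .
 have "(%j::nat. if j = 0 then zroot p z2 * (1 + (z1 - z2) / (zroot p z2)^2) powr (1/2) else zroot p z2) = (%j. zroot p (?z j))"
  unfolding root_shift[OF nz arg] by auto
 hence 2: "(iterate_term YV YW p v1 v2 z1 z2 w mu has_sum F (%j. zroot p (?z j))) UNIV"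
  using F(2)[unfolded iter_val_def, rule_format, OF conjI[OF z(2,3)], of p] by simp
 show ?thesis using has_sum_abs_sums_to[OF 1] has_sum_abs_sums_to[OF 2] by blast
qed

lemma bilinear_eqI:
 assumes f: "!!w. lin scV scW (%u. f u w)" "!!u. lin scW scW (f u)"
  and g: "!!w. lin scV scW (%u. g u w)" "!!u. lin scW scW (g u)"
  and eq: "!!U n \<alpha> w. U \<in> CW ==> w \<in> Wgr (n, \<alpha>) ==> f (vv U) w = g (vv U) w" shows "f u w = g u w"
proof -
 have "f (vv U) = g (vv U)" if "U \<in> CW" for U by (rule lin_eq_on_span[OF f(2) g(2) Wgr_span]) (use eq[OF that] in auto)
 hence "(%u. f u w) = (%u. g u w)" by (intro lin_eq_on_span[OF f(1) g(1) V_span]) auto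
 thus ?thesis by meson
qed

lemma lin_add_scale:
 assumes "lin s1 scW f" "lin s1 scW g" shows "lin s1 scW (%x. f x + scW c (g x))"
 using assms by (simp add: Vector_Spaces.linear_iff W.W.scale_right_distrib W.W.scale_left_commute add_ac)

theorem twisted_module:
 "lower_bounded_theta_twisted_module scV (vac \<pi>V) Vgr YV scW Wgr (W_weight_op scW Mgr \<pi>W) YW"
proof (rule lower_bounded_theta_twisted_module.intro)
 show "vector_space scW" by (rule W.W.vector_space_axioms)
 note weight = W_diag_op[where c = "%(n, \<alpha>). n", folded W_weight_op_def]
 note theta = W_diag_op[where c = "%(m, \<alpha>). theta_eigenvalue \<alpha>"]
 show "graded scW Wgr" by (rule W_graded)
 show "lin scV scW (%u. YW k u w)" for k w by (rule YW_linear_left)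
 show "lin scW scW (YW k u)" for k u by (rule YW_linear_right)
 show "lin scW scW (W_weight_op scW Mgr \<pi>W)" by (rule weight(1))
 show "\<exists>R::real. \<forall>m \<alpha>. Re m < R --> Wgr (m, \<alpha>) = {0}" by (rule lower_bounded)
 show "W_weight_op scW Mgr \<pi>W w = scW m w" if "w \<in> Wgr (m, \<alpha>)" for m \<alpha> w using weight(2)[OF that] by simp
 show "diag_op scW Wgr (%(m, \<alpha>). theta_eigenvalue \<alpha>) (YW k v w) =
   YW k (parity_involution scV Vgr v) (diag_op scW Wgr (%(m, \<alpha>). theta_eigenvalue \<alpha>) w)" for k v w
 proof (rule bilinear_eqI[where f = "%v w. diag_op scW Wgr (%(m, \<alpha>). theta_eigenvalue \<alpha>) (YW k v w)"
    and g = "%v w. YW k (parity_involution scV Vgr v) (diag_op scW Wgr (%(m, \<alpha>). theta_eigenvalue \<alpha>) w)"])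
  fix U :: "'h word" and n \<alpha> w assume U: "U \<in> CW" and w: "w \<in> Wgr (n, \<alpha>)"
  interpret a: Vector_Spaces.linear scV scW "%u. YW k u w'" for w' by (rule YW_linear_left)
  interpret b: Vector_Spaces.linear scW scW "YW k u" for u by (rule YW_linear_right)
  show "diag_op scW Wgr (%(m, \<alpha>). theta_eigenvalue \<alpha>) (YW k (vv U) w) =
    YW k (parity_involution scV Vgr (vv U)) (diag_op scW Wgr (%(m, \<alpha>). theta_eigenvalue \<alpha>) w)"
   using theta(2)[OF YW_Wgr[OF U w, of k]] theta(2)[OF w] V_parity_involution(2)[OF U]
   by (simp add: theta_eigenvalue_cadd a.scale b.scale mult.commute)
 qed (auto intro: lin_comp[OF YW_linear_left theta(1)] lin_comp[OF YW_linear_right theta(1)]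
   lin_comp[OF V_parity_involution(1) YW_linear_left] lin_comp[OF theta(1) YW_linear_right])
 show "W_weight_op scW Mgr \<pi>W (YW k u w) - YW k u (W_weight_op scW Mgr \<pi>W w) =
   YW k (diag_op scV Vgr (%n. n) u) w + scW (- of_int k / 2 - 1) (YW k u w)" for k u w
 proof -
  have "W_weight_op scW Mgr \<pi>W (YW k u w) + scW (- 1) (YW k u (W_weight_op scW Mgr \<pi>W w)) =
   YW k (diag_op scV Vgr (%n. n) u) w + scW (- of_int k / 2 - 1) (YW k u w)"
  proof (rule bilinear_eqI[where f = "%u w. W_weight_op scW Mgr \<pi>W (YW k u w) + scW (- 1) (YW k u (W_weight_op scW Mgr \<pi>W w))"
     and g = "%u w. YW k (diag_op scV Vgr (%n. n) u) w + scW (- of_int k / 2 - 1) (YW k u w)"])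
   fix U :: "'h word" and n \<alpha> w assume U: "U \<in> CW" and w: "w \<in> Wgr (n, \<alpha>)"
   interpret a: Vector_Spaces.linear scV scW "%u. YW k u w'" for w' by (rule YW_linear_left)
   interpret b: Vector_Spaces.linear scW scW "YW k u" for u by (rule YW_linear_right)
   show "W_weight_op scW Mgr \<pi>W (YW k (vv U) w) + scW (- 1) (YW k (vv U) (W_weight_op scW Mgr \<pi>W w)) =
    YW k (diag_op scV Vgr (%n. n) (vv U)) w + scW (- of_int k / 2 - 1) (YW k (vv U) w)"
    using weight(2)[OF YW_Wgr[OF U w, of k]] weight(2)[OF w] V_diag_weight(2)[OF U]
    by (simp add: a.scale b.scale W.W.scale_left_distrib[symmetric] del: W.W.scale_minus_left)
  qed (intro lin_add_scale lin_comp[OF YW_linear_left weight(1)] lin_comp[OF YW_linear_right weight(1)] YW_linear_left YW_linear_right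
    lin_comp[OF weight(1) YW_linear_right] lin_comp[OF V_diag_weight(1) YW_linear_left])+
  thus ?thesis by simp
 qed
 show "YW k (vac \<pi>V) w = (if k = - 2 then w else 0)" for k w
 proof -
  \<comment> \<open>The vacuum is the creation vector of the empty word, whose normal ordered
    product is the identity.\<close>
  have "YW k (vv []) w = W.npc exW [] (k + 2) w" by (subst YW_vec) (simp_all add: creation_words_def)
  also have "... = Sum_any (%ns::int list. if ns = [] then (if k = - 2 then w else 0) else 0)" unfolding W.npc_def by (rule Sum_any.cong) auto
  finally show ?thesis by (simp add: Sum_any_single)
 qed
qed (rule product_rational iterate_rational associative; assumption)+

end

theorem theorem4p3:
  fixes scH :: "complex \<Rightarrow> 'h::ab_group_add \<Rightarrow> 'h"
    and frm :: "'h \<Rightarrow> 'h \<Rightarrow> complex"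
    and lB lF :: complex
    and es :: "'h list"
    and scV :: "complex \<Rightarrow> 'v::ab_group_add \<Rightarrow> 'v"
    and \<pi>V :: "('h gen list \<Rightarrow>\<^sub>0 complex) \<Rightarrow> 'v"
    and scM :: "complex \<Rightarrow> 'm::ab_group_add \<Rightarrow> 'm"
    and act :: "stat \<Rightarrow> 'h \<Rightarrow> 'm \<Rightarrow> 'm"
    and Mgr :: "complex \<times> cmod2 \<Rightarrow> 'm set"
    and scW :: "complex \<Rightarrow> 'w::ab_group_add \<Rightarrow> 'w"
    and \<pi>W :: "('h gen list \<Rightarrow>\<^sub>0 'm) \<Rightarrow> 'w"
  assumes "vector_space scH"
    and "\<exists>B. finite B \<and> module.span scH B = UNIV"
    and "nondegenerate_symmetric_form scH frm"
    and "lB \<noteq> 0" and "lF \<noteq> 0"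
    and "orthonormal_basis scH frm es"
    and "is_V scH frm lB lF scV \<pi>V"
    and "graded_T_module scH scM act Mgr"
    and "is_W scH frm lB lF scM act scW \<pi>W"
  shows "lower_bounded_theta_twisted_module
           scV (vac \<pi>V) (V_grading scV \<pi>V) (Y_V scV \<pi>V)
           scW (W_grading scW Mgr \<pi>W) (W_weight_op scW Mgr \<pi>W) (Y_W frm lF es scV \<pi>V scW \<pi>W)"
proof -
  interpret setting scH frm lB lF es scV \<pi>V scM act Mgr scW \<pi>W
    by (rule setting.intro) (use assms in auto)
  show ?thesis by (rule twisted_module)
qed

end
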